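(* Let $d\ge 1$ and let $\mu$ be a probability measure on $(0,+\infty)$. Consider Deijfen's growth model driven by $\mu$ (defined in the context), with covered set $S_t$ at time $t$ started from the closed unit ball $B$. 1. If $$\int_0^{+\infty}\left(\int_x^{+\infty} r\,\mu(dr)\right)^{1/d}dx<+\infty,$$ then there exists $\lambda\in(0,+\infty)$ such that, almost surely, for all $\epsilon>0$, for all large enough $t$, $$B_{(1-\epsilon)/\lambda}\subset \frac{S_t}{t}\subset B_{(1+\epsilon)/\lambda}.$$ 2. If $$\int_0^{+\infty} r^{d+1}\,\mu(dr)=+\infty,$$ then, almost surely, for all $M>0$, for all large enough $t$, $B_M\subset \frac{S_t}{t}$.
   Context: $\|\cdot\|$ is the Euclidean norm on $\mathbb{R}^d$ and $B_r$ the closed Euclidean ball of radius $r$ centered at $0$; $B=B_1$. Let $\chi$ be a Poisson point process on $\mathbb{R}^d\times[0,+\infty)\times(0,+\infty)$ whose intensity is the product of Lebesgue measure on $\mathbb{R}^d\times[0,+\infty)$ and $\mu$. Passage times $\tau(x,y)\in[0,+\infty]$ for ordered pairs of points of $\mathbb{R}^d$: $\tau(x,x)=0$; for each $(c,t,r)\in\chi$ and each $y\in(c+B_r)\setminus\{c\}$, $\tau(c,y)=t$; all other pairs get $\tau(x,y)=+\infty$. A path from $a$ to $b$ is a finite sequence $\pi=(a=x_0,\dots,x_k=b)$ of distinct points of $\mathbb{R}^d$, with passage time $T(\pi)=\sum_{i=0}^{k-1}\tau(x_i,x_{i+1})$. For $A\subset\mathbb{R}^d$ and $x\in\mathbb{R}^d$,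 $T(A,x)=\inf\{T(\pi): \pi \text{ a path from some } a\in A \text{ to } x\}$. Finally $S_t=\{x\in\mathbb{R}^d: T(B,x)\le t\}$. *)

theory Defs
  imports "HOL-Probability.Probability"
begin

definition poisson_point_process ::
  "'w measure \<Rightarrow> 'p measure \<Rightarrow> ('w \<Rightarrow> 'p set) \<Rightarrow> bool" where
  "poisson_point_process M N chi \<longleftrightarrow>
     prob_space M \<and>
     (\<forall>A \<in> sets N. emeasure N A < \<infinity> \<longrightarrow>
        (AE w in M. finite (chi w \<inter> A)) \<and>
        (\<lambda>w. card (chi w \<inter> A)) \<in> measurable M (count_space UNIV) \<and>
        (\<forall>k::nat. measure M {w \<in> space M. card (chi w \<inter> A) = k}
             = exp (- measure N A) * measure N A ^ k / fact k)) \<and>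
     (\<forall>(I::nat set) (A::nat \<Rightarrow> 'p set). finite I \<longrightarrow> (\<forall>i\<in>I. A i \<in> sets N \<and> emeasure N (A i) < \<infinity>)
        \<longrightarrow> disjoint_family_on A I
        \<longrightarrow> prob_space.indep_vars M (\<lambda>_. count_space UNIV) (\<lambda>i w. card (chi w \<inter> A i)) I)"

definition deijfen_intensity :: "real measure \<Rightarrow> ('a::euclidean_space \<times> real \<times> real) measure" where
  "deijfen_intensity mu = lborel \<Otimes>\<^sub>M (density lborel (indicator {0..}) \<Otimes>\<^sub>M mu)"

text \<open>Passage time between two points, for a realisation X of the point process.
  tau(x,x) = 0; tau(c,y) = t if (c,t,r) in X and y in c + B_r, y <> c; otherwise +oo.
  (If several points share the centre c -- a null event -- the smallest time is taken.)\<close>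

definition tau :: "('a::euclidean_space \<times> real \<times> real) set \<Rightarrow> 'a \<Rightarrow> 'a \<Rightarrow> ennreal" where
  "tau X x y = (if x = y then 0
      else Inf {ennreal t | t r. (x, t, r) \<in> X \<and> norm (y - x) \<le> r})"

definition is_path :: "'a list \<Rightarrow> 'a \<Rightarrow> 'a \<Rightarrow> bool" where
  "is_path ps a b \<longleftrightarrow> ps \<noteq> [] \<and> distinct ps \<and> hd ps = a \<and> last ps = b"

definition path_time :: "('a::euclidean_space \<times> real \<times> real) set \<Rightarrow> 'a list \<Rightarrow> ennreal" where
  "path_time X ps = (\<Sum>i<length ps - 1. tau X (ps ! i) (ps ! Suc i))"

definition set_time :: "('a::euclidean_space \<times> real \<times> real) set \<Rightarrow> 'a set \<Rightarrow> 'a \<Rightarrow> ennreal" where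
  "set_time X A x = Inf {path_time X ps | ps a. a \<in> A \<and> is_path ps a x}"

definition covered :: "('a::euclidean_space \<times> real \<times> real) set \<Rightarrow> real \<Rightarrow> 'a set" where
  "covered X t = {x. set_time X (cball 0 1) x \<le> ennreal t}"

definition tail_root :: "real measure \<Rightarrow> nat \<Rightarrow> real \<Rightarrow> ennreal" where
  "tail_root mu d x = (let v = (\<integral>\<^sup>+ r. ennreal r * indicator {x..} r \<partial>mu) in
      if v = \<infinity> then \<infinity> else ennreal (enn2real v powr (1 / real d)))"

end

theory Submission
  imports Defs
begin

text \<open>
  Let \<open>T(x, y)\<close> be the time at which the unit ball around \<open>y\<close> is covered by the growth started from the unit
  ball around \<open>x\<close>. It is subadditive, stationary and isotropic, and \<open>lam = inf\<^sub>n E T(0, n u) / n\<close> for any unit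
  vector \<open>u\<close>.
  The growth has speed at least \<open>1 / lam\<close>: in a fixed direction by a second moment estimate along squares for finite
  range versions of \<open>T\<close>, in all directions simultaneously because, through balls of a fixed size, distances
  \<open>\<delta> n\<close> are crossed in time \<open>K \<delta> n\<close>, uniformly over the relevant region.
  The speed is at most \<open>1 / lam\<close> by a maximal inequality for stationary subadditive processes, combined with the fact
  that chains of tiny balls are slow.
  The tail root condition yields \<open>lam > 0\<close> by a greedy path argument over dyadic layers of radii. If the moment of
  order \<open>d + 1\<close> is infinite, there are arbitrarily large balls whose centre and waiting time are small with
  respect to their radius, and \<open>lam = 0\<close>.
\<close>

section \<open>Reachability and passage times\<close>

text \<open>Open balls and strict time bounds make \<open>reach\<close> stable under small perturbations of the configuration,
  which gives measurability; the gap to the closed balls of \<open>set_time\<close> is bridged by a rescaling at the end.\<close>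

inductive reach :: "('a::euclidean_space \<times> real \<times> real) set \<Rightarrow> 'a set \<Rightarrow> real \<Rightarrow> 'a \<Rightarrow> bool"
  for X A where
  reach_base: "y \<in> A \<Longrightarrow> 0 \<le> s \<Longrightarrow> reach X A s y"
| reach_step: "reach X A s c \<Longrightarrow> (c, t, r) \<in> X \<Longrightarrow> norm (y - c) < r \<Longrightarrow> s + t < s' \<Longrightarrow> reach X A s' y"

lemma reach_time_mono:
  assumes "reach X A s y" "s \<le> s'"
  shows "reach X A s' y"
  using assms(1)
proof cases
  case reach_base
  then show ?thesis using assms(2) by (intro reach.reach_base) auto
next
  case (reach_step s0 c t r)
  then show ?thesis using assms(2) by - (rule reach.reach_step[of X A s0 c t r], auto)
qed

lemma reach_mono: "reach X A s y \<Longrightarrow> X \<subseteq> X' \<Longrightarrow> A \<subseteq> A' \<Longrightarrow> reach X' A' s y"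
  by (induction rule: reach.induct) (blast intro: reach.intros)+

lemma reach_trans:
  assumes "reach X A' s' z" "A' \<subseteq> {y. reach X A s y}"
  shows "reach X A (s + s') z"
  using assms
proof (induction rule: reach.induct)
  case (reach_base y s')
  then show ?case by (auto intro: reach_time_mono)
next
  case (reach_step s1 c t r y s2)
  then show ?case by - (rule reach.reach_step[of X A "s + s1" c t r], auto)
qed

lemma reach_time_nonneg:
  assumes "reach X A s y" "\<And>c t r. (c, t, r) \<in> X \<Longrightarrow> 0 \<le> t"
  shows "0 \<le> s"
  using assms(1)
proof (induction rule: reach.induct)
  case (reach_step s1 c t r y s2)
  then show ?case using assms(2)[of c t r] by linarith
qed auto

lemma reach_robust:
  assumes "reach X A s z" "open A"
  shows "\<exists>X0 e. finite X0 \<and> X0 \<subseteq> X \<and> 0 < e \<and>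
    (\<forall>X' z'. (\<forall>p\<in>X0. \<exists>p'\<in>X'. dist p p' < e) \<longrightarrow> dist z z' < e \<longrightarrow> reach X' A s z')"
  using assms(1)
proof (induction rule: reach.induct)
  case (reach_base y s)
  then obtain e where e: "e > 0" "ball y e \<subseteq> A" using assms(2) open_contains_ball by blast
  have "\<forall>X' z'. (\<forall>p\<in>{}. \<exists>p'\<in>X'. dist p p' < e) \<longrightarrow> dist y z' < e \<longrightarrow> reach X' A s z'"
    using e reach_base by (auto intro!: reach.reach_base)
  with e(1) show ?case by (intro exI[of _ "{}"] exI[of _ e]) auto
next
  case (reach_step s c t r y s')
  then obtain X0 e where X0: "finite X0" "X0 \<subseteq> X" "0 < e"
    and IH: "\<And>X' z'. (\<forall>p\<in>X0. \<exists>p'\<in>X'. dist p p' < e) \<Longrightarrow> dist c z' < e \<Longrightarrow> reach X' A s z'"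
    by blast
  define e' where "e' = Min {e, (r - norm (y - c)) / 3, s' - s - t}"
  have e': "e' > 0" "e' \<le> e" "3 * e' \<le> r - norm (y - c)" "e' \<le> s' - s - t"
    using X0(3) reach_step.hyps unfolding e'_def by (auto simp: min_def field_simps)
  have "reach X' A s' z'" if X': "\<forall>p\<in>insert (c,t,r) X0. \<exists>p'\<in>X'. dist p p' < e'" and z': "dist y z' < e'"
    for X' z'
  proof -
    obtain c' t' r' where p': "(c',t',r') \<in> X'" "dist (c,t,r) (c',t',r') < e'"
      using X' by (metis insertI1 prod_cases3)
    have "dist c c' < e'" using p'(2) dist_fst_le[of "(c,t,r)" "(c',t',r')"] by simp
    moreover have "dist (t,r) (t',r') < e'" using p'(2) dist_snd_le[of "(c,t,r)" "(c',t',r')"] by simp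
    hence "dist t t' < e'" "dist r r' < e'" 
      using dist_fst_le[of "(t,r)" "(t',r')"] dist_snd_le[of "(t,r)" "(t',r')"] by auto
    ultimately have *: "dist c c' < e'" "t' < t + e'" "r - e' < r'" by (auto simp: dist_real_def)
    have "reach X' A s c'"
    proof (rule IH)
      show "\<forall>p\<in>X0. \<exists>p'\<in>X'. dist p p' < e" using X' e'(2) by (meson insertI2 less_le_trans)
    qed (use * e' in auto)
    moreover have "norm (z' - c') < r'"
    proof -
      have "dist z' c' \<le> dist z' y + dist y c + dist c c'"
        using dist_triangle[of z' c' y] dist_triangle[of y c' c] by linarith
      then show ?thesis using * z' e' by (auto simp: dist_norm norm_minus_commute)
    qed
    ultimately show ?thesis using p' * e' by - (rule reach.reach_step[of X' A s c' t' r' z' s'], auto)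
  qed
  then show ?case using X0 e' reach_step by (intro exI[of _ "insert (c,t,r) X0"] exI[of _ e']) auto
qed

definition cov :: "('a::euclidean_space \<times> real \<times> real) set \<Rightarrow> 'a \<Rightarrow> 'a \<Rightarrow> real \<Rightarrow> bool" where
  "cov X x y s \<longleftrightarrow> cball y 1 \<subseteq> {z. reach X (ball x 1) s z}"

lemma cov_mono: "cov X x y s \<Longrightarrow> X \<subseteq> X' \<Longrightarrow> s \<le> s' \<Longrightarrow> cov X' x y s'"
  unfolding cov_def using reach_mono reach_time_mono by blast

lemma cov_trans:
  assumes "cov X x y s" "cov X y z s'"
  shows "cov X x z (s + s')"
proof -
  have "ball y 1 \<subseteq> {z. reach X (ball x 1) s z}" using assms(1) ball_subset_cball unfolding cov_def by blast
  then show ?thesis using assms(2) unfolding cov_def by (auto intro: reach_trans)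
qed

lemma cov_robust:
  assumes "cov X x y s"
  shows "\<exists>X0 e. finite X0 \<and> X0 \<subseteq> X \<and> 0 < e \<and> (\<forall>X'. (\<forall>p\<in>X0. \<exists>p'\<in>X'. dist p p' < e) \<longrightarrow> cov X' x y s)"
proof -
  have "\<forall>z\<in>cball y 1. \<exists>X0 e. finite X0 \<and> X0 \<subseteq> X \<and> 0 < e \<and>
    (\<forall>X' z'. (\<forall>p\<in>X0. \<exists>p'\<in>X'. dist p p' < e) \<longrightarrow> dist z z' < e \<longrightarrow> reach X' (ball x 1) s z')"
    using assms unfolding cov_def by (intro ballI reach_robust) auto
  then obtain F e where Fe: "\<And>z. z \<in> cball y 1 \<Longrightarrow> finite (F z) \<and> F z \<subseteq> X \<and> (0::real) < e z \<and>
    (\<forall>X' z'. (\<forall>p\<in>F z. \<exists>p'\<in>X'. dist p p' < e z) \<longrightarrow> dist z z' < e z \<longrightarrow> reach X' (ball x 1) s z')"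
    by metis
  obtain D where D: "D \<subseteq> cball y 1" "finite D" "cball y 1 \<subseteq> (\<Union>z\<in>D. ball z (e z))"
  proof (rule compactE_image[of "cball y 1" "cball y 1" "\<lambda>z. ball z (e z)"])
    show "cball y 1 \<subseteq> (\<Union>c\<in>cball y 1. ball c (e c))" using Fe by force
  qed auto
  define d where "d = Min (insert 1 (e ` D))"
  have d: "d > 0" "\<And>z. z \<in> D \<Longrightarrow> d \<le> e z" unfolding d_def using D Fe by (auto simp: subset_iff)
  have "cov X' x y s" if X': "\<forall>p\<in>(\<Union>z\<in>D. F z). \<exists>p'\<in>X'. dist p p' < d" for X'
    unfolding cov_def
  proof
    fix w assume "w \<in> cball y 1"
    then obtain z where z: "z \<in> D" "dist z w < e z" using D by auto
    have "\<forall>p\<in>F z. \<exists>p'\<in>X'. dist p p' < e z" using X' d z by (meson UN_I less_le_trans)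
    then show "w \<in> {z. reach X' (ball x 1) s z}" using Fe z D by auto
  qed
  moreover have "finite (\<Union>z\<in>D. F z)" "(\<Union>z\<in>D. F z) \<subseteq> X" using D Fe by blast+
  ultimately show ?thesis using d(1) by blast
qed

lemma cov_finite:
  assumes "cov X x y s"
  shows "\<exists>X0. finite X0 \<and> X0 \<subseteq> X \<and> cov X0 x y s"
proof -
  obtain X0 e where "finite X0" "X0 \<subseteq> X" "0 < e" and *: "\<And>X'. (\<forall>p\<in>X0. \<exists>p'\<in>X'. dist p p' < e) \<Longrightarrow> cov X' x y s"
    using cov_robust[OF assms] by blast
  moreover have "cov X0 x y s" by (rule *) (use \<open>0 < e\<close> in \<open>auto intro!: bexI\<close>)
  ultimately show ?thesis by blast
qed

lemma reach_image:
  assumes "reach X A s y" "\<And>x y. norm (f x - f y) = norm (x - y)"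
  shows "reach ((\<lambda>(c, t, r). (f c, t, r)) ` X) (f ` A) s (f y)"
  using assms(1)
proof (induction rule: reach.induct)
  case (reach_base y s) then show ?case by (auto intro: reach.reach_base)
next
  case (reach_step s c t r y s')
  have "(f c, t, r) \<in> (\<lambda>(c, t, r). (f c, t, r)) ` X" using reach_step(2) by (auto intro!: rev_image_eqI)
  then show ?case using assms(2) reach_step by - (rule reach.reach_step[of _ _ s "f c" t r "f y" s'], simp_all)
qed

lemma cov_image:
  assumes "cov X x y s" "\<And>x y. norm (f x - f y) = norm (x - y)" "surj f"
  shows "cov ((\<lambda>(c, t, r). (f c, t, r)) ` X) (f x) (f y) s"
  unfolding cov_def
proof
  fix z assume z: "z \<in> cball (f y) 1"
  obtain w where w: "z = f w" using assms(3) by blast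
  have "w \<in> cball y 1" using z w assms(2) by (auto simp: dist_norm)
  hence "reach X (ball x 1) s w" using assms(1) unfolding cov_def by auto
  hence "reach ((\<lambda>(c, t, r). (f c, t, r)) ` X) (f ` ball x 1) s (f w)" by (rule reach_image) fact
  moreover have "f ` ball x 1 \<subseteq> ball (f x) 1" using assms(2) by (auto simp: dist_norm)
  ultimately show "z \<in> {z. reach ((\<lambda>(c, t, r). (f c, t, r)) ` X) (ball (f x) 1) s z}"
    using w by (auto intro: reach_mono)
qed

abbreviation ctr :: "'a \<times> real \<times> real \<Rightarrow> 'a" where "ctr p \<equiv> fst p"
abbreviation tm :: "'a \<times> real \<times> real \<Rightarrow> real" where "tm p \<equiv> fst (snd p)"
abbreviation rd :: "'a \<times> real \<times> real \<Rightarrow> real" where "rd p \<equiv> snd (snd p)"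

definition links :: "('a::euclidean_space \<times> real \<times> real) list \<Rightarrow> bool" where
  "links = successively (\<lambda>p q. norm (ctr q - ctr p) < rd p)"

lemma links_simps [simp]:
  "links []" "links [p]" "links (p # q # ps) \<longleftrightarrow> norm (ctr q - ctr p) < rd p \<and> links (q # ps)"
  by (auto simp: links_def)

lemma links_Cons: "links (p # ps) \<longleftrightarrow> (ps = [] \<or> norm (ctr (hd ps) - ctr p) < rd p) \<and> links ps"
  by (cases ps) auto

lemma links_append:
  "links (ps @ qs) \<longleftrightarrow> links ps \<and> links qs \<and> (ps = [] \<or> qs = [] \<or> norm (ctr (hd qs) - ctr (last ps)) < rd (last ps))"
  unfolding links_def successively_append_iff by auto

lemma reach_chain:
  assumes "reach X A s y"
  shows "y \<in> A \<or> (\<exists>ps. ps \<noteq> [] \<and> set ps \<subseteq> X \<and> ctr (hd ps) \<in> A \<and> links ps \<and>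
    norm (y - ctr (last ps)) < rd (last ps) \<and> sum_list (map tm ps) < s)"
proof -
  have "0 \<le> s \<and> y \<in> A \<or> (\<exists>ps. ps \<noteq> [] \<and> set ps \<subseteq> X \<and> ctr (hd ps) \<in> A \<and> links ps \<and>
    norm (y - ctr (last ps)) < rd (last ps) \<and> sum_list (map tm ps) < s)"
    using assms
  proof (induction rule: reach.induct)
    case (reach_step s c t r y s')
    from reach_step.IH show ?case
    proof (elim disjE exE conjE)
      assume "0 \<le> s" "c \<in> A"
      then show ?thesis using reach_step by (intro disjI2 exI[of _ "[(c,t,r)]"]) auto
    next
      fix ps assume ps: "ps \<noteq> []" "set ps \<subseteq> X" "ctr (hd ps) \<in> A" "links ps"
        "norm (c - ctr (last ps)) < rd (last ps)" "sum_list (map tm ps) < s"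
      then show ?thesis using reach_step
        by (intro disjI2 exI[of _ "ps @ [(c,t,r)]"]) (auto simp: links_append)
    qed
  qed auto
  then show ?thesis by blast
qed

lemma links_remove_loops:
  assumes "links ps" "ps \<noteq> []" "\<And>p. p \<in> set ps \<Longrightarrow> 0 \<le> tm p"
  shows "\<exists>qs. qs \<noteq> [] \<and> set qs \<subseteq> set ps \<and> links qs \<and> distinct (map ctr qs) \<and>
    ctr (hd qs) = ctr (hd ps) \<and> last qs = last ps \<and> sum_list (map tm qs) \<le> sum_list (map tm ps)"
  using assms
proof (induction "length ps" arbitrary: ps rule: less_induct)
  case less
  obtain p ps' where ps: "ps = p # ps'" using less.prems by (cases ps) auto
  show ?case
  proof (cases "\<exists>q\<in>set ps'. ctr q = ctr p")
    case True
    then obtain q us vs where q: "ps' = us @ q # vs" "ctr q = ctr p" by (metis split_list)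
    have l: "links (q # vs)" using less.prems(1) by (auto simp: ps q links_Cons links_append)
    obtain qs where qs: "qs \<noteq> []" "set qs \<subseteq> set (q # vs)" "links qs" "distinct (map ctr qs)"
      "ctr (hd qs) = ctr (hd (q # vs))" "last qs = last (q # vs)" "sum_list (map tm qs) \<le> sum_list (map tm (q # vs))"
      using less.hyps[of "q # vs"] l less.prems(3) by (auto simp: ps q)
    have "0 \<le> sum_list (map tm us)" using less.prems(3) by (intro sum_list_nonneg) (auto simp: ps q)
    then show ?thesis using qs q less.prems(3)[of p] by (intro exI[of _ qs]) (auto simp: ps)
  next
    case False
    show ?thesis
    proof (cases "ps' = []")
      case True then show ?thesis using ps by (intro exI[of _ "[p]"]) auto
    next
      case ne: False
      obtain qs where qs: "qs \<noteq> []" "set qs \<subseteq> set ps'" "links qs" "distinct (map ctr qs)"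
        "ctr (hd qs) = ctr (hd ps')" "last qs = last ps'" "sum_list (map tm qs) \<le> sum_list (map tm ps')"
        using less.hyps[of ps'] less.prems ne by (auto simp: ps links_Cons)
      have "ctr p \<notin> ctr ` set qs" using False qs(2) by (metis imageE subsetD)
      then show ?thesis using qs less.prems(1) ne
        by (intro exI[of _ "p # qs"]) (auto simp: ps links_Cons)
    qed
  qed
qed

lemma reach_chain_distinct:
  assumes "reach X A s y" "y \<notin> A" "\<And>p. p \<in> X \<Longrightarrow> 0 \<le> tm p"
  shows "\<exists>ps. ps \<noteq> [] \<and> set ps \<subseteq> X \<and> ctr (hd ps) \<in> A \<and> links ps \<and> distinct (map ctr ps) \<and>
    norm (y - ctr (last ps)) < rd (last ps) \<and> sum_list (map tm ps) < s"
proof -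
  obtain ps where ps: "ps \<noteq> []" "set ps \<subseteq> X" "ctr (hd ps) \<in> A" "links ps"
    "norm (y - ctr (last ps)) < rd (last ps)" "sum_list (map tm ps) < s"
    using reach_chain[OF assms(1)] assms(2) by blast
  obtain qs where "qs \<noteq> []" "set qs \<subseteq> set ps" "links qs" "distinct (map ctr qs)"
    "ctr (hd qs) = ctr (hd ps)" "last qs = last ps" "sum_list (map tm qs) \<le> sum_list (map tm ps)"
    using links_remove_loops[OF ps(4,1)] ps assms(3) by blast
  then show ?thesis using ps by (intro exI[of _ qs]) auto
qed

lemma chain_reach:
  assumes "links ps" "ps \<noteq> []" "set ps \<subseteq> X" "ctr (hd ps) \<in> A" "norm (y - ctr (last ps)) < rd (last ps)"
    "sum_list (map tm ps) < s" "\<And>p. p \<in> X \<Longrightarrow> 0 \<le> tm p"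
  shows "reach X A s y"
  using assms(1-6)
proof (induction ps arbitrary: y s rule: rev_induct)
  case (snoc p ps)
  show ?case
  proof (cases "ps = []")
    case True
    then show ?thesis using snoc.prems
      by - (rule reach.reach_step[of X A 0 "ctr p" "tm p" "rd p"], auto intro: reach_base)
  next
    case False
    define s0 where "s0 = (s + sum_list (map tm ps) - tm p) / 2"
    have s0: "sum_list (map tm ps) < s0" "s0 + tm p < s" using snoc.prems(6) by (auto simp: s0_def field_simps)
    have "reach X A s0 (ctr p)" using snoc.prems s0 False by (intro snoc.IH) (auto simp: links_append)
    then show ?thesis using snoc.prems s0
      by - (rule reach.reach_step[of X A s0 "ctr p" "tm p" "rd p"], auto)
  qed
qed auto

lemma path_time_simps [simp]:
  "path_time X [x] = 0" "path_time X (x # y # zs) = tau X x y + path_time X (y # zs)"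
  by (simp_all add: path_time_def sum.lessThan_Suc_shift del: sum.lessThan_Suc)

lemma path_time_append_le: "path_time X (zs) \<le> path_time X (us @ zs)" if "zs \<noteq> []"
proof (induction us)
  case (Cons u us)
  then show ?case using that
    by (cases "us @ zs") (auto intro: order_trans add_increasing)
qed simp

lemma path_time_remove_loops:
  assumes "ws \<noteq> []"
  shows "\<exists>zs. zs \<noteq> [] \<and> set zs \<subseteq> set ws \<and> distinct zs \<and> hd zs = hd ws \<and> last zs = last ws \<and> path_time X zs \<le> path_time X ws"
  using assms
proof (induction "length ws" arbitrary: ws rule: less_induct)
  case less
  obtain w ws' where ws: "ws = w # ws'" using less.prems by (cases ws) auto
  show ?case
  proof (cases "w \<in> set ws'")
    case True
    then obtain us vs where q: "ws' = us @ w # vs" by (metis split_list)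
    obtain zs where zs: "zs \<noteq> []" "set zs \<subseteq> set (w # vs)" "distinct zs" "hd zs = hd (w # vs)" "last zs = last (w # vs)"
       "path_time X zs \<le> path_time X (w # vs)"
      using less.hyps[of "w # vs"] by (auto simp: ws q)
    moreover have "path_time X (w # vs) \<le> path_time X ws"
      using path_time_append_le[of "w # vs" X "w # us"] by (simp add: ws q)
    ultimately show ?thesis by (intro exI[of _ zs]) (auto simp: ws q)
  next
    case False
    show ?thesis
    proof (cases "ws' = []")
      case True then show ?thesis using ws by (intro exI[of _ "[w]"]) auto
    next
      case ne: False
      obtain zs where zs: "zs \<noteq> []" "set zs \<subseteq> set ws'" "distinct zs" "hd zs = hd ws'" "last zs = last ws'"
       "path_time X zs \<le> path_time X ws'"
        using less.hyps[of ws'] ne by (auto simp: ws)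
      have "path_time X (w # zs) \<le> path_time X ws" using zs ne ws
        by (cases zs; cases ws') (auto intro: add_left_mono)
      then show ?thesis using zs ne False by (intro exI[of _ "w # zs"]) (auto simp: ws)
    qed
  qed
qed

lemma path_time_snoc: "ws \<noteq> [] \<Longrightarrow> path_time X (ws @ [y]) = path_time X ws + tau X (last ws) y"
proof (induction ws)
  case (Cons w ws)
  then show ?case by (cases ws) (auto simp: add.assoc)
qed simp

lemma reach_imp_set_time_le:
  assumes "reach X A s y" "\<And>c t r. (c, t, r) \<in> X \<Longrightarrow> 0 \<le> t"
  shows "set_time X A y \<le> ennreal s"
proof -
  have "\<exists>ws. ws \<noteq> [] \<and> hd ws \<in> A \<and> last ws = y \<and> path_time X ws \<le> ennreal s"
    using assms(1)
  proof (induction rule: reach.induct)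
    case (reach_base y s)
    then show ?case by (intro exI[of _ "[y]"]) auto
  next
    case (reach_step s c t r y s')
    then obtain ws where ws: "ws \<noteq> []" "hd ws \<in> A" "last ws = c" "path_time X ws \<le> ennreal s" by blast
    have s0: "0 \<le> s" "0 \<le> t" using reach_time_nonneg[OF reach_step.hyps(1)] assms(2) reach_step.hyps(2) by blast+
    have "tau X c y \<le> ennreal t"
    proof (cases "c = y")
      case False
      then show ?thesis using reach_step.hyps unfolding tau_def
        by (simp, intro Inf_lower) (use less_imp_le in blast)
    qed (simp add: tau_def)
    then have "path_time X (ws @ [y]) \<le> ennreal s + ennreal t"
      using ws by (auto simp: path_time_snoc intro: add_mono)
    also have "\<dots> = ennreal (s + t)" using s0 by (simp add: ennreal_plus)
    also have "\<dots> \<le> ennreal s'" using reach_step by (intro ennreal_leI) auto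
    finally show ?case using ws by (intro exI[of _ "ws @ [y]"]) auto
  qed
  then obtain ws where ws: "ws \<noteq> []" "hd ws \<in> A" "last ws = y" "path_time X ws \<le> ennreal s" by blast
  obtain zs where zs: "zs \<noteq> []" "distinct zs" "hd zs = hd ws" "last zs = last ws" "path_time X zs \<le> path_time X ws"
    using path_time_remove_loops[OF ws(1)] by blast
  have "set_time X A y \<le> path_time X zs"
    unfolding set_time_def by (rule Inf_lower) (use zs ws in \<open>auto simp: is_path_def\<close>)
  then show ?thesis using zs ws by auto
qed

lemma set_time_less_imp_reach:
  assumes "set_time X A y < ennreal s" "\<And>c t r. (c, t, r) \<in> X \<Longrightarrow> 0 \<le> t \<and> 0 < r" "0 < k"
  shows "reach ((\<lambda>(c, t, r). (c, t, (1 + k) * r)) ` X) A s y"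
proof -
  define Y where "Y = (\<lambda>(c, t, r). (c, t, (1 + k) * r)) ` X"
  obtain ps a where ps: "a \<in> A" "is_path ps a y" "path_time X ps < ennreal s"
    using assms(1) unfolding set_time_def by (auto simp: Inf_less_iff)
  have "\<And>s. path_time X ws < ennreal s \<Longrightarrow> hd ws \<in> A \<Longrightarrow> reach Y A s (last ws)" if "ws \<noteq> []" for ws
    using that
  proof (induction ws rule: rev_induct)
    case (snoc y ws)
    show ?case
    proof (cases "ws = []")
      case True
      then show ?thesis using snoc.prems by (auto simp: path_time_def intro: reach_base)
    next
      case False
      define c where "c = last ws"
      have pt: "path_time X ws + tau X c y < ennreal s"
        using snoc.prems False by (simp add: path_time_snoc c_def)
      define P where "P = enn2real (path_time X ws)"
      define T where "T = enn2real (tau X c y)"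
      have "path_time X ws < top" "tau X c y < top" 
        using pt by (metis ennreal_add_eq_top ennreal_less_top less_trans top.not_eq_extremum)+
      then have PT: "path_time X ws = ennreal P" "tau X c y = ennreal T" "0 \<le> P" "0 \<le> T"
        by (auto simp: P_def T_def)
      have lt: "P + T < s" using pt PT by (simp add: ennreal_plus[symmetric] ennreal_less_iff del: ennreal_plus)
      define e where "e = (s - P - T) / 2"
      have e: "e > 0" "P + T + 2 * e = s" using lt by (auto simp: e_def field_simps)
      have r: "reach Y A (P + e) c"
        unfolding c_def using snoc.prems False e PT by (intro snoc.IH) (auto simp: ennreal_less_iff)
      show ?thesis
      proof (cases "c = y")
        case True
        then show ?thesis using r reach_time_mono[OF r, of s] e PT by auto
      next
        case ne: False
        have "Inf {ennreal t | t r. (c, t, r) \<in> X \<and> norm (y - c) \<le> r} < ennreal (T + e)"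
          using PT(2,4) e ne unfolding tau_def by (auto simp: ennreal_less_iff)
        then obtain t r where tr: "(c, t, r) \<in> X" "norm (y - c) \<le> r" "ennreal t < ennreal (T + e)"
          by (auto simp: Inf_less_iff)
        have "t < T + e" using tr assms(2)[of c t r] by (auto simp: ennreal_less_iff)
        moreover have "norm (y - c) < (1 + k) * r"
          using tr(2) mult_pos_pos[OF assms(3), of r] assms(2)[OF tr(1)] by (auto simp: distrib_right)
        moreover have "(c, t, (1 + k) * r) \<in> Y" unfolding Y_def using tr by force
        ultimately show ?thesis using r e by (auto intro: reach_step[where c=c and s="P + e"])
      qed
    qed
  qed auto
  from this[of ps s] ps show ?thesis by (auto simp: is_path_def Y_def)
qed

section \<open>Poisson processes and their laws\<close>

definition slab :: "nat \<Rightarrow> ('a::euclidean_space \<times> real \<times> real) set" where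
  "slab n = cball 0 (real n) \<times> {..real n} \<times> UNIV"

definition nice :: "('a::euclidean_space \<times> real \<times> real) set \<Rightarrow> bool" where
  "nice X \<longleftrightarrow> (\<forall>n. finite (X \<inter> slab n)) \<and> (\<forall>p\<in>X. 0 \<le> tm p \<and> 0 < rd p)"

definition bset :: "('a::euclidean_space \<times> real \<times> real) set \<Rightarrow> bool" where
  "bset A \<longleftrightarrow> A \<in> sets borel \<and> (\<exists>n. A \<subseteq> slab n)"

lemma slab_borel [measurable]: "slab n \<in> sets borel"
  unfolding slab_def by (intro borel_closed closed_Times) auto

lemma nice_finite: "nice X \<Longrightarrow> bset A \<Longrightarrow> finite (X \<inter> A)"
  unfolding nice_def bset_def by (meson Int_mono finite_subset order_refl)

lemma nice_subset: "nice X \<Longrightarrow> Y \<subseteq> X \<Longrightarrow> nice Y"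
  unfolding nice_def by (meson Int_mono finite_subset order_refl subsetD)

lemma bset_subset: "bset A \<Longrightarrow> B \<subseteq> A \<Longrightarrow> B \<in> sets borel \<Longrightarrow> bset B"
  unfolding bset_def by blast

lemma bset_Int: "bset A \<Longrightarrow> L \<in> sets borel \<Longrightarrow> bset (L \<inter> A)"
  by (rule bset_subset) (auto simp: bset_def)

lemma bset_bounded:
  assumes "A \<in> sets borel" "bounded (A :: ('a::euclidean_space \<times> real \<times> real) set)"
  shows "bset A"
proof -
  obtain B where B: "\<And>p. p \<in> A \<Longrightarrow> norm p \<le> B" using assms(2) by (auto simp: bounded_iff)
  obtain n :: nat where n: "B \<le> real n" using real_arch_simple by blast
  have "A \<subseteq> slab n"
  proof
    fix p assume p: "p \<in> A"
    have "norm (ctr p) \<le> norm p" "\<bar>tm p\<bar> \<le> norm p"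
      using norm_fst_le[of "fst p" "snd p"] norm_fst_le[of "fst (snd p)" "snd (snd p)"]
        norm_snd_le[of "snd p" "fst p"] by auto
    then show "p \<in> slab n" using B[OF p] n by (cases p) (auto simp: slab_def)
  qed
  then show ?thesis using assms(1) by (auto simp: bset_def)
qed

definition gens :: "('a::euclidean_space \<times> real \<times> real) set set set" where
  "gens = {{X. nice X \<and> (\<forall>i<n. card (X \<inter> A i) = k i)} | n A (k::nat\<Rightarrow>nat). \<forall>i<(n::nat). bset (A i)}"

definition nconf :: "('a::euclidean_space \<times> real \<times> real) set measure" where
  "nconf = sigma (Collect nice) gens"

lemma gens_Pow: "gens \<subseteq> Pow (Collect nice)"
  by (auto simp: gens_def)

lemma sets_nconf: "sets nconf = sigma_sets (Collect nice) gens"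
  unfolding nconf_def by (rule sets_measure_of[OF gens_Pow])

lemma space_nconf [simp]: "space nconf = Collect nice"
  unfolding nconf_def by (rule space_measure_of[OF gens_Pow])

lemma Int_stable_gens: "Int_stable gens"
proof (rule Int_stableI)
  fix E F :: "('a::euclidean_space \<times> real \<times> real) set set" assume "E \<in> gens" "F \<in> gens"
  then obtain n A k m B l where E: "E = {X. nice X \<and> (\<forall>i<n. card (X \<inter> A i) = (k::nat\<Rightarrow>nat) i)}" "\<forall>i<(n::nat). bset (A i)"
    and F: "F = {X. nice X \<and> (\<forall>i<m. card (X \<inter> B i) = (l::nat\<Rightarrow>nat) i)}" "\<forall>i<(m::nat). bset (B i)"
    unfolding gens_def by blast
  let ?C = "\<lambda>i. if i < n then A i else B (i - n)" and ?h = "\<lambda>i. if i < n then k i else l (i - n)"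
  have "E \<inter> F = {X. nice X \<and> (\<forall>i<n+m. card (X \<inter> ?C i) = ?h i)}"
  proof -
    have all: "(\<forall>i<n+m. Q i) \<longleftrightarrow> (\<forall>i<n. Q i) \<and> (\<forall>i<m. Q (n + i))" for Q :: "nat \<Rightarrow> bool"
    proof (safe)
      fix i assume *: "\<forall>i<n. Q i" "\<forall>i<m. Q (n + i)" "i < n + m"
      show "Q i"
      proof (cases "i < n")
        case False
        then have "Q (n + (i - n))" using * by (intro *(2)[rule_format]) linarith
        then show ?thesis using False by simp
      qed (use * in auto)
    qed auto
    have "X \<in> E \<inter> F \<longleftrightarrow> nice X \<and> (\<forall>i<n+m. card (X \<inter> ?C i) = ?h i)" for X
      unfolding E(1) F(1) all by simp blast
    then show ?thesis by blast
  qed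
  moreover have "\<forall>i<n+m. bset (?C i)" using E(2) F(2) by (simp add: less_diff_conv2)
  ultimately show "E \<inter> F \<in> gens" unfolding gens_def
    by (intro CollectI exI[of _ "n + m"] exI[of _ ?C] exI[of _ ?h] conjI)
qed

lemma nice_in_gens: "Collect nice \<in> gens"
  unfolding gens_def by (rule CollectI, rule exI[of _ 0]) auto

lemma gensI:
  "bset A \<Longrightarrow> {X. nice X \<and> card (X \<inter> A) = k} \<in> gens"
  unfolding gens_def by (rule CollectI, rule exI[of _ 1], rule exI[of _ "\<lambda>_. A"], rule exI[of _ "\<lambda>_. k"]) auto

lemma card_measurable_nconf:
  assumes "bset A" shows "(\<lambda>X. card (X \<inter> A)) \<in> measurable nconf (count_space UNIV)"
proof (rule measurable_count_space_eq2_countable[THEN iffD2], safe)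
  fix k :: nat
  have "(\<lambda>X. card (X \<inter> A)) -` {k} \<inter> space nconf = {X. nice X \<and> card (X \<inter> A) = k}" by auto
  then show "(\<lambda>X. card (X \<inter> A)) -` {k} \<inter> space nconf \<in> sets nconf"
    using gensI[OF assms] by (auto simp: sets_nconf)
qed auto

lemma Int_measurable_nconf:
  assumes [measurable]: "L \<in> sets borel" shows "(\<lambda>X. X \<inter> L) \<in> measurable nconf nconf"
  unfolding nconf_def
proof (rule measurable_measure_of)
  show "gens \<subseteq> Pow (Collect nice)" by (rule gens_Pow)
  show "(\<lambda>X. X \<inter> L) \<in> space (sigma (Collect nice) gens) \<rightarrow> Collect nice"
    using space_nconf unfolding nconf_def by (auto intro: nice_subset)
  fix E :: "('a \<times> real \<times> real) set set" assume "E \<in> gens"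
  then obtain n A k where E: "E = {X. nice X \<and> (\<forall>i<n. card (X \<inter> A i) = (k::nat\<Rightarrow>nat) i)}" "\<forall>i<(n::nat). bset (A i)"
    unfolding gens_def by blast
  have "(\<lambda>X. X \<inter> L) -` E \<inter> Collect nice = {X. nice X \<and> (\<forall>i<n. card (X \<inter> (L \<inter> A i)) = k i)}"
    unfolding E by (auto intro: nice_subset simp: Int_assoc)
  moreover have "\<forall>i<n. bset (L \<inter> A i)"
    using E(2) bset_Int[OF _ assms] by auto
  ultimately have "(\<lambda>X. X \<inter> L) -` E \<inter> Collect nice \<in> gens"
    unfolding gens_def by (intro CollectI exI[of _ n] exI[of _ "\<lambda>i. L \<inter> A i"] exI[of _ k]) auto
  then have "(\<lambda>X. X \<inter> L) -` E \<inter> space nconf \<in> sets nconf"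
    by (simp add: sets_nconf)
  then show "(\<lambda>X. X \<inter> L) -` E \<inter> space (sigma (Collect nice) gens) \<in> sets (sigma (Collect nice) gens)"
    unfolding nconf_def .
qed

text \<open>Counts of arbitrary bounded sets are functions of the counts of the atoms of the
  finite Boolean algebra that they generate.\<close>

lemma counts_via_atoms:
  fixes A :: "nat \<Rightarrow> ('a::euclidean_space \<times> real \<times> real) set" and k :: "nat \<Rightarrow> nat"
  assumes A: "\<And>i. i < n \<Longrightarrow> bset (A i)"
  shows "\<exists>(J::nat set) C F. finite J \<and> finite F \<and> F \<subseteq> extensional J \<and>
    (\<forall>j\<in>J. bset (C j) \<and> C j \<subseteq> (\<Union>i<n. A i)) \<and> disjoint_family_on C J \<and>
    (\<forall>X. nice X \<longrightarrow> ((\<forall>i<n. card (X \<inter> A i) = k i) \<longleftrightarrow> (\<lambda>j\<in>J. card (X \<inter> C j)) \<in> F))"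
proof -
  define J where "J = set_encode ` (Pow {..<n} - {{}})"
  define C where "C j = {x. {i. i < n \<and> x \<in> A i} = set_decode j}" for j
  define F where "F = {f \<in> PiE J (\<lambda>_. {..\<Sum>i<n. k i}). \<forall>i<n. (\<Sum>j\<in>{j\<in>J. i \<in> set_decode j}. f j) = k i}"
  have J: "finite J" unfolding J_def by auto
  have dec: "set_decode j \<subseteq> {..<n}" "set_decode j \<noteq> {}" if j: "j \<in> J" for j
  proof -
    obtain S where S: "S \<subseteq> {..<n}" "S \<noteq> {}" "j = set_encode S" using j by (auto simp: J_def)
    then show "set_decode j \<subseteq> {..<n}" "set_decode j \<noteq> {}" using finite_subset[OF S(1)] by auto
  qed
  have "finite (PiE J (\<lambda>_. {..\<Sum>i<n. k i}))" using J by (intro finite_PiE) auto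
  then have F: "finite F" unfolding F_def by (rule rev_finite_subset) auto
  have Ceq: "C j = (\<Inter>i\<in>{..<n}. if i \<in> set_decode j then A i else - A i)" if "j \<in> J" for j
    unfolding C_def using dec[OF that] by (auto split: if_splits)
  have Csub: "C j \<subseteq> A i" if "j \<in> J" "i \<in> set_decode j" for i j
    using that dec unfolding C_def by auto
  have Cb: "bset (C j)" if j: "j \<in> J" for j
  proof -
    obtain i where i: "i \<in> set_decode j" "i < n" using dec[OF j] by auto
    have "C j \<in> sets borel" unfolding Ceq[OF j]
    proof (rule sets.finite_INT)
      fix i assume "i \<in> {..<n}"
      then have "A i \<in> sets borel" using A by (simp add: bset_def)
      then show "(if i \<in> set_decode j then A i else - A i) \<in> sets borel" by (simp add: borel_comp)
    qed (use i in auto)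
    then show ?thesis by (rule bset_subset[OF A[OF i(2)] Csub[OF j i(1)]])
  qed
  have disj: "disjoint_family_on C J"
    unfolding disjoint_family_on_def
  proof (intro ballI impI)
    fix i j assume "i \<in> J" "j \<in> J" "i \<noteq> j"
    moreover have "i = j" if "x \<in> C i" "x \<in> C j" for x
    proof -
      have "set_decode i = set_decode j" using that[unfolded C_def, THEN CollectD] by (rule trans[OF sym])
      then show ?thesis by (metis set_decode_inverse)
    qed
    ultimately show "C i \<inter> C j = {}" by blast
  qed
  have cardA: "card (X \<inter> A i) = (\<Sum>j\<in>{j\<in>J. i \<in> set_decode j}. card (X \<inter> C j))" if X: "nice X" and i: "i < n" for X i
  proof -
    have "X \<inter> A i = (\<Union>j\<in>{j\<in>J. i \<in> set_decode j}. X \<inter> C j)"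
    proof (intro equalityI subsetI)
      fix x assume x: "x \<in> X \<inter> A i"
      let ?S = "{i. i < n \<and> x \<in> A i}"
      have "finite ?S" by simp
      then have dS: "set_decode (set_encode ?S) = ?S" by (rule set_encode_inverse)
      have "?S \<in> Pow {..<n} - {{}}" using x i by blast
      then have "set_encode ?S \<in> J" unfolding J_def by (rule imageI)
      moreover have "x \<in> C (set_encode ?S)" unfolding C_def dS by (rule CollectI refl)+
      moreover have "i \<in> set_decode (set_encode ?S)" unfolding dS using x i by blast
      ultimately show "x \<in> (\<Union>j\<in>{j\<in>J. i \<in> set_decode j}. X \<inter> C j)" using x by blast
    qed (use Csub in blast)
    moreover have "card (\<Union>j\<in>{j\<in>J. i \<in> set_decode j}. X \<inter> C j) = (\<Sum>j\<in>{j\<in>J. i \<in> set_decode j}. card (X \<inter> C j))"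
    proof (rule card_UN_disjoint)
      show "\<forall>a\<in>{j\<in>J. i \<in> set_decode j}. \<forall>b\<in>{j\<in>J. i \<in> set_decode j}. a \<noteq> b \<longrightarrow> X \<inter> C a \<inter> (X \<inter> C b) = {}"
        using disj unfolding disjoint_family_on_def by blast
    qed (use J nice_finite[OF X Cb] in auto)
    ultimately show ?thesis by simp
  qed
  have "(\<forall>i<n. card (X \<inter> A i) = k i) \<longleftrightarrow> (\<lambda>j\<in>J. card (X \<inter> C j)) \<in> F" if X: "nice X" for X
  proof
    assume L: "\<forall>i<n. card (X \<inter> A i) = k i"
    have "card (X \<inter> C j) \<le> (\<Sum>i<n. k i)" if j: "j \<in> J" for j
    proof -
      obtain i where i: "i \<in> set_decode j" "i < n" using dec[OF j] by auto
      have "card (X \<inter> C j) \<le> card (X \<inter> A i)"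
        using Csub[OF j i(1)] nice_finite[OF X A[OF i(2)]] by (intro card_mono) auto
      also have "\<dots> = k i" using L i by auto
      also have "\<dots> \<le> (\<Sum>i<n. k i)" using i by (intro member_le_sum) auto
      finally show ?thesis .
    qed
    then show "(\<lambda>j\<in>J. card (X \<inter> C j)) \<in> F"
      using L cardA[OF X] unfolding F_def by (auto intro!: sum.cong)
  next
    assume "(\<lambda>j\<in>J. card (X \<inter> C j)) \<in> F"
    then show "\<forall>i<n. card (X \<inter> A i) = k i"
      using cardA[OF X] unfolding F_def by auto
  qed
  moreover have "F \<subseteq> extensional J" unfolding F_def by (auto simp: PiE_def)
  moreover have "C j \<subseteq> (\<Union>i<n. A i)" if j: "j \<in> J" for j
  proof -
    obtain i where i: "i \<in> set_decode j" "i < n" using dec[OF j] by auto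
    then show ?thesis using Csub[OF j i(1)] by (intro order_trans[OF _ UN_upper[of i]]) auto
  qed
  ultimately show ?thesis using J F Cb disj
    by (intro exI[of _ J] exI[of _ C] exI[of _ F] conjI ballI allI impI)
qed

definition pois :: "real \<Rightarrow> nat \<Rightarrow> real" where
  "pois m k = exp (- m) * m ^ k / fact k"

locale ppp = prob_space M for M :: "'w measure" +
  fixes N :: "('a::euclidean_space \<times> real \<times> real) measure" and chi :: "'w \<Rightarrow> ('a \<times> real \<times> real) set"
  assumes sets_N: "sets N = sets borel"
    and fin_slab: "\<And>n. emeasure N (slab n) < \<infinity>"
    and nice_chi: "\<And>w. nice (chi w)"
    and count_measurable: "\<And>A. A \<in> sets borel \<Longrightarrow> emeasure N A < \<infinity> \<Longrightarrow>
      (\<lambda>w. card (chi w \<inter> A)) \<in> measurable M (count_space UNIV)"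
    and count_prob: "\<And>A k. A \<in> sets borel \<Longrightarrow> emeasure N A < \<infinity> \<Longrightarrow>
      prob {w \<in> space M. card (chi w \<inter> A) = k} = pois (measure N A) k"
    and count_AE_finite: "\<And>A. A \<in> sets borel \<Longrightarrow> emeasure N A < \<infinity> \<Longrightarrow> AE w in M. finite (chi w \<inter> A)"
    and count_joint_finite: "\<And>(J::nat set) C f. finite J \<Longrightarrow> (\<And>j. j \<in> J \<Longrightarrow> C j \<in> sets borel \<and> emeasure N (C j) < \<infinity>) \<Longrightarrow>
      disjoint_family_on C J \<Longrightarrow>
      prob {w \<in> space M. \<forall>j\<in>J. card (chi w \<inter> C j) = f j} = (\<Prod>j\<in>J. pois (measure N (C j)) (f j))"
begin

lemma space_N: "space N = UNIV"
  using sets_eq_imp_space_eq[OF sets_N] by simp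

lemma bset_fin: "bset A \<Longrightarrow> emeasure N A < \<infinity>"
  unfolding bset_def using fin_slab sets_N slab_borel by (metis emeasure_mono order.strict_trans1)

lemma count_joint:
  fixes J :: "nat set"
  assumes "finite J" "\<And>j. j \<in> J \<Longrightarrow> bset (C j)" "disjoint_family_on C J"
  shows "prob {w \<in> space M. \<forall>j\<in>J. card (chi w \<inter> C j) = f j} = (\<Prod>j\<in>J. pois (measure N (C j)) (f j))"
  using assms bset_fin by (intro count_joint_finite) (auto simp: bset_def)

lemma count_event: "bset A \<Longrightarrow> {w \<in> space M. card (chi w \<inter> A) = k} \<in> events"
proof -
  assume "bset A"
  then have "(\<lambda>w. card (chi w \<inter> A)) \<in> measurable M (count_space UNIV)"
    using bset_fin by (intro count_measurable) (auto simp: bset_def)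
  from measurable_sets[OF this, of "{k}"] show ?thesis by (auto simp: vimage_def Int_def conj_commute)
qed

lemma prob_atoms:
  fixes J :: "nat set"
  assumes "finite J" "\<And>j. j \<in> J \<Longrightarrow> bset (C j)" "disjoint_family_on C J" "finite F" "F \<subseteq> extensional J"
  shows "prob {w \<in> space M. (\<lambda>j\<in>J. card (chi w \<inter> C j)) \<in> F} = (\<Sum>f\<in>F. \<Prod>j\<in>J. pois (measure N (C j)) (f j))"
proof -
  have ext: "(\<lambda>j\<in>J. card (chi w \<inter> C j)) = f \<longleftrightarrow> (\<forall>j\<in>J. card (chi w \<inter> C j) = f j)" if "f \<in> F" for f w
    using that assms(5) by (auto simp: fun_eq_iff extensional_def subset_iff)
  have eq: "{w \<in> space M. (\<lambda>j\<in>J. card (chi w \<inter> C j)) \<in> F} = (\<Union>f\<in>F. {w \<in> space M. \<forall>j\<in>J. card (chi w \<inter> C j) = f j})"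
  proof (intro equalityI subsetI)
    fix w assume "w \<in> (\<Union>f\<in>F. {w \<in> space M. \<forall>j\<in>J. card (chi w \<inter> C j) = f j})"
    then obtain f where "f \<in> F" "w \<in> space M" "\<forall>j\<in>J. card (chi w \<inter> C j) = f j" by blast
    then show "w \<in> {w \<in> space M. (\<lambda>j\<in>J. card (chi w \<inter> C j)) \<in> F}" using ext[of f w] by auto
  qed (use ext in auto)
  have "{w \<in> space M. \<forall>j\<in>J. card (chi w \<inter> C j) = f j} \<in> events" for f
    using assms(1,2) by (intro sets.sets_Collect_finite_All count_event) auto
  then show ?thesis unfolding eq
  proof (subst finite_measure_finite_Union)
    show "disjoint_family_on (\<lambda>f. {w \<in> space M. \<forall>j\<in>J. card (chi w \<inter> C j) = f j}) F"
      unfolding disjoint_family_on_def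
    proof (intro ballI impI)
      fix a b assume ab: "a \<in> F" "b \<in> F" "a \<noteq> b"
      have "a = b" if "\<forall>j\<in>J. card (chi w \<inter> C j) = a j" "\<forall>j\<in>J. card (chi w \<inter> C j) = b j" for w
        using that ext[OF ab(1), of w] ext[OF ab(2), of w] by metis
      then show "{w \<in> space M. \<forall>j\<in>J. card (chi w \<inter> C j) = a j} \<inter> {w \<in> space M. \<forall>j\<in>J. card (chi w \<inter> C j) = b j} = {}"
        using ab(3) by blast
    qed
    show "(\<Sum>f\<in>F. prob {w \<in> space M. \<forall>j\<in>J. card (chi w \<inter> C j) = f j}) = (\<Sum>f\<in>F. \<Prod>j\<in>J. pois (measure N (C j)) (f j))"
      using assms by (intro sum.cong refl count_joint) auto
  qed (use assms in auto)
qed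

lemma chi_measurable: "chi \<in> measurable M nconf"
  unfolding nconf_def
proof (rule measurable_measure_of)
  fix E :: "('a \<times> real \<times> real) set set" assume "E \<in> gens"
  then obtain n A k where E: "E = {X. nice X \<and> (\<forall>i<n. card (X \<inter> A i) = (k::nat\<Rightarrow>nat) i)}" "\<forall>i<(n::nat). bset (A i)"
    unfolding gens_def by blast
  have "chi -` E \<inter> space M = {w \<in> space M. \<forall>i\<in>{..<n}. card (chi w \<inter> A i) = k i}"
    unfolding E using nice_chi by auto
  then show "chi -` E \<inter> space M \<in> sets M"
    using E(2) by (simp only:, intro sets.sets_Collect_finite_All count_event) auto
qed (use gens_Pow nice_chi in auto)

end

lemma ppp_law_unique:
  fixes N :: "('a::euclidean_space \<times> real \<times> real) measure"
  assumes "ppp M N chi" "ppp M' N chi'"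
  shows "distr M nconf chi = distr M' nconf chi'"
proof -
  interpret a: ppp M N chi by fact
  interpret b: ppp M' N chi' by fact
  show ?thesis
  proof (rule measure_eqI_generator_eq[OF Int_stable_gens gens_Pow])
    fix E :: "('a \<times> real \<times> real) set set" assume EG: "E \<in> gens"
    then obtain n A k where E: "E = {X. nice X \<and> (\<forall>i<n. card (X \<inter> A i) = (k::nat\<Rightarrow>nat) i)}" "\<forall>i<(n::nat). bset (A i)"
      unfolding gens_def by blast
    obtain J C F where JCF: "finite (J::nat set)" "finite F" "F \<subseteq> extensional J"
      "\<forall>j\<in>J. bset (C j) \<and> C j \<subseteq> (\<Union>i<n. A i)" "disjoint_family_on C J"
      and eq: "\<And>X. nice X \<Longrightarrow> ((\<forall>i<n. card (X \<inter> A i) = k i) \<longleftrightarrow> (\<lambda>j\<in>J. card (X \<inter> C j)) \<in> F)"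
      using counts_via_atoms[of n A k] E(2) by blast
    have EN: "E \<in> sets nconf" using EG by (auto simp: sets_nconf)
    have "chi -` E \<inter> space M = {w \<in> space M. (\<lambda>j\<in>J. card (chi w \<inter> C j)) \<in> F}"
      unfolding E using eq[OF a.nice_chi] a.nice_chi by auto
    moreover have "chi' -` E \<inter> space M' = {w \<in> space M'. (\<lambda>j\<in>J. card (chi' w \<inter> C j)) \<in> F}"
      unfolding E using eq[OF b.nice_chi] b.nice_chi by auto
    ultimately have "measure M (chi -` E \<inter> space M) = measure M' (chi' -` E \<inter> space M')"
      using a.prob_atoms[of J C F] b.prob_atoms[of J C F] JCF by auto
    then show "emeasure (distr M nconf chi) E = emeasure (distr M' nconf chi') E"
      using EN a.chi_measurable b.chi_measurable
      by (simp add: emeasure_distr a.emeasure_eq_measure b.emeasure_eq_measure)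
  next
    show "range (\<lambda>_::nat. Collect nice :: ('a \<times> real \<times> real) set set) \<subseteq> gens" using nice_in_gens by auto
    have "finite_measure (distr M nconf chi)" by (intro a.finite_measure_distr a.chi_measurable)
    then show "emeasure (distr M nconf chi) (Collect nice) \<noteq> \<infinity>" 
      by (simp add: finite_measure.emeasure_finite)
  qed (auto simp: sets_nconf)
qed

context ppp begin

lemma Int_chi_measurable: "L \<in> sets borel \<Longrightarrow> (\<lambda>w. chi w \<inter> L) \<in> measurable M nconf"
  using measurable_comp[OF chi_measurable Int_measurable_nconf] by (simp add: comp_def)

lemma indep_restrict:
  assumes L: "L1 \<in> sets borel" "L2 \<in> sets borel" "L1 \<inter> L2 = {}"
  shows "indep_var nconf (\<lambda>w. chi w \<inter> L1) nconf (\<lambda>w. chi w \<inter> L2)"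
proof -
  let ?G = "\<lambda>L. {(\<lambda>w. chi w \<inter> L) -` E \<inter> space M | E. E \<in> gens}"
  have sig: "sigma_sets (space M) {(\<lambda>w. chi w \<inter> L) -` A \<inter> space M |A. A \<in> sets nconf} = sigma_sets (space M) (?G L)" for L
  proof -
    have eq: "{(\<lambda>w. chi w \<inter> L) -` A \<inter> space M |A. A \<in> sets nconf} = sigma_sets (space M) (?G L)"
      unfolding sets_nconf by (rule sigma_sets_vimage_commute) (auto intro: nice_subset[OF nice_chi])
    have "?G L \<subseteq> Pow (space M)" by auto
    then show ?thesis unfolding eq by (rule sigma_sets_sigma_sets_eq)
  qed
  have stab: "Int_stable (?G L)" for L
  proof (rule Int_stableI, clarsimp)
    fix E F :: "('a \<times> real \<times> real) set set" assume "E \<in> gens" "F \<in> gens"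
    then have "E \<inter> F \<in> gens" using Int_stable_gens unfolding Int_stable_def by blast
    then show "\<exists>G. (\<lambda>w. chi w \<inter> L) -` E \<inter> space M \<inter> ((\<lambda>w. chi w \<inter> L) -` F \<inter> space M) = (\<lambda>w. chi w \<inter> L) -` G \<inter> space M \<and> G \<in> gens"
      by (intro exI[of _ "E \<inter> F"]) auto
  qed
  have rep: "\<exists>(J::nat set) C F. finite J \<and> finite F \<and> F \<subseteq> extensional J \<and> (\<forall>j\<in>J. bset (C j) \<and> C j \<subseteq> L) \<and> disjoint_family_on C J \<and>
    (\<lambda>w. chi w \<inter> L) -` E \<inter> space M = {w\<in>space M. (\<lambda>j\<in>J. card (chi w \<inter> C j)) \<in> F}"
    if EG: "E \<in> gens" and L: "L \<in> sets borel" for E L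
  proof -
    obtain n A k where E: "E = {X. nice X \<and> (\<forall>i<n. card (X \<inter> A i) = (k::nat\<Rightarrow>nat) i)}" "\<forall>i<(n::nat). bset (A i)"
      using EG unfolding gens_def by blast
    have b: "\<And>i. i < n \<Longrightarrow> bset (L \<inter> A i)" using E(2) bset_Int[OF _ L] by auto
    obtain J C F where JCF: "finite (J::nat set)" "finite F" "F \<subseteq> extensional J"
      "\<forall>j\<in>J. bset (C j) \<and> C j \<subseteq> (\<Union>i<n. L \<inter> A i)" "disjoint_family_on C J"
      and eq: "\<And>X. nice X \<Longrightarrow> ((\<forall>i<n. card (X \<inter> (L \<inter> A i)) = k i) \<longleftrightarrow> (\<lambda>j\<in>J. card (X \<inter> C j)) \<in> F)"
      using counts_via_atoms[of n "\<lambda>i. L \<inter> A i" k, OF b] by blast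
    have "(\<lambda>w. chi w \<inter> L) -` E \<inter> space M = {w\<in>space M. (\<lambda>j\<in>J. card (chi w \<inter> C j)) \<in> F}"
      unfolding E using eq[OF nice_chi] nice_chi by (auto intro: nice_subset simp: Int_assoc)
    with JCF show ?thesis by (intro exI[of _ J] exI[of _ C] exI[of _ F]) auto
  qed
  have meas: "(\<lambda>w. chi w \<inter> L) -` E \<inter> space M \<in> events" if "E \<in> gens" "L \<in> sets borel" for E L
    using measurable_sets[OF Int_chi_measurable[OF that(2)], of E] that by (auto simp: sets_nconf)
  have ind: "indep_set (?G L1) (?G L2)"
  proof (safe intro!: indep_setI meas L)
    fix E1 E2 :: "('a \<times> real \<times> real) set set" assume E: "E1 \<in> gens" "E2 \<in> gens"
    obtain J1 C1 F1 where 1: "finite (J1::nat set)" "finite F1" "F1 \<subseteq> extensional J1" "\<And>j. j\<in>J1 \<Longrightarrow> bset (C1 j)" "\<And>j. j\<in>J1 \<Longrightarrow> C1 j \<subseteq> L1" "disjoint_family_on C1 J1"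
      "(\<lambda>w. chi w \<inter> L1) -` E1 \<inter> space M = {w\<in>space M. (\<lambda>j\<in>J1. card (chi w \<inter> C1 j)) \<in> F1}"
      using rep[OF E(1) L(1)] by (elim exE conjE) (rule that, assumption+, simp_all)
    obtain J2 C2 F2 where 2: "finite (J2::nat set)" "finite F2" "F2 \<subseteq> extensional J2" "\<And>j. j\<in>J2 \<Longrightarrow> bset (C2 j)" "\<And>j. j\<in>J2 \<Longrightarrow> C2 j \<subseteq> L2" "disjoint_family_on C2 J2"
      "(\<lambda>w. chi w \<inter> L2) -` E2 \<inter> space M = {w\<in>space M. (\<lambda>j\<in>J2. card (chi w \<inter> C2 j)) \<in> F2}"
      using rep[OF E(2) L(2)] by (elim exE conjE) (rule that, assumption+, simp_all)
    define e o' where "e = (\<lambda>j::nat. 2 * j)" and "o' = (\<lambda>j::nat. Suc (2 * j))"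
    define J where "J = e ` J1 \<union> o' ` J2"
    define C where "C j = (if even j then C1 (j div 2) else C2 (j div 2))" for j
    have inj: "inj_on e J1" "inj_on o' J2" "e ` J1 \<inter> o' ` J2 = {}" by (auto simp: e_def o'_def inj_on_def) presburger
    have Ce: "C (e j) = C1 j" "C (o' j) = C2 j" for j by (auto simp: C_def e_def o'_def)
    have bC: "bset (C j)" if "j \<in> J" for j using that 1 2 Ce by (auto simp: J_def)
    have dC: "disjoint_family_on C J"
      unfolding disjoint_family_on_def
    proof (intro ballI impI)
      fix i j assume ij: "i \<in> J" "j \<in> J" "i \<noteq> j"
      have d1: "C1 a \<inter> C1 b = {}" if "a \<in> J1" "b \<in> J1" "a \<noteq> b" for a b using 1(6) that by (auto simp: disjoint_family_on_def)
      have d2: "C2 a \<inter> C2 b = {}" if "a \<in> J2" "b \<in> J2" "a \<noteq> b" for a b using 2(6) that by (auto simp: disjoint_family_on_def)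
      have d3: "C1 a \<inter> C2 b = {}" if "a \<in> J1" "b \<in> J2" for a b using 1(5)[OF that(1)] 2(5)[OF that(2)] L(3) by blast
      from ij(1,2) show "C i \<inter> C j = {}" unfolding J_def
      proof (elim UnE imageE)
        fix a b assume "i = e a" "a \<in> J1" "j = e b" "b \<in> J1"
        then show ?thesis using d1[of a b] ij(3) by (simp add: Ce) blast
      next
        fix a b assume "i = e a" "a \<in> J1" "j = o' b" "b \<in> J2"
        then show ?thesis using d3[of a b] by (simp add: Ce)
      next
        fix a b assume "i = o' a" "a \<in> J2" "j = e b" "b \<in> J1"
        then show ?thesis using d3[of b a] by (simp add: Ce Int_commute)
      next
        fix a b assume "i = o' a" "a \<in> J2" "j = o' b" "b \<in> J2"
        then show ?thesis using d2[of a b] ij(3) by (simp add: Ce) blast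
      qed
    qed
    define pr where "pr f g = (\<lambda>j. if even j then f (j div 2) else g (j div 2))" for f g :: "nat \<Rightarrow> nat"
    have pre: "pr f g (e j) = f j" "pr f g (o' j) = g j" for f g j by (auto simp: pr_def e_def o'_def)
    have joint: "prob {w\<in>space M. (\<forall>j\<in>J1. card (chi w \<inter> C1 j) = f j) \<and> (\<forall>j\<in>J2. card (chi w \<inter> C2 j) = g j)}
      = (\<Prod>j\<in>J1. pois (measure N (C1 j)) (f j)) * (\<Prod>j\<in>J2. pois (measure N (C2 j)) (g j))" for f g
    proof -
      have "prob {w\<in>space M. \<forall>j\<in>J. card (chi w \<inter> C j) = pr f g j} = (\<Prod>j\<in>J. pois (measure N (C j)) (pr f g j))"
        by (rule count_joint) (use 1 2 bC dC in \<open>auto simp: J_def\<close>)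
      also have "\<dots> = (\<Prod>j\<in>J1. pois (measure N (C1 j)) (f j)) * (\<Prod>j\<in>J2. pois (measure N (C2 j)) (g j))"
        unfolding J_def using 1(1) 2(1) inj by (subst prod.union_disjoint) (auto simp: prod.reindex Ce pre)
      finally show ?thesis by (simp add: J_def ball_Un Ce pre)
    qed
    have ext: "(\<lambda>j\<in>J1. card (chi w \<inter> C1 j)) = f \<longleftrightarrow> (\<forall>j\<in>J1. card (chi w \<inter> C1 j) = f j)" if "f \<in> F1" for f w
      using that 1(3) by (auto simp: fun_eq_iff extensional_def subset_iff)
    have ext2: "(\<lambda>j\<in>J2. card (chi w \<inter> C2 j)) = f \<longleftrightarrow> (\<forall>j\<in>J2. card (chi w \<inter> C2 j) = f j)" if "f \<in> F2" for f w
      using that 2(3) by (auto simp: fun_eq_iff extensional_def subset_iff)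
    let ?A = "\<lambda>(f,g). {w\<in>space M. (\<forall>j\<in>J1. card (chi w \<inter> C1 j) = f j) \<and> (\<forall>j\<in>J2. card (chi w \<inter> C2 j) = g j)}"
    have eq: "((\<lambda>w. chi w \<inter> L1) -` E1 \<inter> space M) \<inter> ((\<lambda>w. chi w \<inter> L2) -` E2 \<inter> space M) = (\<Union>fg\<in>F1\<times>F2. ?A fg)"
      
    proof (intro equalityI subsetI)
      fix w assume "w \<in> (\<Union>fg\<in>F1\<times>F2. ?A fg)"
      then obtain f g where "f \<in> F1" "g \<in> F2" "w \<in> ?A (f, g)" by blast
      then show "w \<in> ((\<lambda>w. chi w \<inter> L1) -` E1 \<inter> space M) \<inter> ((\<lambda>w. chi w \<inter> L2) -` E2 \<inter> space M)"
        unfolding 1(7) 2(7) using ext[of f w] ext2[of g w] by auto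
    next
      fix w assume w: "w \<in> ((\<lambda>w. chi w \<inter> L1) -` E1 \<inter> space M) \<inter> ((\<lambda>w. chi w \<inter> L2) -` E2 \<inter> space M)"
      show "w \<in> (\<Union>fg\<in>F1\<times>F2. ?A fg)"
        by (rule UN_I[of "(\<lambda>j\<in>J1. card (chi w \<inter> C1 j), \<lambda>j\<in>J2. card (chi w \<inter> C2 j))"])
           (use w in \<open>auto simp: 1(7) 2(7)\<close>)
    qed
    have "prob (\<Union>fg\<in>F1\<times>F2. ?A fg) = (\<Sum>fg\<in>F1\<times>F2. prob (?A fg))"
    proof (rule finite_measure_finite_Union)
      have "?A fg \<in> events" for fg
        using 1(1,4) 2(1,4) by (cases fg) (auto intro!: sets.sets_Collect_conj sets.sets_Collect_finite_All count_event)
      then show "?A ` (F1 \<times> F2) \<subseteq> events" by blast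
      show "disjoint_family_on ?A (F1 \<times> F2)"
        unfolding disjoint_family_on_def
      proof (intro ballI impI)
        fix a b assume ab: "a \<in> F1 \<times> F2" "b \<in> F1 \<times> F2" "a \<noteq> b"
        have "a = b" if "w \<in> ?A a" "w \<in> ?A b" for w
          using that ab ext[of "fst a" w] ext[of "fst b" w] ext2[of "snd a" w] ext2[of "snd b" w]
          by (cases a; cases b) auto
        then show "?A a \<inter> ?A b = {}" using ab(3) by blast
      qed
    qed (use 1 2 in auto)
    also have "\<dots> = (\<Sum>f\<in>F1. \<Sum>g\<in>F2. (\<Prod>j\<in>J1. pois (measure N (C1 j)) (f j)) * (\<Prod>j\<in>J2. pois (measure N (C2 j)) (g j)))"
      by (simp add: sum.cartesian_product case_prod_beta joint)
    also have "\<dots> = prob {w\<in>space M. (\<lambda>j\<in>J1. card (chi w \<inter> C1 j)) \<in> F1} * prob {w\<in>space M. (\<lambda>j\<in>J2. card (chi w \<inter> C2 j)) \<in> F2}"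
      using 1 2 by (simp add: prob_atoms sum_product)
    finally show "prob (((\<lambda>w. chi w \<inter> L1) -` E1 \<inter> space M) \<inter> ((\<lambda>w. chi w \<inter> L2) -` E2 \<inter> space M)) =
       prob ((\<lambda>w. chi w \<inter> L1) -` E1 \<inter> space M) * prob ((\<lambda>w. chi w \<inter> L2) -` E2 \<inter> space M)"
      unfolding 1(7) 2(7) using eq[unfolded 1(7) 2(7)] by simp
  qed
  show ?thesis
    unfolding indep_var_eq sig
    using indep_set_sigma_sets[OF ind stab stab] Int_chi_measurable L by auto
qed

lemma ppp_image:
  assumes g: "inj g" "g \<in> measurable borel borel" "distr N borel g = N" "\<And>X. nice X \<Longrightarrow> nice (g ` X)"
  shows "ppp M N (\<lambda>w. g ` chi w)"
proof unfold_locales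
  have cg: "card (g ` X \<inter> A) = card (X \<inter> g -` A)" for X A
  proof -
    have "g ` X \<inter> A = g ` (X \<inter> g -` A)" by auto
    then show ?thesis using g(1) by (simp add: card_image inj_on_subset)
  qed
  have fg: "finite (g ` X \<inter> A) \<longleftrightarrow> finite (X \<inter> g -` A)" for X A
  proof -
    have "g ` X \<inter> A = g ` (X \<inter> g -` A)" by auto
    then show ?thesis using g(1) by (simp add: finite_image_iff inj_on_subset)
  qed
  have gN: "g \<in> measurable N borel" using g(2) measurable_cong_sets[OF sets_N refl] by blast
  have em: "emeasure N (g -` A) = emeasure N A" if "A \<in> sets borel" for A
    using emeasure_distr[OF gN that] g(3) space_N by simp
  then have me: "measure N (g -` A) = measure N A" if "A \<in> sets borel" for A
    using that by (simp add: measure_def)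
  have gA: "g -` A \<in> sets borel" if "A \<in> sets borel" for A using measurable_sets[OF g(2) that] by simp
  show "(\<lambda>w. card (g ` chi w \<inter> A)) \<in> measurable M (count_space UNIV)"
    "prob {w \<in> space M. card (g ` chi w \<inter> A) = k} = pois (measure N A) k"
    "AE w in M. finite (g ` chi w \<inter> A)" if A: "A \<in> sets borel" "emeasure N A < \<infinity>" for A k
    using A count_measurable[of "g -` A"] count_prob[of "g -` A" k] count_AE_finite[of "g -` A"] gA em me
    by (simp_all add: cg fg)
  fix J :: "nat set" and C f
  assume J: "finite J" "\<And>j. j \<in> J \<Longrightarrow> C j \<in> sets borel \<and> emeasure N (C j) < \<infinity>" "disjoint_family_on C J"
  have "disjoint_family_on (\<lambda>i. g -` C i) J" using J(3) unfolding disjoint_family_on_def by blast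
  then have "prob {w \<in> space M. \<forall>j\<in>J. card (chi w \<inter> (g -` C j)) = f j} = (\<Prod>j\<in>J. pois (measure N (g -` C j)) (f j))"
    using J gA em by (intro count_joint_finite) auto
  then show "prob {w \<in> space M. \<forall>j\<in>J. card (g ` chi w \<inter> C j) = f j} = (\<Prod>j\<in>J. pois (measure N (C j)) (f j))"
    using J(2) me by (simp add: cg)
qed (use sets_N fin_slab g(4) nice_chi in auto)

lemma ppp_image_law:
  assumes g: "inj g" "g \<in> measurable borel borel" "distr N borel g = N" "\<And>X. nice X \<Longrightarrow> nice (g ` X)"
  shows "distr M nconf (\<lambda>w. g ` chi w) = distr M nconf chi"
  by (rule ppp_law_unique[OF ppp_image[OF g]]) unfold_locales

end

section \<open>Invariance of the intensity\<close>

lemma poisson_process_nice_version: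
  fixes N :: "('a::euclidean_space \<times> real \<times> real) measure"
  assumes P: "poisson_point_process M N chi" and sN: "sets N = sets borel"
    and fs: "\<And>n. emeasure N (slab n) < \<infinity>"
    and z: "emeasure N {p. tm p < 0 \<or> rd p \<le> 0} = 0"
  shows "\<exists>chi'. ppp M N chi' \<and> (AE w in M. chi' w = chi w)"
proof -
  have "prob_space M" using P unfolding poisson_point_process_def by blast
  then interpret prob_space M .
  note P1 = P[unfolded poisson_point_process_def, THEN conjunct2, THEN conjunct1, rule_format]
  note P2 = P[unfolded poisson_point_process_def, THEN conjunct2, THEN conjunct2, rule_format]
  let ?Z = "{p :: 'a \<times> real \<times> real. tm p < 0 \<or> rd p \<le> 0}"
  have ZM: "?Z \<in> sets borel" 
  proof -
    have "?Z = {p. tm p < 0} \<union> {p. rd p \<le> 0}" by auto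
    moreover have "open {p :: 'a \<times> real \<times> real. tm p < 0}"
      by (intro open_Collect_less continuous_intros)
    moreover have "closed {p :: 'a \<times> real \<times> real. rd p \<le> 0}"
      by (intro closed_Collect_le continuous_intros)
    ultimately show ?thesis by auto
  qed
  have "AE w in M. chi w \<inter> ?Z = {}"
  proof -
    have "prob {w \<in> space M. card (chi w \<inter> ?Z) = 0} = 1"
      using P1[of ?Z] ZM z sN by (simp add: measure_def)
    then have "AE w in M. card (chi w \<inter> ?Z) = 0"
      using P1[of ?Z] ZM z sN by (subst prob_Collect_eq_1[symmetric]) (auto simp: measure_def)
    moreover have "AE w in M. finite (chi w \<inter> ?Z)" using P1[of ?Z] ZM z sN by simp
    ultimately show ?thesis by eventually_elim simp
  qed
  moreover have "AE w in M. \<forall>n. finite (chi w \<inter> slab n)"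
    using P1[of "slab _"] fs sN by (intro AE_all_countable[THEN iffD2] allI) auto
  ultimately have "AE w in M. nice (chi w)"
    by eventually_elim (unfold nice_def, fastforce)
  then obtain Z where Z: "Z \<in> null_sets M" "{w \<in> space M. \<not> nice (chi w)} \<subseteq> Z"
    unfolding eventually_ae_filter by auto
  define chi' where "chi' w = (if w \<in> Z \<or> w \<notin> space M then {} else chi w)" for w
  have eq: "AE w in M. chi' w = chi w"
    using AE_not_in[OF Z(1)] AE_space by eventually_elim (simp add: chi'_def)
  have nice': "nice (chi' w)" for w using Z(2) by (auto simp: chi'_def nice_def)
  have meas: "(\<lambda>w. card (chi' w \<inter> A)) \<in> measurable M (count_space UNIV)"
    if A: "A \<in> sets borel" "emeasure N A < \<infinity>" for A
  proof -
    have [measurable]: "Z \<in> sets M" using Z by auto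
    have [measurable]: "(\<lambda>w. card (chi w \<inter> A)) \<in> measurable M (count_space UNIV)" using P1[of A] A sN by simp
    have "(\<lambda>w. if w \<in> Z then 0 else card (chi w \<inter> A)) \<in> measurable M (count_space UNIV)" by measurable
    then show ?thesis by (rule measurable_cong[THEN iffD1, rotated]) (auto simp: chi'_def)
  qed
  have "ppp M N chi'"
  proof unfold_locales
    fix A :: "('a \<times> real \<times> real) set" and k :: nat assume A: "A \<in> sets borel" "emeasure N A < \<infinity>"
    have "prob {w \<in> space M. card (chi' w \<inter> A) = k} = prob {w \<in> space M. card (chi w \<inter> A) = k}"
    proof (rule finite_measure_eq_AE)
      show "AE w in M. (w \<in> {w \<in> space M. card (chi' w \<inter> A) = k}) = (w \<in> {w \<in> space M. card (chi w \<inter> A) = k})"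
        using eq by eventually_elim simp
    qed (use meas[OF A] P1[of A] A sN in \<open>auto intro!: measurable_count_space_eq2_countable[THEN iffD1, THEN conjunct2, rule_format] \<close>)
    then show "prob {w \<in> space M. card (chi' w \<inter> A) = k} = pois (measure N A) k"
      using P1[of A] A sN by (simp add: pois_def)
    show "AE w in M. finite (chi' w \<inter> A)" using P1[of A] A sN eq by auto
  next
    fix J :: "nat set" and C f
    assume J: "finite J" "\<And>j. j \<in> J \<Longrightarrow> C j \<in> sets borel \<and> emeasure N (C j) < \<infinity>" "disjoint_family_on C J"
    have ev: "{w \<in> space M. \<forall>j\<in>J. card (X w \<inter> C j) = f j} \<in> events"
      if "\<And>j. j \<in> J \<Longrightarrow> (\<lambda>w. card (X w \<inter> C j)) \<in> measurable M (count_space UNIV)" for X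
    proof (intro sets.sets_Collect_finite_All J)
      fix j assume "j \<in> J"
      from measurable_sets[OF that[OF this], of "{f j}"] show "{w \<in> space M. card (X w \<inter> C j) = f j} \<in> events"
        by (auto simp: vimage_def Int_def conj_commute)
    qed
    have m: "(\<lambda>w. card (chi w \<inter> C j)) \<in> measurable M (count_space UNIV)" if "j \<in> J" for j
      using P1[of "C j"] J(2)[OF that] sN by simp
    have "prob {w \<in> space M. \<forall>j\<in>J. card (chi' w \<inter> C j) = f j} = prob {w \<in> space M. \<forall>j\<in>J. card (chi w \<inter> C j) = f j}"
    proof (rule finite_measure_eq_AE)
      show "AE w in M. (w \<in> {w \<in> space M. \<forall>j\<in>J. card (chi' w \<inter> C j) = f j}) = (w \<in> {w \<in> space M. \<forall>j\<in>J. card (chi w \<inter> C j) = f j})"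
        using eq by eventually_elim simp
      show "{w \<in> space M. \<forall>j\<in>J. card (chi' w \<inter> C j) = f j} \<in> events" using J(2) meas by (intro ev) auto
      show "{w \<in> space M. \<forall>j\<in>J. card (chi w \<inter> C j) = f j} \<in> events" using m by (intro ev) auto
    qed
    also have "\<dots> = (\<Prod>j\<in>J. pois (measure N (C j)) (f j))"
    proof (cases "J = {}")
      case False
      have "indep_vars (\<lambda>_. count_space UNIV) (\<lambda>i w. card (chi w \<inter> C i)) J"
        using J by (intro P2) (auto simp: sN)
      from indep_varsD_finite[OF this False J(1), of "\<lambda>j. {f j}"]
      have "prob (\<Inter>j\<in>J. (\<lambda>w. card (chi w \<inter> C j)) -` {f j} \<inter> space M) =
        (\<Prod>j\<in>J. prob ((\<lambda>w. card (chi w \<inter> C j)) -` {f j} \<inter> space M))" by simp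
      moreover have "(\<Inter>j\<in>J. (\<lambda>w. card (chi w \<inter> C j)) -` {f j} \<inter> space M) = {w \<in> space M. \<forall>j\<in>J. card (chi w \<inter> C j) = f j}"
        using False by auto
      moreover have "(\<lambda>w. card (chi w \<inter> C j)) -` {f j} \<inter> space M = {w \<in> space M. card (chi w \<inter> C j) = f j}" for j
        by auto
      moreover have "prob {w \<in> space M. card (chi w \<inter> C j) = f j} = pois (measure N (C j)) (f j)" if "j \<in> J" for j
        using P1[of "C j"] J(2)[OF that] sN by (simp add: pois_def)
      ultimately show ?thesis by simp
    qed (simp add: prob_space)
    finally show "prob {w \<in> space M. \<forall>j\<in>J. card (chi' w \<inter> C j) = f j} = (\<Prod>j\<in>J. pois (measure N (C j)) (f j))" .
  qed (use sN fs nice' meas in auto)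
  then show ?thesis using eq by blast
qed

lemma nn_integral_lborel_shift:
  fixes a :: "'a::euclidean_space"
  assumes [measurable]: "F \<in> borel_measurable borel"
  shows "(\<integral>\<^sup>+x. F (x + a) \<partial>lborel) = (\<integral>\<^sup>+x. F x \<partial>lborel)"
proof -
  have "(\<integral>\<^sup>+x. F x \<partial>lborel) = (\<integral>\<^sup>+x. F x \<partial>(distr lborel borel ((+) a)))" by (simp add: lborel_distr_plus)
  also have "\<dots> = (\<integral>\<^sup>+x. F (a + x) \<partial>lborel)" by (subst nn_integral_distr) auto
  finally show ?thesis by (simp add: add.commute)
qed

lemma emeasure_lborel_shift:
  fixes a :: "'a::euclidean_space"
  assumes [measurable]: "A \<in> sets borel"
  shows "emeasure lborel {x. x + a \<in> A} = emeasure lborel A"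
proof -
  have "{x. x + a \<in> A} \<in> sets borel" by measurable
  then show ?thesis using nn_integral_lborel_shift[of "indicator A" a]
    by (simp flip: nn_integral_indicator add: indicator_def)
qed

text \<open>Integrate \<open>1\<^sub>A (f x + y) 1\<^sub>E (y)\<close>, \<open>E\<close> the unit ball, in both orders: translation invariance
  gives \<open>|E| |f\<^sup>-\<^sup>1 A|\<close> one way and \<open>|A| |E|\<close> the other way.\<close>

lemma emeasure_lborel_involutive_isometry:
  fixes f :: "'a::euclidean_space \<Rightarrow> 'a"
  assumes f: "linear f" "\<And>x. f (f x) = x" "\<And>x. norm (f x) = norm x" and A[measurable]: "A \<in> sets borel"
  shows "emeasure lborel (f -` A) = emeasure lborel A"
proof -
  have [measurable]: "f \<in> borel_measurable borel"
    using linear_continuous_on[OF linear_conv_bounded_linear[THEN iffD1, OF f(1)]]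
    by (intro borel_measurable_continuous_onI) auto
  let ?E = "ball (0::'a) 1"
  have [measurable]: "?E \<in> sets borel" by simp
  have fA[measurable]: "f -` A \<in> sets borel" using measurable_sets[of f borel borel A] by simp
  let ?I = "\<lambda>x y. indicator A (f x + y) * indicator ?E y :: ennreal"
  have add: "f x + y = f (x + f y)" for x y using f by (simp add: linear_add)
  have "(\<integral>\<^sup>+y. \<integral>\<^sup>+x. ?I x y \<partial>lborel \<partial>lborel) = (\<integral>\<^sup>+y. emeasure lborel (f -` A) * indicator ?E y \<partial>lborel)"
  proof (rule nn_integral_cong)
    fix y
    have "(\<integral>\<^sup>+x. ?I x y \<partial>lborel) = (\<integral>\<^sup>+x. indicator (f -` A) (x + f y) \<partial>lborel) * indicator ?E y"
      by (simp add: nn_integral_multc add) (simp add: indicator_def)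
    then show "(\<integral>\<^sup>+x. ?I x y \<partial>lborel) = emeasure lborel (f -` A) * indicator ?E y"
      by (subst (asm) nn_integral_lborel_shift) auto
  qed
  then have 1: "(\<integral>\<^sup>+y. \<integral>\<^sup>+x. ?I x y \<partial>lborel \<partial>lborel) = emeasure lborel (f -` A) * emeasure lborel ?E"
    by (simp only:) (rule nn_integral_cmult_indicator, simp)
  have "(\<integral>\<^sup>+x. \<integral>\<^sup>+y. ?I x y \<partial>lborel \<partial>lborel) = (\<integral>\<^sup>+x. \<integral>\<^sup>+y. indicator A y * indicator ?E (y - f x) \<partial>lborel \<partial>lborel)"
  proof (rule nn_integral_cong)
    fix x
    have "(\<lambda>y. indicator A y * indicator ?E (y - f x) :: ennreal) \<in> borel_measurable borel" by measurable
    then show "(\<integral>\<^sup>+y. ?I x y \<partial>lborel) = (\<integral>\<^sup>+y. indicator A y * indicator ?E (y - f x) \<partial>lborel)"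
      using nn_integral_lborel_shift[of "\<lambda>y. indicator A y * indicator ?E (y - f x)" "f x"] by (simp add: add.commute)
  qed
  also have "\<dots> = (\<integral>\<^sup>+y. \<integral>\<^sup>+x. indicator A y * indicator ?E (y - f x) \<partial>lborel \<partial>lborel)"
    by (rule lborel_pair.Fubini') measurable
  also have "\<dots> = (\<integral>\<^sup>+y. indicator A y * emeasure lborel ?E \<partial>lborel)"
  proof (rule nn_integral_cong)
    fix y
    have "norm (y - f x) = norm (x + (- f y))" for x
      using f(3)[of "y - f x"] f by (simp add: linear_diff norm_minus_commute)
    then have "indicator ?E (y - f x) = (indicator ?E (x + (- f y)) :: ennreal)" for x by (simp add: indicator_def)
    then show "(\<integral>\<^sup>+x. indicator A y * indicator ?E (y - f x) \<partial>lborel) = indicator A y * emeasure lborel ?E"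
      using nn_integral_lborel_shift[of "indicator ?E" "- f y"] by (simp add: nn_integral_cmult)
  qed
  also have "\<dots> = emeasure lborel A * emeasure lborel ?E" by (simp add: nn_integral_multc)
  finally have 2: "(\<integral>\<^sup>+x. \<integral>\<^sup>+y. ?I x y \<partial>lborel \<partial>lborel) = emeasure lborel A * emeasure lborel ?E" .
  have 3: "(\<integral>\<^sup>+x. \<integral>\<^sup>+y. ?I x y \<partial>lborel \<partial>lborel) = (\<integral>\<^sup>+y. \<integral>\<^sup>+x. ?I x y \<partial>lborel \<partial>lborel)"
    by (rule lborel_pair.Fubini') measurable
  have "emeasure lborel (f -` A) * emeasure lborel ?E = emeasure lborel A * emeasure lborel ?E"
    using 1 2 3 by simp
  then have "emeasure lborel (f -` A) * (emeasure lborel ?E * ennreal (1 / measure lborel ?E)) = emeasure lborel A * (emeasure lborel ?E * ennreal (1 / measure lborel ?E))"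
    by (simp only: mult.assoc[symmetric])
  moreover have "emeasure lborel ?E * ennreal (1 / measure lborel ?E) = 1"
  proof -
    have "measure lborel ?E > 0" by (rule content_ball_pos) simp
    moreover have "emeasure lborel ?E = ennreal (measure lborel ?E)"
      using emeasure_lborel_ball_finite[of "0::'a" 1] by (intro emeasure_eq_ennreal_measure) (simp add: less_top)
    ultimately show ?thesis by (simp add: ennreal_mult[symmetric])
  qed
  ultimately show ?thesis by simp
qed

lemma exists_reflection:
  fixes u v :: "'a::euclidean_space"
  assumes "norm u = norm v"
  obtains f where "linear f" "\<And>x. f (f x) = x" "\<And>x. norm (f x) = norm x" "f u = v"
proof (cases "u = v")
  case True
  then show ?thesis using that[of id] by (simp add: linear_id)
next
  case False
  define w where "w = u - v"
  define f where "f x = x - (2 * (x \<bullet> w) / (w \<bullet> w)) *\<^sub>R w" for x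
  have w: "w \<bullet> w \<noteq> 0" using False by (simp add: w_def)
  have lin: "linear f" unfolding f_def
    by (rule linearI) (simp_all add: inner_add_left algebra_simps add_divide_distrib)
  have inv: "f (f x) = x" for x
  proof -
    have "2 * (f x \<bullet> w) / (w \<bullet> w) = - (2 * (x \<bullet> w) / (w \<bullet> w))"
      using w by (simp add: f_def inner_diff_left field_simps)
    then show ?thesis unfolding f_def[of "f x"] by (simp add: f_def)
  qed
  have "f x \<bullet> f x = x \<bullet> x" for x
  proof -
    define a where "a = 2 * (x \<bullet> w) / (w \<bullet> w)"
    have "a * (w \<bullet> w) = 2 * (x \<bullet> w)" using w by (simp add: a_def)
    then have "a * (a * (w \<bullet> w)) = a * (2 * (x \<bullet> w))" by simp
    moreover have "f x \<bullet> f x = x \<bullet> x - 2 * a * (x \<bullet> w) + a * (a * (w \<bullet> w))"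
      by (simp add: f_def a_def[symmetric] inner_diff_left inner_diff_right inner_commute[of w x] right_diff_distrib)
    ultimately show ?thesis by simp
  qed
  then have nrm: "norm (f x) = norm x" for x by (simp add: norm_eq_sqrt_inner)
  have "w \<bullet> w = 2 * (u \<bullet> w)"
  proof -
    have "u \<bullet> u = v \<bullet> v" using assms by (simp add: norm_eq_sqrt_inner)
    then show ?thesis unfolding w_def by (simp add: inner_diff_left inner_diff_right inner_commute)
  qed
  then have "f u = v" unfolding f_def using w by (simp add: w_def)
  with lin inv nrm show ?thesis by (rule that)
qed

abbreviation time_measure :: "real measure" where
  "time_measure \<equiv> density lborel (indicator {0..})"

lemma sigma_finite_time: "sigma_finite_measure time_measure"
  by (subst sigma_finite_measure.sigma_finite_iff_density_finite[OF sigma_finite_lborel]) (auto simp: indicator_def)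

lemma emeasure_time: "B \<in> sets borel \<Longrightarrow> emeasure time_measure B = emeasure lborel (B \<inter> {0..})"
  by (subst emeasure_density) (auto simp flip: nn_integral_indicator intro!: nn_integral_cong simp: indicator_def)

locale radius_law = prob_space mu for mu :: "real measure" +
  assumes sets_mu: "sets mu = sets borel" and mu_pos: "emeasure mu {0<..} = 1"
begin

lemma space_mu: "space mu = UNIV"
  using sets_eq_imp_space_eq[OF sets_mu] by simp

lemma sets_time_mu: "sets (time_measure \<Otimes>\<^sub>M mu) = sets borel"
proof -
  have "sets (time_measure \<Otimes>\<^sub>M mu) = sets (borel \<Otimes>\<^sub>M borel)" by (rule sets_pair_measure_cong) (auto simp: sets_mu)
  then show ?thesis unfolding borel_prod .
qed

lemma sets_intensity: "sets (deijfen_intensity mu :: ('a::euclidean_space \<times> real \<times> real) measure) = sets borel"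
proof -
  have "sets (deijfen_intensity mu :: ('a \<times> real \<times> real) measure) = sets (borel \<Otimes>\<^sub>M borel)"
    unfolding deijfen_intensity_def by (rule sets_pair_measure_cong[OF sets_lborel sets_time_mu])
  then show ?thesis unfolding borel_prod .
qed

lemma pair_sf: "pair_sigma_finite time_measure mu"
  by (simp add: pair_sigma_finite_def sigma_finite_time sigma_finite_measure_axioms)

lemma sf_time_mu: "sigma_finite_measure (time_measure \<Otimes>\<^sub>M mu)"
proof -
  interpret pair_sigma_finite time_measure mu by (rule pair_sf)
  show ?thesis by unfold_locales
qed

lemma emeasure_intensity_Times:
  fixes U :: "'a::euclidean_space set"
  assumes "U \<in> sets borel" "V \<in> sets borel"
  shows "emeasure (deijfen_intensity mu) (U \<times> V) = emeasure lborel U * emeasure (time_measure \<Otimes>\<^sub>M mu) V"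
proof -
  interpret sigma_finite_measure "time_measure \<Otimes>\<^sub>M mu" by (rule sf_time_mu)
  show ?thesis unfolding deijfen_intensity_def using assms sets_time_mu
    by (intro emeasure_pair_measure_Times) auto
qed

lemma emeasure_time_mu: "V \<in> sets borel \<Longrightarrow>
   emeasure (time_measure \<Otimes>\<^sub>M mu) V = (\<integral>\<^sup>+ r. emeasure time_measure ((\<lambda>t. (t, r)) -` V) \<partial>mu)"
proof -
  interpret pair_sigma_finite time_measure mu by (rule pair_sf)
  assume "V \<in> sets borel" then show ?thesis using sets_time_mu by (intro emeasure_pair_measure_alt2) auto
qed

lemma emeasure_time_mu_Times:
  assumes "B \<in> sets borel" "C \<in> sets borel"
  shows "emeasure (time_measure \<Otimes>\<^sub>M mu) (B \<times> C) = emeasure lborel (B \<inter> {0..}) * emeasure mu C"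
  using assms sets_mu by (subst emeasure_pair_measure_Times) (auto simp: emeasure_time)

lemma slab_intensity_finite:
  "emeasure (deijfen_intensity mu) (slab n :: ('a::euclidean_space \<times> real \<times> real) set) < \<infinity>"
proof -
  have b: "({..real n} \<times> UNIV :: (real \<times> real) set) \<in> sets borel"
    by (intro borel_closed closed_Times) auto
  have "{..real n} \<inter> {0..} = {0..real n}" by auto
  then have "emeasure (time_measure \<Otimes>\<^sub>M mu) ({..real n} \<times> UNIV) = ennreal (real n)"
    using emeasure_space_1 by (subst emeasure_time_mu_Times) (auto simp: space_mu)
  then show ?thesis unfolding slab_def using b emeasure_lborel_cball_finite[of "0::'a" "real n"]
    by (subst emeasure_intensity_Times) (auto simp: ennreal_mult_less_top)
qed

lemma null_intensity:
  "emeasure (deijfen_intensity mu) {p :: 'a::euclidean_space \<times> real \<times> real. tm p < 0 \<or> rd p \<le> 0} = 0"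
proof -
  have "{p :: 'a \<times> real \<times> real. tm p < 0 \<or> rd p \<le> 0} = UNIV \<times> ({..<0} \<times> UNIV \<union> UNIV \<times> {..0})" by auto
  moreover have b1: "({..<0} \<times> UNIV :: (real \<times> real) set) \<in> sets borel" by (intro borel_open open_Times) auto
  moreover have b2: "(UNIV \<times> {..0} :: (real \<times> real) set) \<in> sets borel" by (intro borel_closed closed_Times) auto
  moreover have "emeasure (time_measure \<Otimes>\<^sub>M mu) ({..<0} \<times> UNIV) = 0"
  proof -
    have "{..<0} \<inter> {0::real..} = {}" by auto
    then show ?thesis by (subst emeasure_time_mu_Times) auto
  qed
  moreover have "emeasure (time_measure \<Otimes>\<^sub>M mu) (UNIV \<times> {..0}) = 0"
  proof -
    have "{..0} = space mu - {0<..}" by (auto simp: space_mu)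
    then have "emeasure mu {..0} = 0" using mu_pos emeasure_compl[of "{0<..}" mu] emeasure_space_1 by (simp add: sets_mu)
    then show ?thesis by (subst emeasure_time_mu_Times) auto
  qed
  ultimately have "emeasure (time_measure \<Otimes>\<^sub>M mu) ({..<0} \<times> UNIV \<union> UNIV \<times> {..0}) = 0"
    using sets_time_mu by (intro emeasure_Un_null_set[THEN trans]) (auto simp: null_sets_def)
  then show ?thesis
    using b1 b2 \<open>{p :: 'a \<times> real \<times> real. tm p < 0 \<or> rd p \<le> 0} = _\<close> by (simp add: emeasure_intensity_Times)
qed

lemma intensity_invariant:
  fixes f :: "'a::euclidean_space \<Rightarrow> 'a"
  assumes fm[measurable]: "f \<in> borel_measurable borel" and hm[measurable]: "h \<in> borel_measurable borel"
    and k: "0 < k"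
    and f: "\<And>U. U \<in> sets borel \<Longrightarrow> emeasure lborel (f -` U) = ennreal k * emeasure lborel U"
    and h: "\<And>U. U \<in> sets borel \<Longrightarrow> emeasure time_measure (h -` U) = ennreal (1 / k) * emeasure time_measure U"
  shows "distr (deijfen_intensity mu) borel (\<lambda>(c, t, r). (f c, h t, r)) = deijfen_intensity mu"
proof -
  let ?N = "deijfen_intensity mu :: ('a \<times> real \<times> real) measure"
  let ?g = "\<lambda>(c::'a, t::real, r::real). (f c, h t, r)"
  let ?h = "\<lambda>(t::real, r::real). (h t, r)"
  have hm': "?h \<in> measurable borel borel" unfolding borel_prod[symmetric] by measurable
  have gb: "?g \<in> measurable borel borel" unfolding borel_prod[symmetric] by measurable
  have gm: "?g \<in> measurable ?N borel"
    using gb measurable_cong_sets[OF sets_intensity refl] by blast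
  have "?N = distr ?N borel ?g"
    unfolding deijfen_intensity_def
  proof (rule pair_measure_eqI[OF sigma_finite_lborel sf_time_mu])
    show "sets (lborel \<Otimes>\<^sub>M (time_measure \<Otimes>\<^sub>M mu)) = sets (distr (lborel \<Otimes>\<^sub>M (time_measure \<Otimes>\<^sub>M mu)) borel ?g)"
      using sets_intensity[where 'a='a] unfolding deijfen_intensity_def by simp
    fix U :: "'a set" and V assume U: "U \<in> sets lborel" and V0: "V \<in> sets (time_measure \<Otimes>\<^sub>M mu)"
    have Ub: "U \<in> sets borel" using U by simp
    have V: "V \<in> sets borel" using V0 sets_time_mu by simp
    have fU: "f -` U \<in> sets borel" using measurable_sets[OF fm Ub] by simp
    have hV: "?h -` V \<in> sets borel" using measurable_sets[OF hm' V] by simp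
    have UV: "U \<times> V \<in> sets borel" using Ub V by (metis borel_prod pair_measureI)
    have "emeasure (time_measure \<Otimes>\<^sub>M mu) (?h -` V) = (\<integral>\<^sup>+ r. ennreal (1 / k) * emeasure time_measure ((\<lambda>t. (t, r)) -` V) \<partial>mu)"
      unfolding emeasure_time_mu[OF hV]
    proof (rule nn_integral_cong)
      fix r :: real
      have tm: "(\<lambda>t::real. (t, r)) \<in> borel_measurable borel" by (intro borel_measurable_continuous_onI continuous_intros)
      have "(\<lambda>t. (t, r)) -` V \<in> sets borel"
        using measurable_sets[OF tm V] by simp
      moreover have "(\<lambda>t. (t, r)) -` (?h -` V) = h -` ((\<lambda>t. (t, r)) -` V)" by auto
      ultimately show "emeasure time_measure ((\<lambda>t. (t, r)) -` ?h -` V) = ennreal (1 / k) * emeasure time_measure ((\<lambda>t. (t, r)) -` V)"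
        using h by simp
    qed
    also have "\<dots> = ennreal (1 / k) * emeasure (time_measure \<Otimes>\<^sub>M mu) V"
      unfolding emeasure_time_mu[OF V]
    proof (rule nn_integral_cmult)
      interpret pair_sigma_finite time_measure mu by (rule pair_sf)
      show "(\<lambda>r. emeasure time_measure ((\<lambda>t. (t, r)) -` V)) \<in> borel_measurable mu"
        by (rule measurable_emeasure_Pair2[OF V0])
    qed
    finally have hV2: "emeasure (time_measure \<Otimes>\<^sub>M mu) (?h -` V) = ennreal (1 / k) * emeasure (time_measure \<Otimes>\<^sub>M mu) V" .
    have "?g -` (U \<times> V) = (f -` U) \<times> (?h -` V)" by auto
    then have "emeasure (distr ?N borel ?g) (U \<times> V) = emeasure ?N ((f -` U) \<times> (?h -` V))"
      using emeasure_distr[OF gm UV] sets_eq_imp_space_eq[OF sets_intensity[where 'a='a]] by simp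
    also have "\<dots> = (ennreal k * emeasure lborel U) * (ennreal (1 / k) * emeasure (time_measure \<Otimes>\<^sub>M mu) V)"
      using fU hV f[OF Ub] hV2 by (simp add: emeasure_intensity_Times)
    also have "\<dots> = ennreal (k * (1 / k)) * (emeasure lborel U * emeasure (time_measure \<Otimes>\<^sub>M mu) V)"
      using k by (subst ennreal_mult) (auto simp: mult_ac)
    also have "\<dots> = emeasure lborel U * emeasure (time_measure \<Otimes>\<^sub>M mu) V" using k by simp
    finally show "emeasure lborel U * emeasure (time_measure \<Otimes>\<^sub>M mu) V = emeasure (distr (lborel \<Otimes>\<^sub>M (time_measure \<Otimes>\<^sub>M mu)) borel ?g) (U \<times> V)"
      unfolding deijfen_intensity_def by simp
  qed
  then show ?thesis by simp
qed

end

lemma nice_image: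
  fixes f :: "'a::euclidean_space \<Rightarrow> 'a" and K :: nat
  assumes X: "nice X" and "k > 0" and f: "inj f" and b: "\<And>x. norm x \<le> a * norm (f x) + b" and a: "a \<ge> 0" "b \<ge> 0"
  shows "nice ((\<lambda>(c, t, r). (f c, k * t, r)) ` X)"
  unfolding nice_def
proof (intro conjI allI ballI)
  let ?g = "\<lambda>(c, t, r). (f c, k * t, r) :: 'a \<times> real \<times> real"
  fix n :: nat
  obtain m :: nat where m: "a * real n + b + real n / k \<le> real m" using real_arch_simple by blast
  have "?g ` X \<inter> slab n \<subseteq> ?g ` (X \<inter> slab m)"
  proof
    fix p assume p: "p \<in> ?g ` X \<inter> slab n"
    then obtain c t r where ctr: "(c, t, r) \<in> X" "p = (f c, k * t, r)" by auto
    have 1: "norm (f c) \<le> real n" "k * t \<le> real n" using p ctr by (auto simp: slab_def)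
    have "norm c \<le> a * real n + b" using b[of c] mult_left_mono[OF 1(1) a(1)] by linarith
    moreover have "t \<le> real n / k" using 1 assms(2) by (simp add: field_simps)
    moreover have "0 \<le> real n / k" "0 \<le> a * real n + b" using assms by auto
    ultimately have "(c, t, r) \<in> slab m" using m by (auto simp: slab_def)
    then show "p \<in> ?g ` (X \<inter> slab m)" using ctr by force
  qed
  moreover have "finite (X \<inter> slab m)" using X by (auto simp: nice_def)
  ultimately show "finite (?g ` X \<inter> slab n)" using finite_subset by blast
next
  fix p assume "p \<in> (\<lambda>(c, t, r). (f c, k * t, r)) ` X"
  then obtain c t r where ctr: "(c, t, r) \<in> X" "p = (f c, k * t, r)" by auto
  then show "0 \<le> tm p" "0 < rd p" using X assms(2) by (auto simp: nice_def)
qed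

section \<open>Lattice cells, outer probabilities and covering times\<close>

definition lat :: "'a::euclidean_space set" where
  "lat = {z. \<forall>b\<in>Basis. z \<bullet> b \<in> \<int>}"

definition fl :: "'a::euclidean_space \<Rightarrow> 'a" where
  "fl x = (\<Sum>b\<in>Basis. of_int \<lfloor>x \<bullet> b\<rfloor> *\<^sub>R b)"

definition cell :: "real \<Rightarrow> 'a::euclidean_space \<Rightarrow> 'a set" where
  "cell h z = {x. fl (x /\<^sub>R h) = z}"

lemma fl_inner: "b \<in> Basis \<Longrightarrow> fl x \<bullet> b = of_int \<lfloor>x \<bullet> b\<rfloor>"
  unfolding fl_def by (simp add: inner_sum_left inner_Basis if_distrib sum.delta cong: if_cong)

lemma fl_lat: "fl x \<in> lat"
  by (simp add: lat_def fl_inner)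

lemma fl_id: "z \<in> lat \<Longrightarrow> fl z = z"
  by (rule euclidean_eqI) (auto simp: fl_inner lat_def elim!: Ints_cases)

lemma norm_le_coord: "(\<And>b. b \<in> Basis \<Longrightarrow> \<bar>x \<bullet> b\<bar> \<le> a) \<Longrightarrow> norm (x::'a::euclidean_space) \<le> real DIM('a) * a"
  for a :: real
  by (rule order_trans[OF norm_le_l1]) (use sum_bounded_above[of Basis "\<lambda>b. \<bar>x \<bullet> b\<bar>" a] in auto)

lemma fl_near: "norm (x - fl x) \<le> DIM('a)" for x :: "'a::euclidean_space"
proof -
  have "\<bar>(x - fl x) \<bullet> b\<bar> \<le> 1" if "b \<in> Basis" for b using that by (simp add: inner_diff_left fl_inner) linarith
  from norm_le_coord[OF this] show ?thesis by simp
qed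

lemma fl_diff: "norm ((fl x - fl y) - (x - y)) \<le> DIM('a)" for x :: "'a::euclidean_space"
proof -
  have "\<bar>((fl x - fl y) - (x - y)) \<bullet> b\<bar> \<le> 1" if "b \<in> Basis" for b using that by (simp add: inner_diff_left fl_inner) linarith
  from norm_le_coord[OF this] show ?thesis by simp
qed

lemma fl_diff_norm: 
  fixes x y :: "'a::euclidean_space"
  shows "norm (fl x - fl y) \<le> norm (x - y) + DIM('a)" "norm (x - y) - DIM('a) \<le> norm (fl x - fl y)"
  using fl_diff[of x y] norm_triangle_ineq3[of "fl x - fl y" "x - y"] by linarith+

lemma fl_step:
  assumes "norm (x - y) \<le> 1" "b \<in> Basis"
  shows "\<bar>(fl x - fl y) \<bullet> b\<bar> \<le> 1"
proof -
  have 1: "\<bar>x \<bullet> b - y \<bullet> b\<bar> \<le> 1" using Basis_le_norm[of b "x - y"] assms by (simp add: inner_diff_left)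
  have "\<lfloor>x \<bullet> b\<rfloor> \<le> \<lfloor>y \<bullet> b + 1\<rfloor>" "\<lfloor>y \<bullet> b\<rfloor> \<le> \<lfloor>x \<bullet> b + 1\<rfloor>"
    by (rule floor_mono, use 1 in linarith)+
  then have "\<bar>\<lfloor>x \<bullet> b\<rfloor> - \<lfloor>y \<bullet> b\<rfloor>\<bar> \<le> 1" using one_add_floor[of "x \<bullet> b"] one_add_floor[of "y \<bullet> b"] by linarith
  then have "real_of_int \<bar>\<lfloor>x \<bullet> b\<rfloor> - \<lfloor>y \<bullet> b\<rfloor>\<bar> \<le> real_of_int 1" by (simp only: of_int_le_iff)
  then show ?thesis using assms(2) by (simp add: inner_diff_left fl_inner)
qed

lemma lat_diff: "x \<in> lat \<Longrightarrow> y \<in> lat \<Longrightarrow> x - y \<in> lat" and lat_add: "x \<in> lat \<Longrightarrow> y \<in> lat \<Longrightarrow> x + y \<in> lat"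
  and lat_0: "0 \<in> lat"
  by (auto simp: lat_def inner_diff_left inner_add_left)

lemma lat_box_card:
  fixes R :: real
  assumes "0 \<le> R"
  shows "finite {z\<in>(lat :: 'a::euclidean_space set). \<forall>b\<in>Basis. \<bar>z \<bullet> b\<bar> \<le> R}"
    and "card {z\<in>(lat :: 'a::euclidean_space set). \<forall>b\<in>Basis. \<bar>z \<bullet> b\<bar> \<le> R} \<le> (2 * R + 1) ^ DIM('a)"
proof -
  let ?L = "{z\<in>(lat :: 'a set). \<forall>b\<in>Basis. \<bar>z \<bullet> b\<bar> \<le> R}"
  let ?P = "PiE (Basis :: 'a set) (\<lambda>_. {-\<lfloor>R\<rfloor>..\<lfloor>R\<rfloor>})"
  define F where "F z = (\<lambda>b\<in>(Basis :: 'a set). \<lfloor>z \<bullet> b\<rfloor>)" for z :: 'a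
  have fin: "finite ?P" by (intro finite_PiE) auto
  have inj: "inj_on F ?L"
  proof (rule inj_onI)
    fix x y assume xy: "x \<in> ?L" "y \<in> ?L" "F x = F y"
    have "x \<bullet> b = y \<bullet> b" if b: "b \<in> Basis" for b
    proof -
      have "\<lfloor>x \<bullet> b\<rfloor> = \<lfloor>y \<bullet> b\<rfloor>" using fun_cong[OF xy(3), of b] b by (simp add: F_def)
      then show ?thesis using xy(1,2) b by (auto simp: lat_def elim!: Ints_cases ballE[of _ _ b])
    qed
    then show "x = y" by (rule euclidean_eqI)
  qed
  have sub: "F ` ?L \<subseteq> ?P"
  proof
    fix g assume "g \<in> F ` ?L"
    then obtain z where z: "z \<in> ?L" "g = F z" by auto
    have "\<lfloor>z \<bullet> b\<rfloor> \<in> {-\<lfloor>R\<rfloor>..\<lfloor>R\<rfloor>}" if b: "b \<in> Basis" for b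
    proof -
      have "z \<bullet> b \<in> \<int>" "\<bar>z \<bullet> b\<bar> \<le> R" using z b by (auto simp: lat_def)
      then obtain i where "z \<bullet> b = of_int i" "\<bar>real_of_int i\<bar> \<le> R" by (auto elim!: Ints_cases)
      then show ?thesis by (auto simp: le_floor_iff) linarith
    qed
    then show "g \<in> ?P" using z by (auto simp: F_def)
  qed
  show "finite ?L" using inj finite_subset[OF sub fin] finite_imageD by blast
  have "card ?L = card (F ` ?L)" using inj by (simp add: card_image)
  also have "\<dots> \<le> card ?P" by (rule card_mono[OF fin sub])
  also have "\<dots> = (card {-\<lfloor>R\<rfloor>..\<lfloor>R\<rfloor>}) ^ DIM('a)" by (simp add: card_PiE)
  finally have "card ?L \<le> card {-\<lfloor>R\<rfloor>..\<lfloor>R\<rfloor>} ^ DIM('a)" .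
  then have "real (card ?L) \<le> real (card {-\<lfloor>R\<rfloor>..\<lfloor>R\<rfloor>} ^ DIM('a))" by (rule of_nat_mono)
  also have "\<dots> = real (card {-\<lfloor>R\<rfloor>..\<lfloor>R\<rfloor>}) ^ DIM('a)" by (rule of_nat_power)
  also have "\<dots> \<le> (2 * R + 1) ^ DIM('a)"
  proof (rule power_mono)
    have "0 \<le> \<lfloor>R\<rfloor>" using assms by simp
    then have "real (card {-\<lfloor>R\<rfloor>..\<lfloor>R\<rfloor>}) = 2 * of_int \<lfloor>R\<rfloor> + 1" by simp
    then show "real (card {-\<lfloor>R\<rfloor>..\<lfloor>R\<rfloor>}) \<le> 2 * R + 1" using of_int_floor_le[of R] by linarith
  qed simp
  finally show "card ?L \<le> (2 * R + 1) ^ DIM('a)" .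
qed

lemma lat_ball_card:
  fixes R :: real
  assumes "0 \<le> R"
  shows "finite {z\<in>(lat :: 'a::euclidean_space set). norm z \<le> R}"
    and "card {z\<in>(lat :: 'a::euclidean_space set). norm z \<le> R} \<le> (2 * R + 1) ^ DIM('a)"
proof -
  have sub: "{z\<in>(lat :: 'a set). norm z \<le> R} \<subseteq> {z\<in>lat. \<forall>b\<in>Basis. \<bar>z \<bullet> b\<bar> \<le> R}"
    by (auto intro: order_trans[OF Basis_le_norm])
  show "finite {z\<in>(lat :: 'a set). norm z \<le> R}" using finite_subset[OF sub] lat_box_card(1)[OF assms] by blast
  show "card {z\<in>(lat :: 'a set). norm z \<le> R} \<le> (2 * R + 1) ^ DIM('a)"
    using card_mono[OF lat_box_card(1)[OF assms] sub] lat_box_card(2)[where 'a='a, OF assms] by linarith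
qed

lemma countable_lat: "countable (lat :: 'a::euclidean_space set)"
proof -
  have "lat \<subseteq> (\<Union>n::nat. {z\<in>(lat :: 'a set). norm z \<le> real n})"
    using real_arch_simple by auto
  moreover have "countable (\<Union>n::nat. {z\<in>(lat :: 'a set). norm z \<le> real n})"
    using lat_ball_card(1)[where 'a='a] by (intro countable_UN) (auto intro: countable_finite)
  ultimately show ?thesis by (rule countable_subset)
qed

lemma cell_iff:
  assumes "h > 0" "z \<in> lat"
  shows "x \<in> cell h z \<longleftrightarrow> (\<forall>b\<in>Basis. h * (z \<bullet> b) \<le> x \<bullet> b \<and> x \<bullet> b < h * (z \<bullet> b + 1))"
proof -
  have "x \<in> cell h z \<longleftrightarrow> (\<forall>b\<in>Basis. of_int \<lfloor>(x \<bullet> b) / h\<rfloor> = z \<bullet> b)"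
    unfolding cell_def by (auto simp: euclidean_eq_iff[of "fl _"] fl_inner divide_inverse mult.commute)
  also have "\<dots> \<longleftrightarrow> (\<forall>b\<in>Basis. h * (z \<bullet> b) \<le> x \<bullet> b \<and> x \<bullet> b < h * (z \<bullet> b + 1))"
  proof (rule ball_cong[OF refl])
    fix b :: 'a assume "b \<in> Basis"
    then obtain i where i: "z \<bullet> b = of_int i" using assms(2) by (auto simp: lat_def elim!: Ints_cases)
    have "of_int \<lfloor>(x \<bullet> b) / h\<rfloor> = z \<bullet> b \<longleftrightarrow> \<lfloor>(x \<bullet> b) / h\<rfloor> = i" using i by simp
    also have "\<dots> \<longleftrightarrow> h * (z \<bullet> b) \<le> x \<bullet> b \<and> x \<bullet> b < h * (z \<bullet> b + 1)"
      using assms(1) i by (simp add: floor_eq_iff field_simps)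
    finally show "of_int \<lfloor>(x \<bullet> b) / h\<rfloor> = z \<bullet> b \<longleftrightarrow> h * (z \<bullet> b) \<le> x \<bullet> b \<and> x \<bullet> b < h * (z \<bullet> b + 1)" .
  qed
  finally show ?thesis .
qed

lemma cell_borel: assumes "h > 0" "z \<in> lat" shows "cell h z \<in> sets borel"
proof -
  have "cell h z = (\<Inter>b\<in>Basis. {x. h * (z \<bullet> b) \<le> x \<bullet> b} \<inter> {x. x \<bullet> b < h * (z \<bullet> b + 1)})"
    using cell_iff[OF assms] by auto
  also have "\<dots> \<in> sets borel"
    by (intro sets.finite_INT sets.Int borel_closed borel_open closed_Collect_le open_Collect_less continuous_intros) auto
  finally show ?thesis .
qed

lemma cell_measure:
  fixes z :: "'a::euclidean_space"
  assumes "h > 0" "z \<in> lat"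
  shows "emeasure lborel (cell h z) = ennreal (h ^ DIM('a))"
proof (rule antisym)
  let ?o = "\<Sum>b\<in>Basis. b :: 'a"
  have o: "?o \<bullet> b = 1" if "b \<in> Basis" for b using that by (simp add: inner_sum_left inner_Basis if_distrib cong: if_cong)
  have "cell h z \<subseteq> cbox (h *\<^sub>R z) (h *\<^sub>R (z + ?o))"
    using cell_iff[OF assms] by (auto simp: mem_box o inner_add_left less_imp_le)
  then have "emeasure lborel (cell h z) \<le> emeasure lborel (cbox (h *\<^sub>R z) (h *\<^sub>R (z + ?o)))"
    by (intro emeasure_mono) auto
  also have "\<dots> = ennreal (h ^ DIM('a))"
    using assms by (subst emeasure_lborel_cbox) (auto simp: inner_add_left o algebra_simps)
  finally show "emeasure lborel (cell h z) \<le> ennreal (h ^ DIM('a))" .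
  have "box (h *\<^sub>R z) (h *\<^sub>R (z + ?o)) \<subseteq> cell h z"
    using cell_iff[OF assms] by (auto simp: mem_box o inner_add_left less_imp_le)
  then have "emeasure lborel (box (h *\<^sub>R z) (h *\<^sub>R (z + ?o))) \<le> emeasure lborel (cell h z)"
    using cell_borel[OF assms] by (intro emeasure_mono) auto
  moreover have "emeasure lborel (box (h *\<^sub>R z) (h *\<^sub>R (z + ?o))) = ennreal (h ^ DIM('a))"
    using assms by (subst emeasure_lborel_box) (auto simp: inner_add_left o algebra_simps)
  ultimately show "ennreal (h ^ DIM('a)) \<le> emeasure lborel (cell h z)" by simp
qed

lemma cell_self: "x \<in> cell h (fl (x /\<^sub>R h))"
  by (simp add: cell_def)

lemma cell_near: 
  fixes x :: "'a::euclidean_space"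
  assumes "x \<in> cell h z" "h > 0"
  shows "norm (x - h *\<^sub>R z) \<le> h * DIM('a)"
proof -
  have "x - h *\<^sub>R z = h *\<^sub>R (x /\<^sub>R h - fl (x /\<^sub>R h))" using assms by (simp add: cell_def algebra_simps)
  then show ?thesis using fl_near[of "x /\<^sub>R h"] assms by (simp add: mult_left_mono)
qed

lemma cell_dist:
  fixes x y :: "'a::euclidean_space"
  assumes "x \<in> cell h z" "y \<in> cell h z'" "h > 0"
  shows "norm (x - y) \<le> h * (norm (z - z') + DIM('a))"
proof -
  have "norm (x /\<^sub>R h - y /\<^sub>R h) \<le> norm (z - z') + DIM('a)"
    using fl_diff_norm(2)[of "x /\<^sub>R h" "y /\<^sub>R h"] assms by (simp add: cell_def)
  then have "h * norm (x /\<^sub>R h - y /\<^sub>R h) \<le> h * (norm (z - z') + DIM('a))"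
    using assms(3) by (intro mult_left_mono) auto
  moreover have "h * norm (x /\<^sub>R h - y /\<^sub>R h) = norm (x - y)"
  proof -
    have "x - y = h *\<^sub>R (x /\<^sub>R h - y /\<^sub>R h)" using assms(3) by (simp add: scaleR_right_diff_distrib)
    then show ?thesis using assms(3) by (metis abs_of_pos norm_scaleR)
  qed
  ultimately show ?thesis by simp
qed

lemma lat_path:
  fixes z z' :: "'a::euclidean_space"
  assumes z: "z \<in> lat" "z' \<in> lat"
  shows "\<exists>zs. zs \<noteq> [] \<and> hd zs = z \<and> last zs = z' \<and> distinct zs \<and> set zs \<subseteq> lat \<and>
     successively (\<lambda>u v. norm (v - u) \<le> 3 * DIM('a) + 2) zs \<and> length zs \<le> norm (z' - z) + 2"
proof -
  let ?d = "real DIM('a)"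
  define D where "D = norm (z' - z)"
  consider "z = z'" | "z \<noteq> z'" "D < ?d + 1" | "D \<ge> ?d + 1" by linarith
  then show ?thesis
  proof cases
    case 1 then show ?thesis using z by (intro exI[of _ "[z]"]) (auto simp: D_def)
  next
    case 2 then show ?thesis using z by (intro exI[of _ "[z,z']"]) (auto simp: D_def)
  next
    case 3
    define k where "k = nat \<lfloor>D / (?d + 1)\<rfloor>"
    have Dd: "1 \<le> D / (?d + 1)" using 3 by (simp add: field_simps)
    then have fl1: "1 \<le> \<lfloor>D / (?d + 1)\<rfloor>" by (simp add: le_floor_iff)
    then have k: "real k = of_int \<lfloor>D / (?d + 1)\<rfloor>" "k \<ge> 1" unfolding k_def by linarith+
    have k1: "real k \<le> D / (?d + 1)" "D / (?d + 1) < real k + 1" unfolding k(1) by linarith+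
    have kpos: "0 < real k" using k(2) by simp
    define s where "s = D / real k"
    have d0: "0 < ?d + 1" by simp
    have "real k * (?d + 1) \<le> D" using k1(1) unfolding pos_le_divide_eq[OF d0] .
    then have s1: "?d + 1 \<le> s" unfolding s_def pos_le_divide_eq[OF kpos] by (simp only: mult.commute)
    have "D < (real k + 1) * (?d + 1)" using k1(2) unfolding pos_divide_less_eq[OF d0] .
    also have "\<dots> \<le> (2 * real k) * (?d + 1)" using k(2) by (intro mult_right_mono) auto
    finally have "D \<le> (2 * ?d + 2) * real k" by (simp add: algebra_simps)
    then have s2: "s \<le> 2 * ?d + 2" unfolding s_def pos_divide_le_eq[OF kpos] .
    define p where "p i = z + (real i / real k) *\<^sub>R (z' - z)" for i :: nat
    define zs where "zs = map (\<lambda>i. fl (p i)) [0..<Suc k]"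
    have pd: "norm (p i - p j) = \<bar>real i - real j\<bar> * s" for i j
    proof -
      have "p i - p j = ((real i - real j) / real k) *\<^sub>R (z' - z)"
        by (simp add: p_def diff_divide_distrib scaleR_left_diff_distrib)
      then show ?thesis using kpos by (simp add: s_def D_def)
    qed
    have "inj_on (\<lambda>i. fl (p i)) {0..<Suc k}"
    proof (rule inj_onI, rule ccontr)
      fix i j assume eq: "fl (p i) = fl (p j)" and ne: "i \<noteq> j"
      have "1 * s \<le> \<bar>real i - real j\<bar> * s" using ne s1 by (intro mult_right_mono) auto
      moreover have "norm (fl (p i) - fl (p j)) = 0" using eq by simp
      ultimately show False using fl_diff_norm(2)[of "p i" "p j"] pd[of i j] s1 by linarith
    qed
    then have dist: "distinct zs" unfolding zs_def by (simp only: distinct_map set_upt distinct_upt simp_thms)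
    have succ: "successively (\<lambda>u v. norm (v - u) \<le> 3 * DIM('a) + 2) zs"
      unfolding successively_conv_nth
    proof (intro allI impI)
      fix i assume i: "Suc i < length zs"
      then have i': "i < Suc k" "Suc i < Suc k" unfolding zs_def by auto
      have e: "zs ! i = fl (p i)" "zs ! Suc i = fl (p (Suc i))" unfolding zs_def using i' by (auto simp del: upt_Suc)
      have "norm (fl (p (Suc i)) - fl (p i)) \<le> s + ?d" using fl_diff_norm(1)[of "p (Suc i)" "p i"] pd[of "Suc i" i] by simp
      then show "norm (zs ! Suc i - zs ! i) \<le> 3 * DIM('a) + 2" using s2 unfolding e by simp
    qed
    have "D / (?d + 1) \<le> D / 1" using 3 by (intro divide_left_mono) auto
    then have "real k \<le> D" using k1(1) by simp
    then have len: "length zs \<le> norm (z' - z) + 2" unfolding zs_def D_def by simp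
    have "hd zs = z" unfolding zs_def using fl_id[OF z(1)] by (simp add: p_def hd_map upt_conv_Cons del: upt_Suc)
    moreover have "last zs = z'" unfolding zs_def using fl_id[OF z(2)] kpos by (simp add: p_def)
    moreover have "set zs \<subseteq> lat" "zs \<noteq> []" unfolding zs_def using fl_lat by auto
    ultimately show ?thesis using dist succ len by blast
  qed
qed

lemma power_le_fact_exp: "0 \<le> (x::real) \<Longrightarrow> x ^ p \<le> fact p * exp x"
proof -
  assume x: "0 \<le> x"
  have "(\<lambda>n. x ^ n / fact n) sums exp x"
    using exp_converges[of x] by (simp add: divide_inverse mult.commute)
  then have "x ^ p / fact p \<le> exp x"
    using sum_le_suminf[of "\<lambda>n. x ^ n / fact n" "{p}"] x by (simp add: sums_iff)
  then show ?thesis using pos_divide_le_eq[of "fact p" "x ^ p" "exp x"] by (simp only: fact_gt_zero mult.commute)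
qed

lemma summable_poly_exp:
  fixes a b c :: real
  assumes "0 < a" "0 \<le> b" "0 < c"
  shows "summable (\<lambda>n::nat. (a * n + b) ^ p * exp (- c * n))"
proof (rule summable_comparison_test)
  let ?q = "c / (2 * a)" 
  let ?C = "fact p * (1 / ?q) ^ p * exp (?q * b)"
  have "norm ((a * real n + b) ^ p * exp (- c * real n)) \<le> ?C * exp (- (c / 2)) ^ n" for n :: nat
  proof -
    have "(?q * (a * n + b)) ^ p \<le> fact p * exp (?q * (a * n + b))"
      using assms by (intro power_le_fact_exp) auto
    then have "(1 / ?q) ^ p * (?q * (a * n + b)) ^ p \<le> (1 / ?q) ^ p * (fact p * exp (?q * (a * n + b)))"
      using assms by (intro mult_left_mono) auto
    moreover have "(1 / ?q) ^ p * (?q * (a * n + b)) ^ p = (a * n + b) ^ p"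
      using assms by (simp flip: power_mult_distrib)
    ultimately have "(a * n + b) ^ p * exp (- c * n) \<le> (1 / ?q) ^ p * (fact p * exp (?q * (a * n + b))) * exp (- c * n)"
      by (intro mult_right_mono) auto
    also have "\<dots> = fact p * (1 / ?q) ^ p * (exp (?q * (a * n + b)) * exp (- c * n))" by simp
    also have "exp (?q * (a * n + b)) * exp (- c * n) = exp (?q * b) * exp (- (c / 2)) ^ n"
      unfolding exp_of_nat_mult[symmetric] exp_add[symmetric] using assms by (simp add: field_simps)
    finally show ?thesis using assms by simp
  qed
  then show "\<exists>N. \<forall>n\<ge>N. norm ((a * real n + b) ^ p * exp (- c * real n)) \<le> ?C * exp (- (c / 2)) ^ n" by blast
  show "summable (\<lambda>n. ?C * exp (- (c / 2)) ^ n)"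
    using assms by (intro summable_mult summable_geometric) auto
qed

context prob_space begin

definition outer_prob_le :: "('a \<Rightarrow> bool) \<Rightarrow> real \<Rightarrow> bool" where
  "outer_prob_le E p \<longleftrightarrow> (\<exists>B\<in>events. {w\<in>space M. E w} \<subseteq> B \<and> prob B \<le> p)"

lemma outer_prob_leI: "B \<in> events \<Longrightarrow> (\<And>w. w \<in> space M \<Longrightarrow> E w \<Longrightarrow> w \<in> B) \<Longrightarrow> prob B \<le> p \<Longrightarrow> outer_prob_le E p"
  unfolding outer_prob_le_def by blast

lemma outer_prob_le_mono: "outer_prob_le E p \<Longrightarrow> (\<And>w. w \<in> space M \<Longrightarrow> E' w \<Longrightarrow> E w) \<Longrightarrow> p \<le> q \<Longrightarrow> outer_prob_le E' q"
  unfolding outer_prob_le_def by (elim bexE conjE, rule_tac x=B in bexI) auto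

lemma outer_prob_le_AE_mono:
  assumes "outer_prob_le E p" "AE w in M. E' w \<longrightarrow> E w" "p \<le> q"
  shows "outer_prob_le E' q"
proof -
  obtain B where B: "B \<in> events" "{w\<in>space M. E w} \<subseteq> B" "prob B \<le> p" using assms(1) by (auto simp: outer_prob_le_def)
  obtain Z where Z: "Z \<in> null_sets M" "{w \<in> space M. \<not> (E' w \<longrightarrow> E w)} \<subseteq> Z"
    using assms(2) unfolding eventually_ae_filter by auto
  have "prob (B \<union> Z) \<le> prob B + prob Z" using B Z by (intro measure_Un_le) auto
  also have "prob Z = 0" using Z by (simp add: measure_eq_0_null_sets)
  finally show ?thesis using B Z assms(3) by (intro outer_prob_leI[of "B \<union> Z"]) auto
qed

lemma outer_prob_le_prob: "outer_prob_le E p \<Longrightarrow> prob {w\<in>space M. E w} \<le> p"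
  unfolding outer_prob_le_def by (meson finite_measure_mono order_trans)

lemma outer_prob_le_UN:
  assumes "finite I" "\<And>i. i \<in> I \<Longrightarrow> outer_prob_le (E i) (p i)"
  shows "outer_prob_le (\<lambda>w. \<exists>i\<in>I. E i w) (\<Sum>i\<in>I. p i)"
proof -
  obtain B where B: "\<And>i. i \<in> I \<Longrightarrow> B i \<in> events \<and> {w\<in>space M. E i w} \<subseteq> B i \<and> prob (B i) \<le> p i"
    using assms(2) unfolding outer_prob_le_def by metis
  have "prob (\<Union>i\<in>I. B i) \<le> (\<Sum>i\<in>I. prob (B i))"
    using B assms(1) by (intro finite_measure_subadditive_finite) auto
  also have "\<dots> \<le> (\<Sum>i\<in>I. p i)" using B by (intro sum_mono) auto
  finally show ?thesis using B assms(1) by (intro outer_prob_leI[of "\<Union>i\<in>I. B i"]) (auto intro!: sets.finite_UN)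
qed

lemma outer_prob_le_UN_const:
  assumes "finite I" "\<And>i. i \<in> I \<Longrightarrow> outer_prob_le (E i) p" "real (card I) * p \<le> q"
  shows "outer_prob_le (\<lambda>w. \<exists>i\<in>I. E i w) q"
  using outer_prob_le_mono[OF outer_prob_le_UN[OF assms(1,2)]] assms(3) by simp

lemma outer_prob_le_UN_nat:
  assumes "\<And>i::nat. outer_prob_le (E i) (p i)" "p sums q"
  shows "outer_prob_le (\<lambda>w. \<exists>i. E i w) q"
proof -
  obtain B where B: "\<And>i. B i \<in> events \<and> {w\<in>space M. E i w} \<subseteq> B i \<and> prob (B i) \<le> p i"
    using assms(1) unfolding outer_prob_le_def by metis
  have sB: "summable (\<lambda>i. prob (B i))"
    by (rule summable_comparison_test[OF _ sums_summable[OF assms(2)]]) (use B in auto)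
  have "prob (\<Union>i. B i) \<le> (\<Sum>i. prob (B i))"
    using B sB by (intro finite_measure_subadditive_countably) auto
  also have "\<dots> \<le> (\<Sum>i. p i)" using B sB assms(2) by (intro suminf_le) (auto simp: sums_iff)
  also have "\<dots> = q" using assms(2) by (simp add: sums_iff)
  finally show ?thesis using B by (intro outer_prob_leI[of "\<Union>i. B i"]) auto
qed

lemma outer_prob_le_borel_cantelli:
  assumes "\<And>n::nat. n \<ge> n0 \<Longrightarrow> outer_prob_le (E n) (p n)" "summable p"
  shows "AE w in M. \<exists>n1. \<forall>n\<ge>n1. \<not> E n w"
proof -
  have "\<forall>n. \<exists>B. n \<ge> n0 \<longrightarrow> B \<in> events \<and> {w\<in>space M. E n w} \<subseteq> B \<and> prob B \<le> p n"
    using assms(1) unfolding outer_prob_le_def by blast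
  then obtain B where B: "\<And>n. n \<ge> n0 \<Longrightarrow> B n \<in> events \<and> {w\<in>space M. E n w} \<subseteq> B n \<and> prob (B n) \<le> p n" by metis
  define C where "C n = B (n + n0)" for n
  have C: "C n \<in> events" "prob (C n) \<le> p (n + n0)" for n using B[of "n + n0"] by (auto simp: C_def)
  have sC: "summable (\<lambda>n. prob (C n))"
    by (rule summable_comparison_test[OF _ summable_ignore_initial_segment[OF assms(2), of n0]]) (use C in auto)
  have "AE w in M. eventually (\<lambda>n. w \<in> space M - C n) sequentially"
    using C(1) sC by (intro borel_cantelli_AE1) (auto simp: less_top[symmetric])
  then show ?thesis
  proof eventually_elim
    case (elim w)
    then obtain n1 where n1: "\<And>n. n \<ge> n1 \<Longrightarrow> w \<in> space M - C n" by (auto simp: eventually_sequentially)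
    have "\<not> E n w" if "n \<ge> n1 + n0" for n
    proof -
      have "w \<in> space M - B n" using n1[of "n - n0"] that by (simp add: C_def)
      moreover have "{w\<in>space M. E n w} \<subseteq> B n" using B[of n] that by simp
      ultimately show ?thesis by blast
    qed
    then show ?case by blast
  qed
qed

end

lemma cov_measurable [measurable]:
  "Measurable.pred nconf (\<lambda>X. cov X x y s)"
proof -
  let ?P = "\<lambda>F. \<forall>X. (\<forall>b\<in>F. X \<inter> b \<noteq> {}) \<longrightarrow> cov X x y s"
  obtain B :: "('a \<times> real \<times> real) set set" where B: "countable B" "topological_basis B"
    using ex_countable_basis by blast
  define B' where "B' = {b\<in>B. bounded b}"
  define FF where "FF = {F. F \<subseteq> B' \<and> finite F \<and> ?P F}"
  have "countable B'" using B by (auto simp: B'_def)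
  then have "countable {F. F \<subseteq> B' \<and> finite F}" using countable_Collect_finite_subset[of B'] by (simp add: conj_commute)
  then have cF: "countable FF" unfolding FF_def by (rule countable_subset[rotated]) auto
  have bB': "bset b" if "b \<in> B'" for b
    using that topological_basis_open[OF B(2)] by (intro bset_bounded) (auto simp: B'_def)
  have ne: "{X\<in>space nconf. X \<inter> b \<noteq> {}} \<in> sets nconf" if "b \<in> B'" for b
  proof -
    have "{X\<in>space nconf. X \<inter> b \<noteq> {}} = space nconf - ((\<lambda>X. card (X \<inter> b)) -` {0} \<inter> space nconf)"
    proof -
      have "card (X \<inter> b) = 0 \<longleftrightarrow> X \<inter> b = {}" if "nice X" for X
        using nice_finite[OF that bB'[OF \<open>b \<in> B'\<close>]] by (simp add: card_eq_0_iff)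
      then show ?thesis unfolding space_nconf by blast
    qed
    then show ?thesis using sets.compl_sets[OF measurable_sets[OF card_measurable_nconf[OF bB'[OF that]], of "{0}"]] by simp
  qed
  have "{X\<in>space nconf. cov X x y s} = (\<Union>F\<in>FF. {X\<in>space nconf. \<forall>b\<in>F. X \<inter> b \<noteq> {}})"
  proof (intro equalityI subsetI)
    fix X assume X: "X \<in> {X\<in>space nconf. cov X x y s}"
    obtain X0 e where X0: "finite X0" "X0 \<subseteq> X" "0 < e"
      and c: "\<And>X'. (\<forall>p\<in>X0. \<exists>p'\<in>X'. dist p p' < e) \<Longrightarrow> cov X' x y s"
      using cov_robust[of X x y s] X by blast
    have "\<forall>p\<in>X0. \<exists>b\<in>B. p \<in> b \<and> b \<subseteq> ball p e"
    proof
      fix p assume "p \<in> X0"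
      have "p \<in> ball p e" using X0(3) by simp
      then obtain b where "b \<in> B" "p \<in> b" "b \<subseteq> ball p e" by (rule topological_basisE[OF B(2) open_ball])
      then show "\<exists>b\<in>B. p \<in> b \<and> b \<subseteq> ball p e" by (intro bexI[of _ b] conjI)
    qed
    then obtain b where b: "\<And>p. p \<in> X0 \<Longrightarrow> b p \<in> B \<and> p \<in> b p \<and> b p \<subseteq> ball p e" by metis
    have "?P (b ` X0)"
    proof (intro allI impI c ballI)
      fix X' p assume X': "\<forall>b\<in>b ` X0. X' \<inter> b \<noteq> {}" and p: "p \<in> X0"
      then obtain p' where "p' \<in> X'" "p' \<in> b p" by blast
      then show "\<exists>p'\<in>X'. dist p p' < e" using b[OF p] by (intro bexI[of _ p']) auto
    qed
    moreover have "b ` X0 \<subseteq> B'"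
    proof
      fix c assume "c \<in> b ` X0"
      then obtain p where p: "p \<in> X0" "c = b p" by blast
      then show "c \<in> B'" unfolding B'_def using b[OF p(1)] bounded_subset[OF bounded_ball, of c p e] by simp
    qed
    ultimately have "b ` X0 \<in> FF" unfolding FF_def using X0(1) by simp
    moreover have "\<forall>c\<in>b ` X0. X \<inter> c \<noteq> {}" using b X0(2) by blast
    ultimately show "X \<in> (\<Union>F\<in>FF. {X\<in>space nconf. \<forall>b\<in>F. X \<inter> b \<noteq> {}})" using X by blast
  next
    fix X assume "X \<in> (\<Union>F\<in>FF. {X\<in>space nconf. \<forall>b\<in>F. X \<inter> b \<noteq> {}})"
    then obtain F where "F \<in> FF" "X \<in> space nconf" "\<forall>b\<in>F. X \<inter> b \<noteq> {}" by blast
    then show "X \<in> {X\<in>space nconf. cov X x y s}" unfolding FF_def by simp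
  qed
  also have "\<dots> \<in> sets nconf"
  proof (rule sets.countable_UN'[OF cF], rule image_subsetI)
    fix F assume "F \<in> FF"
    then show "{X\<in>space nconf. \<forall>b\<in>F. X \<inter> b \<noteq> {}} \<in> sets nconf"
      unfolding FF_def by (intro sets.sets_Collect_finite_All ne) auto
  qed
  finally show ?thesis by (simp add: pred_def)
qed

text \<open>Integer valued covering time of a unit ball from another one: it is measurable and subadditive.
  Junk value 0 if the ball is never covered.\<close>

definition cover_time :: "('a::euclidean_space \<times> real \<times> real) set \<Rightarrow> 'a \<Rightarrow> 'a \<Rightarrow> nat" where
  "cover_time X x y = (if \<exists>n::nat. cov X x y (real n) then LEAST n. cov X x y (real n) else 0)"

lemma cover_time_measurable [measurable]: "(\<lambda>X. cover_time X x y) \<in> measurable nconf (count_space UNIV)"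
  unfolding cover_time_def by measurable

lemma cover_time_le: "cov X x y (real n) \<Longrightarrow> cover_time X x y \<le> n"
  unfolding cover_time_def by (auto intro: Least_le)

lemma cover_time_cov: "cov X x y s \<Longrightarrow> cov X x y (real (cover_time X x y))"
proof -
  assume "cov X x y s"
  moreover obtain n :: nat where "s \<le> real n" using real_arch_simple by blast
  ultimately have "\<exists>n. cov X x y (real n)" by (meson cov_mono order_refl)
  then show ?thesis unfolding cover_time_def by (auto intro: LeastI_ex)
qed

lemma cover_time_le_real: "cov X x y s \<Longrightarrow> 0 \<le> s \<Longrightarrow> real (cover_time X x y) \<le> s + 1"
proof -
  assume c: "cov X x y s" and s: "0 \<le> s"
  have "s \<le> real (nat \<lceil>s\<rceil>)" by linarith
  then have "cov X x y (real (nat \<lceil>s\<rceil>))" using c cov_mono[OF c order_refl] by blast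
  then have "cover_time X x y \<le> nat \<lceil>s\<rceil>" by (rule cover_time_le)
  then show ?thesis using s by linarith
qed

lemma cover_time_triangle:
  assumes "cov X x y s" "cov X y z s'"
  shows "cover_time X x z \<le> cover_time X x y + cover_time X y z"
  using cov_trans[OF cover_time_cov[OF assms(1)] cover_time_cov[OF assms(2)]] by (intro cover_time_le) simp

lemma cov_image_iff:
  assumes f: "\<And>x y. norm (f x - f y) = norm (x - y)" "surj f"
  shows "cov ((\<lambda>(c, t, r). (f c, t, r)) ` X) (f x) (f y) s \<longleftrightarrow> cov X x y s"
proof
  have inj: "inj f" using f(1) by (metis injI norm_eq_zero right_minus_eq)
  let ?g = "inv f"
  have gf1: "?g (f x) = x" for x using inj by simp
  have gf2: "f (?g x) = x" for x using f(2) by (simp add: surj_f_inv_f)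
  note gf = gf1 gf2
  have g: "norm (?g x - ?g y) = norm (x - y)" for x y using f(1)[of "?g x" "?g y"] gf by simp
  have sg: "surj ?g" using gf1 by (metis surjI)
  assume "cov ((\<lambda>(c, t, r). (f c, t, r)) ` X) (f x) (f y) s"
  from cov_image[OF this g sg]
  show "cov X x y s" by (simp add: gf image_image case_prod_beta)
qed (rule cov_image[OF _ f])

lemma cover_time_image:
  assumes "\<And>x y. norm (f x - f y) = norm (x - y)" "surj f"
  shows "cover_time ((\<lambda>(c, t, r). (f c, t, r)) ` X) (f x) (f y) = cover_time X x y"
  unfolding cover_time_def by (simp only: cov_image_iff[OF assms])

section \<open>Crossing large distances through balls of fixed size\<close>

lemma (in prob_space) outer_prob_le_null:
  assumes "\<And>e. e > 0 \<Longrightarrow> outer_prob_le E e"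
  shows "AE w in M. \<not> E w"
proof -
  have "\<forall>n::nat. \<exists>B. B \<in> events \<and> {w\<in>space M. E w} \<subseteq> B \<and> prob B \<le> 1 / real (Suc n)"
    using assms unfolding outer_prob_le_def by (metis of_nat_0_less_iff zero_less_Suc zero_less_divide_1_iff)
  then obtain B where B: "\<And>n::nat. B n \<in> events \<and> {w\<in>space M. E w} \<subseteq> B n \<and> prob (B n) \<le> 1 / real (Suc n)" by metis
  define C where "C = (\<Inter>n. B n)"
  have C: "C \<in> events" unfolding C_def using B by (intro sets.countable_INT) auto
  have "prob C \<le> 1 / real (Suc n)" for n
  proof -
    have "prob C \<le> prob (B n)" using B[of n] by (intro finite_measure_mono) (auto simp: C_def)
    then show ?thesis using B[of n] by linarith
  qed
  then have "prob C \<le> 0" by (intro LIMSEQ_le_const[OF LIMSEQ_inverse_real_of_nat]) (auto simp: inverse_eq_divide)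
  then have "prob C = 0" using measure_nonneg[of M C] by linarith
  then have "C \<in> null_sets M" using C by (auto simp: emeasure_eq_measure null_sets_def)
  moreover have "{w\<in>space M. \<not> \<not> E w} \<subseteq> C" using B unfolding C_def by blast
  ultimately show ?thesis by (rule AE_I')
qed

lemma list_below:
  fixes vs :: "nat list"
  assumes "q \<le> sum_list vs"
  shows "\<exists>l. list_all2 (\<le>) l vs \<and> sum_list l = q"
  using assms
proof (induction vs arbitrary: q)
  case (Cons v vs)
  have "q - min v q \<le> sum_list vs" using Cons.prems by auto
  then obtain l where "list_all2 (\<le>) l vs" "sum_list l = q - min v q" using Cons.IH by blast
  then show ?case by (intro exI[of _ "min v q # l"]) auto
qed auto

locale deijfen_process = R: radius_law mu + ppp M "deijfen_intensity mu" chi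
  for mu :: "real measure" and M :: "'w measure" and chi :: "'w \<Rightarrow> ('a::euclidean_space \<times> real \<times> real) set"
begin

abbreviation N :: "('a \<times> real \<times> real) measure" where "N \<equiv> deijfen_intensity mu"

lemma nice_tm: "p \<in> chi w \<Longrightarrow> 0 \<le> tm p"
  using nice_chi[of w] by (auto simp: nice_def)

lemma law_isometry:
  fixes f :: "'a \<Rightarrow> 'a"
  assumes fm: "f \<in> borel_measurable borel" and fl: "\<And>U. U \<in> sets borel \<Longrightarrow> emeasure lborel (f -` U) = emeasure lborel U"
    and iso: "\<And>x y. norm (f x - f y) = norm (x - y)"
  shows "distr M nconf (\<lambda>w. (\<lambda>(c, t, r). (f c, t, r)) ` chi w) = distr M nconf chi"
proof (rule ppp_image_law)
  have inj: "inj f" using iso by (metis injI norm_eq_zero right_minus_eq)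
  show "inj (\<lambda>(c::'a, t::real, r::real). (f c, t, r))" using inj by (auto simp: inj_def)
  note fm[measurable]
  show "(\<lambda>(c::'a, t::real, r::real). (f c, t, r)) \<in> measurable borel borel" unfolding borel_prod[symmetric] by measurable
  show "distr N borel (\<lambda>(c, t, r). (f c, t, r)) = N"
    by (rule R.intensity_invariant[of f "\<lambda>t. t" 1]) (use fm fl in auto)
  fix X :: "('a \<times> real \<times> real) set" assume X: "nice X"
  have "norm x \<le> 1 * norm (f x) + norm (f 0)" for x
    using iso[of x 0] norm_triangle_ineq4[of "f x" "f 0"] by simp
  from nice_image[OF X zero_less_one inj this] show "nice ((\<lambda>(c, t, r). (f c, t, r)) ` X)" by simp
qed

lemma iso_measurable:
  fixes f :: "'a \<Rightarrow> 'a"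
  assumes fm: "f \<in> borel_measurable borel" and iso: "\<And>x y. norm (f x - f y) = norm (x - y)"
    and fl: "\<And>U. U \<in> sets borel \<Longrightarrow> emeasure lborel (f -` U) = emeasure lborel U"
  shows "(\<lambda>w. (\<lambda>(c, t, r). (f c, t, r)) ` chi w) \<in> measurable M nconf"
proof -
  have inj: "inj f" using iso by (metis injI norm_eq_zero right_minus_eq)
  have "ppp M N (\<lambda>w. (\<lambda>(c, t, r). (f c, t, r)) ` chi w)"
  proof (rule ppp_image)
    show "inj (\<lambda>(c::'a, t::real, r::real). (f c, t, r))" using inj by (auto simp: inj_def)
    note fm[measurable]
    show "(\<lambda>(c::'a, t::real, r::real). (f c, t, r)) \<in> measurable borel borel" unfolding borel_prod[symmetric] by measurable
    show "distr N borel (\<lambda>(c, t, r). (f c, t, r)) = N"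
      by (rule R.intensity_invariant[of f "\<lambda>t. t" 1]) (use fm fl in auto)
    fix X :: "('a \<times> real \<times> real) set" assume X: "nice X"
    have "norm x \<le> 1 * norm (f x) + norm (f 0)" for x
      using iso[of x 0] norm_triangle_ineq4[of "f x" "f 0"] by simp
    from nice_image[OF X zero_less_one inj this] show "nice ((\<lambda>(c, t, r). (f c, t, r)) ` X)" by simp
  qed
  then show ?thesis by (rule ppp.chi_measurable)
qed

lemma expectation_isometry:
  fixes f :: "'a \<Rightarrow> 'a" and F :: "('a \<times> real \<times> real) set \<Rightarrow> real"
  assumes f: "f \<in> borel_measurable borel" "\<And>U. U \<in> sets borel \<Longrightarrow> emeasure lborel (f -` U) = emeasure lborel U"
    "\<And>x y. norm (f x - f y) = norm (x - y)" and F: "F \<in> borel_measurable nconf"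
  shows "expectation (\<lambda>w. F ((\<lambda>(c, t, r). (f c, t, r)) ` chi w)) = expectation (\<lambda>w. F (chi w))"
proof -
  have "expectation (\<lambda>w. F ((\<lambda>(c, t, r). (f c, t, r)) ` chi w)) = integral\<^sup>L (distr M nconf (\<lambda>w. (\<lambda>(c, t, r). (f c, t, r)) ` chi w)) F"
    by (rule integral_distr[symmetric, OF iso_measurable[OF f(1,3,2)] F])
  also have "\<dots> = integral\<^sup>L (distr M nconf chi) F" by (simp only: law_isometry[OF f])
  also have "\<dots> = expectation (\<lambda>w. F (chi w))" by (rule integral_distr[OF chi_measurable F])
  finally show ?thesis .
qed

lemma shift_isometry:
  "(\<lambda>x::'a. x + v) \<in> borel_measurable borel"
  "U \<in> sets borel \<Longrightarrow> emeasure lborel ((\<lambda>x::'a. x + v) -` U) = emeasure lborel U"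
  "norm ((x + v) - (y + v)) = norm (x - y)" "surj (\<lambda>x::'a. x + v)"
  using emeasure_lborel_shift[of U v] by (auto simp: vimage_def surj_plus_right)

end

definition cell_points :: "real \<Rightarrow> real \<Rightarrow> nat \<Rightarrow> 'a::euclidean_space \<Rightarrow> nat \<Rightarrow> ('a \<times> real \<times> real) set" where
  "cell_points h rho T z n = cell h z \<times> {..<real (T * n)} \<times> {rho<..}"

definition wait :: "real \<Rightarrow> real \<Rightarrow> nat \<Rightarrow> ('a::euclidean_space \<times> real \<times> real) set \<Rightarrow> 'a \<Rightarrow> nat" where
  "wait h rho T X z = (LEAST n. X \<inter> cell_points h rho T z n \<noteq> {})"

definition hits :: "real \<Rightarrow> real \<Rightarrow> nat \<Rightarrow> ('a::euclidean_space \<times> real \<times> real) set \<Rightarrow> bool" where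
  "hits h rho T X \<longleftrightarrow> (\<forall>z\<in>lat. \<exists>n. X \<inter> cell_points h rho T z n \<noteq> {})"

definition points_over_cells :: "real \<Rightarrow> 'a::euclidean_space set \<Rightarrow> ('a \<times> real \<times> real) set" where
  "points_over_cells h S = {p. fl (ctr p /\<^sub>R h) \<in> S}"

lemma cell_step:
  fixes z z' :: "'a::euclidean_space" and h rho :: real
  assumes "cell h z \<subseteq> {y. reach X A s y}" "X \<inter> cell_points h rho T z n \<noteq> {}" "norm (z' - z) \<le> 3 * DIM('a) + 2"
    "h > 0" "10 * DIM('a) * h \<le> rho"
  shows "cell h z' \<subseteq> {y. reach X A (s + real T * real n) y}"
proof
  fix y assume y: "y \<in> cell h z'"
  obtain c t r where p: "(c, t, r) \<in> X" "c \<in> cell h z" "t < real T * real n" "rho < r"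
    using assms(2) unfolding cell_points_def by auto
  have "norm (y - c) \<le> h * (norm (z' - z) + DIM('a))" by (rule cell_dist[OF y p(2) assms(4)])
  also have "\<dots> \<le> h * (3 * DIM('a) + 2 + DIM('a))" using assms(3,4) by (intro mult_left_mono) auto
  also have "\<dots> \<le> h * (10 * DIM('a))"
  proof -
    have "1 \<le> real DIM('a)" by (simp add: Suc_leI)
    then have "real (3 * DIM('a) + 2 + DIM('a)) \<le> real (10 * DIM('a))" by (simp only: of_nat_add of_nat_mult of_nat_numeral)
    then show ?thesis using assms(4) by (intro mult_left_mono) auto
  qed
  also have "\<dots> \<le> rho" using assms(5) by (simp add: mult.commute mult.left_commute)
  finally have "norm (y - c) < r" using p(4) by simp
  moreover have "reach X A s c" using assms(1) p(2) by auto
  ultimately show "y \<in> {y. reach X A (s + real T * real n) y}"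
    using reach_step[OF _ p(1)] p(3) by simp
qed

lemma wait_hit: "\<exists>n. X \<inter> cell_points h rho T z n \<noteq> {} \<Longrightarrow> X \<inter> cell_points h rho T z (wait h rho T X z) \<noteq> {}"
  unfolding wait_def by (rule LeastI_ex)

lemma path_cells:
  fixes zs :: "'a::euclidean_space list" and h rho :: real
  assumes "zs \<noteq> []" "successively (\<lambda>u v. norm (v - u) \<le> 3 * DIM('a) + 2) zs" "cell h (hd zs) \<subseteq> {y. reach X A s y}"
    "\<And>z. z \<in> set zs \<Longrightarrow> \<exists>n. X \<inter> cell_points h rho T z n \<noteq> {}" "h > 0" "10 * DIM('a) * h \<le> rho"
  shows "cell h (last zs) \<subseteq> {y. reach X A (s + real T * real (sum_list (map (wait h rho T X) zs))) y}"
  using assms(1-4)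
proof (induction zs arbitrary: s)
  case (Cons z zs)
  let ?w = "wait h rho T X z"
  have w: "X \<inter> cell_points h rho T z ?w \<noteq> {}" using Cons.prems(4)[of z] by (intro wait_hit) auto
  show ?case
  proof (cases zs)
    case Nil
    have "cell h z \<subseteq> {y. reach X A s y}" using Cons.prems by simp
    also have "\<dots> \<subseteq> {y. reach X A (s + real T * real (sum_list (map (wait h rho T X) (z # zs)))) y}"
      by (auto intro: reach_time_mono)
    finally show ?thesis using Nil by simp
  next
    case (Cons z' zs')
    have n: "norm (z' - z) \<le> 3 * DIM('a) + 2" using Cons.prems(2) Cons by simp
    have "cell h z' \<subseteq> {y. reach X A (s + real T * real ?w) y}"
      using Cons.prems(3) by (intro cell_step[OF _ w n assms(5,6)]) simp
    then have "cell h (last zs) \<subseteq> {y. reach X A (s + real T * real ?w + real T * real (sum_list (map (wait h rho T X) zs))) y}"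
      using Cons.prems Cons by (intro Cons.IH) auto
    then show ?thesis using Cons by (simp add: algebra_simps)
  qed
qed simp

definition lpath :: "'a::euclidean_space \<Rightarrow> 'a \<Rightarrow> 'a list" where
  "lpath z z' = (SOME zs. zs \<noteq> [] \<and> hd zs = z \<and> last zs = z' \<and> distinct zs \<and> set zs \<subseteq> lat \<and>
     successively (\<lambda>u v. norm (v - u) \<le> 3 * DIM('a) + 2) zs \<and> length zs \<le> norm (z' - z) + 2)"

lemma lpath:
  fixes z z' :: "'a::euclidean_space"
  assumes "z \<in> lat" "z' \<in> lat"
  shows "lpath z z' \<noteq> []" "hd (lpath z z') = z" "last (lpath z z') = z'" "distinct (lpath z z')" "set (lpath z z') \<subseteq> lat"
    "successively (\<lambda>u v. norm (v - u) \<le> 3 * DIM('a) + 2) (lpath z z')" "length (lpath z z') \<le> norm (z' - z) + 2"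
  using someI_ex[OF lat_path[OF assms]] unfolding lpath_def[symmetric] by blast+

lemma cells_reach:
  fixes z z' :: "'a::euclidean_space" and h rho :: real
  assumes "z \<in> lat" "z' \<in> lat" "cell h z \<subseteq> A" "hits h rho T X" "h > 0" "10 * DIM('a) * h \<le> rho"
    "set (lpath z z') \<subseteq> S" "finite S"
  shows "cell h z' \<subseteq> {y. reach (X \<inter> points_over_cells h S) A (real T * real (\<Sum>u\<in>S. wait h rho T X u)) y}"
proof -
  let ?X = "X \<inter> points_over_cells h S"
  have eq: "?X \<inter> cell_points h rho T u n = X \<inter> cell_points h rho T u n" if "u \<in> S" for u n
    using that by (auto simp: points_over_cells_def cell_points_def cell_def)
  have weq: "wait h rho T ?X u = wait h rho T X u" if "u \<in> S" for u
    unfolding wait_def by (simp only: eq[OF that])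
  have "cell h (last (lpath z z')) \<subseteq> {y. reach ?X A (0 + real T * real (sum_list (map (wait h rho T ?X) (lpath z z')))) y}"
  proof (rule path_cells)
    show "cell h (hd (lpath z z')) \<subseteq> {y. reach ?X A 0 y}"
      using assms(3) lpath(2)[OF assms(1,2)] by (auto intro: reach_base)
    fix u assume u: "u \<in> set (lpath z z')"
    have uS: "u \<in> S" using u assms(7) by (rule subsetD[rotated])
    have "u \<in> lat" using u lpath(5)[OF assms(1,2)] by (rule subsetD[rotated])
    then show "\<exists>n. ?X \<inter> cell_points h rho T u n \<noteq> {}" using assms(4) unfolding hits_def eq[OF uS] by (rule bspec[rotated])
  qed (use lpath[OF assms(1,2)] assms in auto)
  moreover have "sum_list (map (wait h rho T ?X) (lpath z z')) \<le> (\<Sum>u\<in>S. wait h rho T X u)"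
  proof -
    have "sum_list (map (wait h rho T ?X) (lpath z z')) = (\<Sum>u\<in>set (lpath z z'). wait h rho T ?X u)"
      using lpath(4)[OF assms(1,2)] by (simp add: sum_list_distinct_conv_sum_set)
    also have "\<dots> = (\<Sum>u\<in>set (lpath z z'). wait h rho T X u)" using assms(7) weq by (intro sum.cong) auto
    also have "\<dots> \<le> (\<Sum>u\<in>S. wait h rho T X u)" using assms(7,8) by (intro sum_mono2) auto
    finally show ?thesis .
  qed
  ultimately have "cell h z' \<subseteq> {y. reach ?X A (real T * real (sum_list (map (wait h rho T ?X) (lpath z z')))) y}"
    "real T * real (sum_list (map (wait h rho T ?X) (lpath z z'))) \<le> real T * real (\<Sum>u\<in>S. wait h rho T X u)"
    using lpath(3)[OF assms(1,2)] by (simp, intro mult_left_mono of_nat_mono) auto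
  then show ?thesis using reach_time_mono by (smt (verit) Collect_mono subset_trans)
qed

lemma cells_cov:
  fixes x y :: "'a::euclidean_space" and h rho :: real
  assumes "h > 0" "10 * DIM('a) * h \<le> rho" "rho \<le> 1"
  shows "\<exists>S. finite S \<and> S \<subseteq> lat \<and>
    (\<forall>X. hits h rho T X \<longrightarrow> cov (X \<inter> points_over_cells h S) x y (real T * real (\<Sum>u\<in>S. wait h rho T X u)))"
proof -
  define z where "z = fl (x /\<^sub>R h)"
  define Z where "Z = {z'\<in>(lat::'a set). norm z' \<le> (norm y + 1) / h + DIM('a)}"
  define S where "S = (\<Union>z'\<in>Z. set (lpath z z'))"
  have zl: "z \<in> lat" unfolding z_def by (rule fl_lat)
  have Z: "finite Z" unfolding Z_def using assms(1) by (intro lat_ball_card) auto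
  have S: "finite S" "S \<subseteq> lat" unfolding S_def using Z lpath(5)[OF zl] by (auto simp: Z_def subset_iff)
  have cx: "cell h z \<subseteq> ball x 1"
  proof
    fix v assume "v \<in> cell h z"
    then have "norm (v - x) \<le> h * (norm (z - z) + DIM('a))" by (rule cell_dist) (use assms in \<open>auto simp: z_def cell_self\<close>)
    moreover have "h * DIM('a) > 0" using assms by simp
    moreover have "10 * (h * DIM('a)) \<le> 1" using assms by (simp add: mult.commute)
    ultimately show "v \<in> ball x 1" by (simp add: dist_norm norm_minus_commute)
  qed
  have "cov (X \<inter> points_over_cells h S) x y (real T * real (\<Sum>u\<in>S. wait h rho T X u))" if "hits h rho T X" for X
    unfolding cov_def
  proof
    fix v assume v: "v \<in> cball y 1"
    define z' where "z' = fl (v /\<^sub>R h)"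
    have "norm z' \<le> norm (v /\<^sub>R h) + DIM('a)" using fl_diff_norm(1)[of "v /\<^sub>R h" 0] by (simp add: z'_def fl_id[OF lat_0])
    moreover have "norm (v /\<^sub>R h) \<le> (norm y + 1) / h"
    proof -
      have "norm v \<le> norm y + 1" using v norm_triangle_ineq2[of v y] by (simp add: dist_norm norm_minus_commute)
      then show ?thesis using assms(1) by (simp add: divide_inverse mult.commute mult_left_mono)
    qed
    ultimately have zZ: "z' \<in> Z" unfolding Z_def using fl_lat by (auto simp: z'_def)
    then have "cell h z' \<subseteq> {y. reach (X \<inter> points_over_cells h S) (ball x 1) (real T * real (\<Sum>u\<in>S. wait h rho T X u)) y}"
      using zl cx that assms S(1) by (intro cells_reach[of z z']) (auto simp: S_def Z_def)
    then show "v \<in> {y. reach (X \<inter> points_over_cells h S) (ball x 1) (real T * real (\<Sum>u\<in>S. wait h rho T X u)) y}"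
      using cell_self[of v h] unfolding z'_def by blast
  qed
  then show ?thesis using S by blast
qed

context deijfen_process begin

lemma cell_points_measure:
  assumes "h > 0" "z \<in> lat"
  shows "cell_points h rho T z n \<in> sets borel"
    "emeasure N (cell_points h rho T z n) = ennreal (h ^ DIM('a) * real T * measure mu {rho<..} * real n)"
    "cell_points h rho T z n \<subseteq> slab (T * n + nat \<lceil>h * (norm z + DIM('a))\<rceil>)"
proof -
  have b: "({..<real (T * n)} \<times> {rho<..} :: (real \<times> real) set) \<in> sets borel" by (intro borel_open open_Times) auto
  have c: "cell h z \<in> sets borel" using assms by (rule cell_borel)
  show "cell_points h rho T z n \<in> sets borel" unfolding cell_points_def using c b by (metis borel_prod pair_measureI)
  have "{..<real (T * n)} \<inter> {0..} = {0..<real (T * n)}" by auto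
  then have "emeasure (time_measure \<Otimes>\<^sub>M mu) ({..<real (T * n)} \<times> {rho<..}) = ennreal (real (T * n)) * ennreal (measure mu {rho<..})"
    by (subst R.emeasure_time_mu_Times) (auto simp: R.emeasure_eq_measure)
  then show "emeasure N (cell_points h rho T z n) = ennreal (h ^ DIM('a) * real T * measure mu {rho<..} * real n)"
    unfolding cell_points_def using c b assms
    by (subst R.emeasure_intensity_Times) (auto simp: cell_measure ennreal_mult[symmetric] mult_ac)
  show "cell_points h rho T z n \<subseteq> slab (T * n + nat \<lceil>h * (norm z + DIM('a))\<rceil>)"
  proof
    fix p assume p: "p \<in> cell_points h rho T z n"
    have "norm (ctr p) \<le> norm (ctr p - h *\<^sub>R z) + norm (h *\<^sub>R z)" by (metis diff_add_cancel norm_triangle_ineq)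
    also have "\<dots> \<le> h * DIM('a) + h * norm z" using cell_near[of "ctr p" h z] p assms by (auto simp: cell_points_def)
    finally have "norm (ctr p) \<le> h * (norm z + DIM('a))" by (simp add: algebra_simps)
    then have "norm (ctr p) \<le> real (nat \<lceil>h * (norm z + DIM('a))\<rceil>)" by linarith
    then show "p \<in> slab (T * n + nat \<lceil>h * (norm z + DIM('a))\<rceil>)" using p by (cases p) (auto simp: cell_points_def slab_def simp del: of_nat_mult)
  qed
qed

lemma wait_tail:
  assumes h: "h > 0" and kap: "4 \<le> h ^ DIM('a) * real T * measure mu {rho<..}"
    and S: "finite S" "S \<subseteq> lat" "2 * card S \<le> m"
  shows "outer_prob_le (\<lambda>w. m < (\<Sum>z\<in>S. wait h rho T (chi w) z)) (exp (- real m))"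
proof (cases "S = {}")
  case True
  then show ?thesis by (intro outer_prob_leI[of "{}"]) auto
next
  case False
  let ?kap = "h ^ DIM('a) * real T * measure mu {rho<..}"
  obtain zs where zs: "set zs = S" "distinct zs" using S(1) finite_distinct_list by blast
  define k where "k = length zs"
  have k: "k = card S" "k \<ge> 1" using zs False S(1) by (auto simp: k_def distinct_card Suc_le_eq card_gt_0_iff)
  define q where "q = m + 1 - k"
  have q: "q + k = m + 1" "m + 2 \<le> 2 * q" using S(3) k by (auto simp: q_def)
  define LL where "LL = {l::nat list. length l = k \<and> sum_list l = q}"
  have cL: "card LL = m choose q" using card_length_sum_list[of k q] q k(2) unfolding LL_def by simp
  then have fL: "finite LL" using q k(2) by (intro card_ge_0_finite) (simp add: zero_less_binomial_iff)
  define U where "U l = (\<Union>i<k. cell_points h rho T (zs ! i) (l ! i))" for l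
  have zl: "zs ! i \<in> lat" if "i < k" for i using that zs S(2) nth_mem[of i zs] unfolding k_def by blast
  have disj: "disjoint_family_on (\<lambda>i. cell_points h rho T (zs ! i) (l ! i)) {..<k}" for l
    unfolding disjoint_family_on_def
  proof (intro ballI impI)
    fix i j assume ij: "i \<in> {..<k}" "j \<in> {..<k}" "i \<noteq> j"
    then have "zs ! i \<noteq> zs ! j" using zs(2) by (simp add: nth_eq_iff_index_eq k_def)
    then show "cell_points h rho T (zs ! i) (l ! i) \<inter> cell_points h rho T (zs ! j) (l ! j) = {}" by (auto simp: cell_points_def cell_def)
  qed
  have Um: "U l \<in> sets borel" for l unfolding U_def using cell_points_measure(1)[OF h zl] by (intro sets.finite_UN) auto
  have Ue: "emeasure N (U l) = ennreal (?kap * real q)" if l: "l \<in> LL" for l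
  proof -
    have "emeasure N (U l) = (\<Sum>i<k. emeasure N (cell_points h rho T (zs ! i) (l ! i)))"
      unfolding U_def using cell_points_measure(1)[OF h zl] R.sets_intensity disj[of l]
      by (intro sum_emeasure[symmetric]) auto
    also have "\<dots> = (\<Sum>i<k. ennreal (?kap * real (l ! i)))" using cell_points_measure(2)[OF h zl] by (intro sum.cong) auto
    also have "\<dots> = ennreal (\<Sum>i<k. ?kap * real (l ! i))" using h by (intro sum_ennreal) auto
    also have "(\<Sum>i<k. ?kap * real (l ! i)) = ?kap * real (\<Sum>i<k. l ! i)" by (simp add: sum_distrib_left)
    also have "(\<Sum>i<k. l ! i) = q" using l unfolding LL_def by (auto simp: sum_list_sum_nth atLeast0LessThan)
    finally show ?thesis .
  qed
  have obU: "outer_prob_le (\<lambda>w. card (chi w \<inter> U l) = 0) (exp (- (2 * real m)))" if l: "l \<in> LL" for l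
  proof (rule outer_prob_leI[of "{w\<in>space M. card (chi w \<inter> U l) = 0}"])
    have fin: "emeasure N (U l) < \<infinity>" using Ue[OF l] by simp
    from measurable_sets[OF count_measurable[OF Um fin], of "{0}"]
    show "{w\<in>space M. card (chi w \<inter> U l) = 0} \<in> events" by (auto simp: vimage_def Int_def conj_commute)
    have "prob {w\<in>space M. card (chi w \<inter> U l) = 0} = exp (- measure N (U l))"
      using count_prob[OF Um fin, of 0] by (simp add: pois_def)
    also have "measure N (U l) = ?kap * real q" using Ue[OF l] h by (simp add: measure_def)
    also have "exp (- (?kap * real q)) \<le> exp (- (2 * real m))"
    proof -
      have "4 * real q \<le> ?kap * real q" using kap by (intro mult_right_mono) auto
      moreover have "2 * real m \<le> 4 * real q" using q(2) by linarith
      ultimately have "2 * real m \<le> ?kap * real q" by linarith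
      then show ?thesis by (simp only: exp_le_cancel_iff neg_le_iff_le)
    qed
    finally show "prob {w\<in>space M. card (chi w \<inter> U l) = 0} \<le> exp (- (2 * real m))" .
  qed auto
  have "outer_prob_le (\<lambda>w. \<exists>l\<in>LL. card (chi w \<inter> U l) = 0) (exp (- real m))"
  proof (rule outer_prob_le_UN_const[OF fL obU])
    have "card LL \<le> 2 ^ m" unfolding cL by (rule binomial_le_pow2)
    then have "real (card LL) \<le> 2 ^ m" by (metis of_nat_le_iff of_nat_numeral of_nat_power)
    also have "\<dots> \<le> exp 1 ^ m" using exp_ge_add_one_self[of 1] by (intro power_mono) auto
    also have "exp 1 ^ m = exp (real m)" by (simp flip: exp_of_nat_mult)
    finally have "real (card LL) * exp (- (2 * real m)) \<le> exp (real m) * exp (- (2 * real m))" by (intro mult_right_mono) auto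
    also have "\<dots> = exp (- real m)" by (simp flip: exp_add)
    finally show "real (card LL) * exp (- (2 * real m)) \<le> exp (- real m)" .
  qed
  then show ?thesis
  proof (rule outer_prob_le_mono)
    fix w assume w: "m < (\<Sum>z\<in>S. wait h rho T (chi w) z)"
    let ?W = "wait h rho T (chi w)"
    define vs where "vs = map (\<lambda>z. ?W z - 1) zs"
    have "(\<Sum>z\<in>S. ?W z) = sum_list (map ?W zs)" using zs by (simp add: sum_list_distinct_conv_sum_set)
    also have "\<dots> \<le> sum_list vs + length zs" unfolding vs_def by (induction zs) auto
    finally have "q \<le> sum_list vs" using w q unfolding k_def by simp
    then obtain l where l: "list_all2 (\<le>) l vs" "sum_list l = q" using list_below by blast
    have ll: "length l = k" using list_all2_lengthD[OF l(1)] by (simp add: vs_def k_def)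
    have "chi w \<inter> cell_points h rho T (zs ! i) (l ! i) = {}" if i: "i < k" for i
    proof (cases "l ! i = 0")
      case True
      show ?thesis unfolding cell_points_def True using nice_tm[of _ w] by force
    next
      case False
      have "l ! i \<le> vs ! i" using list_all2_nthD[OF l(1), of i] i ll by simp
      then have "l ! i < ?W (zs ! i)" using False i by (simp add: vs_def k_def)
      then show ?thesis unfolding wait_def by (drule_tac not_less_Least) simp
    qed
    then have "chi w \<inter> U l = {}" unfolding U_def by blast
    then show "\<exists>l\<in>LL. card (chi w \<inter> U l) = 0" using l ll by (intro bexI[of _ l]) (auto simp: LL_def)
  qed auto
qed

lemma hits_AE:
  assumes h: "h > 0" and kap: "4 \<le> h ^ DIM('a) * real T * measure mu {rho<..}"
  shows "AE w in M. hits h rho T (chi w)"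
proof -
  let ?kap = "h ^ DIM('a) * real T * measure mu {rho<..}"
  have "AE w in M. \<not> (\<forall>n. chi w \<inter> cell_points h rho T z n = {})" if z: "z \<in> lat" for z :: 'a
  proof (rule outer_prob_le_null)
    fix e :: real assume "e > 0"
    obtain n :: nat where n: "- ln e \<le> real n" using real_arch_simple by blast
    have "exp (- (?kap * real n)) \<le> exp (- real n)"
      using mult_right_mono[OF kap, of "real n"] by simp
    also have "\<dots> \<le> exp (ln e)" using n by simp
    finally have le: "exp (- (?kap * real n)) \<le> e" using \<open>e > 0\<close> by simp
    note H = cell_points_measure[OF h z, where rho=rho and T=T and n=n]
    have fin: "emeasure N (cell_points h rho T z n) < \<infinity>" using H by simp
    show "outer_prob_le (\<lambda>w. \<forall>n. chi w \<inter> cell_points h rho T z n = {}) e"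
    proof (rule outer_prob_leI[of "{w\<in>space M. card (chi w \<inter> cell_points h rho T z n) = 0}"])
      from measurable_sets[OF count_measurable[OF H(1) fin], of "{0}"]
      show "{w\<in>space M. card (chi w \<inter> cell_points h rho T z n) = 0} \<in> events" by (auto simp: vimage_def Int_def conj_commute)
      show "prob {w\<in>space M. card (chi w \<inter> cell_points h rho T z n) = 0} \<le> e"
        using count_prob[OF H(1) fin, of 0] H(2) h le by (simp add: pois_def measure_def)
    qed auto
  qed
  then have "AE w in M. \<forall>z\<in>lat. \<not> (\<forall>n. chi w \<inter> cell_points h rho T z n = {})"
    by (intro AE_ball_countable[OF countable_lat, THEN iffD2] ballI)
  then show ?thesis by eventually_elim (simp add: hits_def)
qed

lemma params_exist:
  assumes "0 < rho1"
  obtains h rho :: real and T :: nat where "0 < h" "10 * DIM('a) * h \<le> rho" "0 < rho" "rho \<le> 1" "rho \<le> rho1" "4 \<le> h ^ DIM('a) * real T * measure mu {rho<..}"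
proof -
  have "\<exists>n::nat. measure mu {1 / real (Suc n)<..} > 0"
  proof (rule ccontr)
    assume "\<not> ?thesis"
    then have z: "measure mu {1 / real (Suc n)<..} = 0" for n by (meson antisym_conv measure_nonneg not_le)
    have "{1 / real (Suc n)<..} \<in> null_sets mu" for n
      using z[of n] by (auto simp: null_sets_def R.emeasure_eq_measure R.sets_mu)
    then have "(\<Union>n. {1 / real (Suc n)<..}) \<in> null_sets mu" by (rule null_sets_UN)
    moreover have "(\<Union>n. {1 / real (Suc n)<..}) = {0::real<..}"
    proof (intro equalityI subsetI)
      fix x :: real assume "x \<in> {0<..}"
      then obtain n where "inverse (real (Suc n)) < x" using reals_Archimedean by auto
      then show "x \<in> (\<Union>n. {1 / real (Suc n)<..})" by (auto simp: inverse_eq_divide)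
    next
      fix x :: real assume "x \<in> (\<Union>n. {1 / real (Suc n)<..})"
      then obtain n :: nat where "1 / real (Suc n) < x" by auto
      moreover have "0 < 1 / real (Suc n)" by simp
      ultimately have "0 < x" by linarith
      then show "x \<in> {0<..}" by simp
    qed
    ultimately show False using R.mu_pos by auto
  qed
  then obtain n :: nat where n: "measure mu {1 / real (Suc n)<..} > 0" by blast
  define rho where "rho = min (1 / real (Suc n)) rho1"
  have "1 / real (Suc n) \<le> 1" "0 < 1 / real (Suc n)" by simp_all
  then have rho: "0 < rho" "rho \<le> 1" "rho \<le> rho1" using assms unfolding rho_def by linarith+
  have "measure mu {1 / real (Suc n)<..} \<le> measure mu {rho<..}"
    by (intro R.finite_measure_mono) (auto simp: rho_def R.sets_mu)
  then have p: "0 < measure mu {rho<..}" using n by linarith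
  define h where "h = rho / (10 * DIM('a))"
  have h: "0 < h" "10 * DIM('a) * h = rho" using rho by (auto simp: h_def)
  have c: "0 < h ^ DIM('a) * measure mu {rho<..}" using h p by simp
  obtain T :: nat where "4 / (h ^ DIM('a) * measure mu {rho<..}) \<le> real T" using real_arch_simple by blast
  then have "4 \<le> h ^ DIM('a) * real T * measure mu {rho<..}" using c by (simp add: field_simps)
  then show ?thesis using that[of h rho T] h rho by simp
qed

lemma cover_fast_fine:
  assumes "0 < rho1"
  shows "\<exists>K>0. \<forall>del>0. AE w in M. \<exists>n0. \<forall>n\<ge>n0. \<forall>x y A. norm x \<le> 3 * real n \<longrightarrow> norm (x - y) \<le> del * real n \<longrightarrow>
     ball x rho1 \<subseteq> A \<longrightarrow> reach (chi w) A (K * del * real n) y"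
proof -
  obtain h rho :: real and T :: nat where P: "0 < h" "10 * DIM('a) * h \<le> rho" "0 < rho" "rho \<le> 1" "rho \<le> rho1" "4 \<le> h ^ DIM('a) * real T * measure mu {rho<..}"
    using params_exist[OF assms] .
  have T0: "0 < real T" using P(1,6) by (cases "T = 0") auto
  define K where "K = 5 * real T / h"
  have K: "K > 0" using T0 P(1) by (simp add: K_def)
  have "AE w in M. \<exists>n0. \<forall>n\<ge>n0. \<forall>x y A. norm x \<le> 3 * real n \<longrightarrow> norm (x - y) \<le> del * real n \<longrightarrow>
     ball x rho1 \<subseteq> A \<longrightarrow> reach (chi w) A (K * del * real n) y" if del: "del > 0" for del :: real
  proof -
    define m where "m n = nat \<lceil>4 * del * real n / h\<rceil>" for n :: nat
    define I where "I n = {(z, z'). z \<in> lat \<and> z' \<in> (lat::'a set) \<and> norm z \<le> 3 * real n / h + DIM('a) \<and> norm z' \<le> (3 + del) * real n / h + 2 * DIM('a) \<and>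
       norm (z' - z) \<le> del * real n / h + DIM('a)}" for n :: nat
    define E where "E n w \<longleftrightarrow> (\<exists>zz\<in>I n. m n < (\<Sum>u\<in>set (lpath (fst zz) (snd zz)). wait h rho T (chi w) u))" for n w
    define a b c where "a = 2 * (3 + del) / h" and "b = 4 * real DIM('a) + 1" and "c = 4 * del / h"
    have abc: "0 < a" "0 \<le> b" "0 < c" using P(1) del by (auto simp: a_def b_def c_def)
    have ceq: "c * real n = 4 * del * real n / h" for n by (simp add: c_def)
    have mge: "c * real n \<le> real (m n)" for n unfolding m_def ceq by linarith
    have mle: "real (m n) \<le> c * real n + 1" for n
    proof -
      have "0 \<le> 4 * del * real n / h" using P(1) del by simp
      then show ?thesis unfolding m_def ceq by linarith
    qed
    obtain n1 :: nat where n1: "(DIM('a) + 2) * h / del \<le> real n1" using real_arch_simple by blast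
    have big: "DIM('a) + 2 \<le> del * real n / h" "1 \<le> c * real n / 4" if "n \<ge> n1" for n
    proof -
      have "(DIM('a) + 2) * h / del \<le> real n" using n1 that by linarith
      then show 1: "DIM('a) + 2 \<le> del * real n / h" using P(1) del by (simp add: field_simps)
      have "del * real n / h = c * real n / 4" by (simp add: c_def)
      then show "1 \<le> c * real n / 4" using 1 by linarith
    qed
    have card_I: "finite (I n)" "real (card (I n)) \<le> (a * real n + b) ^ (2 * DIM('a))" for n
    proof -
      let ?A = "{z\<in>(lat::'a set). norm z \<le> 3 * real n / h + DIM('a)}" and ?B = "{z\<in>(lat::'a set). norm z \<le> (3 + del) * real n / h + 2 * DIM('a)}"
      have nn: "0 \<le> 3 * real n / h + DIM('a)" "0 \<le> (3 + del) * real n / h + 2 * DIM('a)" using P(1) del by auto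
      have sub: "I n \<subseteq> ?A \<times> ?B" unfolding I_def by auto
      have f: "finite ?A" "finite ?B" using lat_ball_card(1)[where 'a='a] nn by auto
      show "finite (I n)" using finite_subset[OF sub] f by blast
      have "card (I n) \<le> card ?A * card ?B" using card_mono[OF finite_cartesian_product[OF f] sub] by (simp add: card_cartesian_product)
      then have "real (card (I n)) \<le> real (card ?A * card ?B)" by (rule of_nat_mono)
      then have "real (card (I n)) \<le> real (card ?A) * real (card ?B)" by (simp only: of_nat_mult)
      also have "\<dots> \<le> (a * real n + b) ^ DIM('a) * (a * real n + b) ^ DIM('a)"
      proof (rule mult_mono)
        have "2 * (3 * real n / h + DIM('a)) + 1 \<le> a * real n + b" using P(1) del by (simp add: a_def b_def field_simps)
        then have "(2 * (3 * real n / h + DIM('a)) + 1) ^ DIM('a) \<le> (a * real n + b) ^ DIM('a)" using nn by (intro power_mono) auto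
        then show "real (card ?A) \<le> (a * real n + b) ^ DIM('a)" using lat_ball_card(2)[where 'a='a, OF nn(1)] by linarith
        have "2 * ((3 + del) * real n / h + 2 * DIM('a)) + 1 \<le> a * real n + b" using P(1) del by (simp add: a_def b_def field_simps)
        then have "(2 * ((3 + del) * real n / h + 2 * DIM('a)) + 1) ^ DIM('a) \<le> (a * real n + b) ^ DIM('a)" using nn by (intro power_mono) auto
        then show "real (card ?B) \<le> (a * real n + b) ^ DIM('a)" using lat_ball_card(2)[where 'a='a, OF nn(2)] by linarith
      qed (use abc in auto)
      finally show "real (card (I n)) \<le> (a * real n + b) ^ (2 * DIM('a))" by (simp add: power_add[symmetric] mult_2)
    qed
    have "AE w in M. \<exists>n2. \<forall>n\<ge>n2. \<not> E n w"
    proof (rule outer_prob_le_borel_cantelli)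
      show "summable (\<lambda>n. (a * real n + b) ^ (2 * DIM('a)) * exp (- c * real n))" using abc by (rule summable_poly_exp)
      fix n assume n: "n1 \<le> n"
      show "outer_prob_le (E n) ((a * real n + b) ^ (2 * DIM('a)) * exp (- c * real n))"
        unfolding E_def
      proof (rule outer_prob_le_UN_const[OF card_I(1)])
        fix zz assume zz: "zz \<in> I n"
        then have zl: "fst zz \<in> lat" "snd zz \<in> lat" "norm (snd zz - fst zz) \<le> del * real n / h + DIM('a)" by (auto simp: I_def)
        let ?S = "set (lpath (fst zz) (snd zz))"
        have "real (card ?S) \<le> norm (snd zz - fst zz) + 2" using lpath(4,7)[OF zl(1,2)] by (simp add: distinct_card)
        then have "2 * real (card ?S) \<le> 4 * (del * real n / h)" using zl(3) big(1)[OF n] by linarith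
        also have "\<dots> = c * real n" by (simp add: c_def)
        finally have "2 * card ?S \<le> m n" using mge[of n] by linarith
        then show "outer_prob_le (\<lambda>w. m n < (\<Sum>u\<in>?S. wait h rho T (chi w) u)) (exp (- real (m n)))"
          using lpath(5)[OF zl(1,2)] by (intro wait_tail[OF P(1,6)]) auto
      next
        have "exp (- real (m n)) \<le> exp (- c * real n)" using mge[of n] by simp
        then show "real (card (I n)) * exp (- real (m n)) \<le> (a * real n + b) ^ (2 * DIM('a)) * exp (- c * real n)"
          using card_I(2)[of n] abc by (intro mult_mono) auto
      qed
    qed
    with hits_AE[OF P(1,6)] show ?thesis
    proof eventually_elim
      case (elim w)
      then obtain n2 where n2: "\<And>n. n \<ge> n2 \<Longrightarrow> \<not> E n w" by blast
      show ?case
      proof (intro exI[of _ "max n1 n2"] allI impI)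
        fix n and x y :: 'a and A assume n: "max n1 n2 \<le> n" and x: "norm x \<le> 3 * real n" and xy: "norm (x - y) \<le> del * real n" and A: "ball x rho1 \<subseteq> A"
        define z z' where "z = fl (x /\<^sub>R h)" and "z' = fl (y /\<^sub>R h)"
        have zl: "z \<in> lat" "z' \<in> lat" by (auto simp: z_def z'_def fl_lat)
        have sc: "norm (v /\<^sub>R h) = norm v / h" for v :: 'a using P(1) by (simp add: divide_inverse mult.commute)
        have nz: "norm z \<le> 3 * real n / h + DIM('a)"
        proof -
          have "norm z \<le> norm (x /\<^sub>R h) + DIM('a)" using fl_diff_norm(1)[of "x /\<^sub>R h" 0] by (simp add: z_def fl_id[OF lat_0])
          moreover have "norm x / h \<le> 3 * real n / h" using x P(1) by (intro divide_right_mono) auto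
          ultimately show ?thesis using sc[of x] by linarith
        qed
        have nzz: "norm (z' - z) \<le> del * real n / h + DIM('a)"
        proof -
          have "norm (z' - z) \<le> norm (y /\<^sub>R h - x /\<^sub>R h) + DIM('a)" unfolding z_def z'_def by (rule fl_diff_norm(1))
          moreover have "norm (y /\<^sub>R h - x /\<^sub>R h) = norm (x - y) / h" using sc[of "y - x"] by (simp add: scaleR_right_diff_distrib norm_minus_commute)
          moreover have "norm (x - y) / h \<le> del * real n / h" using xy P(1) by (intro divide_right_mono) auto
          ultimately show ?thesis by linarith
        qed
        have nz': "norm z' \<le> (3 + del) * real n / h + 2 * DIM('a)"
        proof -
          have "norm z' \<le> norm (z' - z) + norm z" by (metis diff_add_cancel norm_triangle_ineq)
          moreover have "(3 + del) * real n / h = 3 * real n / h + del * real n / h" by (simp add: add_divide_distrib distrib_right)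
          ultimately show ?thesis using nz nzz by linarith
        qed
        have "(z, z') \<in> I n" using zl nz nz' nzz by (simp add: I_def)
        then have sm: "(\<Sum>u\<in>set (lpath z z'). wait h rho T (chi w) u) \<le> m n"
          using n2[of n] n unfolding E_def by (metis fst_conv snd_conv max.bounded_iff not_le)
        have "cell h z \<subseteq> A"
        proof
          fix v assume "v \<in> cell h z"
          then have "norm (v - x) \<le> h * (norm (z - z) + DIM('a))" by (rule cell_dist) (use P in \<open>auto simp: z_def cell_self\<close>)
          moreover have "h * DIM('a) > 0" using P by simp
          moreover have "10 * (h * DIM('a)) \<le> rho1" using P by (simp add: mult.commute mult.left_commute)
          ultimately have "v \<in> ball x rho1" by (simp add: dist_norm norm_minus_commute)
          then show "v \<in> A" using A by blast
        qed
        then have "cell h z' \<subseteq> {y. reach (chi w \<inter> points_over_cells h (set (lpath z z'))) A (real T * real (\<Sum>u\<in>set (lpath z z'). wait h rho T (chi w) u)) y}"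
          using zl elim(1) P(1,2) by (intro cells_reach) auto
        then have r: "reach (chi w) A (real T * real (\<Sum>u\<in>set (lpath z z'). wait h rho T (chi w) u)) y"
          using cell_self[of y h] reach_mono[OF _ Int_lower1 order_refl] unfolding z'_def by blast
        show "reach (chi w) A (K * del * real n) y"
        proof (rule reach_time_mono[OF r])
          have "real T * real (\<Sum>u\<in>set (lpath z z'). wait h rho T (chi w) u) \<le> real T * (c * real n + 1)"
          proof (rule mult_left_mono)
            have "real (\<Sum>u\<in>set (lpath z z'). wait h rho T (chi w) u) \<le> real (m n)" using sm by (rule of_nat_mono)
            then show "real (\<Sum>u\<in>set (lpath z z'). wait h rho T (chi w) u) \<le> c * real n + 1" using mle[of n] by linarith
          qed simp
          also have "\<dots> \<le> real T * (5 / 4 * (c * real n))" using big(2)[of n] n by (intro mult_left_mono) auto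
          also have "\<dots> = K * del * real n" by (simp add: K_def c_def)
          finally show "real T * real (\<Sum>u\<in>set (lpath z z'). wait h rho T (chi w) u) \<le> K * del * real n" .
        qed
      qed
    qed
  qed
  then show ?thesis using K by blast
qed

text \<open>The constant \<open>K\<close> does not depend on the radius \<open>rho1\<close> of the initial ball: the small ball first
  grows to a unit ball, at its own slow speed but over a distance negligible with respect to \<open>n\<close>.\<close>

lemma cover_fast:
  "\<exists>K>0. \<forall>rho1>0. \<forall>del>0. AE w in M. \<exists>n0. \<forall>n\<ge>n0. \<forall>x y A. norm x \<le> 3 * real n \<longrightarrow> norm (x - y) \<le> del * real n \<longrightarrow>
     ball x rho1 \<subseteq> A \<longrightarrow> reach (chi w) A (K * del * real n) y"
proof -
  obtain K where K: "K > 0" and big: "\<And>del. del > 0 \<Longrightarrow> AE w in M. \<exists>n0. \<forall>n\<ge>n0. \<forall>x y A. norm x \<le> 3 * real n \<longrightarrow> norm (x - y) \<le> del * real n \<longrightarrow>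
     ball x 1 \<subseteq> A \<longrightarrow> reach (chi w) A (K * del * real n) y"
    using cover_fast_fine[of 1] by auto
  have "AE w in M. \<exists>n0. \<forall>n\<ge>n0. \<forall>x y A. norm x \<le> 3 * real n \<longrightarrow> norm (x - y) \<le> del * real n \<longrightarrow>
     ball x rho1 \<subseteq> A \<longrightarrow> reach (chi w) A ((K + 1) * del * real n) y" if r: "rho1 > 0" and del: "del > 0" for rho1 del :: real
  proof -
    obtain K' where K': "K' > 0" and small: "\<And>del. del > 0 \<Longrightarrow> AE w in M. \<exists>n0. \<forall>n\<ge>n0. \<forall>x y A. norm x \<le> 3 * real n \<longrightarrow> norm (x - y) \<le> del * real n \<longrightarrow>
       ball x rho1 \<subseteq> A \<longrightarrow> reach (chi w) A (K' * del * real n) y"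
      using cover_fast_fine[OF r] by auto
    define e where "e = del / K'"
    have e: "e > 0" using del K' by (simp add: e_def)
    obtain n3 :: nat where n3: "1 / e \<le> real n3" using real_arch_simple by blast
    from big[OF del] small[OF e] show ?thesis
    proof eventually_elim
      case (elim w)
      then obtain n1 n2 where n1: "\<And>n x y A. n \<ge> n1 \<Longrightarrow> norm x \<le> 3 * real n \<Longrightarrow> norm (x - y) \<le> del * real n \<Longrightarrow>
         ball x 1 \<subseteq> A \<Longrightarrow> reach (chi w) A (K * del * real n) y"
        and n2: "\<And>n x y A. n \<ge> n2 \<Longrightarrow> norm x \<le> 3 * real n \<Longrightarrow> norm (x - y) \<le> e * real n \<Longrightarrow>
         ball x rho1 \<subseteq> A \<Longrightarrow> reach (chi w) A (K' * e * real n) y" by metis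
      show ?case
      proof (intro exI[of _ "max n1 (max n2 n3)"] allI impI)
        fix n and x y :: 'a and A assume n: "max n1 (max n2 n3) \<le> n" and x: "norm x \<le> 3 * real n" and xy: "norm (x - y) \<le> del * real n" and A: "ball x rho1 \<subseteq> A"
        have "1 / e \<le> real n" using n3 n by linarith
        then have en: "1 \<le> e * real n" using e by (simp add: field_simps)
        have "ball x 1 \<subseteq> {v. reach (chi w) A (K' * e * real n) v}"
        proof
          fix v assume "v \<in> ball x 1"
          then have "norm (x - v) \<le> e * real n" using en by (simp add: dist_norm)
          then show "v \<in> {v. reach (chi w) A (K' * e * real n) v}" using n2[OF _ x _ A] n by simp
        qed
        then have "reach (chi w) A (K' * e * real n + K * del * real n) y"
          using n by (intro reach_trans[OF n1[OF _ x xy]]) auto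
        moreover have "K' * e = del" using K' by (simp add: e_def)
        ultimately show "reach (chi w) A ((K + 1) * del * real n) y" by (simp add: algebra_simps)
      qed
    qed
  qed
  then show ?thesis using K by (intro exI[of _ "K + 1"]) auto
qed

end

section \<open>The time constant\<close>

context prob_space begin

lemma nat_square_integrable:
  fixes V :: "'a \<Rightarrow> nat"
  assumes V: "V \<in> measurable M (count_space UNIV)" and T: "T > 0"
    and tail: "\<And>m. m \<ge> m0 \<Longrightarrow> prob {w\<in>space M. T * m < V w} \<le> exp (- real m)"
  shows "integrable M (\<lambda>w. (real (V w))\<^sup>2)"
proof (rule integrableI_bounded)
  note V[measurable]
  show "(\<lambda>w. (real (V w))\<^sup>2) \<in> borel_measurable M" by measurable
  let ?c = "\<lambda>m. (real (T * (m + 1)))\<^sup>2"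
  let ?A = "\<lambda>m. {w\<in>space M. T * m < V w}"
  have Am: "?A m \<in> events" for m by measurable
  have pt: "ennreal (norm ((real (V w))\<^sup>2)) \<le> (\<Sum>m. ennreal (?c m) * indicator (?A m) w)" if w: "w \<in> space M" for w
  proof (cases "V w = 0")
    case False
    define m where "m = (V w - 1) div T"
    have "V w - 1 = T * m + (V w - 1) mod T" by (simp add: m_def)
    moreover have "(V w - 1) mod T < T" using T by simp
    ultimately have m: "T * m < V w" "V w \<le> T * (m + 1)" using False by auto
    have "(real (V w))\<^sup>2 \<le> ?c m" using m(2) by (intro power_mono of_nat_mono) auto
    then have "ennreal (norm ((real (V w))\<^sup>2)) \<le> ennreal (?c m) * indicator (?A m) w"
      using m(1) w by (simp add: ennreal_leI)
    also have "\<dots> \<le> (\<Sum>m. ennreal (?c m) * indicator (?A m) w)"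
    proof -
      define hh where "hh = (\<lambda>m. ennreal (?c m) * indicator (?A m) w)"
      have "hh m \<le> suminf hh" using sum_le_suminf[of hh "{m}"] by simp
      then show ?thesis unfolding hh_def .
    qed
    finally show ?thesis .
  qed simp
  have sm: "summable (\<lambda>m. ?c m * prob (?A m))"
  proof (rule summable_comparison_test')
    have "summable (\<lambda>m. (real T * real m + real T) ^ 2 * exp (- 1 * real m))"
      using T by (intro summable_poly_exp) auto
    then show "summable (\<lambda>m. (real T * real m + real T) ^ 2 * exp (- 1 * real m))" .
    fix m assume "m \<ge> m0"
    then have "prob (?A m) \<le> exp (- 1 * real m)" using tail[of m] by simp
    moreover have "?c m = (real T * real m + real T) ^ 2" by (simp add: algebra_simps)
    ultimately have "?c m * prob (?A m) \<le> (real T * real m + real T) ^ 2 * exp (- 1 * real m)"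
      by (simp only: mult_left_mono zero_le_power2)
    moreover have "0 \<le> ?c m * prob (?A m)" by (intro mult_nonneg_nonneg) auto
    ultimately show "norm (?c m * prob (?A m)) \<le> (real T * real m + real T) ^ 2 * exp (- 1 * real m)"
      by (simp only: real_norm_def abs_of_nonneg)
  qed
  have "(\<integral>\<^sup>+ w. ennreal (norm ((real (V w))\<^sup>2)) \<partial>M) \<le> (\<integral>\<^sup>+ w. (\<Sum>m. ennreal (?c m) * indicator (?A m) w) \<partial>M)"
    using pt by (intro nn_integral_mono)
  also have "\<dots> = (\<Sum>m. \<integral>\<^sup>+ w. ennreal (?c m) * indicator (?A m) w \<partial>M)"
    using Am by (intro nn_integral_suminf) auto
  also have "\<dots> = (\<Sum>m. ennreal (?c m * prob (?A m)))"
  proof (rule suminf_cong)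
    fix m
    have "(\<integral>\<^sup>+ w. ennreal (?c m) * indicator (?A m) w \<partial>M) = ennreal (?c m) * ennreal (prob (?A m))"
      unfolding nn_integral_cmult_indicator[OF Am] emeasure_eq_measure ..
    also have "\<dots> = ennreal (?c m * prob (?A m))" by (rule ennreal_mult[symmetric]) auto
    finally show "(\<integral>\<^sup>+ w. ennreal (?c m) * indicator (?A m) w \<partial>M) = ennreal (?c m * prob (?A m))" .
  qed
  also have "\<dots> = ennreal (\<Sum>m. ?c m * prob (?A m))"
    by (rule suminf_ennreal2[OF _ sm]) (intro mult_nonneg_nonneg zero_le_power2 measure_nonneg)
  also have "\<dots> < \<infinity>" unfolding infinity_ennreal_def by (rule ennreal_less_top)
  finally show "(\<integral>\<^sup>+ w. ennreal (norm ((real (V w))\<^sup>2)) \<partial>M) < \<infinity>" .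
qed

lemma finite_range_variance:
  fixes Y :: "nat \<Rightarrow> 'a \<Rightarrow> real" and q :: nat
  assumes meas: "\<And>j. Y j \<in> borel_measurable M"
    and sq: "\<And>j. integrable M (\<lambda>w. (Y j w)\<^sup>2)" "\<And>j. expectation (\<lambda>w. (Y j w)\<^sup>2) \<le> C"
    and ind: "\<And>i j. i + q \<le> j \<Longrightarrow> expectation (\<lambda>w. Y i w * Y j w) = 0"
    and C: "0 \<le> C"
  shows "integrable M (\<lambda>w. (\<Sum>j<k. Y j w)\<^sup>2)" "expectation (\<lambda>w. (\<Sum>j<k. Y j w)\<^sup>2) \<le> real k * (2 * real q + 1) * C"
proof -
  note meas[measurable]
  have int: "integrable M (\<lambda>w. Y i w * Y j w)" for i j
  proof (rule Bochner_Integration.integrable_bound)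
    show "integrable M (\<lambda>w. (Y i w)\<^sup>2 + (Y j w)\<^sup>2)" using sq by auto
    have "\<bar>x * y\<bar> \<le> x\<^sup>2 + y\<^sup>2" for x y :: real
    proof -
      have "0 \<le> (\<bar>x\<bar> - \<bar>y\<bar>)\<^sup>2" by simp
      then have "2 * (\<bar>x\<bar> * \<bar>y\<bar>) \<le> x\<^sup>2 + y\<^sup>2" by (simp add: power2_diff)
      moreover have "0 \<le> \<bar>x\<bar> * \<bar>y\<bar>" by simp
      ultimately show ?thesis unfolding abs_mult by linarith
    qed
    then show "AE w in M. norm (Y i w * Y j w) \<le> norm ((Y i w)\<^sup>2 + (Y j w)\<^sup>2)" by simp
  qed measurable
  have eq: "(\<Sum>j<k. Y j w)\<^sup>2 = (\<Sum>i<k. \<Sum>j<k. Y i w * Y j w)" for w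
    by (simp add: power2_eq_square sum_product)
  show "integrable M (\<lambda>w. (\<Sum>j<k. Y j w)\<^sup>2)" unfolding eq using int by auto
  have "expectation (\<lambda>w. (\<Sum>j<k. Y j w)\<^sup>2) = (\<Sum>i<k. \<Sum>j<k. expectation (\<lambda>w. Y i w * Y j w))"
    unfolding eq using int by (simp add: Bochner_Integration.integral_sum)
  also have "\<dots> \<le> (\<Sum>i<k. \<Sum>j<k. if j \<in> {i - q..i + q} then C else 0)"
  proof (intro sum_mono)
    fix i j
    show "expectation (\<lambda>w. Y i w * Y j w) \<le> (if j \<in> {i - q..i + q} then C else 0)"
    proof (cases "j \<in> {i - q..i + q}")
      case True
      have le: "Y i w * Y j w \<le> ((Y i w)\<^sup>2 + (Y j w)\<^sup>2) / 2" for w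
        using sum_squares_bound[of "Y i w" "Y j w"] by simp
      have "expectation (\<lambda>w. Y i w * Y j w) \<le> expectation (\<lambda>w. ((Y i w)\<^sup>2 + (Y j w)\<^sup>2) / 2)"
        using int sq(1) le by (intro integral_mono) auto
      also have "\<dots> = (expectation (\<lambda>w. (Y i w)\<^sup>2) + expectation (\<lambda>w. (Y j w)\<^sup>2)) / 2" using sq(1) by simp
      also have "\<dots> \<le> C" using sq(2)[of i] sq(2)[of j] by simp
      finally show ?thesis using True by simp
    next
      case False
      then consider "i + q \<le> j" | "j + q \<le> i" by fastforce
      then show ?thesis
      proof cases
        case 1 then show ?thesis using ind[OF 1] C by simp
      next
        case 2 then show ?thesis using ind[OF 2] C by (simp add: mult.commute)
      qed
    qed
  qed
  also have "\<dots> \<le> (\<Sum>i<k. (2 * real q + 1) * C)"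
  proof (rule sum_mono)
    fix i
    have "(\<Sum>j<k. if j \<in> {i - q..i + q} then C else 0) = (\<Sum>j\<in>{..<k} \<inter> {i - q..i + q}. C)"
      by (rule sum.inter_restrict[symmetric]) simp
    also have "\<dots> = real (card ({..<k} \<inter> {i - q..i + q})) * C" by simp
    also have "\<dots> \<le> (2 * real q + 1) * C"
    proof (rule mult_right_mono[OF _ C])
      have "card ({..<k} \<inter> {i - q..i + q}) \<le> card {i - q..i + q}" by (intro card_mono) auto
      also have "\<dots> \<le> 2 * q + 1" by simp
      finally show "real (card ({..<k} \<inter> {i - q..i + q})) \<le> 2 * real q + 1" by linarith
    qed
    finally show "(\<Sum>j<k. if j \<in> {i - q..i + q} then C else 0) \<le> (2 * real q + 1) * C" .
  qed
  also have "\<dots> = real k * (2 * real q + 1) * C" by simp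
  finally show "expectation (\<lambda>w. (\<Sum>j<k. Y j w)\<^sup>2) \<le> real k * (2 * real q + 1) * C" .
qed

text \<open>A maximal inequality in the spirit of Steele's proof of Kingman's theorem: if fast
  stretches were frequent, following them greedily would make the mean too small.\<close>

lemma subadditive_maximal:
  fixes Y :: "nat \<Rightarrow> nat \<Rightarrow> 'a \<Rightarrow> real" and b e eta :: real
  assumes int: "\<And>i j. integrable M (Y i j)"
    and sub: "AE w in M. \<forall>i j k. i < j \<longrightarrow> j < k \<longrightarrow> Y i k w \<le> Y i j w + Y j k w"
    and e: "0 < e"
    and stat: "\<And>i N. prob {w\<in>space M. \<exists>n\<in>{1..N}. Y i (i + n) w \<le> (b - e) * real n} = prob {w\<in>space M. \<exists>n\<in>{1..N}. Y 0 n w \<le> (b - e) * real n}"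
    and dev: "\<And>i. expectation (\<lambda>w. \<bar>Y i (Suc i) w - b\<bar>) \<le> eta"
    and low: "\<And>K. b * real K \<le> expectation (Y 0 K)"
  shows "prob {w\<in>space M. \<exists>n\<in>{1..N}. Y 0 n w \<le> (b - e) * real n} \<le> eta / e"
proof (cases "N = 0")
  case True
  have "0 \<le> expectation (\<lambda>w. \<bar>Y 0 (Suc 0) w - b\<bar>)" by (intro Bochner_Integration.integral_nonneg) auto
  then have "0 \<le> eta" using dev[of 0] by linarith
  then show ?thesis using True e by simp
next
  case N: False
  define fast where "fast i w \<longleftrightarrow> (\<exists>n\<in>{1..N}. Y i (i + n) w \<le> (b - e) * real n)" for i w
  define p where "p = prob {w\<in>space M. fast 0 w}"
  have [measurable]: "Y i j \<in> borel_measurable M" for i j using int by auto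
  have fm[measurable]: "Measurable.pred M (fast i)" for i unfolding fast_def by measurable
  have fp: "prob {w\<in>space M. fast i w} = p" for i unfolding p_def fast_def using stat[of N i] by simp
  let ?g = "\<lambda>k w. b + \<bar>Y k (Suc k) w - b\<bar>" and ?f = "\<lambda>k w. if fast k w then 1 else 0 :: real"
  have key: "Y i (K + N) w \<le> (\<Sum>k=i..<K+N. ?g k w) - e * (\<Sum>k=i..<K. ?f k w)"
    if sw: "\<forall>i j k. i < j \<longrightarrow> j < k \<longrightarrow> Y i k w \<le> Y i j w + Y j k w" and iK: "i < K + N" for i K w
    using iK
  proof (induction "K + N - i" arbitrary: i rule: less_induct)
    case less
    have one: "Y i (Suc i) w \<le> ?g i w" by linarith
    have split: "(\<Sum>k=i..<K+N. ?g k w) = ?g i w + (\<Sum>k=Suc i..<K+N. ?g k w)"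
      using less.prems by (simp add: sum.atLeast_Suc_lessThan)
    show ?case
    proof (cases "i < K \<and> fast i w")
      case False
      have fsum: "(\<Sum>k=i..<K. ?f k w) = (\<Sum>k=Suc i..<K. ?f k w)"
      proof (cases "i < K")
        case True then show ?thesis using False by (simp add: sum.atLeast_Suc_lessThan)
      qed auto
      show ?thesis
      proof (cases "Suc i = K + N")
        case True
        then have "{i..<K} = {}" using N by auto
        moreover have "{i..<K+N} = {i}" using True by auto
        ultimately show ?thesis using one True by (simp only: sum.empty sum.insert finite.emptyI) simp
      next
        case F2: False
        have lt: "Suc i < K + N" using F2 less.prems by simp
        have "Y i (K + N) w \<le> Y i (Suc i) w + Y (Suc i) (K + N) w" using sw lt by simp
        also have "\<dots> \<le> ?g i w + ((\<Sum>k=Suc i..<K+N. ?g k w) - e * (\<Sum>k=Suc i..<K. ?f k w))"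
          using one less.hyps[of "Suc i"] lt by (intro add_mono) auto
        finally show ?thesis unfolding split fsum by linarith
      qed
    next
      case True
      then obtain n where n: "1 \<le> n" "n \<le> N" "Y i (i + n) w \<le> (b - e) * real n" unfolding fast_def by auto
      have lt: "i + n < K + N" using True n by simp
      have "Y i (K + N) w \<le> Y i (i + n) w + Y (i + n) (K + N) w" using sw lt n by simp
      moreover have "Y (i + n) (K + N) w \<le> (\<Sum>k=i+n..<K+N. ?g k w) - e * (\<Sum>k=i+n..<K. ?f k w)"
        using less.hyps[of "i + n"] lt n by simp
      moreover have "(\<Sum>k=i..<K+N. ?g k w) = (\<Sum>k=i..<i+n. ?g k w) + (\<Sum>k=i+n..<K+N. ?g k w)"
        using lt by (simp add: sum.atLeastLessThan_concat)
      moreover have "b * real n \<le> (\<Sum>k=i..<i+n. ?g k w)"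
      proof -
        have "(\<Sum>k=i..<i+n. b) \<le> (\<Sum>k=i..<i+n. ?g k w)" by (intro sum_mono) auto
        then show ?thesis by (simp add: mult.commute)
      qed
      moreover have "e * (\<Sum>k=i..<K. ?f k w) \<le> e * real n + e * (\<Sum>k=i+n..<K. ?f k w)"
      proof -
        have "(\<Sum>k=i..<K. ?f k w) \<le> (\<Sum>k\<in>{i..<i+n} \<union> {i+n..<K}. ?f k w)" by (intro sum_mono2) auto
        also have "\<dots> = (\<Sum>k=i..<i+n. ?f k w) + (\<Sum>k=i+n..<K. ?f k w)" by (intro sum.union_disjoint) auto
        also have "(\<Sum>k=i..<i+n. ?f k w) \<le> real n"
          using sum_bounded_above[of "{i..<i+n}" "\<lambda>k. ?f k w" 1] by simp
        finally have "(\<Sum>k=i..<K. ?f k w) \<le> real n + (\<Sum>k=i+n..<K. ?f k w)" by simp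
        from mult_left_mono[OF this, of e] show ?thesis using e by (simp add: distrib_left)
      qed
      moreover have "(b - e) * real n = b * real n - e * real n" by (simp add: left_diff_distrib)
      ultimately show ?thesis using n(3) by linarith
    qed
  qed
  have main: "e * p * real K \<le> eta * real (K + N)" for K
  proof -
    have intg: "integrable M (\<lambda>w. \<Sum>k=0..<K+N. ?g k w)" using int by auto
    have intf: "integrable M (\<lambda>w. e * (\<Sum>k=0..<K. ?f k w))"
      by (intro integrable_mult_right Bochner_Integration.integrable_sum integrable_const_bound[of _ 1]) auto
    have ef: "expectation (\<lambda>w. ?f k w) = p" for k
    proof -
      have "expectation (\<lambda>w. ?f k w) = expectation (indicat_real {w\<in>space M. fast k w})"
        by (rule Bochner_Integration.integral_cong) (auto simp: indicator_def)
      also have "\<dots> = p" using fp[of k] by simp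
      finally show ?thesis .
    qed
    have intf1: "integrable M (?f k)" for k by (intro integrable_const_bound[of _ 1]) auto
    have "b * real (K + N) \<le> expectation (Y 0 (K + N))" by (rule low)
    also have "\<dots> \<le> expectation (\<lambda>w. (\<Sum>k=0..<K+N. ?g k w) - e * (\<Sum>k=0..<K. ?f k w))"
    proof (rule integral_mono_AE)
      show "AE w in M. Y 0 (K + N) w \<le> (\<Sum>k=0..<K+N. ?g k w) - e * (\<Sum>k=0..<K. ?f k w)"
        using sub
      proof eventually_elim
        case (elim w)
        show ?case using key[OF elim, of 0 K] N by simp
      qed
      show "integrable M (\<lambda>w. (\<Sum>k=0..<K+N. ?g k w) - e * (\<Sum>k=0..<K. ?f k w))"
        using intg intf by (rule Bochner_Integration.integrable_diff)
    qed (rule int)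
    also have "\<dots> = expectation (\<lambda>w. \<Sum>k=0..<K+N. ?g k w) - expectation (\<lambda>w. e * (\<Sum>k=0..<K. ?f k w))"
      using intg intf by (rule Bochner_Integration.integral_diff)
    also have "expectation (\<lambda>w. e * (\<Sum>k=0..<K. ?f k w)) = e * (\<Sum>k=0..<K. expectation (?f k))"
      using intf1 by (simp add: Bochner_Integration.integral_sum)
    also have "\<dots> = e * (real K * p)" using ef by simp
    also have "expectation (\<lambda>w. \<Sum>k=0..<K+N. ?g k w) = (\<Sum>k=0..<K+N. expectation (?g k))"
      using int by (intro Bochner_Integration.integral_sum) auto
    also have "\<dots> \<le> (\<Sum>k=0..<K+N. b + eta)"
    proof (rule sum_mono)
      fix k
      have "expectation (?g k) = b + expectation (\<lambda>w. \<bar>Y k (Suc k) w - b\<bar>)" using int by (simp add: prob_space)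
      then show "expectation (?g k) \<le> b + eta" using dev[of k] by linarith
    qed
    also have "\<dots> = (b + eta) * real (K + N)" by (simp add: mult.commute)
    finally show ?thesis by (simp add: algebra_simps)
  qed
  have "e * p \<le> eta"
  proof (rule LIMSEQ_le_const)
    have "(\<lambda>K. eta + eta * real N * inverse (real (Suc K))) \<longlonglongrightarrow> eta + eta * real N * 0"
      by (intro tendsto_intros LIMSEQ_inverse_real_of_nat)
    then show "(\<lambda>K. eta + eta * real N * inverse (real (Suc K))) \<longlonglongrightarrow> eta" by simp
    show "\<exists>K0. \<forall>K\<ge>K0. e * p \<le> eta + eta * real N * inverse (real (Suc K))"
    proof (intro exI allI impI)
      fix K :: nat
      have "e * p * real (Suc K) \<le> eta * real (Suc K) + eta * real N" using main[of "Suc K"] by (simp only: of_nat_add distrib_left)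
      then have "e * p * real (Suc K) * inverse (real (Suc K)) \<le> (eta * real (Suc K) + eta * real N) * inverse (real (Suc K))"
        by (intro mult_right_mono) auto
      then show "e * p \<le> eta + eta * real N * inverse (real (Suc K))"
        by (simp only: distrib_right mult.assoc) simp
    qed
  qed
  then have "p \<le> eta / e" using e by (simp add: field_simps)
  then show ?thesis unfolding p_def fast_def by simp
qed

end

definition points_over_cball :: "'a::euclidean_space \<Rightarrow> real \<Rightarrow> ('a \<times> real \<times> real) set" where
  "points_over_cball x R = {p. norm (ctr p - x) \<le> R}"

lemma points_over_cball_borel: "points_over_cball x R \<in> sets borel"
  unfolding points_over_cball_def by (intro borel_closed closed_Collect_le continuous_intros)

lemma cover_time_mono_cov: "cov X x y s \<Longrightarrow> X \<subseteq> X' \<Longrightarrow> cover_time X' x y \<le> cover_time X x y"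
proof -
  assume c: "cov X x y s" and sub: "X \<subseteq> X'"
  have "cov X' x y (real (cover_time X x y))" by (rule cov_mono[OF cover_time_cov[OF c] sub order_refl])
  then show ?thesis by (rule cover_time_le)
qed

context deijfen_process begin

lemma cover_time_chi_measurable:
  "L \<in> sets borel \<Longrightarrow> (\<lambda>w. cover_time (chi w \<inter> L) x y) \<in> measurable M (count_space UNIV)"
  "(\<lambda>w. cover_time (chi w) x y) \<in> measurable M (count_space UNIV)"
  using measurable_compose[OF Int_chi_measurable cover_time_measurable] measurable_compose[OF chi_measurable cover_time_measurable] by auto

lemma cover_time_moments:
  fixes x y :: 'a
  shows "\<exists>R0>0. \<forall>L\<in>sets borel. points_over_cball x R0 \<subseteq> L \<longrightarrow>
    (AE w in M. \<exists>s. cov (chi w \<inter> L) x y s) \<and> integrable M (\<lambda>w. (real (cover_time (chi w \<inter> L) x y))\<^sup>2)"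
proof -
  obtain h rho :: real and T :: nat where P: "0 < h" "10 * DIM('a) * h \<le> rho" "0 < rho" "rho \<le> 1" "rho \<le> 1" "4 \<le> h ^ DIM('a) * real T * measure mu {rho<..}"
    using params_exist[of 1] by auto
  have T0: "0 < T" using P(1,6) by (cases "T = 0") auto
  obtain S :: "'a set" where S: "finite S" "S \<subseteq> lat" and
    cv: "\<And>X. hits h rho T X \<Longrightarrow> cov (X \<inter> points_over_cells h S) x y (real T * real (\<Sum>u\<in>S. wait h rho T X u))"
    using cells_cov[OF P(1,2,4), of T x y] by blast
  obtain B where B: "\<And>z. z \<in> S \<Longrightarrow> norm z \<le> B" using finite_imp_bounded[OF S(1)] by (auto simp: bounded_iff)
  define R0 where "R0 = h * DIM('a) + h * \<bar>B\<bar> + norm x + 1"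
  have R0: "R0 > 0" using P(1) by (simp add: R0_def add_nonneg_pos)
  have sub: "points_over_cells h S \<subseteq> points_over_cball x R0"
  proof
    fix p :: "'a \<times> real \<times> real" assume p: "p \<in> points_over_cells h S"
    define z where "z = fl (ctr p /\<^sub>R h)"
    have zS: "z \<in> S" using p by (simp add: points_over_cells_def z_def)
    have "norm (ctr p - h *\<^sub>R z) \<le> h * DIM('a)" using cell_self[of "ctr p" h] P(1) unfolding z_def by (rule cell_near)
    moreover have "norm (h *\<^sub>R z) \<le> h * \<bar>B\<bar>" using B[OF zS] P(1) by (auto intro!: mult_left_mono)
    moreover have "norm (ctr p - x) \<le> norm (ctr p - h *\<^sub>R z) + norm (h *\<^sub>R z) + norm x"
      using norm_triangle_ineq[of "ctr p - h *\<^sub>R z" "h *\<^sub>R z"] norm_triangle_ineq4[of "ctr p" x] by simp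
    ultimately show "p \<in> points_over_cball x R0" by (simp add: points_over_cball_def R0_def)
  qed
  have "(AE w in M. \<exists>s. cov (chi w \<inter> L) x y s) \<and> integrable M (\<lambda>w. (real (cover_time (chi w \<inter> L) x y))\<^sup>2)"
    if L: "L \<in> sets borel" "points_over_cball x R0 \<subseteq> L" for L
  proof
    have c: "cov (chi w \<inter> L) x y (real T * real (\<Sum>u\<in>S. wait h rho T (chi w) u))" if "hits h rho T (chi w)" for w
      using cov_mono[OF cv[OF that]] sub L(2) by blast
    show "AE w in M. \<exists>s. cov (chi w \<inter> L) x y s" using hits_AE[OF P(1,6)] by eventually_elim (use c in blast)
    show "integrable M (\<lambda>w. (real (cover_time (chi w \<inter> L) x y))\<^sup>2)"
    proof (rule nat_square_integrable[OF cover_time_chi_measurable(1)[OF L(1)] T0])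
      fix m assume m: "2 * card S \<le> m"
      have "outer_prob_le (\<lambda>w. T * m < cover_time (chi w \<inter> L) x y) (exp (- real m))"
      proof (rule outer_prob_le_AE_mono[OF wait_tail[OF P(1,6) S m] _ order_refl])
        show "AE w in M. T * m < cover_time (chi w \<inter> L) x y \<longrightarrow> m < (\<Sum>z\<in>S. wait h rho T (chi w) z)"
          using hits_AE[OF P(1,6)]
        proof eventually_elim
          case (elim w)
          have "cover_time (chi w \<inter> L) x y \<le> T * (\<Sum>z\<in>S. wait h rho T (chi w) z)"
            using c[OF elim] by (intro cover_time_le) (simp only: of_nat_mult)
          show ?case
          proof
            assume "T * m < cover_time (chi w \<inter> L) x y"
            then have "T * m < T * (\<Sum>z\<in>S. wait h rho T (chi w) z)" using \<open>cover_time (chi w \<inter> L) x y \<le> _\<close> by (rule less_le_trans)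
            then show "m < (\<Sum>z\<in>S. wait h rho T (chi w) z)" by (rule mult_less_cancel1[THEN iffD1, THEN conjunct2])
          qed
        qed
      qed
      then show "prob {w\<in>space M. T * m < cover_time (chi w \<inter> L) x y} \<le> exp (- real m)" by (rule outer_prob_le_prob)
    qed
  qed
  then show ?thesis using R0 by blast
qed

lemma cov_AE: "AE w in M. \<exists>s. cov (chi w) x y s"
proof -
  obtain R0 where "\<forall>L\<in>sets borel. points_over_cball x R0 \<subseteq> L \<longrightarrow>
    (AE w in M. \<exists>s. cov (chi w \<inter> L) x y s) \<and> integrable M (\<lambda>w. (real (cover_time (chi w \<inter> L) x y))\<^sup>2)"
    using cover_time_moments[of x y] by blast
  from bspec[OF this, of UNIV] show ?thesis by simp
qed

lemma cover_time_square_integrable: "integrable M (\<lambda>w. (real (cover_time (chi w) x y))\<^sup>2)"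
proof -
  obtain R0 where "\<forall>L\<in>sets borel. points_over_cball x R0 \<subseteq> L \<longrightarrow>
    (AE w in M. \<exists>s. cov (chi w \<inter> L) x y s) \<and> integrable M (\<lambda>w. (real (cover_time (chi w \<inter> L) x y))\<^sup>2)"
    using cover_time_moments[of x y] by blast
  from bspec[OF this, of UNIV] show ?thesis by simp
qed

lemma integrable_of_square:
  fixes f :: "'w \<Rightarrow> real"
  assumes "f \<in> borel_measurable M" "integrable M (\<lambda>w. (f w)\<^sup>2)"
  shows "integrable M f"
proof (rule Bochner_Integration.integrable_bound)
  show "integrable M (\<lambda>w. 1 + (f w)\<^sup>2)" using assms(2) by simp
  have "\<bar>x\<bar> \<le> 1 + x\<^sup>2" for x :: real
  proof -
    have "0 \<le> (\<bar>x\<bar> - 1)\<^sup>2" by simp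
    then have "2 * \<bar>x\<bar> \<le> x\<^sup>2 + 1" by (simp add: power2_diff)
    moreover have "0 \<le> \<bar>x\<bar>" by simp
    ultimately show ?thesis by linarith
  qed
  then show "AE w in M. norm (f w) \<le> norm (1 + (f w)\<^sup>2)" by simp
qed (use assms in auto)

lemma real_cover_time_measurable:
  "(\<lambda>w. real (cover_time (chi w) x y)) \<in> borel_measurable M"
  by (rule measurable_compose[OF cover_time_chi_measurable(2)]) simp

lemma real_cover_time_Int_measurable:
  "L \<in> sets borel \<Longrightarrow> (\<lambda>w. real (cover_time (chi w \<inter> L) x y)) \<in> borel_measurable M"
  by (rule measurable_compose[OF cover_time_chi_measurable(1)]) simp_all

lemma cover_time_integrable: "integrable M (\<lambda>w. real (cover_time (chi w) x y))"
  by (rule integrable_of_square[OF real_cover_time_measurable cover_time_square_integrable])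

definition mean_time :: "'a \<Rightarrow> 'a \<Rightarrow> real" where
  "mean_time x y = expectation (\<lambda>w. real (cover_time (chi w) x y))"

lemma real_cover_time_nconf: "(\<lambda>X. real (cover_time X x y)) \<in> borel_measurable nconf"
  by (rule measurable_compose[OF cover_time_measurable]) simp

lemma mean_time_shift: "mean_time (x + v) (y + v) = mean_time x y"
proof -
  have "mean_time x y = expectation (\<lambda>w. real (cover_time ((\<lambda>(c, t, r). (c + v, t, r)) ` chi w) (x + v) (y + v)))"
    unfolding mean_time_def by (subst cover_time_image) (auto simp: shift_isometry(4))
  also have "\<dots> = mean_time (x + v) (y + v)"
    unfolding mean_time_def using shift_isometry by (intro expectation_isometry real_cover_time_nconf) auto
  finally show ?thesis by simp
qed

lemma mean_time_isotropic: assumes "norm u = norm v" shows "mean_time 0 u = mean_time 0 v"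
proof -
  obtain f where f: "linear f" "\<And>x. f (f x) = x" "\<And>x. norm (f x) = norm x" "f u = v"
    using exists_reflection[OF assms] by metis
  have iso: "norm (f x - f y) = norm (x - y)" for x y using f(1,3) by (simp add: linear_diff[symmetric])
  have fm: "f \<in> borel_measurable borel"
    using linear_continuous_on[OF linear_conv_bounded_linear[THEN iffD1, OF f(1)]] by (intro borel_measurable_continuous_onI) auto
  have sf: "surj f" using f(2) by (rule surjI)
  have "mean_time 0 u = expectation (\<lambda>w. real (cover_time ((\<lambda>(c, t, r). (f c, t, r)) ` chi w) (f 0) (f u)))"
    unfolding mean_time_def by (simp only: cover_time_image[OF iso sf])
  also have "\<dots> = mean_time (f 0) (f u)"
    unfolding mean_time_def by (rule expectation_isometry[OF fm _ iso real_cover_time_nconf])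
      (rule emeasure_lborel_involutive_isometry[OF f(1,2,3)])
  finally show ?thesis using f(4) linear_0[OF f(1)] by simp
qed

definition lam :: real where
  "lam = (INF n::nat. mean_time 0 (real (Suc n) *\<^sub>R (SOME b. b \<in> Basis)) / real (Suc n))"

lemma mean_time_nonneg: "0 \<le> mean_time x y"
  unfolding mean_time_def by (intro Bochner_Integration.integral_nonneg) auto

lemma lam_bdd: "bdd_below (range (\<lambda>n::nat. mean_time 0 (real (Suc n) *\<^sub>R (SOME b. b \<in> Basis)) / real (Suc n)))"
proof (rule bdd_belowI[of _ 0])
  fix x assume "x \<in> range (\<lambda>n::nat. mean_time 0 (real (Suc n) *\<^sub>R (SOME b. b \<in> Basis)) / real (Suc n))"
  then obtain n :: nat where "x = mean_time 0 (real (Suc n) *\<^sub>R (SOME b. b \<in> Basis)) / real (Suc n)" by (rule rangeE)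
  then show "0 \<le> x" by (simp only:) (rule divide_nonneg_nonneg[OF mean_time_nonneg of_nat_0_le_iff])
qed

lemma some_Basis: "norm (SOME b::'a. b \<in> Basis) = 1"
proof -
  have "(SOME b::'a. b \<in> Basis) \<in> Basis" unfolding some_in_eq by (rule nonempty_Basis)
  then show ?thesis by simp
qed

lemma lam_nonneg: "0 \<le> lam"
  unfolding lam_def by (rule cINF_greatest[OF UNIV_not_empty], rule divide_nonneg_nonneg[OF mean_time_nonneg of_nat_0_le_iff])

lemma lam_lower: assumes "norm u = 1" shows "lam * real n \<le> mean_time 0 (real n *\<^sub>R u)"
proof (cases n)
  case 0 then show ?thesis by (simp add: mean_time_nonneg)
next
  case (Suc m)
  have "lam \<le> mean_time 0 (real (Suc m) *\<^sub>R (SOME b. b \<in> Basis)) / real (Suc m)"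
    unfolding lam_def by (rule cINF_lower[OF lam_bdd]) simp
  also have "mean_time 0 (real (Suc m) *\<^sub>R (SOME b. b \<in> Basis)) = mean_time 0 (real (Suc m) *\<^sub>R u)"
    using assms some_Basis by (intro mean_time_isotropic) simp
  finally have "lam * real (Suc m) \<le> mean_time 0 (real (Suc m) *\<^sub>R u)" by (simp only: pos_le_divide_eq of_nat_0_less_iff zero_less_Suc)
  then show ?thesis using Suc by simp
qed

lemma lam_upper: assumes "0 < e" shows "\<exists>n\<ge>1. \<forall>u. norm u = 1 \<longrightarrow> mean_time 0 (real n *\<^sub>R u) \<le> (lam + e) * real n"
proof -
  have "lam < lam + e" using assms by simp
  then obtain m where m: "mean_time 0 (real (Suc m) *\<^sub>R (SOME b. b \<in> Basis)) / real (Suc m) < lam + e"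
    unfolding lam_def by (subst (asm) cINF_less_iff[OF _ lam_bdd]) auto
  then have m2: "mean_time 0 (real (Suc m) *\<^sub>R (SOME b. b \<in> Basis)) \<le> (lam + e) * real (Suc m)"
    by (simp only: pos_divide_less_eq of_nat_0_less_iff zero_less_Suc less_imp_le)
  have "mean_time 0 (real (Suc m) *\<^sub>R u) \<le> (lam + e) * real (Suc m)" if "norm u = 1" for u
    using m2 mean_time_isotropic[of "real (Suc m) *\<^sub>R u" "real (Suc m) *\<^sub>R (SOME b. b \<in> Basis)"] that some_Basis by simp
  then show ?thesis by (intro exI[of _ "Suc m"]) auto
qed

end

section \<open>Deviations in a fixed direction\<close>

context deijfen_process begin

lemma prob_shift:
  assumes P: "Measurable.pred nconf P"
  shows "prob {w\<in>space M. P ((\<lambda>(c, t, r). (c + v, t, r)) ` chi w)} = prob {w\<in>space M. P (chi w)}"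
proof -
  have m: "(\<lambda>w. (\<lambda>(c, t, r). (c + v, t, r)) ` chi w) \<in> measurable M nconf"
    using shift_isometry by (intro iso_measurable) auto
  have law: "distr M nconf (\<lambda>w. (\<lambda>(c, t, r). (c + v, t, r)) ` chi w) = distr M nconf chi"
    using shift_isometry by (intro law_isometry) auto
  have Ps: "{X\<in>space nconf. P X} \<in> sets nconf" using P by (simp add: pred_def)
  have pull: "f -` {X\<in>space nconf. P X} \<inter> space M = {w\<in>space M. P (f w)}" if "f \<in> measurable M nconf" for f
    using measurable_space[OF that] by auto
  have "measure (distr M nconf (\<lambda>w. (\<lambda>(c, t, r). (c + v, t, r)) ` chi w)) {X\<in>space nconf. P X} = measure (distr M nconf chi) {X\<in>space nconf. P X}"
    by (simp only: law)
  then show ?thesis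
    unfolding measure_distr[OF m Ps] measure_distr[OF chi_measurable Ps] pull[OF m] pull[OF chi_measurable] .
qed

lemma points_over_cball_shift: "(\<lambda>(c, t, r). (c + v, t, r)) ` X \<inter> points_over_cball (x + v) R = (\<lambda>(c, t, r). (c + v, t, r)) ` (X \<inter> points_over_cball x R)"
  by (auto simp: points_over_cball_def image_iff)

lemma restricted_mean:
  assumes e: "0 < e"
  shows "\<exists>R>0. (AE w in M. \<exists>s. cov (chi w \<inter> points_over_cball 0 R) 0 v s) \<and> integrable M (\<lambda>w. (real (cover_time (chi w \<inter> points_over_cball 0 R) 0 v))\<^sup>2)
     \<and> expectation (\<lambda>w. real (cover_time (chi w \<inter> points_over_cball 0 R) 0 v)) \<le> mean_time 0 v + e"
proof -
  obtain R0 where R0: "R0 > 0" and mom: "\<And>L. L\<in>sets borel \<Longrightarrow> points_over_cball 0 R0 \<subseteq> L \<Longrightarrow>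
    (AE w in M. \<exists>s. cov (chi w \<inter> L) 0 v s) \<and> integrable M (\<lambda>w. (real (cover_time (chi w \<inter> L) 0 v))\<^sup>2)"
    using cover_time_moments[of 0 v] by blast
  let ?Z = "\<lambda>m w. real (cover_time (chi w \<inter> points_over_cball 0 (R0 + real m)) 0 v)"
  have BRm: "points_over_cball 0 R \<subseteq> points_over_cball 0 R'" if "R \<le> R'" for R R' using that by (auto simp: points_over_cball_def)
  have lim: "(\<lambda>m. expectation (?Z m)) \<longlonglongrightarrow> expectation (\<lambda>w. real (cover_time (chi w) 0 v))"
  proof (rule integral_dominated_convergence)
    have sub0: "points_over_cball 0 R0 \<subseteq> points_over_cball 0 (R0 + real 0)" by (rule BRm) simp
    show "integrable M (?Z 0)"
      by (rule integrable_of_square[OF real_cover_time_Int_measurable[OF points_over_cball_borel] mom[OF points_over_cball_borel sub0, THEN conjunct2]])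
    have A0: "AE w in M. \<exists>s. cov (chi w \<inter> points_over_cball 0 (R0 + real 0)) 0 v s" by (rule mom[OF points_over_cball_borel sub0, THEN conjunct1])
    show "AE w in M. (\<lambda>m. ?Z m w) \<longlonglongrightarrow> real (cover_time (chi w) 0 v)"
      using A0
    proof eventually_elim
      case (elim w)
      then obtain s where s: "cov (chi w \<inter> points_over_cball 0 (R0 + real 0)) 0 v s" by blast
      have cm: "cov (chi w \<inter> points_over_cball 0 (R0 + real m)) 0 v s" for m
        using BRm[of "R0 + real 0" "R0 + real m"] by (rule_tac cov_mono[OF s]) auto
      have cw: "cov (chi w) 0 v s" using cov_mono[OF s, of "chi w" s] by auto
      obtain X0 where X0: "finite X0" "X0 \<subseteq> chi w" "cov X0 0 v (real (cover_time (chi w) 0 v))"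
        using cov_finite[OF cover_time_cov[OF cw]] by blast
      obtain B where B: "\<And>x. x \<in> ctr ` X0 \<Longrightarrow> norm x \<le> B" using bounded_iff[THEN iffD1, OF finite_imp_bounded[OF finite_imageI[OF X0(1), of fst]]] by blast
      obtain m0 :: nat where m0: "B \<le> real m0" using real_arch_simple by blast
      have "?Z m w = real (cover_time (chi w) 0 v)" if "m \<ge> m0" for m
      proof -
        have "X0 \<subseteq> points_over_cball 0 (R0 + real m)"
        proof
          fix p assume "p \<in> X0"
          then have "norm (ctr p) \<le> B" using B by blast
          then show "p \<in> points_over_cball 0 (R0 + real m)" using m0 that R0 by (simp add: points_over_cball_def)
        qed
        then have "cov (chi w \<inter> points_over_cball 0 (R0 + real m)) 0 v (real (cover_time (chi w) 0 v))"
          using X0(2) by (rule_tac cov_mono[OF X0(3)]) auto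
        then have "cover_time (chi w \<inter> points_over_cball 0 (R0 + real m)) 0 v \<le> cover_time (chi w) 0 v" by (rule cover_time_le)
        moreover have "cover_time (chi w) 0 v \<le> cover_time (chi w \<inter> points_over_cball 0 (R0 + real m)) 0 v" by (rule cover_time_mono_cov[OF cm]) simp
        ultimately show ?thesis by simp
      qed
      then show "(\<lambda>m. ?Z m w) \<longlonglongrightarrow> real (cover_time (chi w) 0 v)"
        by (intro tendsto_eventually) (auto simp: eventually_sequentially)
    qed
    show "AE w in M. norm (?Z m w) \<le> ?Z 0 w" for m
      using A0
    proof eventually_elim
      case (elim w)
      then obtain s where s: "cov (chi w \<inter> points_over_cball 0 (R0 + real 0)) 0 v s" by blast
      have "cover_time (chi w \<inter> points_over_cball 0 (R0 + real m)) 0 v \<le> cover_time (chi w \<inter> points_over_cball 0 (R0 + real 0)) 0 v"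
        using BRm[of "R0 + real 0" "R0 + real m"] by (intro cover_time_mono_cov[OF s]) auto
      then show ?case by simp
    qed
  qed (auto intro!: real_cover_time_measurable real_cover_time_Int_measurable points_over_cball_borel)
  have "\<forall>\<^sub>F m in sequentially. expectation (?Z m) < mean_time 0 v + e"
    using order_tendstoD(2)[OF lim, of "mean_time 0 v + e"] e by (simp add: mean_time_def)
  then obtain m where m: "expectation (?Z m) < mean_time 0 v + e" by (auto simp: eventually_sequentially)
  have "points_over_cball 0 R0 \<subseteq> points_over_cball 0 (R0 + real m)" by (rule BRm) simp
  then show ?thesis using mom[OF points_over_cball_borel, of 0 "R0 + real m"] m R0 by (intro exI[of _ "R0 + real m"]) auto
qed

lemma cover_time_chain:
  assumes "\<And>j. \<exists>s. cov (X \<inter> L j) (real j *\<^sub>R v) (real (Suc j) *\<^sub>R v) s" "1 \<le> k"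
  shows "cover_time X 0 (real k *\<^sub>R v) \<le> (\<Sum>j<k. cover_time (X \<inter> L j) (real j *\<^sub>R v) (real (Suc j) *\<^sub>R v))"
proof -
  let ?T = "\<lambda>j. cover_time (X \<inter> L j) (real j *\<^sub>R v) (real (Suc j) *\<^sub>R v)"
  have c: "cov X (real j *\<^sub>R v) (real (Suc j) *\<^sub>R v) (real (?T j))" for j
  proof -
    obtain s where s: "cov (X \<inter> L j) (real j *\<^sub>R v) (real (Suc j) *\<^sub>R v) s" using assms(1) by blast
    show ?thesis by (rule cov_mono[OF cover_time_cov[OF s] Int_lower1 order_refl])
  qed
  have "cov X 0 (real k *\<^sub>R v) (real (\<Sum>j<k. ?T j))"
    using assms(2)
  proof (induction k rule: nat_induct_at_least)
    case base
    show ?case using c[of 0] by simp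
  next
    case (Suc k)
    have "cov X 0 (real (Suc k) *\<^sub>R v) (real (\<Sum>j<k. ?T j) + real (?T k))" by (rule cov_trans[OF Suc.IH c])
    then show ?case by (simp only: sum.lessThan_Suc of_nat_add)
  qed
  then show ?thesis by (rule cover_time_le)
qed

text \<open>Restricting the passage times to bounded regions makes them finitely dependent, so that the variance of
  their sum grows linearly.\<close>

lemma range_decomp:
  assumes u: "norm u = 1" and e: "0 < e"
  shows "\<exists>n1\<ge>1. \<exists>C\<ge>0. \<exists>Y::nat\<Rightarrow>'w\<Rightarrow>real. (\<forall>k. Y k \<in> borel_measurable M \<and> integrable M (\<lambda>w. (Y k w)\<^sup>2) \<and>
     expectation (\<lambda>w. (Y k w)\<^sup>2) \<le> C * real k) \<and>
     (\<forall>k\<ge>1. AE w in M. real (cover_time (chi w) 0 (real (k * n1) *\<^sub>R u)) \<le> (lam + e) * real (k * n1) + Y k w)"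
proof -
  obtain n1 where n1: "1 \<le> n1" "mean_time 0 (real n1 *\<^sub>R u) \<le> (lam + e / 2) * real n1" using lam_upper[of "e / 2"] e u by auto
  define v where "v = real n1 *\<^sub>R u"
  have nv: "norm v = real n1" using u by (simp add: v_def)
  obtain R where R: "R > 0" and Rc: "AE w in M. \<exists>s. cov (chi w \<inter> points_over_cball 0 R) 0 v s"
    and Rs: "integrable M (\<lambda>w. (real (cover_time (chi w \<inter> points_over_cball 0 R) 0 v))\<^sup>2)"
    and Rm: "expectation (\<lambda>w. real (cover_time (chi w \<inter> points_over_cball 0 R) 0 v)) \<le> mean_time 0 v + e / 2"
    using restricted_mean[of "e / 2" v] e by auto
  define F where "F j X = real (cover_time (X \<inter> points_over_cball (real j *\<^sub>R v) R) (real j *\<^sub>R v) (real (Suc j) *\<^sub>R v))" for j :: nat and X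
  define L where "L j = points_over_cball (real j *\<^sub>R v) R" for j :: nat
  have Fm: "F j \<in> borel_measurable nconf" for j
    unfolding F_def using measurable_compose[OF Int_measurable_nconf[OF points_over_cball_borel] real_cover_time_nconf] by simp
  have Fshift: "F j ((\<lambda>(c, t, r). (c + real j *\<^sub>R v, t, r)) ` X) = real (cover_time (X \<inter> points_over_cball 0 R) 0 v)" for j X
  proof -
    have "(\<lambda>(c, t, r). (c + real j *\<^sub>R v, t, r)) ` X \<inter> points_over_cball (real j *\<^sub>R v) R = (\<lambda>(c, t, r). (c + real j *\<^sub>R v, t, r)) ` (X \<inter> points_over_cball 0 R)"
      using points_over_cball_shift[of "real j *\<^sub>R v" X 0 R] by simp
    moreover have "cover_time ((\<lambda>(c, t, r). (c + real j *\<^sub>R v, t, r)) ` (X \<inter> points_over_cball 0 R)) (0 + real j *\<^sub>R v) (v + real j *\<^sub>R v) = cover_time (X \<inter> points_over_cball 0 R) 0 v"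
      by (rule cover_time_image) (auto simp: shift_isometry(4))
    moreover have "v + real j *\<^sub>R v = real (Suc j) *\<^sub>R v" by (simp add: scaleR_left_distrib)
    ultimately show ?thesis unfolding F_def by simp
  qed
  have Fexp: "expectation (\<lambda>w. G (F j (chi w))) = expectation (\<lambda>w. G (real (cover_time (chi w \<inter> points_over_cball 0 R) 0 v)))"
    if G: "G \<in> borel_measurable borel" for G :: "real \<Rightarrow> real" and j
  proof -
    have "(\<lambda>X. G (F j X)) \<in> borel_measurable nconf" using measurable_compose[OF Fm G] .
    from expectation_isometry[OF shift_isometry(1,2,3) this, of "real j *\<^sub>R v"]
    show ?thesis unfolding Fshift by (rule sym)
  qed
  define m where "m = expectation (\<lambda>w. real (cover_time (chi w \<inter> points_over_cball 0 R) 0 v))"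
  have Fw: "(\<lambda>w. F j (chi w)) \<in> borel_measurable M" for j using measurable_compose[OF chi_measurable Fm] .
  have Fsq: "integrable M (\<lambda>w. (F j (chi w))\<^sup>2)" for j
  proof -
    have mm: "(\<lambda>w. (\<lambda>(c, t, r). (c + real j *\<^sub>R v, t, r)) ` chi w) \<in> measurable M nconf"
      using shift_isometry by (intro iso_measurable) auto
    have law: "distr M nconf (\<lambda>w. (\<lambda>(c, t, r). (c + real j *\<^sub>R v, t, r)) ` chi w) = distr M nconf chi"
      using shift_isometry by (intro law_isometry) auto
    have sqm: "(\<lambda>X. (F j X)\<^sup>2) \<in> borel_measurable nconf" using Fm by measurable
    have "integrable M (\<lambda>w. (F j ((\<lambda>(c, t, r). (c + real j *\<^sub>R v, t, r)) ` chi w))\<^sup>2)" using Rs by (simp only: Fshift)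
    then have "integrable (distr M nconf chi) (\<lambda>X. (F j X)\<^sup>2)"
      unfolding law[symmetric] by (simp only: integrable_distr_eq[OF mm sqm])
    then show ?thesis by (simp only: integrable_distr_eq[OF chi_measurable sqm])
  qed
  have Fint: "integrable M (\<lambda>w. F j (chi w))" for j by (rule integrable_of_square[OF Fw Fsq])
  define Y where "Y j w = F j (chi w) - m" for j w
  have Ym: "Y j \<in> borel_measurable M" for j unfolding Y_def using Fw by measurable
  have Ysq: "integrable M (\<lambda>w. (Y j w)\<^sup>2)" for j
    unfolding Y_def power2_diff using Fsq Fint by auto
  have Yint: "integrable M (Y j)" for j by (rule integrable_of_square[OF Ym Ysq])
  define C0 where "C0 = expectation (\<lambda>w. (real (cover_time (chi w \<inter> points_over_cball 0 R) 0 v) - m)\<^sup>2)"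
  have C0: "0 \<le> C0" unfolding C0_def by (intro Bochner_Integration.integral_nonneg) auto
  have Yv: "expectation (\<lambda>w. (Y j w)\<^sup>2) \<le> C0" for j
    using Fexp[of "\<lambda>x. (x - m)\<^sup>2" j] by (simp add: Y_def C0_def)
  have Y0: "expectation (Y j) = 0" for j
  proof -
    have "expectation (Y j) = expectation (\<lambda>w. F j (chi w) - m)"
      by (rule Bochner_Integration.integral_cong) (simp_all add: Y_def)
    also have "\<dots> = expectation (\<lambda>w. F j (chi w)) - m" using Fint[of j] by (simp add: prob_space)
    also have "\<dots> = 0" using Fexp[of "\<lambda>x. x" j] by (simp add: m_def)
    finally show ?thesis .
  qed
  define q where "q = nat \<lceil>2 * R\<rceil> + 1"
  have q: "2 * R < real q" using R unfolding q_def by linarith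
  have ind: "expectation (\<lambda>w. Y i w * Y j w) = 0" if ij: "i + q \<le> j" for i j
  proof -
    have dj: "L i \<inter> L j = {}"
    proof (rule ccontr)
      assume "L i \<inter> L j \<noteq> {}"
      then obtain p where p: "norm (ctr p - real i *\<^sub>R v) \<le> R" "norm (ctr p - real j *\<^sub>R v) \<le> R" by (auto simp: L_def points_over_cball_def)
      have "norm (real j *\<^sub>R v - real i *\<^sub>R v) \<le> norm (ctr p - real i *\<^sub>R v) + norm (ctr p - real j *\<^sub>R v)"
        using norm_triangle_ineq4[of "ctr p - real i *\<^sub>R v" "ctr p - real j *\<^sub>R v"] by simp
      also have "\<dots> \<le> 2 * R" using p by simp
      also have "norm (real j *\<^sub>R v - real i *\<^sub>R v) = (real j - real i) * real n1"
        using ij nv by (simp flip: scaleR_left_diff_distrib)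
      finally have "(real j - real i) * real n1 \<le> 2 * R" .
      have "real (i + q) \<le> real j" using ij by (rule of_nat_mono)
      then have "real q \<le> (real j - real i) * 1" by simp
      also have "\<dots> \<le> (real j - real i) * real n1" using ij n1 by (intro mult_left_mono) auto
      also have "\<dots> \<le> 2 * R" by fact
      finally show False using q by linarith
    qed
    let ?G = "\<lambda>j X. real (cover_time X (real j *\<^sub>R v) (real (Suc j) *\<^sub>R v)) - m"
    have Gm: "?G j \<in> borel_measurable nconf" for j :: nat using real_cover_time_nconf by measurable
    have "indep_var nconf (\<lambda>w. chi w \<inter> L i) nconf (\<lambda>w. chi w \<inter> L j)"
      unfolding L_def by (intro indep_restrict points_over_cball_borel) (use dj in \<open>simp add: L_def\<close>)
    from indep_var_compose[OF this Gm[of i] Gm[of j]]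
    have "indep_var borel (Y i) borel (Y j)" by (simp add: comp_def Y_def[abs_def] F_def L_def)
    from indep_var_lebesgue_integral[OF this Yint Yint] show ?thesis using Y0 by simp
  qed
  note fv = finite_range_variance[where Y=Y and C=C0 and q=q, OF Ym Ysq Yv ind C0]
  have bound: "AE w in M. real (cover_time (chi w) 0 (real (k * n1) *\<^sub>R u)) \<le> (lam + e) * real (k * n1) + (\<Sum>j<k. Y j w)" if k: "1 \<le> k" for k
  proof -
    have "AE w in M. \<exists>n::nat. cov (chi w \<inter> L j) (real j *\<^sub>R v) (real (Suc j) *\<^sub>R v) (real n)" for j
    proof -
      let ?v = "real j *\<^sub>R v"
      let ?P = "\<lambda>X. \<exists>n::nat. cov (X \<inter> points_over_cball 0 R) 0 v (real n)"
      have pm: "Measurable.pred nconf (\<lambda>X. \<exists>n::nat. cov (X \<inter> L j) x y (real n))" for x y j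
        using measurable_compose[OF Int_measurable_nconf[OF points_over_cball_borel] cov_measurable] unfolding L_def by measurable
      have "AE w in M. ?P (chi w)"
        using Rc
      proof eventually_elim
        case (elim w)
        then obtain s where "cov (chi w \<inter> points_over_cball 0 R) 0 v s" by blast
        then show ?case using cover_time_cov by blast
      qed
      moreover have "?P X \<longleftrightarrow> (\<exists>n::nat. cov ((\<lambda>(c, t, r). (c + ?v, t, r)) ` X \<inter> L j) ?v (real (Suc j) *\<^sub>R v) (real n))" for X
      proof -
        have "(\<lambda>(c, t, r). (c + ?v, t, r)) ` X \<inter> L j = (\<lambda>(c, t, r). (c + ?v, t, r)) ` (X \<inter> points_over_cball 0 R)"
          using points_over_cball_shift[of ?v X 0 R] by (simp add: L_def)
        moreover have "cov ((\<lambda>(c, t, r). (c + ?v, t, r)) ` (X \<inter> points_over_cball 0 R)) (0 + ?v) (v + ?v) s \<longleftrightarrow> cov (X \<inter> points_over_cball 0 R) 0 v s" for s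
          by (rule cov_image_iff) (auto simp: shift_isometry(4))
        moreover have "v + ?v = real (Suc j) *\<^sub>R v" by (simp add: scaleR_left_distrib)
        ultimately show ?thesis by simp
      qed
      ultimately have A: "AE w in M. \<exists>n::nat. cov ((\<lambda>(c, t, r). (c + ?v, t, r)) ` chi w \<inter> L j) ?v (real (Suc j) *\<^sub>R v) (real n)" by simp
      have m: "(\<lambda>w. (\<lambda>(c, t, r). (c + ?v, t, r)) ` chi w) \<in> measurable M nconf"
        using shift_isometry by (intro iso_measurable) auto
      have law: "distr M nconf (\<lambda>w. (\<lambda>(c, t, r). (c + ?v, t, r)) ` chi w) = distr M nconf chi"
        using shift_isometry by (intro law_isometry) auto
      let ?Q = "\<lambda>X. \<exists>n::nat. cov (X \<inter> L j) ?v (real (Suc j) *\<^sub>R v) (real n)"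
      have Qs: "{X\<in>space nconf. ?Q X} \<in> sets nconf" using pm by (simp only: pred_def)
      have "AE X in distr M nconf (\<lambda>w. (\<lambda>(c, t, r). (c + ?v, t, r)) ` chi w). ?Q X" using A by (simp only: AE_distr_iff[OF m Qs])
      then show ?thesis unfolding law by (simp only: AE_distr_iff[OF chi_measurable Qs])
    qed
    then have "AE w in M. \<forall>j. \<exists>n::nat. cov (chi w \<inter> L j) (real j *\<^sub>R v) (real (Suc j) *\<^sub>R v) (real n)"
      unfolding AE_all_countable by (rule allI)
    then show ?thesis
    proof eventually_elim
      case (elim w)
      then have ex: "\<exists>s. cov (chi w \<inter> L j) (real j *\<^sub>R v) (real (Suc j) *\<^sub>R v) s" for j by blast
      have kv: "real (k * n1) *\<^sub>R u = real k *\<^sub>R v" by (simp add: v_def)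
      have "real (cover_time (chi w) 0 (real k *\<^sub>R v)) \<le> real (\<Sum>j<k. cover_time (chi w \<inter> L j) (real j *\<^sub>R v) (real (Suc j) *\<^sub>R v))"
        using cover_time_chain[OF ex k] by (rule of_nat_mono)
      also have "\<dots> = (\<Sum>j<k. F j (chi w))" by (simp add: F_def L_def)
      also have "\<dots> = real k * m + (\<Sum>j<k. Y j w)" by (simp add: Y_def sum_subtractf)
      also have "real k * m \<le> real k * ((lam + e) * real n1)"
      proof (rule mult_left_mono)
        have "m \<le> (lam + e / 2) * real n1 + e / 2" using Rm n1(2) unfolding m_def v_def by linarith
        also have "\<dots> \<le> (lam + e / 2) * real n1 + e / 2 * real n1" using n1(1) e by simp
        finally show "m \<le> (lam + e) * real n1" by (simp add: algebra_simps)
      qed simp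
      finally show ?case unfolding kv by (simp add: mult_ac)
    qed
  qed
  show ?thesis
  proof (intro exI[of _ n1] conjI exI[of _ "(2 * real q + 1) * C0"] exI[of _ "\<lambda>k w. \<Sum>j<k. Y j w"] allI impI)
    show "1 \<le> n1" by fact
    show "0 \<le> (2 * real q + 1) * C0" using C0 by simp
    fix k
    show "(\<lambda>w. \<Sum>j<k. Y j w) \<in> borel_measurable M" using Ym by measurable
    show "integrable M (\<lambda>w. (\<Sum>j<k. Y j w)\<^sup>2)" by (rule fv(1))
    show "expectation (\<lambda>w. (\<Sum>j<k. Y j w)\<^sup>2) \<le> (2 * real q + 1) * C0 * real k" using fv(2)[of k] by (simp add: mult_ac)
  next
    fix k :: nat assume "1 \<le> k"
    then show "AE w in M. real (cover_time (chi w) 0 (real (k * n1) *\<^sub>R u)) \<le> (lam + e) * real (k * n1) + (\<Sum>j<k. Y j w)" by (rule bound)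
  qed
qed

lemma limsup_direction:
  assumes u: "norm u = 1" and e: "0 < e"
  shows "\<exists>n1\<ge>1. AE w in M. \<exists>k0. \<forall>k\<ge>k0. real (cover_time (chi w) 0 (real (k\<^sup>2 * n1) *\<^sub>R u)) \<le> (lam + e) * real (k\<^sup>2 * n1)"
proof -
  have e2: "0 < e / 2" using e by simp
  obtain n1 C and Y :: "nat \<Rightarrow> 'w \<Rightarrow> real" where n1: "1 \<le> n1" and C: "0 \<le> C" and YY: "\<forall>k. Y k \<in> borel_measurable M \<and> integrable M (\<lambda>w. (Y k w)\<^sup>2) \<and>
     expectation (\<lambda>w. (Y k w)\<^sup>2) \<le> C * real k"
    and bb: "\<forall>k\<ge>1. AE w in M. real (cover_time (chi w) 0 (real (k * n1) *\<^sub>R u)) \<le> (lam + e / 2) * real (k * n1) + Y k w"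
    using range_decomp[OF u e2] by blast
  note Y = YY[rule_format, THEN conjunct1] YY[rule_format, THEN conjunct2, THEN conjunct1] YY[rule_format, THEN conjunct2, THEN conjunct2]
  note b = bb[rule_format]
  define a where "a k = e / 2 * real (k\<^sup>2 * n1)" for k :: nat
  have "AE w in M. \<exists>k1. \<forall>k\<ge>k1. \<not> (a k \<le> \<bar>Y (k\<^sup>2) w\<bar>)"
  proof (rule outer_prob_le_borel_cantelli[where ?n0.0=1])
    show "summable (\<lambda>k. (C / (e / 2 * real n1)\<^sup>2) * inverse (real k ^ 2))"
      by (intro summable_mult inverse_power_summable) simp
    fix k :: nat assume k: "1 \<le> k"
    have a: "0 < a k" using k n1 e by (simp add: a_def)
    have [measurable]: "Y (k\<^sup>2) \<in> borel_measurable M" by (rule Y)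
    show "outer_prob_le (\<lambda>w. a k \<le> \<bar>Y (k\<^sup>2) w\<bar>) ((C / (e / 2 * real n1)\<^sup>2) * inverse (real k ^ 2))"
    proof (rule outer_prob_leI[of "{w\<in>space M. a k \<le> \<bar>Y (k\<^sup>2) w\<bar>}"])
      have "prob {w\<in>space M. a k \<le> \<bar>Y (k\<^sup>2) w\<bar>} \<le> expectation (\<lambda>w. (Y (k\<^sup>2) w)\<^sup>2) / (a k)\<^sup>2"
        by (rule second_moment_method[OF Y(1,2) a])
      also have "\<dots> \<le> C * real (k\<^sup>2) / (a k)\<^sup>2" using Y(3)[of "k\<^sup>2"] by (intro divide_right_mono) auto
      also have "\<dots> = (C / (e / 2 * real n1)\<^sup>2) * inverse (real k ^ 2)"
        using k n1 e by (simp add: a_def field_simps power2_eq_square)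
      finally show "prob {w\<in>space M. a k \<le> \<bar>Y (k\<^sup>2) w\<bar>} \<le> (C / (e / 2 * real n1)\<^sup>2) * inverse (real k ^ 2)" .
      show "{w\<in>space M. a k \<le> \<bar>Y (k\<^sup>2) w\<bar>} \<in> events" by measurable
    qed simp
  qed
  moreover have "AE w in M. \<forall>k\<in>{1..}. real (cover_time (chi w) 0 (real (k * n1) *\<^sub>R u)) \<le> (lam + e / 2) * real (k * n1) + Y k w"
    using b by (intro AE_ball_countable[THEN iffD2]) auto
  ultimately have "AE w in M. \<exists>k0. \<forall>k\<ge>k0. real (cover_time (chi w) 0 (real (k\<^sup>2 * n1) *\<^sub>R u)) \<le> (lam + e) * real (k\<^sup>2 * n1)"
  proof eventually_elim
    case (elim w)
    then obtain k1 where k1: "\<And>k. k \<ge> k1 \<Longrightarrow> \<not> (a k \<le> \<bar>Y (k\<^sup>2) w\<bar>)" by blast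
    show ?case
    proof (intro exI[of _ "max 1 k1"] allI impI)
      fix k assume k: "max 1 k1 \<le> k"
      have "k\<^sup>2 \<in> {1..}" using k by simp
      then have "real (cover_time (chi w) 0 (real (k\<^sup>2 * n1) *\<^sub>R u)) \<le> (lam + e / 2) * real (k\<^sup>2 * n1) + Y (k\<^sup>2) w"
        using elim(2) by blast
      moreover have "Y (k\<^sup>2) w \<le> a k" using k1[of k] k by linarith
      moreover have "(lam + e / 2) * real (k\<^sup>2 * n1) + a k = (lam + e) * real (k\<^sup>2 * n1)" by (simp only: a_def distrib_right)
      ultimately show "real (cover_time (chi w) 0 (real (k\<^sup>2 * n1) *\<^sub>R u)) \<le> (lam + e) * real (k\<^sup>2 * n1)" by linarith
    qed
  qed
  then show ?thesis using n1 by blast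
qed

lemma mean_deviation:
  assumes u: "norm u = 1" and eta: "0 < eta"
  shows "\<exists>n0\<ge>1. expectation (\<lambda>w. \<bar>real (cover_time (chi w) 0 (real n0 *\<^sub>R u)) - lam * real n0\<bar>) \<le> eta * real n0"
proof -
  define e where "e = eta / 4"
  have e: "e > 0" using eta by (simp add: e_def)
  obtain n1 C and Y :: "nat \<Rightarrow> 'w \<Rightarrow> real" where n1: "1 \<le> n1" and C: "0 \<le> C" and YY: "\<forall>k. Y k \<in> borel_measurable M \<and> integrable M (\<lambda>w. (Y k w)\<^sup>2) \<and>
     expectation (\<lambda>w. (Y k w)\<^sup>2) \<le> C * real k"
    and bb: "\<forall>k\<ge>1. AE w in M. real (cover_time (chi w) 0 (real (k * n1) *\<^sub>R u)) \<le> (lam + e) * real (k * n1) + Y k w"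
    using range_decomp[OF u e] by blast
  note Y = YY[rule_format, THEN conjunct1] YY[rule_format, THEN conjunct2, THEN conjunct1] YY[rule_format, THEN conjunct2, THEN conjunct2]
  note b = bb[rule_format]
  obtain k0 :: nat where k0: "C / (e * e) \<le> real k0" using real_arch_simple by blast
  define k n0 where "k = Suc k0" and "n0 = k * n1"
  have "k * 1 \<le> k * n1" using n1 by (rule mult_le_mono2)
  then have n0: "1 \<le> n0" "real k \<le> real n0" using n1 unfolding n0_def k_def by (auto intro: of_nat_mono simp del: of_nat_mult of_nat_Suc)
  define al where "al = e * real n0"
  have al: "al > 0" using e n0 by (simp add: al_def)
  define T where "T = (\<lambda>w. real (cover_time (chi w) 0 (real n0 *\<^sub>R u)))"
  have Ti: "integrable M T" unfolding T_def by (rule cover_time_integrable)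
  have ET: "lam * real n0 \<le> expectation T" using lam_lower[OF u, of n0] by (simp add: mean_time_def T_def)
  have Yi: "integrable M (Y k)" by (rule integrable_of_square[OF Y(1,2)])
  have pt: "AE w in M. \<bar>T w - lam * real n0\<bar> \<le> 2 * (e * real n0) + al + (Y k w)\<^sup>2 / al - (T w - lam * real n0)"
    using b[of k]
  proof (rule AE_mp)
    show "1 \<le> k" by (simp add: k_def)
    show "AE w in M. real (cover_time (chi w) 0 (real (k * n1) *\<^sub>R u)) \<le> (lam + e) * real (k * n1) + Y k w \<longrightarrow>
       \<bar>T w - lam * real n0\<bar> \<le> 2 * (e * real n0) + al + (Y k w)\<^sup>2 / al - (T w - lam * real n0)"
    proof (intro AE_I2 impI)
      fix w assume "real (cover_time (chi w) 0 (real (k * n1) *\<^sub>R u)) \<le> (lam + e) * real (k * n1) + Y k w"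
      then have 1: "T w - lam * real n0 \<le> e * real n0 + Y k w" by (simp add: T_def n0_def distrib_right)
      have "0 \<le> (Y k w)\<^sup>2 + al\<^sup>2 - 2 * \<bar>Y k w\<bar> * al"
        using zero_le_power2[of "\<bar>Y k w\<bar> - al"] by (simp only: power2_diff power2_abs)
      then have "2 * \<bar>Y k w\<bar> * al \<le> (Y k w)\<^sup>2 + al * al" unfolding power2_eq_square[of al] by linarith
      then have "2 * \<bar>Y k w\<bar> \<le> ((Y k w)\<^sup>2 + al * al) / al" using al by (simp add: pos_le_divide_eq)
      also have "\<dots> = (Y k w)\<^sup>2 / al + al" using al by (simp add: add_divide_distrib)
      finally have 2: "2 * \<bar>Y k w\<bar> \<le> (Y k w)\<^sup>2 / al + al" .
      have "0 \<le> e * real n0" "0 \<le> (Y k w)\<^sup>2 / al" using e al by auto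
      then show "\<bar>T w - lam * real n0\<bar> \<le> 2 * (e * real n0) + al + (Y k w)\<^sup>2 / al - (T w - lam * real n0)"
        using 1 2 al by linarith
    qed
  qed
  have "expectation (\<lambda>w. \<bar>T w - lam * real n0\<bar>) \<le> expectation (\<lambda>w. 2 * (e * real n0) + al + (Y k w)\<^sup>2 / al - (T w - lam * real n0))"
    using pt Ti Y(2) by (intro integral_mono_AE) auto
  also have "\<dots> = 2 * (e * real n0) + al + expectation (\<lambda>w. (Y k w)\<^sup>2) / al - (expectation T - lam * real n0)"
    using Ti Y(2) by (simp add: prob_space)
  also have "\<dots> \<le> 2 * (e * real n0) + al + C * real k / al"
    using ET Y(3)[of k] al by (smt (verit) divide_right_mono)
  also have "C * real k / al \<le> al"
  proof -
    have "C / (e * e) \<le> real n0" using k0 n0(2) by (simp add: k_def)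
    then have "C \<le> e * e * real n0" using e by (simp add: field_simps)
    then have "C * real k \<le> (e * e * real n0) * real n0" using n0(2) C by (intro mult_mono) auto
    also have "\<dots> = al * al" by (simp add: al_def)
    finally show ?thesis using al by (simp add: field_simps)
  qed
  also have "2 * (e * real n0) + al + al = eta * real n0" by (simp add: al_def e_def)
  finally show ?thesis unfolding T_def using n0(1) by (intro exI[of _ n0]) auto
qed

lemma slow_direction:
  assumes u: "norm u = 1" and e: "0 < e" and eta: "0 < eta"
  shows "\<exists>n0\<ge>1. outer_prob_le (\<lambda>w. \<exists>n\<ge>1. real (cover_time (chi w) 0 (real (n * n0) *\<^sub>R u)) \<le> (lam - e) * real (n * n0)) eta"
proof -
  obtain n0 where n0: "1 \<le> n0" and dv: "expectation (\<lambda>w. \<bar>real (cover_time (chi w) 0 (real n0 *\<^sub>R u)) - lam * real n0\<bar>) \<le> (eta * e) * real n0"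
    using mean_deviation[OF u, of "eta * e"] e eta by auto
  define v where "v = real n0 *\<^sub>R u"
  define Y where "Y i j w = real (cover_time (chi w) (real i *\<^sub>R v) (real j *\<^sub>R v))" for i j :: nat and w
  have vi: "real n *\<^sub>R v + real i *\<^sub>R v = real (i + n) *\<^sub>R v" for i n :: nat by (simp add: scaleR_left_distrib)
  have Yshift: "cover_time ((\<lambda>(c, t, r). (c + real i *\<^sub>R v, t, r)) ` X) (real i *\<^sub>R v) (real (i + n) *\<^sub>R v) = cover_time X 0 (real n *\<^sub>R v)" for i n :: nat and X
    using cover_time_image[of "\<lambda>x. x + real i *\<^sub>R v" X 0 "real n *\<^sub>R v"] shift_isometry(4)[of "real i *\<^sub>R v"] unfolding vi by simp
  let ?A = "\<lambda>N. {w\<in>space M. \<exists>n\<in>{1..N}. Y 0 n w \<le> (lam * real n0 - e * real n0) * real n}"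
  have le: "prob (?A N) \<le> (eta * e * real n0) / (e * real n0)" for N
  proof (rule subadditive_maximal)
    show "integrable M (Y i j)" for i j unfolding Y_def by (rule cover_time_integrable)
    have "AE w in M. \<forall>i j. \<exists>s. cov (chi w) (real (i::nat) *\<^sub>R v) (real (j::nat) *\<^sub>R v) s" unfolding AE_all_countable using cov_AE by blast
    then show "AE w in M. \<forall>i j k. i < j \<longrightarrow> j < k \<longrightarrow> Y i k w \<le> Y i j w + Y j k w"
    proof eventually_elim
      case (elim w)
      have "Y i k w \<le> Y i j w + Y j k w" for i j k
      proof -
        obtain s s' where s: "cov (chi w) (real i *\<^sub>R v) (real j *\<^sub>R v) s" "cov (chi w) (real j *\<^sub>R v) (real k *\<^sub>R v) s'" using elim by blast
        have "real (cover_time (chi w) (real i *\<^sub>R v) (real k *\<^sub>R v)) \<le> real (cover_time (chi w) (real i *\<^sub>R v) (real j *\<^sub>R v) + cover_time (chi w) (real j *\<^sub>R v) (real k *\<^sub>R v))"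
          using cover_time_triangle[OF s] by (rule of_nat_mono)
        then show ?thesis unfolding Y_def by (simp only: of_nat_add)
      qed
      then show ?case by blast
    qed
    show "0 < e * real n0" using e n0 by simp
    fix i N :: nat
    let ?P = "\<lambda>X. \<exists>n\<in>{1..N}. real (cover_time X (real i *\<^sub>R v) (real (i + n) *\<^sub>R v)) \<le> (lam * real n0 - e * real n0) * real n"
    have "Measurable.pred nconf ?P" using real_cover_time_nconf by measurable
    from prob_shift[OF this, of "real i *\<^sub>R v"]
    show "prob {w\<in>space M. \<exists>n\<in>{1..N}. Y i (i + n) w \<le> (lam * real n0 - e * real n0) * real n} = prob (?A N)"
      unfolding Yshift by (simp add: Y_def)
  next
    fix i
    let ?F = "\<lambda>X. \<bar>real (cover_time X (real i *\<^sub>R v) (real (i + 1) *\<^sub>R v)) - lam * real n0\<bar>"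
    have "?F \<in> borel_measurable nconf" using real_cover_time_nconf by measurable
    from expectation_isometry[OF _ _ _ this, of "\<lambda>x. x + real i *\<^sub>R v"]
    have "expectation (\<lambda>w. \<bar>real (cover_time (chi w) 0 (real (1::nat) *\<^sub>R v)) - lam * real n0\<bar>) = expectation (\<lambda>w. ?F (chi w))"
      unfolding Yshift using shift_isometry by auto
    then show "expectation (\<lambda>w. \<bar>Y i (Suc i) w - lam * real n0\<bar>) \<le> eta * e * real n0"
      using dv unfolding Y_def v_def by simp
  next
    fix K
    have "lam * real (K * n0) \<le> mean_time 0 (real (K * n0) *\<^sub>R u)" by (rule lam_lower[OF u])
    moreover have "expectation (Y 0 K) = mean_time 0 (real (K * n0) *\<^sub>R u)"
      unfolding mean_time_def by (rule Bochner_Integration.integral_cong) (simp_all add: Y_def v_def)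
    ultimately show "lam * real n0 * real K \<le> expectation (Y 0 K)" by (simp add: mult_ac)
  qed
  have le': "prob (?A N) \<le> eta" for N using le[of N] e n0 by simp
  have [measurable]: "Y i j \<in> borel_measurable M" for i j unfolding Y_def by (rule real_cover_time_measurable)
  have Am: "?A N \<in> events" for N by measurable
  have inc: "incseq ?A" by (rule incseq_SucI) auto
  have "(\<lambda>N. prob (?A N)) \<longlonglongrightarrow> prob (\<Union>N. ?A N)" using Am inc by (intro finite_Lim_measure_incseq) auto
  then have "prob (\<Union>N. ?A N) \<le> eta" using le' by (intro LIMSEQ_le_const2) auto
  moreover have "w \<in> (\<Union>N. ?A N)" if w: "w \<in> space M" and ex: "\<exists>n\<ge>1. real (cover_time (chi w) 0 (real (n * n0) *\<^sub>R u)) \<le> (lam - e) * real (n * n0)" for w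
  proof -
    obtain n where n: "1 \<le> n" "real (cover_time (chi w) 0 (real (n * n0) *\<^sub>R u)) \<le> (lam - e) * real (n * n0)" using ex by blast
    have "Y 0 n w \<le> (lam * real n0 - e * real n0) * real n" using n(2) by (simp add: Y_def v_def algebra_simps)
    then have "w \<in> ?A n" using n(1) w by auto
    then show ?thesis by blast
  qed
  ultimately have "outer_prob_le (\<lambda>w. \<exists>n\<ge>1. real (cover_time (chi w) 0 (real (n * n0) *\<^sub>R u)) \<le> (lam - e) * real (n * n0)) eta"
    using Am by (intro outer_prob_leI[of "\<Union>N. ?A N"]) auto
  then show ?thesis using n0 by blast
qed

end

section \<open>Slowness of small balls\<close>

definition unit_steps :: "'a::euclidean_space set" where
  "unit_steps = {z\<in>lat. \<forall>b\<in>Basis. \<bar>z \<bullet> b\<bar> \<le> 1}"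

lemma finite_unit_steps: "finite (unit_steps :: 'a::euclidean_space set)" and card_unit_steps: "real (card (unit_steps :: 'a::euclidean_space set)) \<le> 3 ^ DIM('a)"
  using lat_box_card[where 'a='a and R=1] by (auto simp: unit_steps_def)

lemma unit_steps_lat: "z \<in> unit_steps \<Longrightarrow> z \<in> lat"
  by (simp add: unit_steps_def)

lemma fl_step_unit_steps: "norm (x - y) \<le> 1 \<Longrightarrow> fl x - fl y \<in> unit_steps"
  unfolding unit_steps_def using fl_step lat_diff[OF fl_lat fl_lat] by blast

context deijfen_process begin

lemma pois_sums: "(\<lambda>i. pois m i) sums 1"
proof -
  have "(\<lambda>i. m ^ i /\<^sub>R fact i) sums exp m" by (rule exp_converges)
  then have "(\<lambda>i. exp (- m) * (m ^ i /\<^sub>R fact i)) sums (exp (- m) * exp m)" by (rule sums_mult)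
  moreover have "exp (- m) * (m ^ i /\<^sub>R fact i) = pois m i" for i by (simp add: pois_def divide_inverse)
  moreover have "exp (- m) * exp m = 1" by (simp flip: exp_add)
  ultimately show ?thesis by simp
qed

lemma pois_le: assumes "0 \<le> m" shows "pois m (j + i) \<le> m ^ j / fact j * pois m i"
proof -
  have "fact j * fact i \<le> (fact (j + i) :: nat)"
    using fact_fact_dvd_fact[of j i, where 'a=nat] by (intro dvd_imp_le) auto
  then have "real (fact j * fact i) \<le> real (fact (j + i))" by (rule of_nat_mono)
  then have f: "(fact j * fact i :: real) \<le> fact (j + i)" by simp
  have "pois m (j + i) = exp (- m) * (m ^ j * m ^ i) / fact (j + i)" by (simp add: pois_def power_add)
  also have "\<dots> \<le> exp (- m) * (m ^ j * m ^ i) / (fact j * fact i)"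
    using f assms by (intro divide_left_mono) auto
  also have "\<dots> = m ^ j / fact j * pois m i" by (simp add: pois_def)
  finally show ?thesis .
qed

lemma many_points:
  assumes A: "A \<in> sets borel" "emeasure N A \<le> ennreal m" and m: "0 \<le> m" and j: "1 \<le> j"
  shows "outer_prob_le (\<lambda>w. \<exists>P. finite P \<and> P \<subseteq> chi w \<inter> A \<and> j \<le> card P) ((exp 1 * m / real j) ^ j)"
proof -
  have fin: "emeasure N A < \<infinity>" using A(2) by (simp add: le_less_trans)
  define m' where "m' = measure N A"
  have m': "0 \<le> m'" "m' \<le> m"
    using A(2) m fin unfolding m'_def measure_def by (auto intro: enn2real_leI)
  have "outer_prob_le (\<lambda>w. \<exists>i. card (chi w \<inter> A) = j + i) (m' ^ j / fact j * 1)"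
  proof (rule outer_prob_le_UN_nat)
    show "(\<lambda>i. m' ^ j / fact j * pois m' i) sums (m' ^ j / fact j * 1)" by (rule sums_mult[OF pois_sums])
    fix i
    show "outer_prob_le (\<lambda>w. card (chi w \<inter> A) = j + i) (m' ^ j / fact j * pois m' i)"
    proof (rule outer_prob_leI[of "{w\<in>space M. card (chi w \<inter> A) = j + i}"])
      from measurable_sets[OF count_measurable[OF A(1) fin], of "{j + i}"]
      show "{w\<in>space M. card (chi w \<inter> A) = j + i} \<in> events" by (auto simp: vimage_def Int_def conj_commute)
      show "prob {w\<in>space M. card (chi w \<inter> A) = j + i} \<le> m' ^ j / fact j * pois m' i"
        using count_prob[OF A(1) fin, of "j + i"] pois_le[OF m'(1), of j i] by (simp add: m'_def)
    qed auto
  qed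
  then show ?thesis
  proof (rule outer_prob_le_AE_mono)
    show "AE w in M. (\<exists>P. finite P \<and> P \<subseteq> chi w \<inter> A \<and> j \<le> card P) \<longrightarrow> (\<exists>i. card (chi w \<inter> A) = j + i)"
      using count_AE_finite[OF A(1) fin]
    proof eventually_elim
      case (elim w)
      show ?case
      proof
        assume "\<exists>P. finite P \<and> P \<subseteq> chi w \<inter> A \<and> j \<le> card P"
        then obtain P where "P \<subseteq> chi w \<inter> A" "j \<le> card P" by blast
        then have "j \<le> card (chi w \<inter> A)" using card_mono[OF elim] by (meson le_trans)
        then show "\<exists>i. card (chi w \<inter> A) = j + i" by (simp add: le_iff_add)
      qed
    qed
    have "real j ^ j \<le> fact j * exp (real j)" by (rule power_le_fact_exp) simp
    then have "m' ^ j * real j ^ j \<le> m ^ j * (fact j * exp (real j))"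
      using m' by (intro mult_mono power_mono) auto
    then have "m' ^ j / fact j \<le> m ^ j * exp (real j) / real j ^ j"
      using j by (simp add: field_simps)
    also have "\<dots> = (exp 1 * m / real j) ^ j"
      by (simp add: power_divide power_mult_distrib exp_of_nat_mult[symmetric])
    finally show "m' ^ j / fact j * 1 \<le> (exp 1 * m / real j) ^ j" by simp
  qed
qed

text \<open>Union bound over the lattice paths \<open>f\<close>, with a Poisson tail bound for the points close to each of them.\<close>

lemma skeleton_points:
  fixes Z0 :: "'a set" and V :: "(real \<times> real) set"
  assumes h: "0 < h" and Z0: "finite Z0" "Z0 \<subseteq> lat" and V: "V \<in> sets borel" "emeasure (time_measure \<Otimes>\<^sub>M mu) V \<le> ennreal v" "0 \<le> v"
    and j: "1 \<le> j"
  shows "outer_prob_le (\<lambda>w. \<exists>f P. f 0 \<in> Z0 \<and> (\<forall>i<k. f (Suc i) - f i \<in> unit_steps) \<and> finite P \<and> P \<subseteq> chi w \<and> j \<le> card P \<and>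
       (\<forall>p\<in>P. snd p \<in> V \<and> (\<exists>i\<le>k. fl (ctr p /\<^sub>R h) - f i \<in> unit_steps)))
     (real (card Z0) * (3 ^ DIM('a)) ^ k * (exp 1 * (real (k + 1) * 3 ^ DIM('a) * h ^ DIM('a) * v) / real j) ^ j)"
proof -
  define I where "I = Z0 \<times> {ds. set ds \<subseteq> (unit_steps::'a set) \<and> length ds = k}"
  have fI: "finite I" unfolding I_def using Z0 finite_unit_steps by (auto intro: finite_lists_length_eq)
  have cI: "real (card I) \<le> real (card Z0) * (3 ^ DIM('a)) ^ k"
  proof -
    have "card I = card Z0 * card (unit_steps::'a set) ^ k"
      unfolding I_def using card_lists_length_eq[OF finite_unit_steps[where 'a='a], of k] by (simp add: card_cartesian_product)
    then have "real (card I) = real (card Z0) * real (card (unit_steps::'a set)) ^ k" by simp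
    also have "\<dots> \<le> real (card Z0) * (3 ^ DIM('a)) ^ k" using card_unit_steps[where 'a='a] by (intro mult_left_mono power_mono) auto
    finally show ?thesis .
  qed
  define vis where "vis zd = (\<lambda>(i, e). fst zd + sum_list (take i (snd zd)) + e) ` ({..k} \<times> (unit_steps::'a set))" for zd :: "'a \<times> 'a list"
  define U where "U zd = (\<Union>z\<in>vis zd. cell h z)" for zd
  let ?m = "real (k + 1) * 3 ^ DIM('a) * h ^ DIM('a) * v"
  have sumlat: "set ds \<subseteq> lat \<Longrightarrow> sum_list ds \<in> lat" for ds :: "'a list"
    by (induction ds) (auto intro: lat_add lat_0)
  have vlat: "vis zd \<subseteq> lat" if "zd \<in> I" for zd
  proof
    fix z assume "z \<in> vis zd"
    then obtain i e where ie: "e \<in> unit_steps" "z = fst zd + sum_list (take i (snd zd)) + e" by (auto simp: vis_def)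
    have "set (snd zd) \<subseteq> unit_steps" using that by (auto simp: I_def)
    then have "set (take i (snd zd)) \<subseteq> unit_steps" using set_take_subset[of i "snd zd"] by (rule subset_trans[rotated])
    then have "set (take i (snd zd)) \<subseteq> lat" using unit_steps_lat by blast
    moreover have "fst zd \<in> lat" using that Z0 by (auto simp: I_def)
    ultimately show "z \<in> lat" unfolding ie using lat_add[OF lat_add[OF _ sumlat] unit_steps_lat[OF ie(1)]] by blast
  qed
  have vfin: "finite (vis zd)" for zd unfolding vis_def using finite_unit_steps by auto
  have vcard: "real (card (vis zd)) \<le> real (k + 1) * 3 ^ DIM('a)" for zd
  proof -
    have "card (vis zd) \<le> card ({..k} \<times> (unit_steps::'a set))" unfolding vis_def using finite_unit_steps by (intro card_image_le) auto
    also have "\<dots> = (k + 1) * card (unit_steps::'a set)" by (simp add: card_cartesian_product)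
    finally have "real (card (vis zd)) \<le> real ((k + 1) * card (unit_steps::'a set))" by (rule of_nat_mono)
    also have "\<dots> = real (k + 1) * real (card (unit_steps::'a set))" by (rule of_nat_mult)
    also have "\<dots> \<le> real (k + 1) * 3 ^ DIM('a)" using card_unit_steps[where 'a='a] by (intro mult_left_mono) auto
    finally show ?thesis .
  qed
  have Um: "U zd \<in> sets borel" if "zd \<in> I" for zd
    unfolding U_def using vfin vlat[OF that] cell_borel[OF h] by (intro sets.finite_UN) auto
  have UV: "U zd \<times> V \<in> sets borel" if "zd \<in> I" for zd
    using Um[OF that] V(1) by (metis borel_prod pair_measureI)
  have Ue: "emeasure N (U zd \<times> V) \<le> ennreal ?m" if "zd \<in> I" for zd
  proof -
    have "emeasure lborel (U zd) \<le> (\<Sum>z\<in>vis zd. emeasure lborel (cell h z))"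
      unfolding U_def using vfin vlat[OF that] cell_borel[OF h] by (intro emeasure_subadditive_finite) auto
    also have "\<dots> = (\<Sum>z\<in>vis zd. ennreal (h ^ DIM('a)))" using vlat[OF that] cell_measure[OF h] by (intro sum.cong) auto
    also have "\<dots> = ennreal (real (card (vis zd)) * h ^ DIM('a))" using h by (simp add: ennreal_mult ennreal_of_nat_eq_real_of_nat)
    also have "\<dots> \<le> ennreal (real (k + 1) * 3 ^ DIM('a) * h ^ DIM('a))" using vcard[of zd] h by (intro ennreal_leI mult_right_mono) auto
    finally have "emeasure lborel (U zd) * emeasure (time_measure \<Otimes>\<^sub>M mu) V \<le> ennreal (real (k + 1) * 3 ^ DIM('a) * h ^ DIM('a)) * ennreal v"
      using V(2) by (intro mult_mono) auto
    also have "\<dots> = ennreal ?m" using h V(3) by (intro ennreal_mult[symmetric]) auto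
    finally show ?thesis using Um[OF that] V(1) by (simp only: R.emeasure_intensity_Times)
  qed
  have "outer_prob_le (\<lambda>w. \<exists>zd\<in>I. \<exists>P. finite P \<and> P \<subseteq> chi w \<inter> U zd \<times> V \<and> j \<le> card P)
     (real (card Z0) * (3 ^ DIM('a)) ^ k * (exp 1 * ?m / real j) ^ j)"
  proof (rule outer_prob_le_UN_const[OF fI])
    fix zd assume "zd \<in> I"
    then show "outer_prob_le (\<lambda>w. \<exists>P. finite P \<and> P \<subseteq> chi w \<inter> U zd \<times> V \<and> j \<le> card P) ((exp 1 * ?m / real j) ^ j)"
      using UV Ue h V(3) j by (intro many_points) auto
  next
    show "real (card I) * (exp 1 * ?m / real j) ^ j \<le> real (card Z0) * (3 ^ DIM('a)) ^ k * (exp 1 * ?m / real j) ^ j"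
      using cI h V(3) by (intro mult_right_mono) auto
  qed
  then show ?thesis
  proof (rule outer_prob_le_mono)
    fix w assume "\<exists>f P. f 0 \<in> Z0 \<and> (\<forall>i<k. f (Suc i) - f i \<in> unit_steps) \<and> finite P \<and> P \<subseteq> chi w \<and> j \<le> card P \<and>
       (\<forall>p\<in>P. snd p \<in> V \<and> (\<exists>i\<le>k. fl (ctr p /\<^sub>R h) - f i \<in> unit_steps))"
    then obtain f P where f: "f 0 \<in> Z0" "\<And>i. i < k \<Longrightarrow> f (Suc i) - f i \<in> unit_steps" and P: "finite P" "P \<subseteq> chi w" "j \<le> card P"
      "\<And>p. p \<in> P \<Longrightarrow> snd p \<in> V" "\<And>p. p \<in> P \<Longrightarrow> \<exists>i\<le>k. fl (ctr p /\<^sub>R h) - f i \<in> unit_steps" by blast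
    define ds where "ds = map (\<lambda>i. f (Suc i) - f i) [0..<k]"
    have "(f 0, ds) \<in> I" unfolding I_def ds_def using f by auto
    moreover have "P \<subseteq> U (f 0, ds) \<times> V"
    proof
      fix p assume p: "p \<in> P"
      then obtain i where i: "i \<le> k" "fl (ctr p /\<^sub>R h) - f i \<in> unit_steps" using P(5) by blast
      have tel: "f i = f 0 + sum_list (take i ds)"
      proof -
        have "take i ds = map (\<lambda>i. f (Suc i) - f i) [0..<i]" unfolding ds_def using i(1) by (simp add: take_map)
        then have "sum_list (take i ds) = (\<Sum>j<i. f (Suc j) - f j)" by (simp add: sum_list_sum_nth atLeast0LessThan)
        also have "\<dots> = f i - f 0" by (rule sum_lessThan_telescope)
        finally show ?thesis by simp
      qed
      have "f 0 + sum_list (take i ds) + (fl (ctr p /\<^sub>R h) - f i) \<in> vis (f 0, ds)"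
        unfolding vis_def using i by (auto intro!: rev_image_eqI[of "(i, fl (ctr p /\<^sub>R h) - f i)"])
      then have "fl (ctr p /\<^sub>R h) \<in> vis (f 0, ds)" using tel by simp
      then have "ctr p \<in> U (f 0, ds)" unfolding U_def using cell_self by blast
      then show "p \<in> U (f 0, ds) \<times> V" using P(4)[OF p] by (simp add: mem_Times_iff)
    qed
    ultimately show "\<exists>zd\<in>I. \<exists>P. finite P \<and> P \<subseteq> chi w \<inter> U zd \<times> V \<and> j \<le> card P"
      using P(1-3) by (intro bexI[of _ "(f 0, ds)"] exI[of _ P]) auto
  qed simp
qed

lemma half_small_times:
  fixes qs :: "('a \<times> real \<times> real) list"
  assumes "distinct qs" "length qs = k" "1 \<le> k" "sum_list (map tm qs) \<le> s" "\<And>p. p \<in> set qs \<Longrightarrow> 0 \<le> tm p" "0 < s"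
  shows "real k / 2 \<le> real (card {p\<in>set qs. tm p \<le> 2 * s / real k})"
proof -
  let ?B = "{p\<in>set qs. \<not> tm p \<le> 2 * s / real k}" and ?A = "{p\<in>set qs. tm p \<le> 2 * s / real k}"
  have k0: "0 < real k" using assms(3) by simp
  have "real (card ?B) * (2 * s / real k) = (\<Sum>p\<in>?B. 2 * s / real k)" by simp
  also have "\<dots> \<le> (\<Sum>p\<in>?B. tm p)" by (intro sum_mono) auto
  also have "\<dots> \<le> (\<Sum>p\<in>set qs. tm p)" using assms(5) by (intro sum_mono2) auto
  also have "\<dots> = sum_list (map tm qs)" using assms(1) by (simp add: sum_list_distinct_conv_sum_set)
  finally have "real (card ?B) * (2 * s / real k) \<le> s" using assms(4) by linarith
  then have "real (card ?B) * 2 \<le> real k" using k0 assms(6) by (simp add: field_simps)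
  moreover have "card ?A + card ?B = k"
  proof -
    have "card ?A + card ?B = card (?A \<union> ?B)" by (intro card_Un_disjoint[symmetric]) auto
    also have "?A \<union> ?B = set qs" by auto
    finally show ?thesis using assms(1,2) by (simp add: distinct_card)
  qed
  ultimately show ?thesis by linarith
qed

lemma small_balls_ob:
  assumes rho: "0 < rho" and s: "0 < s" and k: "1 \<le> k" and Rr: "0 \<le> Rr"
    and small: "4 * exp 3 * 27 ^ DIM('a) * rho ^ DIM('a) * s / real k \<le> 1"
  shows "outer_prob_le (\<lambda>w. \<exists>qs. distinct qs \<and> set qs \<subseteq> chi w \<and> links qs \<and> (\<forall>p\<in>set qs. rd p < rho) \<and>
      norm (ctr (hd qs)) \<le> Rr \<and> sum_list (map tm qs) \<le> s \<and> length qs = k)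
    ((2 * (Rr / rho + DIM('a)) + 1) ^ DIM('a) * exp (- real k))"
proof -
  let ?d = "DIM('a)"
  define Z0 where "Z0 = {z\<in>(lat::'a set). norm z \<le> Rr / rho + ?d}"
  have nn: "0 \<le> Rr / rho + ?d" using Rr rho by simp
  have Z0: "finite Z0" "Z0 \<subseteq> lat" "real (card Z0) \<le> (2 * (Rr / rho + ?d) + 1) ^ ?d"
    using lat_ball_card[where 'a='a, OF nn] by (auto simp: Z0_def)
  define j where "j = nat \<lceil>real k / 2\<rceil>"
  have j: "1 \<le> j" "real k \<le> 2 * real j" using k unfolding j_def by linarith+
  define V where "V = {..2 * s / real k} \<times> (UNIV::real set)"
  have Vb: "V \<in> sets borel" unfolding V_def by (intro borel_closed closed_Times) auto
  have "{..2 * s / real k} \<inter> {0..} = {0..2 * s / real k}" by auto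
  then have Ve: "emeasure (time_measure \<Otimes>\<^sub>M mu) V \<le> ennreal (2 * s / real k)"
    unfolding V_def using R.emeasure_space_1 s k by (subst R.emeasure_time_mu_Times) (auto simp: R.space_mu)
  have v0: "0 \<le> 2 * s / real k" using s by simp
  note sk = skeleton_points[OF rho Z0(1,2) Vb Ve v0 j(1), of "k - 1"]
  let ?q = "exp 1 * (real (k - 1 + 1) * 3 ^ ?d * rho ^ ?d * (2 * s / real k)) / real j"
  have "?q \<le> exp (- 2) * (1 / 9) ^ ?d"
  proof -
    have kk: "real (k - 1 + 1) = real k" using k by simp
    have "?q = exp 1 * 3 ^ ?d * rho ^ ?d * (2 * s) / real j" unfolding kk using k by simp
    also have "\<dots> \<le> exp 1 * 3 ^ ?d * rho ^ ?d * (2 * s) / (real k / 2)"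
      using j k s rho by (intro divide_left_mono) auto
    also have "\<dots> = 4 * exp 1 * 3 ^ ?d * rho ^ ?d * s / real k" by simp
    also have "\<dots> = (4 * exp 3 * 27 ^ ?d * rho ^ ?d * s / real k) * (exp (- 2) * (1 / 9) ^ ?d)"
    proof -
      have "(27::real) ^ ?d * (1 / 9) ^ ?d = 3 ^ ?d" by (simp flip: power_mult_distrib)
      moreover have "exp 3 * exp (- 2) = exp (1::real)" by (simp flip: exp_add)
      ultimately have "(4 * exp 3 * 27 ^ ?d * rho ^ ?d * s / real k) * (exp (- 2) * (1 / 9) ^ ?d) = 4 * exp 1 * 3 ^ ?d * rho ^ ?d * s / real k"
        by (simp add: mult_ac)
      then show ?thesis by (rule sym)
    qed
    also have "\<dots> \<le> 1 * (exp (- 2) * (1 / 9) ^ ?d)" by (rule mult_right_mono[OF small]) auto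
    finally show ?thesis by simp
  qed
  then have "?q ^ j \<le> (exp (- 2) * (1 / 9) ^ ?d) ^ j" using s rho by (intro power_mono) auto
  also have "\<dots> = exp (- 1) ^ (2 * j) * ((1 / 3) ^ ?d) ^ (2 * j)"
  proof -
    have "exp (- 2) = exp (- 1 :: real) ^ 2" by (simp flip: exp_of_nat_mult)
    moreover have "(1 / 9 :: real) ^ ?d = ((1 / 3) ^ ?d) ^ 2" by (simp add: power2_eq_square flip: power_mult_distrib)
    ultimately show ?thesis by (simp only: power_mult_distrib power_mult[symmetric] mult.assoc)
  qed
  also have "\<dots> \<le> exp (- 1) ^ k * ((1 / 3) ^ ?d) ^ k"
    using j(2) by (intro mult_mono power_decreasing) (auto simp: power_le_one)
  also have "exp (- 1 :: real) ^ k = exp (- real k)" by (simp flip: exp_of_nat_mult)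
  finally have qj: "?q ^ j \<le> exp (- real k) * ((1 / 3) ^ ?d) ^ k" .
  have "(3 ^ ?d) ^ (k - 1) * ?q ^ j \<le> (3 ^ ?d) ^ k * (exp (- real k) * ((1 / 3) ^ ?d) ^ k)"
    using qj by (intro mult_mono power_increasing) (auto simp: s rho less_imp_le)
  also have "\<dots> = exp (- real k) * ((3 ^ ?d) * (1 / 3) ^ ?d) ^ k" by (simp only: power_mult_distrib mult_ac)
  also have "\<dots> = exp (- real k)" by (simp flip: power_mult_distrib)
  finally have "(3 ^ ?d) ^ (k - 1) * ?q ^ j \<le> exp (- real k)" .
  then have fin: "real (card Z0) * (3 ^ ?d) ^ (k - 1) * ?q ^ j \<le> (2 * (Rr / rho + ?d) + 1) ^ ?d * exp (- real k)"
    unfolding mult.assoc using Z0(3) nn by (intro mult_mono) (auto simp: s rho less_imp_le)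
  show ?thesis
  proof (rule outer_prob_le_mono[OF sk _ fin])
    fix w assume "\<exists>qs. distinct qs \<and> set qs \<subseteq> chi w \<and> links qs \<and> (\<forall>p\<in>set qs. rd p < rho) \<and>
      norm (ctr (hd qs)) \<le> Rr \<and> sum_list (map tm qs) \<le> s \<and> length qs = k"
    then obtain qs where qs: "distinct qs" "set qs \<subseteq> chi w" "links qs" "\<And>p. p\<in>set qs \<Longrightarrow> rd p < rho"
      "norm (ctr (hd qs)) \<le> Rr" "sum_list (map tm qs) \<le> s" "length qs = k" by blast
    define f where "f i = fl (ctr (qs ! i) /\<^sub>R rho)" for i
    have sc: "norm (x /\<^sub>R rho - y /\<^sub>R rho) = norm (x - y) / rho" for x y :: 'a
    proof -
      have "x /\<^sub>R rho - y /\<^sub>R rho = (x - y) /\<^sub>R rho" by (simp add: scaleR_right_diff_distrib)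
      then show ?thesis using rho by (simp add: divide_inverse mult.commute)
    qed
    have f0: "f 0 \<in> Z0"
    proof -
      have "hd qs = qs ! 0" using qs(7) k by (intro hd_conv_nth) auto
      then have "norm (ctr (qs ! 0) /\<^sub>R rho) \<le> Rr / rho" using qs(5) rho sc[of "ctr (qs ! 0)" 0] by (simp add: divide_right_mono)
      then have "norm (f 0) \<le> Rr / rho + ?d" using fl_diff_norm(1)[of "ctr (qs ! 0) /\<^sub>R rho" 0] by (simp add: f_def fl_id[OF lat_0])
      then show ?thesis by (simp add: Z0_def f_def fl_lat)
    qed
    have st: "f (Suc i) - f i \<in> unit_steps" if "i < k - 1" for i
    proof -
      have "norm (ctr (qs ! Suc i) - ctr (qs ! i)) < rd (qs ! i)"
        using qs(3,7) that unfolding links_def successively_conv_nth by auto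
      also have "\<dots> < rho" using qs(4)[of "qs ! i"] qs(7) that by simp
      finally show ?thesis unfolding f_def using rho by (intro fl_step_unit_steps) (simp add: sc)
    qed
    let ?P = "{p\<in>set qs. tm p \<le> 2 * s / real k}"
    have "real k / 2 \<le> real (card ?P)" by (rule half_small_times) (use qs k s nice_tm in auto)
    then have "j \<le> card ?P" unfolding j_def by linarith
    moreover have "\<forall>p\<in>?P. snd p \<in> V \<and> (\<exists>i\<le>k - 1. fl (ctr p /\<^sub>R rho) - f i \<in> unit_steps)"
    proof
      fix p assume p: "p \<in> ?P"
      then obtain i where i: "i < k" "p = qs ! i" using qs(7) by (auto simp: in_set_conv_nth)
      have "fl (ctr p /\<^sub>R rho) - f i = fl 0 - fl 0" by (simp add: f_def i)
      then have "fl (ctr p /\<^sub>R rho) - f i \<in> unit_steps" using fl_step_unit_steps[of 0 0] by simp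
      moreover have "i \<le> k - 1" using i by simp
      moreover have "snd p \<in> V" using p by (auto simp: V_def mem_Times_iff)
      ultimately show "snd p \<in> V \<and> (\<exists>i\<le>k - 1. fl (ctr p /\<^sub>R rho) - f i \<in> unit_steps)" by blast
    qed
    ultimately show "\<exists>f P. f 0 \<in> Z0 \<and> (\<forall>i<k - 1. f (Suc i) - f i \<in> unit_steps) \<and> finite P \<and> P \<subseteq> chi w \<and> j \<le> card P \<and>
       (\<forall>p\<in>P. snd p \<in> V \<and> (\<exists>i\<le>k - 1. fl (ctr p /\<^sub>R rho) - f i \<in> unit_steps))"
      using f0 st qs(2) by (intro exI[of _ f] exI[of _ ?P]) auto
  qed
qed

lemma small_balls_slow:
  assumes S: "0 < S" and del: "0 < del"
  shows "\<exists>rho>0. rho \<le> 1 \<and> (AE w in M. \<exists>n0. \<forall>n\<ge>n0. \<not> (\<exists>qs. distinct qs \<and> set qs \<subseteq> chi w \<and> links qs \<and> (\<forall>p\<in>set qs. rd p < rho) \<and>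
      norm (ctr (hd qs)) \<le> 3 * real n \<and> sum_list (map tm qs) \<le> S * real n \<and> length qs = nat \<lceil>del * real n / rho\<rceil>))"
proof -
  let ?d = "DIM('a)"
  define rho where "rho = min 1 (del / (4 * exp 3 * 27 ^ ?d * S))"
  have rho: "0 < rho" "rho \<le> 1" "rho \<le> del / (4 * exp 3 * 27 ^ ?d * S)" using S del by (auto simp: rho_def)
  define k where "k n = nat \<lceil>del * real n / rho\<rceil>" for n :: nat
  have kge: "del / rho * real n \<le> real (k n)" for n unfolding k_def by simp linarith
  have k1: "1 \<le> k n" if "1 \<le> n" for n
  proof -
    have "0 < del / rho * real n" using that del rho by simp
    then show ?thesis using kge[of n] by linarith
  qed
  have "AE w in M. \<exists>n0. \<forall>n\<ge>n0. \<not> (\<exists>qs. distinct qs \<and> set qs \<subseteq> chi w \<and> links qs \<and> (\<forall>p\<in>set qs. rd p < rho) \<and>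
      norm (ctr (hd qs)) \<le> 3 * real n \<and> sum_list (map tm qs) \<le> S * real n \<and> length qs = k n)"
  proof (rule outer_prob_le_borel_cantelli)
    show "summable (\<lambda>n. ((6 / rho) * real n + (2 * ?d + 1)) ^ ?d * exp (- (del / rho) * real n))"
      using rho del by (intro summable_poly_exp) auto
    fix n :: nat assume n: "1 \<le> n"
    have "4 * exp 3 * 27 ^ ?d * rho ^ ?d * (S * real n) / real (k n) \<le> 1"
    proof -
      have "rho ^ ?d \<le> rho ^ 0" using rho by (intro power_decreasing) auto
      then have "4 * exp 3 * 27 ^ ?d * rho ^ ?d * (S * real n) \<le> 4 * exp 3 * 27 ^ ?d * 1 * (S * real n)"
        using S by (intro mult_right_mono mult_left_mono) auto
      also have "\<dots> \<le> del / rho * real n"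
      proof -
        have "rho * (4 * exp 3 * 27 ^ ?d * S) \<le> del" using rho(3) S by (simp add: pos_le_divide_eq)
        then have "4 * exp 3 * 27 ^ ?d * S \<le> del / rho" using rho(1) by (simp add: pos_le_divide_eq mult.commute)
        from mult_right_mono[OF this, of "real n"] show ?thesis by (simp add: mult_ac)
      qed
      also have "\<dots> \<le> real (k n)" by (rule kge)
      finally show ?thesis using k1[OF n] by (simp add: pos_divide_le_eq)
    qed
    from small_balls_ob[OF rho(1) _ k1[OF n] _ this, of "3 * real n"]
    show "outer_prob_le (\<lambda>w. \<exists>qs. distinct qs \<and> set qs \<subseteq> chi w \<and> links qs \<and> (\<forall>p\<in>set qs. rd p < rho) \<and>
      norm (ctr (hd qs)) \<le> 3 * real n \<and> sum_list (map tm qs) \<le> S * real n \<and> length qs = k n)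
      (((6 / rho) * real n + (2 * ?d + 1)) ^ ?d * exp (- (del / rho) * real n))"
    proof (rule outer_prob_le_mono)
      have e: "2 * (3 * real n / rho + ?d) + 1 = (6 / rho) * real n + (2 * ?d + 1)" by simp
      show "(2 * (3 * real n / rho + ?d) + 1) ^ ?d * exp (- real (k n)) \<le> ((6 / rho) * real n + (2 * ?d + 1)) ^ ?d * exp (- (del / rho) * real n)"
        unfolding e using kge[of n] rho by (intro mult_left_mono) auto
    qed (use S n in auto)
  qed
  then show ?thesis using rho unfolding k_def by blast
qed

end

section \<open>Speed in all directions\<close>

lemma unit_net:
  assumes "0 < del"
  obtains D :: "'a::euclidean_space set" where "finite D" "\<And>u. u \<in> D \<Longrightarrow> norm u = 1"
    "\<And>y. y \<noteq> 0 \<Longrightarrow> \<exists>u\<in>D. norm (y - norm y *\<^sub>R u) \<le> del * norm y"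
proof -
  obtain D where D: "D \<subseteq> sphere (0::'a) 1" "finite D" "sphere (0::'a) 1 \<subseteq> (\<Union>u\<in>D. ball u del)"
  proof (rule compactE_image[of "sphere (0::'a) 1" "sphere (0::'a) 1" "\<lambda>u. ball u del"])
    show "sphere (0::'a) 1 \<subseteq> (\<Union>c\<in>sphere 0 1. ball c del)" using assms by force
  qed auto
  have "\<exists>u\<in>D. norm (y - norm y *\<^sub>R u) \<le> del * norm y" if y: "y \<noteq> 0" for y :: 'a
  proof -
    have "y /\<^sub>R norm y \<in> sphere 0 1" using y by simp
    then obtain u where u: "u \<in> D" "y /\<^sub>R norm y \<in> ball u del" using D(3) by blast
    have u2: "norm (u - y /\<^sub>R norm y) < del" using u(2) by (simp add: dist_norm)
    have "y - norm y *\<^sub>R u = norm y *\<^sub>R (y /\<^sub>R norm y - u)" using y by (simp add: scaleR_right_diff_distrib)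
    then have "norm (y - norm y *\<^sub>R u) = norm y * norm (y /\<^sub>R norm y - u)" by simp
    also have "\<dots> \<le> norm y * del" using u2 by (intro mult_left_mono) (auto simp: norm_minus_commute)
    finally show ?thesis using u(1) by (auto simp: mult.commute)
  qed
  moreover have "norm u = 1" if "u \<in> D" for u using that D(1) by auto
  ultimately show ?thesis using that D(2) by blast
qed

lemma split_last_big:
  "\<exists>as qs. ps = as @ qs \<and> (\<forall>q\<in>set qs. \<not> P q) \<and> (as = [] \<or> P (last as))"
proof (induction ps rule: rev_induct)
  case (snoc p ps)
  then obtain as qs where IH: "ps = as @ qs" "\<forall>q\<in>set qs. \<not> P q" "as = [] \<or> P (last as)" by blast
  show ?case
  proof (cases "P p")
    case True
    then show ?thesis by (intro exI[of _ "ps @ [p]"] exI[of _ "[]"]) auto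
  next
    case False
    then show ?thesis using IH by (intro exI[of _ as] exI[of _ "qs @ [p]"]) auto
  qed
qed auto

lemma links_dist:
  fixes qs :: "('a::euclidean_space \<times> real \<times> real) list"
  assumes "qs \<noteq> []" "links qs" "norm (y - ctr (last qs)) < rd (last qs)" "\<And>p. p \<in> set qs \<Longrightarrow> rd p \<le> rho"
  shows "norm (y - ctr (hd qs)) \<le> real (length qs) * rho"
  using assms
proof (induction qs)
  case (Cons p qs)
  show ?case
  proof (cases "qs = []")
    case True
    then show ?thesis using Cons.prems(3) Cons.prems(4)[of p] by auto
  next
    case False
    have "norm (y - ctr p) \<le> norm (y - ctr (hd qs)) + norm (ctr (hd qs) - ctr p)"
      using norm_triangle_ineq[of "y - ctr (hd qs)" "ctr (hd qs) - ctr p"] by simp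
    moreover have "norm (y - ctr (hd qs)) \<le> real (length qs) * rho"
      using Cons.prems False by (intro Cons.IH) (auto simp: links_Cons)
    moreover have "norm (ctr (hd qs) - ctr p) \<le> rho"
      using Cons.prems(2) Cons.prems(4)[of p] False by (auto simp: links_Cons)
    ultimately show ?thesis by (simp add: algebra_simps)
  qed
qed simp

lemma ball_in_big_ball:
  fixes x' c :: "'a::euclidean_space"
  assumes "norm (x' - c) < r" "rho \<le> r" "0 < rho"
  shows "\<exists>x. norm (x - x') \<le> rho / 2 \<and> ball x (rho / 2) \<subseteq> ball c r"
proof -
  define x where "x = x' + (rho / (2 * r)) *\<^sub>R (c - x')"
  have r: "0 < r" using assms by linarith
  have 1: "norm (x - x') \<le> rho / 2"
  proof -
    have "norm (x - x') = rho / (2 * r) * norm (x' - c)" using r assms(3) by (simp add: x_def norm_minus_commute)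
    also have "\<dots> \<le> rho / (2 * r) * r" using assms r by (intro mult_left_mono) auto
    also have "\<dots> = rho / 2" using r by simp
    finally show ?thesis .
  qed
  have f: "0 \<le> 1 - rho / (2 * r)" using assms r by (simp add: field_simps)
  have "x - c = (1 - rho / (2 * r)) *\<^sub>R (x' - c)" by (simp add: x_def algebra_simps)
  then have "norm (x - c) = (1 - rho / (2 * r)) * norm (x' - c)" using f by simp
  also have "\<dots> \<le> (1 - rho / (2 * r)) * r" using f assms by (intro mult_left_mono) auto
  also have "\<dots> = r - rho / 2" using r by (simp add: left_diff_distrib)
  finally have 2: "norm (x - c) \<le> r - rho / 2" .
  have "ball x (rho / 2) \<subseteq> ball c r"
  proof
    fix v assume "v \<in> ball x (rho / 2)"
    then have "norm (v - x) < rho / 2" by (simp add: dist_norm norm_minus_commute)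
    then have "norm (v - c) < r" using 2 norm_triangle_ineq[of "v - x" "x - c"] by simp
    then show "v \<in> ball c r" by (simp add: dist_norm norm_minus_commute)
  qed
  with 1 show ?thesis by blast
qed

context deijfen_process begin

lemma chain_tm_nonneg: "set ps \<subseteq> chi w \<Longrightarrow> 0 \<le> sum_list (map tm ps)"
  by (induction ps) (auto simp del: split_paired_All dest: nice_tm)

lemma upper_speed:
  assumes e: "0 < e"
  shows "AE w in M. \<exists>t0. \<forall>t\<ge>t0. \<forall>y. (lam + e) * norm y \<le> t \<longrightarrow> reach (chi w) (ball 0 1) t y"
proof -
  obtain K where K: "K > 0" and cf: "\<And>rho1 del. rho1 > 0 \<Longrightarrow> del > 0 \<Longrightarrow> AE w in M. \<exists>n0. \<forall>n\<ge>n0. \<forall>x y A. norm x \<le> 3 * real n \<longrightarrow> norm (x - y) \<le> del * real n \<longrightarrow>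
     ball x rho1 \<subseteq> A \<longrightarrow> reach (chi w) A (K * del * real n) y"
    using cover_fast by auto
  define del where "del = min (1 / (4 * K)) (e / (8 * K))"
  have del: "0 < del" "K * del \<le> 1 / 4" "4 * (K * del) \<le> e / 2"
  proof -
    show "0 < del" using K e by (simp add: del_def)
    have "K * del \<le> K * (1 / (4 * K))" unfolding del_def using K by (intro mult_left_mono) auto
    then show "K * del \<le> 1 / 4" using K by simp
    have "K * del \<le> K * (e / (8 * K))" unfolding del_def using K by (intro mult_left_mono) auto
    then show "4 * (K * del) \<le> e / 2" using K by simp
  qed
  obtain D :: "'a set" where D: "finite D" "\<And>u. u \<in> D \<Longrightarrow> norm u = 1" "\<And>y. y \<noteq> 0 \<Longrightarrow> \<exists>u\<in>D. norm (y - norm y *\<^sub>R u) \<le> del * norm y"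
    using unit_net[OF del(1)] by metis
  have e2: "0 < e / 2" using e by simp
  have "\<forall>u\<in>D. \<exists>n1\<ge>1. AE w in M. \<exists>k0. \<forall>k\<ge>k0. real (cover_time (chi w) 0 (real (k\<^sup>2 * n1) *\<^sub>R u)) \<le> (lam + e / 2) * real (k\<^sup>2 * n1)"
    using limsup_direction[OF D(2) e2] by blast
  from bchoice[OF this] obtain n1 where n1: "\<And>u. u \<in> D \<Longrightarrow> 1 \<le> n1 u" and
    ls: "\<And>u. u \<in> D \<Longrightarrow> AE w in M. \<exists>k0. \<forall>k\<ge>k0. real (cover_time (chi w) 0 (real (k\<^sup>2 * n1 u) *\<^sub>R u)) \<le> (lam + e / 2) * real (k\<^sup>2 * n1 u)"
    by blast
  have A1: "AE w in M. \<forall>u\<in>D. \<exists>k0. \<forall>k\<ge>k0. real (cover_time (chi w) 0 (real (k\<^sup>2 * n1 u) *\<^sub>R u)) \<le> (lam + e / 2) * real (k\<^sup>2 * n1 u)"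
    using AE_finite_allI[OF D(1) ls] .
  have A2: "AE w in M. \<forall>u\<in>D. \<forall>m::nat. \<exists>s. cov (chi w) 0 (real m *\<^sub>R u) s"
  proof (rule AE_finite_allI[OF D(1)])
    fix u show "AE w in M. \<forall>m::nat. \<exists>s. cov (chi w) 0 (real m *\<^sub>R u) s" unfolding AE_all_countable using cov_AE by blast
  qed
  have del2: "0 < 2 * del" using del by simp
  from A1 A2 cf[OF zero_less_one del(1)] cf[OF zero_less_one del2]
  show ?thesis
  proof eventually_elim
    case (elim w)
    let ?A = "ball (0::'a) 1"
    obtain k0 where k0: "\<And>u k. u \<in> D \<Longrightarrow> k \<ge> k0 u \<Longrightarrow> real (cover_time (chi w) 0 (real (k\<^sup>2 * n1 u) *\<^sub>R u)) \<le> (lam + e / 2) * real (k\<^sup>2 * n1 u)"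
      using bchoice[OF elim(1)] by blast
    obtain na where na: "\<And>n x y A. n \<ge> na \<Longrightarrow> norm x \<le> 3 * real n \<Longrightarrow> norm (x - y) \<le> del * real n \<Longrightarrow> ball x 1 \<subseteq> A \<Longrightarrow> reach (chi w) A (K * del * real n) y"
      using elim(3) by blast
    obtain nb where nb: "\<And>n x y A. n \<ge> nb \<Longrightarrow> norm x \<le> 3 * real n \<Longrightarrow> norm (x - y) \<le> (2 * del) * real n \<Longrightarrow> ball x 1 \<subseteq> A \<Longrightarrow> reach (chi w) A (K * (2 * del) * real n) y"
      using elim(4) by blast
    obtain kd :: nat where kd: "3 / del \<le> real kd" using real_arch_simple by blast
    define kk where "kk u = max 1 (max kd (k0 u))" for u
    define l0 where "l0 = real nb + 1 + (\<Sum>u\<in>D. (real (kk u))\<^sup>2 * real (n1 u))"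
    have sumpos: "0 \<le> (\<Sum>u\<in>D. (real (kk u))\<^sup>2 * real (n1 u))" by (intro sum_nonneg) auto
    have far: "reach (chi w) ?A ((lam + e) * norm y) y" if y: "norm y \<ge> l0" for y
    proof -
      define l where "l = norm y"
      have l1: "1 \<le> l" "real nb \<le> l" using y sumpos by (auto simp: l0_def l_def)
      then have "y \<noteq> 0" by (auto simp: l_def)
      then obtain u where u: "u \<in> D" "norm (y - l *\<^sub>R u) \<le> del * l" using D(3) unfolding l_def by blast
      define m where "m = real (n1 u)"
      have m1: "1 \<le> m" using n1[OF u(1)] by (simp add: m_def)
      have "(real (kk u))\<^sup>2 * m \<le> (\<Sum>u\<in>D. (real (kk u))\<^sup>2 * real (n1 u))"
        unfolding m_def using u(1) D(1) by (intro member_le_sum) auto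
      then have lk: "(real (kk u))\<^sup>2 * m \<le> l" using y unfolding l0_def l_def by linarith
      define k where "k = nat \<lfloor>sqrt (l / m)\<rfloor>"
      have sq: "0 \<le> sqrt (l / m)" using l1 m1 by simp
      have kr: "real k \<le> sqrt (l / m)" "sqrt (l / m) < real k + 1" unfolding k_def using sq by linarith+
      have ksq: "(real k)\<^sup>2 * m \<le> l"
      proof -
        have "(real k)\<^sup>2 \<le> (sqrt (l / m))\<^sup>2" using kr(1) by (intro power_mono) auto
        also have "\<dots> = l / m" using l1 m1 by simp
        finally show ?thesis using m1 by (simp add: pos_le_divide_eq)
      qed
      have ksq2: "l \<le> (real k + 1)\<^sup>2 * m"
      proof -
        have "(sqrt (l / m))\<^sup>2 \<le> (real k + 1)\<^sup>2" using kr(2) sq by (intro power_mono) auto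
        moreover have "(sqrt (l / m))\<^sup>2 = l / m" using l1 m1 by simp
        ultimately show ?thesis using m1 by (simp add: pos_divide_le_eq)
      qed
      have kkk: "kk u \<le> k"
      proof -
        have "(real (kk u))\<^sup>2 \<le> l / m" using lk m1 by (simp add: pos_le_divide_eq)
        then have "real (kk u) \<le> sqrt (l / m)" by (rule real_le_rsqrt)
        then show ?thesis unfolding k_def by (simp add: le_nat_floor)
      qed
      then have kb: "1 \<le> k" "kd \<le> k" "k0 u \<le> k" by (auto simp: kk_def)
      define y1 where "y1 = real (k\<^sup>2 * n1 u) *\<^sub>R u"
      have ny1: "norm y1 = (real k)\<^sup>2 * m" using D(2)[OF u(1)] by (simp add: y1_def m_def)
      have gap: "l - (real k)\<^sup>2 * m \<le> del * l"
      proof -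
        have "l - (real k)\<^sup>2 * m \<le> (2 * real k + 1) * m" using ksq2 by (simp add: power2_eq_square algebra_simps)
        also have "\<dots> \<le> (3 * real k) * m" using kb(1) m1 by (intro mult_right_mono) auto
        also have "3 * real k \<le> del * (real k)\<^sup>2"
        proof -
          have "3 / del \<le> real k" using kd kb(2) by linarith
          then have "3 \<le> del * real k" using del(1) by (simp add: pos_divide_le_eq mult.commute)
          from mult_right_mono[OF this, of "real k"] show ?thesis by (simp add: power2_eq_square mult.assoc)
        qed
        then have "(3 * real k) * m \<le> (del * (real k)\<^sup>2) * m" using m1 by (intro mult_right_mono) auto
        also have "\<dots> \<le> del * l" using ksq del(1) by (simp add: mult.assoc)
        finally show ?thesis .
      qed
      have "norm (y1 - y) \<le> norm (y - l *\<^sub>R u) + norm (l *\<^sub>R u - y1)"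
        using norm_triangle_ineq[of "y - l *\<^sub>R u" "l *\<^sub>R u - y1"] by (simp add: norm_minus_commute)
      also have "norm (l *\<^sub>R u - y1) = l - (real k)\<^sup>2 * m"
      proof -
        have "l *\<^sub>R u - y1 = (l - (real k)\<^sup>2 * m) *\<^sub>R u" by (simp add: y1_def m_def scaleR_left_diff_distrib)
        then show ?thesis using D(2)[OF u(1)] ksq by simp
      qed
      finally have d1: "norm (y1 - y) \<le> 2 * del * l" using u(2) gap by linarith
      define s where "s = real (cover_time (chi w) 0 y1)"
      have s: "s \<le> (lam + e / 2) * l"
      proof -
        have "s \<le> (lam + e / 2) * real (k\<^sup>2 * n1 u)" unfolding s_def y1_def using k0[OF u(1) kb(3)] .
        also have "\<dots> = (lam + e / 2) * ((real k)\<^sup>2 * m)" by (simp add: m_def)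
        also have "\<dots> \<le> (lam + e / 2) * l" using ksq lam_nonneg e by (intro mult_left_mono) auto
        finally show ?thesis .
      qed
      obtain s0 where "cov (chi w) 0 y1 s0" using elim(2) u(1) unfolding y1_def by blast
      then have "cov (chi w) 0 y1 s" unfolding s_def by (rule cover_time_cov)
      then have bs: "ball y1 1 \<subseteq> {v. reach (chi w) ?A s v}" unfolding cov_def using ball_subset_cball by blast
      define n where "n = nat \<lceil>l\<rceil>"
      have n: "l \<le> real n" "real n \<le> l + 1" "nb \<le> n" using l1 unfolding n_def by linarith+
      have "norm y1 \<le> 3 * real n" using ny1 ksq n(1) l1 by linarith
      moreover have "norm (y1 - y) \<le> (2 * del) * real n"
      proof -
        have "2 * del * l \<le> 2 * del * real n" using n(1) del(1) by (intro mult_left_mono) auto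
        then show ?thesis using d1 by linarith
      qed
      ultimately have "reach (chi w) {v. reach (chi w) ?A s v} (K * (2 * del) * real n) y" using bs n(3) by (intro nb)
      then have r: "reach (chi w) ?A (s + K * (2 * del) * real n) y" by (rule reach_trans) simp
      have "K * (2 * del) * real n \<le> K * (2 * del) * (2 * l)" using n(2) l1 K del(1) by (intro mult_left_mono) auto
      also have "\<dots> = 4 * (K * del) * l" by simp
      also have "\<dots> \<le> e / 2 * l" using del(3) l1 by (intro mult_right_mono) auto
      finally have "s + K * (2 * del) * real n \<le> (lam + e) * l" using s by (simp add: algebra_simps)
      then show ?thesis using reach_time_mono[OF r] unfolding l_def by simp
    qed
    define t0 where "t0 = max 1 (max (real na) (l0 / del))"
    show ?case
    proof (intro exI[of _ t0] allI impI)
      fix t and y :: 'a assume t: "t0 \<le> t" and y: "(lam + e) * norm y \<le> t"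
      have t1: "1 \<le> t" "real na \<le> t" "l0 / del \<le> t" using t by (auto simp: t0_def)
      show "reach (chi w) ?A t y"
      proof (cases "norm y \<le> del * t")
        case True
        define n where "n = nat \<lceil>t\<rceil>"
        have n: "t \<le> real n" "real n \<le> t + 1" "na \<le> n" using t1 unfolding n_def by linarith+
        have "del * t \<le> del * real n" using n(1) del(1) by (intro mult_left_mono) auto
        then have "norm (0 - y) \<le> del * real n" using True by simp
        then have r: "reach (chi w) ?A (K * del * real n) y" using n by (intro na[of n 0]) auto
        have "K * del * real n \<le> 1 / 4 * (2 * t)" using del(2) n(2) t1 by (intro mult_mono) auto
        then have "K * del * real n \<le> t" using t1 by simp
        then show ?thesis by (rule reach_time_mono[OF r])
      next
        case False
        have "l0 \<le> del * t" using t1(3) del(1) by (simp add: pos_divide_le_eq mult.commute)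
        then have "l0 \<le> norm y" using False by linarith
        then show ?thesis by (rule reach_time_mono[OF far y])
      qed
    qed
  qed
qed

text \<open>A chain reaching \<open>y\<close> too early has a last ball of radius at least \<open>rho\<close>. As chains of small balls are slow,
  this ball is close to \<open>y\<close>, and the growth started in it covers a unit ball near \<open>y\<close> soon after.\<close>

lemma lower_speed_event:
  assumes e: "0 < e" "e < lam" and K: "0 < K" and del: "0 < del" "del \<le> 1 / 4" "(5 * K + 1) * del \<le> e / 2"
    and rho: "0 < rho" "rho \<le> 1" and n: "nn \<le> n" "1 / del \<le> real n" "8 \<le> real n" "real n0 + 1 \<le> del * real n" "1 \<le> n0"
    and tiny: "\<not> (\<exists>qs. distinct qs \<and> set qs \<subseteq> chi w \<and> links qs \<and> (\<forall>p\<in>set qs. rd p < rho) \<and>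
      norm (ctr (hd qs)) \<le> 3 * real n \<and> sum_list (map tm qs) \<le> lam * real n \<and> length qs = nat \<lceil>del * real n / rho\<rceil>)"
    and cf: "\<And>x y A. norm x \<le> 3 * real n \<Longrightarrow> norm (x - y) \<le> (5 * del) * real n \<Longrightarrow> ball x (rho / 2) \<subseteq> A \<Longrightarrow> reach (chi w) A (K * (5 * del) * real n) y"
    and y: "n = nat \<lceil>norm y\<rceil>" and u: "norm u = 1" "norm (y - norm y *\<^sub>R u) \<le> del * norm y"
    and re: "reach (chi w) (ball 0 1) ((lam - e) * norm y) y"
  shows "\<exists>m\<ge>1. real (cover_time (chi w) 0 (real (m * n0) *\<^sub>R u)) \<le> (lam - e / 2) * real (m * n0)"
proof -
  define s where "s = (lam - e) * norm y"
  have ny: "norm y \<le> real n" "real n \<le> norm y + 1" using y n(3) by linarith+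
  have s: "0 \<le> s" "s \<le> (lam - e) * real n" using e ny by (auto simp: s_def intro!: mult_left_mono)
  have "y \<notin> ball 0 1" using ny n(3) by simp
  then obtain ps where ps: "ps \<noteq> []" "set ps \<subseteq> chi w" "ctr (hd ps) \<in> ball 0 1" "links ps" "distinct (map ctr ps)"
    "norm (y - ctr (last ps)) < rd (last ps)" "sum_list (map tm ps) < s"
    using reach_chain_distinct[OF re] nice_tm unfolding s_def by blast
  obtain as qs where aq: "ps = as @ qs" "\<forall>q\<in>set qs. \<not> rho \<le> rd q" "as = [] \<or> rho \<le> rd (last as)"
    using split_last_big[of ps "\<lambda>p. rho \<le> rd p"] by blast
  have tmn: "0 \<le> sum_list (map tm as)" "0 \<le> sum_list (map tm qs)"
    using ps(2) chain_tm_nonneg[of as w] chain_tm_nonneg[of qs w] by (auto simp: aq(1))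
  have sums: "sum_list (map tm as) < s" "sum_list (map tm qs) < s" using ps(7) tmn by (auto simp: aq(1))
  have lamn: "s \<le> lam * real n"
  proof -
    have "(lam - e) * real n \<le> lam * real n" using e by (intro mult_right_mono) auto
    then show ?thesis using s(2) by linarith
  qed
  define x' where "x' = (if qs = [] then y else ctr (hd qs))"
  have dist: "distinct qs" using ps(5) unfolding aq(1) by (simp add: distinct_map)
  have close: "norm (y - x') \<le> del * real n"
  proof (rule ccontr)
    assume far: "\<not> ?thesis"
    then have ne: "qs \<noteq> []" using del n(3) by (auto simp: x'_def)
    have lq: "last ps = last qs" using ne by (simp add: aq(1))
    have lk: "links qs" using ps(4) by (simp add: aq(1) links_append)
    define k where "k = nat \<lceil>del * real n / rho\<rceil>"
    have "norm (y - ctr (hd qs)) \<le> real (length qs) * rho"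
      using ne lk ps(6) aq(2) by (intro links_dist) (auto simp: lq)
    then have "del * real n < real (length qs) * rho" using far ne by (simp add: x'_def)
    then have "del * real n / rho < real (length qs)" using rho(1) by (simp add: pos_divide_less_eq)
    then have kl: "k \<le> length qs" unfolding k_def by linarith
    have k1: "1 \<le> k"
    proof -
      have "0 < del * real n / rho" using del n(3) rho by simp
      then show ?thesis unfolding k_def by linarith
    qed
    have kr: "real k * rho \<le> del * real n + rho"
    proof -
      have "0 \<le> del * real n / rho" using del rho by simp
      then have "real k \<le> del * real n / rho + 1" unfolding k_def by linarith
      then have "real k * rho \<le> (del * real n / rho + 1) * rho" using rho by (intro mult_right_mono) auto
      then show ?thesis using rho by (simp add: distrib_right)
    qed
    define qs' where "qs' = drop (length qs - k) qs"
    have q': "length qs' = k" "set qs' \<subseteq> set qs" "last qs' = last qs" "qs = take (length qs - k) qs @ qs'"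
      using kl k1 set_drop_subset[of "length qs - k" qs] by (simp_all add: qs'_def)
    have ne': "qs' \<noteq> []" using q'(1) k1 by auto
    have lk': "links qs'" using lk q'(4) by (metis links_append)
    have "norm (y - ctr (hd qs')) \<le> real (length qs') * rho"
    proof (rule links_dist[OF ne' lk'])
      show "norm (y - ctr (last qs')) < rd (last qs')" using ps(6) q'(3) by (simp add: lq)
      show "rd p \<le> rho" if "p \<in> set qs'" for p using aq(2) q'(2) that by force
    qed
    then have "norm (y - ctr (hd qs')) \<le> del * real n + rho" using kr q'(1) by simp
    moreover have "norm (ctr (hd qs')) \<le> norm y + norm (y - ctr (hd qs'))"
      using norm_triangle_ineq4[of y "y - ctr (hd qs')"] by simp
    moreover have "del * real n \<le> 1 / 4 * real n" using del(2) by (intro mult_right_mono) auto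
    ultimately have b: "norm (ctr (hd qs')) \<le> 3 * real n" using ny(1) rho(2) n(3) by linarith
    have "sum_list (map tm qs') \<le> sum_list (map tm qs)"
    proof -
      have "sum_list (map tm qs) = sum_list (map tm (take (length qs - k) qs)) + sum_list (map tm qs')"
        using arg_cong[OF q'(4), of "\<lambda>l. sum_list (map tm l)"] by simp
      moreover have "0 \<le> sum_list (map tm (take (length qs - k) qs))"
        using ps(2) set_take_subset[of "length qs - k" qs] by (intro chain_tm_nonneg[of _ w]) (simp add: aq(1), blast)
      ultimately show ?thesis by linarith
    qed
    then have "sum_list (map tm qs') \<le> lam * real n" using sums(2) lamn by linarith
    moreover have "distinct qs'" unfolding qs'_def using dist by (rule distinct_drop)
    moreover have "set qs' \<subseteq> chi w" using q'(2) ps(2) by (simp add: aq(1), blast)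
    moreover have "\<forall>p\<in>set qs'. rd p < rho" using subsetD[OF q'(2)] aq(2) by (meson not_le)
    ultimately show False using tiny lk' b q'(1) unfolding k_def by blast
  qed
  have asne: "as \<noteq> []"
  proof
    assume "as = []"
    then have "qs \<noteq> []" "ctr (hd qs) \<in> ball 0 1" using ps(1,3) by (auto simp: aq(1))
    then have "norm x' < 1" by (simp add: x'_def)
    then have "norm y \<le> 1 + del * real n" using close norm_triangle_ineq[of "y - x'" x'] by simp
    moreover have "del * real n \<le> 1 / 4 * real n" using del(2) by (intro mult_right_mono) auto
    ultimately show False using ny(2) n(3) by linarith
  qed
  define p where "p = last as"
  have rp: "rho \<le> rd p" using aq(3) asne by (simp add: p_def)
  have "norm (x' - ctr p) < rd p"
  proof (cases "qs = []")
    case True then show ?thesis using ps(6) by (simp add: x'_def p_def aq(1))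
  next
    case False
    then show ?thesis using ps(4) asne by (simp add: x'_def p_def aq(1) links_append)
  qed
  from ball_in_big_ball[OF this rp rho(1)]
  obtain x where x: "norm (x - x') \<le> rho / 2" "ball x (rho / 2) \<subseteq> ball (ctr p) (rd p)" by blast
  have "ball (ctr p) (rd p) \<subseteq> {v. reach (chi w) (ball 0 1) s v}"
  proof
    fix v assume v: "v \<in> ball (ctr p) (rd p)"
    have "reach (chi w) (ball 0 1) s v"
    proof (rule chain_reach[of as])
      show "links as" using ps(4) by (simp add: aq(1) links_append)
      show "set as \<subseteq> chi w" using ps(2) by (simp add: aq(1))
      show "ctr (hd as) \<in> ball 0 1" using ps(3) asne by (simp add: aq(1))
      show "norm (v - ctr (last as)) < rd (last as)" using v by (simp add: p_def dist_norm norm_minus_commute)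
    qed (use asne sums nice_tm in auto)
    then show "v \<in> {v. reach (chi w) (ball 0 1) s v}" by simp
  qed
  then have bx: "ball x (rho / 2) \<subseteq> {v. reach (chi w) (ball 0 1) s v}" using x(2) by blast
  define m where "m = nat \<lceil>real n / real n0\<rceil>"
  have n00: "0 < real n0" using n(5) by simp
  have mm: "real n \<le> real (m * n0)" "real (m * n0) \<le> real n + real n0" "1 \<le> m"
  proof -
    have "0 \<le> real n / real n0" by simp
    then have "real n / real n0 \<le> real m" "real m \<le> real n / real n0 + 1"
      using n00 unfolding m_def by linarith+
    then have "real n / real n0 * real n0 \<le> real m * real n0" "real m * real n0 \<le> (real n / real n0 + 1) * real n0"
      using n00 by (auto intro!: mult_right_mono simp del: times_divide_eq_left)
    then show "real n \<le> real (m * n0)" "real (m * n0) \<le> real n + real n0"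
      using n00 by (simp_all add: distrib_right)
    have "0 < real n / real n0" using n00 n(3) by simp
    then show "1 \<le> m" unfolding m_def by linarith
  qed
  define y0 where "y0 = real (m * n0) *\<^sub>R u"
  have d1: "norm (y - y0) \<le> 2 * del * real n"
  proof -
    have "norm (y - y0) \<le> norm (y - norm y *\<^sub>R u) + norm (norm y *\<^sub>R u - y0)"
      using norm_triangle_ineq[of "y - norm y *\<^sub>R u" "norm y *\<^sub>R u - y0"] by simp
    also have "norm (norm y *\<^sub>R u - y0) = \<bar>norm y - real (m * n0)\<bar>"
      using u(1) by (simp only: y0_def scaleR_left_diff_distrib[symmetric] norm_scaleR) simp
    also have "\<dots> \<le> real n0 + 1" using mm ny by linarith
    also have "norm (y - norm y *\<^sub>R u) \<le> del * real n"
    proof -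
      have "del * norm y \<le> del * real n" using ny(1) del(1) by (intro mult_left_mono) auto
      then show ?thesis using u(2) by linarith
    qed
    finally show ?thesis using n(4) by linarith
  qed
  have dn1: "1 \<le> del * real n" using n(2) del(1) by (simp add: pos_divide_le_eq mult.commute)
  have dn4: "del * real n \<le> 1 / 4 * real n" using del(2) by (intro mult_right_mono) auto
  have xy: "norm (x - y) \<le> 2 * (del * real n)"
    using x(1) close norm_triangle_ineq[of "x - x'" "x' - y"] rho(2) dn1 by (simp add: norm_minus_commute)
  have nx: "norm x \<le> 3 * real n"
    using xy norm_triangle_ineq[of "x - y" y] ny(1) dn4 by simp
  have cv: "cov (chi w) 0 y0 (s + K * (5 * del) * real n)"
    unfolding cov_def
  proof
    fix v assume "v \<in> cball y0 1"
    then have "norm (y0 - v) \<le> 1" by (simp add: dist_norm)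
    moreover have "norm (x - v) \<le> norm (x - y) + norm (y - y0) + norm (y0 - v)"
      using norm_triangle_ineq[of "x - y" "y - y0"] norm_triangle_ineq[of "x - y0" "y0 - v"] by simp
    ultimately have "norm (x - v) \<le> (5 * del) * real n" using xy d1 dn1 by linarith
    from cf[OF nx this bx] show "v \<in> {z. reach (chi w) (ball 0 1) (s + K * (5 * del) * real n) z}"
      using reach_trans[of "chi w" "{v. reach (chi w) (ball 0 1) s v}" "K * (5 * del) * real n" v "ball 0 1" s] by simp
  qed
  have "real (cover_time (chi w) 0 y0) \<le> s + K * (5 * del) * real n + 1"
    by (rule cover_time_le_real[OF cv]) (use s K del in auto)
  also have "\<dots> \<le> (lam - e) * real n + (5 * K + 1) * del * real n"
    using s(2) dn1 by (simp add: algebra_simps)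
  also have "(5 * K + 1) * del * real n \<le> e / 2 * real n" using del(3) by (intro mult_right_mono) auto
  also have "(lam - e) * real n + e / 2 * real n = (lam - e / 2) * real n" by (simp add: algebra_simps)
  also have "\<dots> \<le> (lam - e / 2) * real (m * n0)" using mm(1) e by (intro mult_left_mono) auto
  finally have "real (cover_time (chi w) 0 y0) \<le> (lam - e / 2) * real (m * n0)" by simp
  then show ?thesis using mm(3) unfolding y0_def by (intro exI[of _ m] conjI)
qed

lemma lower_speed:
  assumes e: "0 < e" "e < lam"
  shows "AE w in M. \<exists>r0. \<forall>y. r0 \<le> norm y \<longrightarrow> \<not> reach (chi w) (ball 0 1) ((lam - e) * norm y) y"
proof -
  obtain K where K: "K > 0" and cf: "\<And>rho1 del. rho1 > 0 \<Longrightarrow> del > 0 \<Longrightarrow> AE w in M. \<exists>n0. \<forall>n\<ge>n0. \<forall>x y A. norm x \<le> 3 * real n \<longrightarrow> norm (x - y) \<le> del * real n \<longrightarrow>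
     ball x rho1 \<subseteq> A \<longrightarrow> reach (chi w) A (K * del * real n) y"
    using cover_fast by auto
  have lam: "0 < lam" using e by simp
  define del where "del = min (1 / 4) (e / 2 / (5 * K + 1))"
  have K5: "0 < 5 * K + 1" using K by simp
  have cancel: "c * (a / c) = a" if "c \<noteq> 0" for a c :: real using that by simp
  have del: "0 < del" "del \<le> 1 / 4" "(5 * K + 1) * del \<le> e / 2"
  proof -
    show "0 < del" using K5 e by (simp add: del_def)
    show "del \<le> 1 / 4" unfolding del_def by (rule min.cobounded1)
    have "(5 * K + 1) * del \<le> (5 * K + 1) * (e / 2 / (5 * K + 1))" unfolding del_def using K5 by (intro mult_left_mono) auto
    also have "\<dots> = e / 2" using K5 by (intro cancel) linarith
    finally show "(5 * K + 1) * del \<le> e / 2" .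
  qed
  obtain rho where rho: "0 < rho" "rho \<le> 1" and tiny: "AE w in M. \<exists>n0. \<forall>n\<ge>n0. \<not> (\<exists>qs. distinct qs \<and> set qs \<subseteq> chi w \<and> links qs \<and> (\<forall>p\<in>set qs. rd p < rho) \<and>
      norm (ctr (hd qs)) \<le> 3 * real n \<and> sum_list (map tm qs) \<le> lam * real n \<and> length qs = nat \<lceil>del * real n / rho\<rceil>)"
    using small_balls_slow[OF lam del(1)] by blast
  obtain D :: "'a set" where D: "finite D" "\<And>u. u \<in> D \<Longrightarrow> norm u = 1" "\<And>y. y \<noteq> 0 \<Longrightarrow> \<exists>u\<in>D. norm (y - norm y *\<^sub>R u) \<le> del * norm y"
    using unit_net[OF del(1)] by metis
  define E where "E w \<longleftrightarrow> \<not> (\<exists>r0. \<forall>y. r0 \<le> norm y \<longrightarrow> \<not> reach (chi w) (ball 0 1) ((lam - e) * norm y) y)" for w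
  have "AE w in M. \<not> E w"
  proof (rule outer_prob_le_null)
    fix eta :: real assume eta: "0 < eta"
    define eta' where "eta' = eta / (real (card D) + 1)"
    have eta': "0 < eta'" using eta by (simp add: eta'_def add_nonneg_pos)
    have e2: "0 < e / 2" using e by simp
    have "\<forall>u\<in>D. \<exists>n0\<ge>1. outer_prob_le (\<lambda>w. \<exists>n\<ge>1. real (cover_time (chi w) 0 (real (n * n0) *\<^sub>R u)) \<le> (lam - e / 2) * real (n * n0)) eta'"
      using slow_direction[OF D(2) e2 eta'] by blast
    from bchoice[OF this] obtain n0 where n0: "\<And>u. u \<in> D \<Longrightarrow> 1 \<le> n0 u" and
      obu: "\<And>u. u \<in> D \<Longrightarrow> outer_prob_le (\<lambda>w. \<exists>n\<ge>1. real (cover_time (chi w) 0 (real (n * n0 u) *\<^sub>R u)) \<le> (lam - e / 2) * real (n * n0 u)) eta'"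
      by blast
    have ob1: "outer_prob_le (\<lambda>w. \<exists>u\<in>D. \<exists>n\<ge>1. real (cover_time (chi w) 0 (real (n * n0 u) *\<^sub>R u)) \<le> (lam - e / 2) * real (n * n0 u)) eta"
    proof (rule outer_prob_le_UN_const[OF D(1) obu])
      have "real (card D) * eta' \<le> (real (card D) + 1) * eta'" using eta' by (intro mult_right_mono) auto
      also have "\<dots> = eta" unfolding eta'_def by simp
      finally show "real (card D) * eta' \<le> eta" .
    qed
    have r2: "0 < rho / 2" and d5: "0 < 5 * del" using rho del by auto
    show "outer_prob_le E eta"
    proof (rule outer_prob_le_AE_mono[OF ob1 _ order_refl])
      from tiny cf[OF r2 d5]
      show "AE w in M. E w \<longrightarrow> (\<exists>u\<in>D. \<exists>n\<ge>1. real (cover_time (chi w) 0 (real (n * n0 u) *\<^sub>R u)) \<le> (lam - e / 2) * real (n * n0 u))"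
      proof eventually_elim
        case (elim w)
        obtain na where na: "\<And>n. n \<ge> na \<Longrightarrow> \<not> (\<exists>qs. distinct qs \<and> set qs \<subseteq> chi w \<and> links qs \<and> (\<forall>p\<in>set qs. rd p < rho) \<and>
          norm (ctr (hd qs)) \<le> 3 * real n \<and> sum_list (map tm qs) \<le> lam * real n \<and> length qs = nat \<lceil>del * real n / rho\<rceil>)"
          using elim(1) by blast
        obtain nb where nb: "\<And>n x y A. n \<ge> nb \<Longrightarrow> norm x \<le> 3 * real n \<Longrightarrow> norm (x - y) \<le> (5 * del) * real n \<Longrightarrow> ball x (rho / 2) \<subseteq> A \<Longrightarrow> reach (chi w) A (K * (5 * del) * real n) y"
          using elim(2) by blast
        show ?case
        proof
          assume Ew: "E w"
          define r0 where "r0 = real na + real nb + 1 / del + 8 + (\<Sum>u\<in>D. (real (n0 u) + 1) / del)"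
          have sp: "0 \<le> (\<Sum>u\<in>D. (real (n0 u) + 1) / del)" using del by (intro sum_nonneg) auto
          have dp: "0 < 1 / del" using del by simp
          obtain y where y: "r0 \<le> norm y" "reach (chi w) (ball 0 1) ((lam - e) * norm y) y" using Ew unfolding E_def by blast
          define n where "n = nat \<lceil>norm y\<rceil>"
          have yn: "norm y \<le> real n" unfolding n_def by linarith
          have "0 < norm y" using y(1) sp dp unfolding r0_def by linarith
          then have "y \<noteq> 0" by simp
          then obtain u where u: "u \<in> D" "norm (y - norm y *\<^sub>R u) \<le> del * norm y" using D(3) by blast
          have "(real (n0 u) + 1) / del \<le> (\<Sum>u\<in>D. (real (n0 u) + 1) / del)" using u(1) D(1) del by (intro member_le_sum) auto
          then have "(real (n0 u) + 1) / del \<le> real n" using y(1) yn dp unfolding r0_def by linarith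
          then have n4: "real (n0 u) + 1 \<le> del * real n" using del(1) by (simp add: pos_divide_le_eq mult.commute)
          have nn: "na \<le> n" "nb \<le> n" "1 / del \<le> real n" "8 \<le> real n" using y(1) yn sp dp unfolding r0_def by linarith+
          have "\<exists>m\<ge>1. real (cover_time (chi w) 0 (real (m * n0 u) *\<^sub>R u)) \<le> (lam - e / 2) * real (m * n0 u)"
            by (rule lower_speed_event[OF e K del rho nn(1,3,4) n4 n0[OF u(1)] na[OF nn(1)] nb[OF nn(2)] n_def D(2)[OF u(1)] u(2) y(2)])
          then show "\<exists>u\<in>D. \<exists>n\<ge>1. real (cover_time (chi w) 0 (real (n * n0 u) *\<^sub>R u)) \<le> (lam - e / 2) * real (n * n0 u)" using u(1) by blast
        qed
      qed
    qed
  qed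
  then show ?thesis unfolding E_def by simp
qed

end

section \<open>Positivity of the time constant\<close>

fun plen :: "'a::euclidean_space list \<Rightarrow> real" where
  "plen (x # y # zs) = norm (y - x) + plen (y # zs)"
| "plen zs = 0"

lemma plen_nonneg: "0 \<le> plen xs"
  by (induction xs rule: plen.induct) auto

lemma polygon:
  fixes xs :: "'a::euclidean_space list"
  assumes "xs \<noteq> []"
  shows "\<exists>gam. (\<forall>s t. norm (gam s - gam t) \<le> \<bar>s - t\<bar>) \<and> gam 0 = hd xs \<and> (\<forall>x\<in>set xs. \<exists>t. 0 \<le> t \<and> t \<le> plen xs \<and> gam t = x)"
  using assms
proof (induction xs)
  case (Cons x xs)
  show ?case
  proof (cases xs)
    case Nil
    then show ?thesis by (intro exI[of _ "\<lambda>_. x"]) auto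
  next
    case (Cons y zs)
    then have "xs \<noteq> []" and hy: "hd xs = y" by auto
    from Cons.IH[OF this(1)] obtain g where g: "\<And>s t. norm (g s - g t) \<le> \<bar>s - t\<bar>" "g 0 = y" "\<And>z. z \<in> set xs \<Longrightarrow> \<exists>t. 0 \<le> t \<and> t \<le> plen xs \<and> g t = z"
      unfolding hy by blast
    define D where "D = norm (y - x)"
    have D: "0 \<le> D" by (simp add: D_def)
    define cl where "cl t = min (max t 0) D" for t :: real
    define m where "m t = max 0 (t - D)" for t :: real
    define gam where "gam t = x + (cl t / D) *\<^sub>R (y - x) + (g (m t) - y)" for t
    have mono: "cl s \<le> cl t" "m s \<le> m t" "(cl t - cl s) + (m t - m s) \<le> t - s" if "s \<le> t" for s t
      using that D by (auto simp: cl_def m_def)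
    have lin: "norm ((cl t / D) *\<^sub>R (y - x) - (cl s / D) *\<^sub>R (y - x)) \<le> \<bar>cl t - cl s\<bar>" for s t
    proof (cases "D = 0")
      case False
      have "(cl t / D) *\<^sub>R (y - x) - (cl s / D) *\<^sub>R (y - x) = ((cl t - cl s) / D) *\<^sub>R (y - x)"
        by (simp only: scaleR_left_diff_distrib[symmetric] diff_divide_distrib)
      then have "norm ((cl t / D) *\<^sub>R (y - x) - (cl s / D) *\<^sub>R (y - x)) = \<bar>(cl t - cl s) / D\<bar> * D" by (simp only: norm_scaleR D_def)
      also have "\<dots> = \<bar>cl t - cl s\<bar>" using D False by (simp add: abs_divide)
      finally show ?thesis by simp
    qed simp
    have L: "norm (gam t - gam s) \<le> t - s" if st: "s \<le> t" for s t
    proof -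
      have "gam t - gam s = ((cl t / D) *\<^sub>R (y - x) - (cl s / D) *\<^sub>R (y - x)) + (g (m t) - g (m s))" by (simp add: gam_def)
      then have "norm (gam t - gam s) \<le> norm ((cl t / D) *\<^sub>R (y - x) - (cl s / D) *\<^sub>R (y - x)) + norm (g (m t) - g (m s))"
        by (simp only: norm_triangle_ineq)
      also have "\<dots> \<le> \<bar>cl t - cl s\<bar> + \<bar>m t - m s\<bar>" by (intro add_mono lin g(1))
      also have "\<dots> \<le> t - s" using mono[OF st] by linarith
      finally show ?thesis .
    qed
    have L2: "norm (gam s - gam t) \<le> \<bar>s - t\<bar>" for s t
      using L[of s t] L[of t s] by (cases "s \<le> t") (auto simp: norm_minus_commute)
    have g0: "gam 0 = x" using D g(2) by (simp add: gam_def cl_def m_def)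
    have pl: "plen (x # xs) = D + plen xs" using Cons by (simp add: D_def)
    have pts: "\<exists>t. 0 \<le> t \<and> t \<le> plen (x # xs) \<and> gam t = z" if z: "z \<in> set (x # xs)" for z
    proof (cases "z = x")
      case True
      then show ?thesis using g0 plen_nonneg[of "x # xs"] by (intro exI[of _ 0]) auto
    next
      case False
      then have "z \<in> set xs" using z by simp
      then obtain t where t: "0 \<le> t" "t \<le> plen xs" "g t = z" using g(3) by blast
      have "gam (D + t) = z"
      proof (cases "D = 0")
        case True
        then have "y = x" by (simp add: D_def)
        then show ?thesis using True t by (simp add: gam_def m_def)
      next
        case False
        then show ?thesis using D t by (simp add: gam_def m_def cl_def)
      qed
      then show ?thesis using t D pl by (intro exI[of _ "D + t"]) auto
    qed
    show ?thesis using L2 g0 pts by (intro exI[of _ gam]) simp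
  qed
qed simp

lemma prefix_reaching:
  fixes f :: "'b \<Rightarrow> real"
  assumes "L \<le> sum_list (map f ps)" "0 < L"
  shows "\<exists>bs b rs. ps = bs @ b # rs \<and> sum_list (map f bs) < L \<and> L \<le> sum_list (map f (bs @ [b]))"
  using assms(1)
proof (induction ps rule: rev_induct)
  case Nil then show ?case using assms(2) by simp
next
  case (snoc p ps)
  show ?case
  proof (cases "L \<le> sum_list (map f ps)")
    case True
    then obtain bs b rs where "ps = bs @ b # rs" "sum_list (map f bs) < L" "L \<le> sum_list (map f (bs @ [b]))" using snoc.IH by blast
    then show ?thesis by (intro exI[of _ bs] exI[of _ b] exI[of _ "rs @ [p]"]) auto
  next
    case False
    then show ?thesis using snoc.prems by (intro exI[of _ ps] exI[of _ p] exI[of _ "[]"]) auto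
  qed
qed

lemma links_sum_dist:
  fixes ps :: "('a::euclidean_space \<times> real \<times> real) list"
  assumes "ps \<noteq> []" "links ps" "norm (y - ctr (last ps)) < rd (last ps)"
  shows "norm (y - ctr (hd ps)) \<le> sum_list (map rd ps)"
  using assms
proof (induction ps)
  case (Cons p ps)
  show ?case
  proof (cases "ps = []")
    case True then show ?thesis using Cons.prems by simp
  next
    case False
    have "norm (y - ctr p) \<le> norm (y - ctr (hd ps)) + norm (ctr (hd ps) - ctr p)"
      using norm_triangle_ineq[of "y - ctr (hd ps)" "ctr (hd ps) - ctr p"] by simp
    moreover have "norm (y - ctr (hd ps)) \<le> sum_list (map rd ps)" using Cons.prems False by (intro Cons.IH) (auto simp: links_Cons)
    moreover have "norm (ctr (hd ps) - ctr p) < rd p" using Cons.prems False by (auto simp: links_Cons)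
    ultimately show ?thesis by simp
  qed
qed simp

lemma links_plen:
  "links (bs @ [b]) \<Longrightarrow> plen (map ctr (bs @ [b])) \<le> sum_list (map rd bs)"
proof (induction bs)
  case (Cons p bs)
  have "links (bs @ [b])" "norm (ctr (hd (bs @ [b])) - ctr p) < rd p" using Cons.prems by (auto simp: links_Cons)
  then show ?case using Cons.IH by (cases bs) auto
qed simp

lemma geometric_weights: "(\<Sum>i<n. (real i + 3) / 2 ^ Suc i) = 4 - (real n + 4) / 2 ^ n"
  by (induction n) (auto simp: field_simps)

context deijfen_process begin

lemma fast_measure:
  assumes a: "0 < a" and x: "0 \<le> x"
  shows "{(t, r). t \<le> a * r \<and> x < r} \<in> sets borel"
    "emeasure (time_measure \<Otimes>\<^sub>M mu) {(t, r). t \<le> a * r \<and> x < r} \<le> ennreal a * (\<integral>\<^sup>+ r. ennreal r * indicator {x..} r \<partial>mu)"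
proof -
  have "{(t, r). t \<le> a * r \<and> x < r} = {p. fst p \<le> a * snd p} \<inter> {p. x < snd p}" by auto
  moreover have "closed {p::real\<times>real. fst p \<le> a * snd p}" by (intro closed_Collect_le continuous_intros)
  moreover have "open {p::real\<times>real. x < snd p}" by (intro open_Collect_less continuous_intros)
  ultimately show V: "{(t, r). t \<le> a * r \<and> x < r} \<in> sets borel" by auto
  have "emeasure (time_measure \<Otimes>\<^sub>M mu) {(t, r). t \<le> a * r \<and> x < r} = (\<integral>\<^sup>+ r. emeasure time_measure ((\<lambda>t. (t, r)) -` {(t, r). t \<le> a * r \<and> x < r}) \<partial>mu)"
    by (rule R.emeasure_time_mu[OF V])
  also have "\<dots> \<le> (\<integral>\<^sup>+ r. ennreal a * (ennreal r * indicator {x..} r) \<partial>mu)"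
  proof (rule nn_integral_mono)
    fix r
    show "emeasure time_measure ((\<lambda>t. (t, r)) -` {(t, r). t \<le> a * r \<and> x < r}) \<le> ennreal a * (ennreal r * indicator {x..} r)"
    proof (cases "x < r")
      case True
      then have "(\<lambda>t. (t, r)) -` {(t, r). t \<le> a * r \<and> x < r} = {..a * r}" by auto
      moreover have "{..a * r} \<inter> {0..} = {0..a * r}" by auto
      moreover have "0 \<le> a * r" using a x True by simp
      ultimately show ?thesis using True a x by (simp add: emeasure_time ennreal_mult)
    next
      case False
      then have "(\<lambda>t. (t, r)) -` {(t, r). t \<le> a * r \<and> x < r} = {}" by auto
      then show ?thesis by (simp only: emeasure_empty zero_le)
    qed
  qed
  also have "\<dots> = ennreal a * (\<integral>\<^sup>+ r. ennreal r * indicator {x..} r \<partial>mu)"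
  proof (rule nn_integral_cmult)
    have "(\<lambda>r. ennreal r * indicator {x..} r) \<in> borel_measurable borel" by measurable
    then show "(\<lambda>r. ennreal r * indicator {x..} r) \<in> borel_measurable mu" using measurable_cong_sets[OF R.sets_mu refl] by blast
  qed
  finally show "emeasure (time_measure \<Otimes>\<^sub>M mu) {(t, r). t \<le> a * r \<and> x < r} \<le> ennreal a * (\<integral>\<^sup>+ r. ennreal r * indicator {x..} r \<partial>mu)" .
qed

text \<open>A chain that travels faster than speed \<open>1 / a\<close> must collect points with \<open>tm p \<le> a * rd p\<close>. Splitting
  their radii into dyadic layers, the tail root integral bounds what such points can contribute.\<close>

definition greedy_event :: "real \<Rightarrow> real \<Rightarrow> real \<Rightarrow> nat \<Rightarrow> 'w \<Rightarrow> bool" where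
  "greedy_event a L x m w \<longleftrightarrow> (\<exists>xs P. xs \<noteq> [] \<and> hd xs = 0 \<and> plen xs \<le> 2 * L \<and> finite P \<and> P \<subseteq> chi w \<and> m \<le> card P \<and>
     (\<forall>p\<in>P. ctr p \<in> set xs \<and> tm p \<le> a * rd p \<and> x < rd p))"

lemma greedy_ob:
  assumes a: "0 < a" and L: "0 < L" and x: "0 \<le> x" and m: "1 \<le> m"
    and g: "(\<integral>\<^sup>+ r. ennreal r * indicator {x..} r \<partial>mu) \<le> ennreal g" "0 \<le> g"
  shows "outer_prob_le (greedy_event a L x m) ((2 * exp 1 * 18 ^ DIM('a) * (a * g) * (L / real m) ^ DIM('a)) ^ m)"
proof -
  let ?d = "DIM('a)"
  define h where "h = 2 * L / real m"
  have m0: "0 < real m" using m by simp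
  have h: "0 < h" "real m * h = 2 * L" using L m0 by (auto simp: h_def)
  note V = fast_measure[OF a x]
  have Ve: "emeasure (time_measure \<Otimes>\<^sub>M mu) {(t, r). t \<le> a * r \<and> x < r} \<le> ennreal (a * g)"
  proof -
    have "ennreal a * (\<integral>\<^sup>+ r. ennreal r * indicator {x..} r \<partial>mu) \<le> ennreal a * ennreal g" using g by (intro mult_left_mono) auto
    also have "\<dots> = ennreal (a * g)" using a g by (simp add: ennreal_mult)
    finally show ?thesis using V(2) by (rule order_trans[rotated])
  qed
  have ag: "0 \<le> a * g" using a g by simp
  have Z0: "finite {0::'a}" "{0::'a} \<subseteq> lat" by (auto simp: lat_0)
  note sk = skeleton_points[OF h(1) Z0 V(1) Ve ag m, of m]
  have bound: "real (card {0::'a}) * (3 ^ ?d) ^ m * (exp 1 * (real (m + 1) * 3 ^ ?d * h ^ ?d * (a * g)) / real m) ^ m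
     \<le> (2 * exp 1 * 18 ^ ?d * (a * g) * (L / real m) ^ ?d) ^ m"
  proof -
    have q: "exp 1 * (real (m + 1) * 3 ^ ?d * h ^ ?d * (a * g)) / real m \<le> 2 * exp 1 * (3 ^ ?d * h ^ ?d * (a * g))"
    proof -
      have "real (m + 1) / real m \<le> 2" using m by (simp add: field_simps)
      then have "real (m + 1) / real m * (exp 1 * (3 ^ ?d * h ^ ?d * (a * g))) \<le> 2 * (exp 1 * (3 ^ ?d * h ^ ?d * (a * g)))"
        using h(1) ag by (intro mult_right_mono) auto
      then show ?thesis by (simp add: mult_ac)
    qed
    have e18: "(3::real) ^ ?d * (3 ^ ?d * h ^ ?d) = 18 ^ ?d * (L / real m) ^ ?d"
    proof -
      have "(3::real) ^ ?d * (3 ^ ?d * h ^ ?d) = (3 * (3 * h)) ^ ?d" by (simp only: power_mult_distrib)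
      also have "3 * (3 * h) = 18 * (L / real m)" by (simp add: h_def)
      finally show ?thesis by (simp only: power_mult_distrib)
    qed
    have "(3 ^ ?d) ^ m * (exp 1 * (real (m + 1) * 3 ^ ?d * h ^ ?d * (a * g)) / real m) ^ m
       = (3 ^ ?d * (exp 1 * (real (m + 1) * 3 ^ ?d * h ^ ?d * (a * g)) / real m)) ^ m" by (simp only: power_mult_distrib)
    also have "\<dots> \<le> (3 ^ ?d * (2 * exp 1 * (3 ^ ?d * h ^ ?d * (a * g)))) ^ m"
    proof (rule power_mono)
      show "3 ^ ?d * (exp 1 * (real (m + 1) * 3 ^ ?d * h ^ ?d * (a * g)) / real m) \<le> 3 ^ ?d * (2 * exp 1 * (3 ^ ?d * h ^ ?d * (a * g)))"
        by (rule mult_left_mono[OF q]) simp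
      show "0 \<le> 3 ^ ?d * (exp 1 * (real (m + 1) * 3 ^ ?d * h ^ ?d * (a * g)) / real m)"
        using h(1) ag by simp
    qed
    also have "3 ^ ?d * (2 * exp 1 * (3 ^ ?d * h ^ ?d * (a * g))) = 2 * exp 1 * (3 ^ ?d * (3 ^ ?d * h ^ ?d)) * (a * g)" by (simp only: mult_ac)
    also have "\<dots> = 2 * exp 1 * 18 ^ ?d * (a * g) * (L / real m) ^ ?d" unfolding e18 by (simp only: mult_ac)
    finally show ?thesis by simp
  qed
  show ?thesis
  proof (rule outer_prob_le_mono[OF sk _ bound])
    fix w assume "greedy_event a L x m w"
    then obtain xs P where xs: "xs \<noteq> []" "hd xs = 0" "plen xs \<le> 2 * L" and P: "finite P" "P \<subseteq> chi w" "m \<le> card P"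
      "\<And>p. p \<in> P \<Longrightarrow> ctr p \<in> set xs \<and> tm p \<le> a * rd p \<and> x < rd p" unfolding greedy_event_def by blast
    obtain gam where gam: "\<And>s t. norm (gam s - gam t) \<le> \<bar>s - t\<bar>" "gam 0 = 0"
      "\<And>z. z \<in> set xs \<Longrightarrow> \<exists>t. 0 \<le> t \<and> t \<le> plen xs \<and> gam t = z" using polygon[OF xs(1)] unfolding xs(2) by blast
    define f where "f i = fl (gam (real i * h) /\<^sub>R h)" for i :: nat
    have near: "fl (gam s /\<^sub>R h) - fl (gam t /\<^sub>R h) \<in> unit_steps" if "\<bar>s - t\<bar> \<le> h" for s t
    proof (rule fl_step_unit_steps)
      have "gam s /\<^sub>R h - gam t /\<^sub>R h = (gam s - gam t) /\<^sub>R h" by (simp add: scaleR_right_diff_distrib)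
      then have "norm (gam s /\<^sub>R h - gam t /\<^sub>R h) = norm (gam s - gam t) / h" using h(1) by (simp add: divide_inverse mult.commute)
      also have "\<dots> \<le> 1" using gam(1)[of s t] that h(1) by (simp add: pos_divide_le_eq)
      finally show "norm (gam s /\<^sub>R h - gam t /\<^sub>R h) \<le> 1" .
    qed
    have f0: "f 0 \<in> {0}" by (simp add: f_def gam(2) fl_id[OF lat_0])
    have st: "\<forall>i<m. f (Suc i) - f i \<in> unit_steps" unfolding f_def using h(1) by (intro allI impI near) (simp add: algebra_simps)
    have pp: "\<forall>p\<in>P. snd p \<in> {(t, r). t \<le> a * r \<and> x < r} \<and> (\<exists>i\<le>m. fl (ctr p /\<^sub>R h) - f i \<in> unit_steps)"
    proof
      fix p assume p: "p \<in> P"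
      obtain t where t: "0 \<le> t" "t \<le> plen xs" "gam t = ctr p" using gam(3) P(4)[OF p] by blast
      define i where "i = nat \<lfloor>t / h\<rfloor>"
      have th: "0 \<le> t / h" using t h by simp
      have i: "real i \<le> t / h" "t / h < real i + 1" unfolding i_def using th by linarith+
      have it: "real i * h \<le> t" "t < (real i + 1) * h" using i h(1) by (simp_all add: pos_le_divide_eq pos_divide_less_eq)
      have "real i * h \<le> real m * h" using it(1) t(2) xs(3) h(2) by linarith
      then have im: "i \<le> m" using h(1) by simp
      have "\<bar>t - real i * h\<bar> \<le> h" using it by (simp add: algebra_simps)
      then have "fl (ctr p /\<^sub>R h) - f i \<in> unit_steps" unfolding f_def t(3)[symmetric] by (rule near)
      then show "snd p \<in> {(t, r). t \<le> a * r \<and> x < r} \<and> (\<exists>i\<le>m. fl (ctr p /\<^sub>R h) - f i \<in> unit_steps)"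
        using P(4)[OF p] im by (auto simp: case_prod_beta)
    qed
    show "\<exists>f P. f 0 \<in> {0} \<and> (\<forall>i<m. f (Suc i) - f i \<in> unit_steps) \<and> finite P \<and> P \<subseteq> chi w \<and> m \<le> card P \<and>
       (\<forall>p\<in>P. snd p \<in> {(t, r). t \<le> a * r \<and> x < r} \<and> (\<exists>i\<le>m. fl (ctr p /\<^sub>R h) - f i \<in> unit_steps))"
      using f0 st P(1-3) pp by blast
  qed
qed

lemma tail_root_real:
  assumes fin: "(\<integral>\<^sup>+ x. tail_root mu DIM('a) x * indicator {0..} x \<partial>lborel) < \<infinity>"
  shows "\<exists>rt H. 0 \<le> H \<and> (\<forall>x\<ge>0. 0 \<le> rt x \<and> (\<integral>\<^sup>+ r. ennreal r * indicator {x..} r \<partial>mu) \<le> ennreal (rt x ^ DIM('a))) \<and>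
     (\<forall>X>0. \<forall>n. (\<Sum>i<n. X / 2 ^ i * rt (X / 2 ^ i)) \<le> 2 * H)"
proof -
  let ?d = "DIM('a)"
  define G where "G x = (\<integral>\<^sup>+ r. ennreal r * indicator {x..} r \<partial>mu)" for x
  have tr: "tail_root mu ?d x = (if G x = \<infinity> then \<infinity> else ennreal (enn2real (G x) powr (1 / real ?d)))" for x
    unfolding tail_root_def G_def Let_def ..
  have "\<exists>x\<in>{0..1}. G x \<noteq> \<infinity>"
  proof (rule ccontr)
    assume "\<not> ?thesis"
    then have "(\<infinity>::ennreal) * indicator {0..1} x \<le> tail_root mu ?d x * indicator {0..} x" for x
      by (auto simp: tr indicator_def)
    then have "(\<integral>\<^sup>+ x. \<infinity> * indicator {0..1::real} x \<partial>lborel) \<le> (\<integral>\<^sup>+ x. tail_root mu ?d x * indicator {0..} x \<partial>lborel)"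
      by (intro nn_integral_mono)
    moreover have "(\<integral>\<^sup>+ x. \<infinity> * indicator {0..1::real} x \<partial>lborel) = \<infinity>" by (subst nn_integral_cmult_indicator) auto
    ultimately show False using fin by auto
  qed
  then obtain x0 where x0: "0 \<le> x0" "G x0 \<noteq> \<infinity>" by auto
  have meas: "(\<lambda>r. ennreal r * indicator {x..} r) \<in> borel_measurable mu" for x
  proof -
    have "(\<lambda>r. ennreal r * indicator {x..} r) \<in> borel_measurable borel" by measurable
    then show ?thesis using measurable_cong_sets[OF R.sets_mu refl] by blast
  qed
  have Gfin: "G x \<noteq> \<infinity>" for x
  proof -
    have "G x \<le> (\<integral>\<^sup>+ r. ennreal r * indicator {x0..} r + ennreal x0 \<partial>mu)"
      unfolding G_def by (intro nn_integral_mono) (auto simp: indicator_def ennreal_leI)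
    also have "\<dots> = G x0 + ennreal x0" unfolding G_def using meas R.emeasure_space_1 by (subst nn_integral_add) auto
    also have "\<dots> < \<infinity>" using x0 by (simp add: less_top)
    finally show ?thesis by simp
  qed
  define rt where "rt x = enn2real (G x) powr (1 / real ?d)" for x
  have rt0: "0 \<le> rt x" for x by (simp add: rt_def)
  have trt: "tail_root mu ?d x = ennreal (rt x)" for x using Gfin by (simp add: tr rt_def)
  have rtd: "G x \<le> ennreal (rt x ^ ?d)" for x
  proof (cases "enn2real (G x) = 0")
    case True
    then have "G x = 0" using Gfin[of x] by (simp add: enn2real_eq_0_iff)
    then show ?thesis by simp
  next
    case False
    then have p: "0 < enn2real (G x)" using enn2real_nonneg[of "G x"] by linarith
    have "rt x ^ ?d = rt x powr real ?d" using p by (simp add: powr_realpow rt_def)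
    also have "\<dots> = enn2real (G x)" using p by (simp add: rt_def powr_powr)
    finally show ?thesis using Gfin[of x] by (simp add: less_top)
  qed
  have rtmono: "rt y \<le> rt x" if "x \<le> y" for x y
  proof -
    have "G y \<le> G x" unfolding G_def using that by (intro nn_integral_mono) (auto simp: indicator_def)
    then have "enn2real (G y) \<le> enn2real (G x)" using Gfin[of x] by (intro enn2real_mono) (auto simp: less_top)
    then show ?thesis unfolding rt_def by (intro powr_mono2) auto
  qed
  define I where "I = (\<integral>\<^sup>+ x. tail_root mu ?d x * indicator {0..} x \<partial>lborel)"
  define H where "H = enn2real I"
  have IH: "I = ennreal H" using fin by (simp add: H_def I_def less_top)
  have sums: "(\<Sum>i<n. X / 2 ^ i * rt (X / 2 ^ i)) \<le> 2 * H" if X: "0 < X" for X :: real and n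
  proof -
    let ?x = "\<lambda>i. X / 2 ^ i"
    let ?J = "\<lambda>i::nat. {?x (Suc i)<..?x i}"
    have xm: "?x j \<le> ?x i" if "i \<le> j" for i j :: nat using X that by (intro divide_left_mono power_increasing) auto
    have pt: "(\<Sum>i<n. ennreal (rt (?x i)) * indicator (?J i) x) \<le> tail_root mu ?d x * indicator {0..} x" for x
    proof (cases "\<exists>i<n. x \<in> ?J i")
      case True
      then obtain i where i: "i < n" "x \<in> ?J i" by blast
      have uniq: "x \<notin> ?J j" if "j \<noteq> i" for j
      proof
        assume j: "x \<in> ?J j"
        show False
        proof (cases "i < j")
          case True
          then have "?x j \<le> ?x (Suc i)" by (intro xm) simp
          then show False using i(2) j by simp
        next
          case False
          then have "?x i \<le> ?x (Suc j)" using that by (intro xm) simp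
          then show False using i(2) j by simp
        qed
      qed
      have "(\<Sum>j<n. ennreal (rt (?x j)) * indicator (?J j) x) = (\<Sum>j\<in>{i}. ennreal (rt (?x j)) * indicator (?J j) x)"
        using i(1) uniq by (intro sum.mono_neutral_right) auto
      also have "\<dots> = ennreal (rt (?x i))" using i(2) by simp
      also have "\<dots> \<le> ennreal (rt x)" using i(2) by (intro ennreal_leI rtmono) simp
      also have "\<dots> = tail_root mu ?d x * indicator {0..} x"
      proof -
        have "0 < ?x (Suc i)" using X by simp
        then have "0 \<le> x" using i(2) by (simp add: less_imp_le less_trans)
        then show ?thesis by (simp add: trt)
      qed
      finally show ?thesis .
    next
      case False
      then have "(\<Sum>i<n. ennreal (rt (?x i)) * indicator (?J i) x) = 0" by (intro sum.neutral) auto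
      then show ?thesis by simp
    qed
    have "(\<integral>\<^sup>+ x. (\<Sum>i<n. ennreal (rt (?x i)) * indicator (?J i) x) \<partial>lborel) \<le> I"
      unfolding I_def using pt by (intro nn_integral_mono)
    moreover have "(\<integral>\<^sup>+ x. (\<Sum>i<n. ennreal (rt (?x i)) * indicator (?J i) x) \<partial>lborel) = (\<Sum>i<n. \<integral>\<^sup>+ x. ennreal (rt (?x i)) * indicator (?J i) x \<partial>lborel)"
      by (rule nn_integral_sum) measurable
    moreover have "(\<integral>\<^sup>+ x. ennreal (rt (?x i)) * indicator (?J i) x \<partial>lborel) = ennreal (?x i * rt (?x i) / 2)" for i
    proof -
      have "emeasure lborel (?J i) = ennreal (?x i - ?x (Suc i))" using xm[of i "Suc i"] by simp
      moreover have "?x i - ?x (Suc i) = ?x i / 2" by simp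
      ultimately have "(\<integral>\<^sup>+ x. ennreal (rt (?x i)) * indicator (?J i) x \<partial>lborel) = ennreal (rt (?x i)) * ennreal (?x i / 2)"
        by (subst nn_integral_cmult_indicator) (simp, simp only:)
      also have "\<dots> = ennreal (rt (?x i) * (?x i / 2))" using X rt0 by (intro ennreal_mult[symmetric]) auto
      also have "rt (?x i) * (?x i / 2) = ?x i * rt (?x i) / 2" by simp
      finally show ?thesis .
    qed
    ultimately have "(\<Sum>i<n. ennreal (?x i * rt (?x i) / 2)) \<le> ennreal H" using IH by simp
    moreover have "(\<Sum>i<n. ennreal (?x i * rt (?x i) / 2)) = ennreal (\<Sum>i<n. ?x i * rt (?x i) / 2)"
      using X rt0 by (intro sum_ennreal) auto
    ultimately have "(\<Sum>i<n. ?x i * rt (?x i) / 2) \<le> H" by (simp add: H_def ennreal_le_iff)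
    then show ?thesis unfolding sum_divide_distrib[symmetric] by simp
  qed
  have "0 \<le> H" by (simp add: H_def)
  then show ?thesis using rt0 rtd sums unfolding G_def by (intro exI[of _ rt] exI[of _ H]) auto
qed

lemma linear_speed:
  assumes fin: "(\<integral>\<^sup>+ x. tail_root mu DIM('a) x * indicator {0..} x \<partial>lborel) < \<infinity>"
  shows "\<exists>c>0. \<forall>L\<ge>1. outer_prob_le (\<lambda>w. \<exists>y. L + 1 \<le> norm y \<and> reach (chi w) (ball 0 1) (c * L) y) (1 / 3)"
proof -
  let ?d = "DIM('a)"
  obtain rt H where H: "0 \<le> H"
    and rt': "\<forall>x\<ge>0. 0 \<le> rt x \<and> (\<integral>\<^sup>+ r. ennreal r * indicator {x..} r \<partial>mu) \<le> ennreal (rt x ^ ?d)"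
    and rs': "\<forall>X>0. \<forall>n. (\<Sum>i<n. X / 2 ^ i * rt (X / 2 ^ i)) \<le> 2 * H"
    using tail_root_real[OF fin] by (elim exE conjE) (rule that; assumption)
  have rt: "\<And>x. 0 \<le> x \<Longrightarrow> 0 \<le> rt x" "\<And>x. 0 \<le> x \<Longrightarrow> (\<integral>\<^sup>+ r. ennreal r * indicator {x..} r \<partial>mu) \<le> ennreal (rt x ^ ?d)"
    using rt' by blast+
  have rs: "\<And>X n. 0 < X \<Longrightarrow> (\<Sum>i<n. X / 2 ^ i * rt (X / 2 ^ i)) \<le> 2 * H" using rs' by blast
  define C :: real where "C = 2 * exp 1 * 18 ^ ?d"
  have "1 * 1 * 1 \<le> C" unfolding C_def by (intro mult_mono) (auto intro: one_le_power)
  then have C: "1 \<le> C" by simp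
  define al where "al = 1 / (512 * C * (H + 1))"
  have al: "0 < al" using C H by (simp add: al_def)
  have alH: "512 * C * (al * H) \<le> 1"
  proof -
    have "512 * C * al = 1 / (H + 1)" using C unfolding al_def by (simp add: divide_simps)
    then have "512 * C * (al * H) = 1 / (H + 1) * H" by (simp only: mult.assoc[symmetric])
    then show ?thesis using H by simp
  qed
  define a where "a = al ^ ?d"
  have a: "0 < a" using al by (simp add: a_def)
  define c where "c = a / 4"
  have c: "0 < c" using a by (simp add: c_def)
  have dpos: "1 \<le> ?d" by (simp add: Suc_leI)
  have "outer_prob_le (\<lambda>w. \<exists>y. L + 1 \<le> norm y \<and> reach (chi w) (ball 0 1) (c * L) y) (1 / 3)" if L: "1 \<le> L" for L
  proof -
    define X where "X = L / 64"
    have X: "0 < X" using L by (simp add: X_def)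
    define x where "x i = X / 2 ^ i" for i :: nat
    have x0: "0 < x i" for i using X by (simp add: x_def)
    define m where "m i = (if i = 0 then 1 else i + 1 + nat \<lceil>4 * C * (L * (al * rt (x i)))\<rceil>)" for i
    have m1: "i + 1 \<le> m i" for i by (simp add: m_def)
    have rx: "0 \<le> rt (x i)" for i using rt(1) x0[of i] by simp
    have small: "(2 * exp 1 * 18 ^ ?d * (a * rt (x i) ^ ?d) * (L / real (m i)) ^ ?d) \<le> 1 / 4" for i
    proof -
      define z where "z = al * rt (x i) * (L / real (m i))"
      have z0: "0 \<le> z" using al rx L by (simp add: z_def)
      have eq: "2 * exp 1 * 18 ^ ?d * (a * rt (x i) ^ ?d) * (L / real (m i)) ^ ?d = C * z ^ ?d"
        by (simp only: C_def a_def z_def power_mult_distrib mult.assoc)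
      have zs: "4 * C * z \<le> 1"
      proof (cases "i = 0")
        case True
        have "X * rt X \<le> 2 * H" using rs[OF X, of 1] by simp
        moreover have "z = 64 * (al * (X * rt X))" using True by (simp add: z_def m_def x_def X_def)
        ultimately have "z \<le> 64 * (al * (2 * H))" using al by simp
        then have "4 * C * z \<le> 4 * C * (64 * (al * (2 * H)))" using C by (intro mult_left_mono) auto
        then show ?thesis using alH by (simp add: mult_ac)
      next
        case False
        have mp: "0 < real (m i)" using m1[of i] by simp
        have "4 * C * (L * (al * rt (x i))) \<le> real (m i)" using False unfolding m_def by (simp del: of_nat_Suc) linarith
        then have "4 * C * (L * (al * rt (x i))) / real (m i) \<le> 1" using mp by (simp add: pos_divide_le_eq)
        then show ?thesis by (simp add: z_def mult_ac)
      qed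
      have z1: "z \<le> 1"
      proof -
        have "1 * z \<le> 4 * C * z" using C z0 by (intro mult_right_mono) auto
        then show ?thesis using zs by linarith
      qed
      have "z ^ ?d \<le> z ^ 1" using z0 z1 dpos by (intro power_decreasing) auto
      then have "C * z ^ ?d \<le> C * z" using C by (intro mult_left_mono) auto
      then show ?thesis unfolding eq using zs by linarith
    qed
    have obi: "outer_prob_le (greedy_event a L (x i) (m i)) ((1 / 4) ^ (i + 1))" for i
    proof (rule outer_prob_le_mono[OF greedy_ob])
      show "0 < a" "0 < L" "0 \<le> x i" "1 \<le> m i" using a L x0[of i] m1[of i] by auto
      show "(\<integral>\<^sup>+ r. ennreal r * indicator {x i..} r \<partial>mu) \<le> ennreal (rt (x i) ^ ?d)" using rt(2) x0[of i] by simp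
      show "0 \<le> rt (x i) ^ ?d" using rx by simp
      have "(2 * exp 1 * 18 ^ ?d * (a * rt (x i) ^ ?d) * (L / real (m i)) ^ ?d) ^ m i \<le> (1 / 4) ^ m i"
        using small[of i] a rx L by (intro power_mono) auto
      also have "\<dots> \<le> (1 / 4) ^ (i + 1)" using m1[of i] by (intro power_decreasing) auto
      finally show "(2 * exp 1 * 18 ^ ?d * (a * rt (x i) ^ ?d) * (L / real (m i)) ^ ?d) ^ m i \<le> (1 / 4) ^ (i + 1)" .
    qed
    have "(\<lambda>i. (1 / 4 :: real) * (1 / 4) ^ i) sums ((1 / 4) * (1 / (1 - 1 / 4)))" by (intro sums_mult geometric_sums) simp
    then have "(\<lambda>i. (1 / 4 :: real) ^ (i + 1)) sums (1 / 3)" by simp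
    from outer_prob_le_UN_nat[OF obi this]
    show ?thesis
    proof (rule outer_prob_le_mono)
      fix w assume "\<exists>y. L + 1 \<le> norm y \<and> reach (chi w) (ball 0 1) (c * L) y"
      then obtain y where y: "L + 1 \<le> norm y" "reach (chi w) (ball 0 1) (c * L) y" by blast
      show "\<exists>i. greedy_event a L (x i) (m i) w"
      proof (rule ccontr)
        assume no: "\<not> ?thesis"
        have "y \<notin> ball 0 1" using y(1) L by simp
        then obtain ps where ps: "ps \<noteq> []" "set ps \<subseteq> chi w" "ctr (hd ps) \<in> ball 0 1" "links ps" "distinct (map ctr ps)"
          "norm (y - ctr (last ps)) < rd (last ps)" "sum_list (map tm ps) < c * L"
          using reach_chain_distinct[OF y(2)] nice_tm by blast
        have "norm y \<le> norm (y - ctr (hd ps)) + norm (ctr (hd ps))" using norm_triangle_ineq[of "y - ctr (hd ps)" "ctr (hd ps)"] by simp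
        then have "L \<le> sum_list (map rd ps)" using links_sum_dist[OF ps(1,4,6)] ps(3) y(1) by simp
        from prefix_reaching[OF this] L
        obtain bs b rest where pre: "ps = bs @ b # rest" "sum_list (map rd bs) < L" "L \<le> sum_list (map rd (bs @ [b]))" by auto
        define qs where "qs = bs @ [b]"
        have psq: "ps = qs @ rest" by (simp add: pre(1) qs_def)
        have qne: "qs \<noteq> []" by (simp add: qs_def)
        have lq: "links qs" using ps(4) unfolding psq links_append by blast
        have qchi: "set qs \<subseteq> chi w" using ps(2) by (simp add: psq)
        have qd: "distinct qs" using ps(5) by (simp add: psq distinct_map)
        have hq: "hd qs = hd ps" using qne by (simp add: psq)
        have rdp: "0 < rd p" if "p \<in> set qs" for p using nice_chi[of w] qchi that unfolding nice_def by blast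
        have tmp: "0 \<le> tm p" if "p \<in> set qs" for p using nice_tm qchi that by blast
        have tsum: "(\<Sum>p\<in>set qs. tm p) \<le> c * L"
        proof -
          have "0 \<le> sum_list (map tm rest)" using ps(2) chain_tm_nonneg[of rest w] by (auto simp: psq)
          then have "sum_list (map tm qs) \<le> c * L" using ps(7) by (simp add: psq)
          then show ?thesis using qd by (simp add: sum_list_distinct_conv_sum_set)
        qed
        have rsum: "L \<le> (\<Sum>p\<in>set qs. rd p)" using pre(3) qd unfolding qs_def[symmetric] by (simp add: sum_list_distinct_conv_sum_set)
        define xs where "xs = 0 # map ctr qs"
        have pl: "plen xs \<le> 2 * L"
        proof -
          have "plen xs = norm (ctr (hd qs)) + plen (map ctr qs)" using qne by (cases qs) (auto simp: xs_def)
          moreover have "plen (map ctr qs) \<le> sum_list (map rd bs)" using links_plen lq unfolding qs_def by blast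
          moreover have "norm (ctr (hd qs)) < 1" using ps(3) by (simp add: hq)
          ultimately show ?thesis using pre(2) L by linarith
        qed
        define P where "P i = {p\<in>set qs. tm p \<le> a * rd p \<and> x i < rd p}" for i
        have cP: "card (P i) < m i" for i
        proof (rule ccontr)
          assume "\<not> ?thesis"
          then have "greedy_event a L (x i) (m i) w"
            unfolding greedy_event_def using pl qchi by (intro exI[of _ xs] exI[of _ "P i"]) (auto simp: xs_def P_def)
          then show False using no by blast
        qed
        define F where "F = {p\<in>set qs. tm p \<le> a * rd p}"
        have slow: "(\<Sum>p\<in>set qs - F. rd p) \<le> L / 4"
        proof -
          have "(\<Sum>p\<in>set qs - F. rd p) \<le> (\<Sum>p\<in>set qs - F. tm p / a)"
            by (intro sum_mono) (use a in \<open>auto simp: F_def pos_le_divide_eq mult.commute less_imp_le not_le\<close>)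
          also have "\<dots> \<le> (\<Sum>p\<in>set qs. tm p / a)" using tmp a by (intro sum_mono2) auto
          also have "\<dots> = (\<Sum>p\<in>set qs. tm p) / a" by (simp only: sum_divide_distrib)
          also have "\<dots> \<le> (c * L) / a" using tsum a by (intro divide_right_mono) auto
          also have "\<dots> = L / 4" using a by (simp add: c_def)
          finally show ?thesis .
        qed
        have F0: "rd p \<le> X" if "p \<in> F" for p
        proof (rule ccontr)
          assume "\<not> ?thesis"
          then have "p \<in> P 0" using that by (simp add: P_def F_def x_def)
          moreover have "finite (P 0)" by (simp add: P_def)
          ultimately have "card (P 0) \<noteq> 0" by auto
          then show False using cP[of 0] by (simp add: m_def)
        qed
        obtain n where n: "\<And>p. p \<in> F \<Longrightarrow> x n < rd p"
        proof -
          have "\<exists>n. \<forall>p\<in>F. x n < rd p"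
          proof (cases "F = {}")
            case False
            have fF: "finite F" by (simp add: F_def)
            define mn where "mn = Min (rd ` F)"
            have mn: "0 < mn" unfolding mn_def using fF False rdp by (auto simp: F_def)
            obtain n where "(1 / 2) ^ n < mn / X" using real_arch_pow_inv[of "mn / X" "1 / 2"] mn X by auto
            then have "x n < mn" using X by (simp add: x_def field_simps)
            moreover have "mn \<le> rd p" if "p \<in> F" for p unfolding mn_def using fF that by (intro Min_le) auto
            ultimately show ?thesis by (intro exI[of _ n]) force
          qed simp
          then show ?thesis using that by blast
        qed
        have layer: "rd p \<le> (\<Sum>i<n. x i * (if x (Suc i) < rd p then 1 else 0))" if p: "p \<in> F" for p
        proof -
          have "rd p \<le> x 0" using F0[OF p] by (simp add: x_def)
          have "\<exists>i<n. x (Suc i) < rd p \<and> rd p \<le> x i"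
          proof (rule ccontr)
            assume no2: "\<not> ?thesis"
            have "i \<le> n \<Longrightarrow> rd p \<le> x i" for i
            proof (induction i)
              case 0 then show ?case using \<open>rd p \<le> x 0\<close> by simp
            next
              case (Suc i)
              then have "rd p \<le> x i" "i < n" by auto
              then have "\<not> x (Suc i) < rd p" using no2 by blast
              then show ?case by simp
            qed
            from this[of n] show False using n[OF p] by simp
          qed
          then obtain i where i: "i < n" "x (Suc i) < rd p" "rd p \<le> x i" by blast
          have "rd p \<le> x i * (if x (Suc i) < rd p then 1 else 0)" using i by simp
          also have "\<dots> \<le> (\<Sum>i<n. x i * (if x (Suc i) < rd p then 1 else 0))"
            using i(1) less_imp_le[OF x0] by (intro member_le_sum) auto
          finally show ?thesis .
        qed
        have fast: "(\<Sum>p\<in>F. rd p) \<le> 3 / 8 * L"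
        proof -
          have "(\<Sum>p\<in>F. rd p) \<le> (\<Sum>p\<in>F. \<Sum>i<n. x i * (if x (Suc i) < rd p then 1 else 0))" by (intro sum_mono layer)
          also have "\<dots> = (\<Sum>i<n. \<Sum>p\<in>F. x i * (if x (Suc i) < rd p then 1 else 0))" by (rule sum.swap)
          also have "\<dots> = (\<Sum>i<n. x i * real (card (P (Suc i))))"
          proof (rule sum.cong[OF refl])
            fix i
            have "(\<Sum>p\<in>F. x i * (if x (Suc i) < rd p then 1 else 0)) = x i * (\<Sum>p\<in>F. if x (Suc i) < rd p then 1 else 0)"
              by (simp only: sum_distrib_left)
            also have "(\<Sum>p\<in>F. if x (Suc i) < rd p then 1 else (0::real)) = real (card (F \<inter> {p. x (Suc i) < rd p}))"
              by (subst sum.inter_filter[symmetric]) (auto simp: F_def Int_def)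
            also have "F \<inter> {p. x (Suc i) < rd p} = P (Suc i)" by (auto simp: F_def P_def)
            finally show "(\<Sum>p\<in>F. x i * (if x (Suc i) < rd p then 1 else 0)) = x i * real (card (P (Suc i)))" .
          qed
          also have "\<dots> \<le> (\<Sum>i<n. 2 * X * ((real i + 3) / 2 ^ Suc i) + 8 * C * L * al * (x (Suc i) * rt (x (Suc i))))"
          proof (rule sum_mono)
            fix i
            have xi: "x i = 2 * x (Suc i)" by (simp add: x_def)
            have "real (card (P (Suc i))) \<le> real (m (Suc i))" using cP[of "Suc i"] by simp
            also have "\<dots> \<le> real i + 3 + 4 * C * (L * (al * rt (x (Suc i))))"
            proof -
              have "0 \<le> 4 * C * (L * (al * rt (x (Suc i))))" using C L al rx by simp
              then show ?thesis unfolding m_def by simp linarith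
            qed
            finally have "x i * real (card (P (Suc i))) \<le> x i * (real i + 3 + 4 * C * (L * (al * rt (x (Suc i)))))"
              using x0[of i] by (intro mult_left_mono) auto
            also have "\<dots> = x i * (real i + 3) + x i * (4 * C * (L * (al * rt (x (Suc i)))))" by (rule distrib_left)
            also have "x i * (real i + 3) = 2 * X * ((real i + 3) / 2 ^ Suc i)" by (simp add: x_def)
            also have "x i * (4 * C * (L * (al * rt (x (Suc i))))) = 8 * C * L * al * (x (Suc i) * rt (x (Suc i)))" unfolding xi by simp
            finally show "x i * real (card (P (Suc i))) \<le> 2 * X * ((real i + 3) / 2 ^ Suc i) + 8 * C * L * al * (x (Suc i) * rt (x (Suc i)))" .
          qed
          also have "\<dots> = 2 * X * (\<Sum>i<n. (real i + 3) / 2 ^ Suc i) + 8 * C * L * al * (\<Sum>i<n. x (Suc i) * rt (x (Suc i)))"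
            by (simp only: sum.distrib sum_distrib_left)
          also have "\<dots> \<le> 2 * X * 4 + 8 * C * L * al * (2 * H)"
          proof (intro add_mono mult_left_mono)
            show "(\<Sum>i<n. (real i + 3) / 2 ^ Suc i) \<le> 4" unfolding geometric_weights by simp
            have "(\<Sum>i<n. x (Suc i) * rt (x (Suc i))) = (\<Sum>i<n. (X / 2) / 2 ^ i * rt ((X / 2) / 2 ^ i))" by (simp add: x_def)
            also have "\<dots> \<le> 2 * H" by (rule rs) (use X in simp)
            finally show "(\<Sum>i<n. x (Suc i) * rt (x (Suc i))) \<le> 2 * H" .
          qed (use X C L al in auto)
          also have "\<dots> \<le> L / 8 + L / 4"
          proof (rule add_mono)
            have "16 * (C * (al * H)) \<le> 1 / 4" using alH by simp
            then have "16 * (C * (al * H)) * L \<le> 1 / 4 * L" using L by (intro mult_right_mono) auto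
            then show "8 * C * L * al * (2 * H) \<le> L / 4" by (simp add: mult_ac)
          qed (simp add: X_def)
          also have "\<dots> = 3 / 8 * L" by simp
          finally show ?thesis .
        qed
        have "(\<Sum>p\<in>set qs. rd p) = (\<Sum>p\<in>set qs - F. rd p) + (\<Sum>p\<in>F. rd p)"
          by (rule sum.subset_diff) (auto simp: F_def)
        then show False using slow fast rsum L by linarith
      qed
    qed simp
  qed
  then show ?thesis using c by blast
qed

lemma lam_pos:
  assumes fin: "(\<integral>\<^sup>+ x. tail_root mu DIM('a) x * indicator {0..} x \<partial>lborel) < \<infinity>"
  shows "0 < lam"
proof -
  obtain c where c: "0 < c" and outer_prob_le: "\<And>L. 1 \<le> L \<Longrightarrow> outer_prob_le (\<lambda>w. \<exists>y. L + 1 \<le> norm y \<and> reach (chi w) (ball 0 1) (c * L) y) (1 / 3)"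
    using linear_speed[OF fin] by blast
  define u where "u = (SOME b::'a. b \<in> Basis)"
  have u: "norm u = 1" unfolding u_def by (rule some_Basis)
  have big: "c * (real N - 1) / 2 \<le> mean_time 0 (real N *\<^sub>R u)" if N: "2 \<le> N" for N :: nat
  proof -
    define L where "L = real N - 1"
    have L: "1 \<le> L" using N by (simp add: L_def)
    define T where "T = (\<lambda>w. real (cover_time (chi w) 0 (real N *\<^sub>R u)))"
    have [measurable]: "T \<in> borel_measurable M" unfolding T_def by (rule real_cover_time_measurable)
    have "outer_prob_le (\<lambda>w. T w \<le> c * L) (1 / 3)"
    proof (rule outer_prob_le_AE_mono[OF outer_prob_le[OF L] _ order_refl])
      show "AE w in M. T w \<le> c * L \<longrightarrow> (\<exists>y. L + 1 \<le> norm y \<and> reach (chi w) (ball 0 1) (c * L) y)"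
        using cov_AE[of 0 "real N *\<^sub>R u"]
      proof eventually_elim
        case (elim w)
        show ?case
        proof
          assume T: "T w \<le> c * L"
          obtain s where "cov (chi w) 0 (real N *\<^sub>R u) s" using elim by blast
          then have "cov (chi w) 0 (real N *\<^sub>R u) (T w)" unfolding T_def by (rule cover_time_cov)
          then have "cball (real N *\<^sub>R u) 1 \<subseteq> {z. reach (chi w) (ball 0 1) (T w) z}" unfolding cov_def .
          then have "real N *\<^sub>R u \<in> {z. reach (chi w) (ball 0 1) (T w) z}" by (rule subsetD) simp
          then have "reach (chi w) (ball 0 1) (T w) (real N *\<^sub>R u)" by simp
          then have "reach (chi w) (ball 0 1) (c * L) (real N *\<^sub>R u)" using T by (rule reach_time_mono)
          moreover have "L + 1 \<le> norm (real N *\<^sub>R u)" using u by (simp add: L_def)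
          ultimately show "\<exists>y. L + 1 \<le> norm y \<and> reach (chi w) (ball 0 1) (c * L) y" by blast
        qed
      qed
    qed
    then have p: "prob {w\<in>space M. T w \<le> c * L} \<le> 1 / 3" by (rule outer_prob_le_prob)
    have "prob {w\<in>space M. \<not> T w \<le> c * L} = 1 - prob {w\<in>space M. T w \<le> c * L}"
      by (rule prob_neg) measurable
    then have p2: "1 / 2 \<le> prob {w\<in>space M. \<not> T w \<le> c * L}" using p by linarith
    have Am: "{w\<in>space M. \<not> T w \<le> c * L} \<in> events" by measurable
    have "c * L * (1 / 2) \<le> c * L * prob {w\<in>space M. \<not> T w \<le> c * L}" using p2 c L by (intro mult_left_mono) auto
    also have "\<dots> = expectation (\<lambda>w. c * L * indicat_real {w\<in>space M. \<not> T w \<le> c * L} w)" using Am by simp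
    also have "\<dots> \<le> expectation T"
    proof (rule integral_mono)
      show "integrable M (\<lambda>w. c * L * indicat_real {w\<in>space M. \<not> T w \<le> c * L} w)"
        using Am by (intro integrable_mult_right integrable_real_indicator) (auto simp: less_top[symmetric])
      show "integrable M T" unfolding T_def by (rule cover_time_integrable)
      fix w show "c * L * indicat_real {w\<in>space M. \<not> T w \<le> c * L} w \<le> T w" by (auto simp: indicator_def T_def)
    qed
    finally show ?thesis unfolding mean_time_def T_def[symmetric] by (simp add: L_def)
  qed
  have sub: "mean_time 0 (real (2 * n) *\<^sub>R u) \<le> 2 * mean_time 0 (real n *\<^sub>R u)" for n :: nat
  proof -
    let ?v = "real n *\<^sub>R u"
    have v2: "real (2 * n) *\<^sub>R u = ?v + ?v" by (simp add: scaleR_left_distrib[symmetric])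
    have "mean_time 0 (?v + ?v) \<le> expectation (\<lambda>w. real (cover_time (chi w) 0 ?v) + real (cover_time (chi w) ?v (?v + ?v)))"
      unfolding mean_time_def
    proof (rule integral_mono_AE)
      from cov_AE[of 0 ?v] cov_AE[of ?v "?v + ?v"]
      show "AE w in M. real (cover_time (chi w) 0 (?v + ?v)) \<le> real (cover_time (chi w) 0 ?v) + real (cover_time (chi w) ?v (?v + ?v))"
      proof eventually_elim
        case (elim w)
        then obtain s s' where "cov (chi w) 0 ?v s" "cov (chi w) ?v (?v + ?v) s'" by blast
        from of_nat_mono[OF cover_time_triangle[OF this], where 'a=real] show ?case by (simp only: of_nat_add)
      qed
    qed (intro Bochner_Integration.integrable_add cover_time_integrable)+
    also have "\<dots> = mean_time 0 ?v + mean_time ?v (?v + ?v)" unfolding mean_time_def by (rule Bochner_Integration.integral_add[OF cover_time_integrable cover_time_integrable])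
    also have "mean_time ?v (?v + ?v) = mean_time 0 ?v" using mean_time_shift[of 0 ?v ?v] by simp
    finally show ?thesis unfolding v2 by simp
  qed
  have "c / 4 \<le> lam" unfolding lam_def
  proof (rule cINF_greatest[OF UNIV_not_empty])
    fix n :: nat
    have "c * (real (2 * Suc n) - 1) / 2 \<le> 2 * mean_time 0 (real (Suc n) *\<^sub>R u)" using big[of "2 * Suc n"] sub[of "Suc n"] by simp
    moreover have "c * real (Suc n) \<le> c * (real (2 * Suc n) - 1)" using c by (intro mult_left_mono) auto
    ultimately have "c / 4 * real (Suc n) \<le> mean_time 0 (real (Suc n) *\<^sub>R u)" by linarith
    then show "c / 4 \<le> mean_time 0 (real (Suc n) *\<^sub>R (SOME b. b \<in> Basis)) / real (Suc n)"
      unfolding u_def by (simp only: pos_le_divide_eq of_nat_0_less_iff zero_less_Suc)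
  qed
  then show ?thesis using c by simp
qed

end

section \<open>Infinite moments\<close>

context deijfen_process begin

text \<open>The sets of points at scale \<open>2 ^ k\<close> are disjoint for different \<open>k\<close> and their intensities have an infinite sum.\<close>

lemma big_points:
  assumes I: "(\<integral>\<^sup>+ r. ennreal (r ^ (DIM('a) + 1)) \<partial>mu) = \<infinity>" and h: "0 < h"
  shows "AE w in M. \<forall>K::nat. \<exists>k\<ge>K. \<exists>c t r. (c, t, r) \<in> chi w \<and> norm c \<le> h * 2 ^ k \<and> t \<le> h * 2 ^ k \<and> 2 ^ k < r"
proof -
  define D where "D = DIM('a) + 1"
  define J where "J k = {2 ^ k<..2 ^ Suc k :: real}" for k :: nat
  define V where "V k = {..h * 2 ^ k} \<times> J k" for k :: nat
  define U where "U k = cball (0::'a) (h * 2 ^ k) \<times> V k" for k :: nat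
  define v where "v = unit_ball_vol (real DIM('a))"
  define a where "a k = v * h ^ D * ((2 ^ k) ^ D * measure mu (J k))" for k :: nat
  have v: "0 < v" unfolding v_def by (rule unit_ball_vol_pos) simp
  have a0: "0 \<le> a k" for k unfolding a_def using v h by (intro mult_nonneg_nonneg) auto
  have Jb: "J k \<in> sets borel" for k unfolding J_def by simp
  have Vb: "V k \<in> sets borel" for k unfolding V_def borel_prod[symmetric] using Jb by (intro pair_measureI) auto
  have Ub: "U k \<in> sets borel" for k
  proof -
    have "U k \<in> sets (borel \<Otimes>\<^sub>M borel)" unfolding U_def using Vb by (intro pair_measureI) auto
    then show ?thesis unfolding borel_prod .
  qed
  have emU: "emeasure N (U k) = ennreal (a k)" for k
  proof -
    have h0: "0 \<le> h * 2 ^ k" using h by simp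
    have "{..h * 2 ^ k} \<inter> {0..} = {0..h * 2 ^ k}" by auto
    then have "emeasure (time_measure \<Otimes>\<^sub>M mu) (V k) = ennreal (h * 2 ^ k) * ennreal (measure mu (J k))"
      unfolding V_def using h0 Jb by (subst R.emeasure_time_mu_Times) (auto simp: R.emeasure_eq_measure)
    then have "emeasure N (U k) = ennreal (v * (h * 2 ^ k) ^ DIM('a)) * (ennreal (h * 2 ^ k) * ennreal (measure mu (J k)))"
      unfolding U_def v_def using Vb h0 by (subst R.emeasure_intensity_Times) (auto simp: emeasure_cball)
    also have "\<dots> = ennreal (v * (h * 2 ^ k) ^ DIM('a) * (h * 2 ^ k * measure mu (J k)))"
      using v h0 by (simp add: ennreal_mult' ennreal_mult)
    also have "v * (h * 2 ^ k) ^ DIM('a) * (h * 2 ^ k * measure mu (J k)) = a k"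
      unfolding a_def D_def by (simp add: power_mult_distrib)
    finally show ?thesis .
  qed
  have mU: "measure N (U k) = a k" for k unfolding measure_def emU using a0 by simp
  have disj: "disjoint_family U"
  proof -
    have dJ: "J i \<inter> J j = {}" if "i < j" for i j
    proof -
      have "(2::real) ^ Suc i \<le> 2 ^ j" using that by (intro power_increasing) auto
      then show ?thesis unfolding J_def by auto
    qed
    have "U i \<inter> U j = {}" if "i \<noteq> j" for i j
      using dJ[of i j] dJ[of j i] that unfolding U_def V_def by (cases "i < j") auto
    then show ?thesis unfolding disjoint_family_on_def by blast
  qed
  have div: "\<not> summable a"
  proof
    assume "summable a"
    then have "summable (\<lambda>k. a k * (2 ^ D / (v * h ^ D)))" by (rule summable_mult2)
    moreover have "a k * (2 ^ D / (v * h ^ D)) = (2 ^ Suc k) ^ D * measure mu (J k)" for k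
      unfolding a_def using v h by (simp add: power_mult_distrib)
    ultimately have sm: "summable (\<lambda>k. (2 ^ Suc k) ^ D * measure mu (J k))" by (simp only:)
    have pos: "AE r in mu. 0 < r"
    proof (rule R.AE_prob_1[of "{0<..}", THEN AE_mp])
      show "measure mu {0<..} = 1" using R.mu_pos by (simp add: measure_def)
    qed auto
    have term_le: "f k \<le> (\<Sum>k. f k)" for f :: "nat \<Rightarrow> ennreal" and k
      using sum_le_suminf[of f "{k}"] by simp
    have "(\<integral>\<^sup>+ r. ennreal (r ^ D) \<partial>mu) \<le> (\<integral>\<^sup>+ r. 1 + (\<Sum>k. ennreal ((2 ^ Suc k) ^ D) * indicator (J k) r) \<partial>mu)"
    proof (rule nn_integral_mono_AE, use pos in eventually_elim)
      fix r :: real assume r: "0 < r"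
      show "ennreal (r ^ D) \<le> 1 + (\<Sum>k. ennreal ((2 ^ Suc k) ^ D) * indicator (J k) r)"
      proof (cases "r \<le> 1")
        case True
        then have "r ^ D \<le> 1" using r by (intro power_le_one) auto
        then have "ennreal (r ^ D) \<le> 1" by (simp add: ennreal_le_1)
        then show ?thesis by (rule order_trans) simp
      next
        case False
        obtain n where n: "r < 2 ^ n" using real_arch_pow[of 2 r] by auto
        define n1 where "n1 = (LEAST n. r \<le> 2 ^ n)"
        have n1: "r \<le> 2 ^ n1" unfolding n1_def by (rule LeastI[of "\<lambda>n. r \<le> 2 ^ n", OF less_imp_le[OF n]])
        then obtain k where k: "n1 = Suc k" using False by (cases n1) auto
        have "\<not> r \<le> 2 ^ k" using k not_less_Least[of k "\<lambda>n. r \<le> 2 ^ n"] unfolding n1_def[symmetric] by simp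
        then have rJ: "r \<in> J k" using n1 unfolding J_def k by simp
        have "r ^ D \<le> (2 ^ Suc k) ^ D" using r n1 unfolding k by (intro power_mono) auto
        from ennreal_leI[OF this] have "ennreal (r ^ D) \<le> ennreal ((2 ^ Suc k) ^ D) * indicator (J k) r"
          using rJ by (simp only: indicator_simps mult_1_right)
        also have "\<dots> \<le> (\<Sum>k. ennreal ((2 ^ Suc k) ^ D) * indicator (J k) r)"
          by (rule term_le)
        finally show ?thesis by (rule order_trans) simp
      qed
    qed
    also have "\<dots> = (\<integral>\<^sup>+ r. 1 \<partial>mu) + (\<integral>\<^sup>+ r. (\<Sum>k. ennreal ((2 ^ Suc k) ^ D) * indicator (J k) r) \<partial>mu)"
      using Jb R.sets_mu by (intro nn_integral_add) auto
    also have "(\<integral>\<^sup>+ r. (\<Sum>k. ennreal ((2 ^ Suc k) ^ D) * indicator (J k) r) \<partial>mu) = (\<Sum>k. \<integral>\<^sup>+ r. ennreal ((2 ^ Suc k) ^ D) * indicator (J k) r \<partial>mu)"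
      using Jb R.sets_mu by (intro nn_integral_suminf) auto
    also have "\<dots> = (\<Sum>k. ennreal ((2 ^ Suc k) ^ D * measure mu (J k)))"
      using Jb R.sets_mu by (intro suminf_cong) (simp add: nn_integral_cmult_indicator R.emeasure_eq_measure ennreal_mult)
    also have "\<dots> = ennreal (\<Sum>k. (2 ^ Suc k) ^ D * measure mu (J k))"
      by (rule suminf_ennreal2[OF _ sm]) simp
    also have "(\<integral>\<^sup>+ r. 1 \<partial>mu) + \<dots> < \<infinity>" using R.emeasure_space_1 by simp
    finally show False using I unfolding D_def by simp
  qed
  have "AE w in M. \<exists>k\<ge>K. chi w \<inter> U k \<noteq> {}" for K
  proof -
    have "AE w in M. \<not> (\<forall>k\<ge>K. chi w \<inter> U k = {})"
    proof (rule outer_prob_le_null)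
      fix e :: real assume e: "0 < e"
      have "\<exists>L. (\<Sum>k\<in>{K..<L}. a k) \<ge> - ln e"
      proof (rule ccontr)
        assume "\<nexists>L. - ln e \<le> sum a {K..<L}"
        then have b: "sum a {K..<L} \<le> - ln e" for L using linear by blast
        have "sum a {..<n} \<le> sum a {..<K} + (- ln e)" for n
        proof -
          have "sum a {..<n} \<le> sum a ({..<K} \<union> {K..<n})" using a0 by (intro sum_mono2) auto
          also have "\<dots> = sum a {..<K} + sum a {K..<n}" by (intro sum.union_disjoint) auto
          finally show ?thesis using b[of n] by linarith
        qed
        then have "sum a {..n} \<le> sum a {..<K} + (- ln e)" for n unfolding lessThan_Suc_atMost[symmetric] .
        with a0 have "summable a" by (rule bounded_imp_summable)
        with div show False by simp
      qed
      then obtain L where L: "- ln e \<le> (\<Sum>k\<in>{K..<L}. a k)" by blast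
      let ?B = "{w \<in> space M. \<forall>k\<in>{K..<L}. card (chi w \<inter> U k) = 0}"
      have pB: "prob ?B = exp (- (\<Sum>k\<in>{K..<L}. a k))"
      proof -
        have "prob ?B = (\<Prod>k\<in>{K..<L}. pois (measure N (U k)) 0)"
          using count_joint_finite[of "{K..<L}" U "\<lambda>_. 0"] Ub emU disjoint_family_on_mono[OF subset_UNIV disj] by simp
        then show ?thesis by (simp add: pois_def mU exp_sum sum_negf[symmetric])
      qed
      show "outer_prob_le (\<lambda>w. \<forall>k\<ge>K. chi w \<inter> U k = {}) e"
      proof (rule outer_prob_leI[of ?B])
        show "?B \<in> events"
        proof (rule ccontr)
          assume "?B \<notin> events"
          then have "prob ?B = 0" by (rule measure_notin_sets)
          then show False unfolding pB by simp
        qed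
        show "prob ?B \<le> e"
        proof -
          have "exp (- (\<Sum>k\<in>{K..<L}. a k)) \<le> exp (ln e)" using L by (simp only: exp_le_cancel_iff)
          then show ?thesis using e pB by simp
        qed
      qed auto
    qed
    then show ?thesis by simp
  qed
  then have "AE w in M. \<forall>K. \<exists>k\<ge>K. chi w \<inter> U k \<noteq> {}" unfolding AE_all_countable by blast
  then show ?thesis
  proof eventually_elim
    case (elim w)
    show ?case
    proof
      fix K
      obtain k p where k: "k \<ge> K" "p \<in> chi w" "p \<in> U k" using elim by blast
      obtain c t r where p: "p = (c, t, r)" by (cases p)
      have "norm c \<le> h * 2 ^ k" "t \<le> h * 2 ^ k" "2 ^ k < r" using k(3) unfolding p U_def V_def J_def by auto
      then show "\<exists>k\<ge>K. \<exists>c t r. (c, t, r) \<in> chi w \<and> norm c \<le> h * 2 ^ k \<and> t \<le> h * 2 ^ k \<and> 2 ^ k < r"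
        using k(1,2) unfolding p by blast
    qed
  qed
qed

lemma lam_zero:
  assumes I: "(\<integral>\<^sup>+ r. ennreal (r ^ (DIM('a) + 1)) \<partial>mu) = \<infinity>"
  shows "lam = 0"
proof (rule ccontr)
  assume "lam \<noteq> 0"
  then have lam: "0 < lam" using lam_nonneg by linarith
  obtain K where K: "K > 0" and cf: "\<And>rho1 del. rho1 > 0 \<Longrightarrow> del > 0 \<Longrightarrow> AE w in M. \<exists>n0. \<forall>n\<ge>n0. \<forall>x y A. norm x \<le> 3 * real n \<longrightarrow> norm (x - y) \<le> del * real n \<longrightarrow>
     ball x rho1 \<subseteq> A \<longrightarrow> reach (chi w) A (K * del * real n) y"
    using cover_fast by auto
  define h where "h = min (1 / 4) (lam / (4 * (K + 2)))"
  have h: "0 < h" "h \<le> 1 / 4" "(K + 2) * h \<le> lam / 4"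
  proof -
    show "0 < h" using K lam by (simp add: h_def)
    show "h \<le> 1 / 4" unfolding h_def by (rule min.cobounded1)
    have "(K + 2) * h \<le> (K + 2) * (lam / (4 * (K + 2)))" unfolding h_def using K by (intro mult_left_mono) auto
    also have "\<dots> = lam / 4" using K by (simp add: divide_simps)
    finally show "(K + 2) * h \<le> lam / 4" .
  qed
  obtain u :: 'a where u: "norm u = 1" using vector_choose_size[of 1] by auto
  have l2: "0 < lam / 2" "lam / 2 < lam" using lam by auto
  from lower_speed[OF l2] big_points[OF I h(1)] cf[OF zero_less_one h(1)]
  have "AE w in M. False"
  proof eventually_elim
    case (elim w)
    obtain r0 where r0: "\<And>y. r0 \<le> norm y \<Longrightarrow> \<not> reach (chi w) (ball 0 1) ((lam - lam / 2) * norm y) y" using elim(1) by blast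
    obtain n0 where n0: "\<And>n x y A. n \<ge> n0 \<Longrightarrow> norm x \<le> 3 * real n \<Longrightarrow> norm (x - y) \<le> h * real n \<Longrightarrow> ball x 1 \<subseteq> A \<Longrightarrow> reach (chi w) A (K * h * real n) y"
      using elim(3) by blast
    obtain m :: nat where m: "2 * r0 \<le> real m" using real_arch_simple by blast
    obtain k c t r where k: "max n0 m \<le> k" "(c, t, r) \<in> chi w" "norm c \<le> h * 2 ^ k" "t \<le> h * 2 ^ k" "2 ^ k < r"
      using elim(2) by blast
    define n where "n = (2::nat) ^ k"
    have rn: "real n = 2 ^ k" by (simp add: n_def)
    have "k < n" unfolding n_def by (rule less_exp)
    then have n: "n0 \<le> n" "m \<le> n" using k(1) by auto
    have n1: "0 < real n" by (simp add: n_def)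
    have rc: "reach (chi w) (ball 0 1) (K * h * real n) c"
      using n(1) k(3) by (intro n0[of n 0]) (auto simp: rn)
    define y where "y = (real n / 2) *\<^sub>R u"
    have ny: "norm y = real n / 2" using u n1 by (simp add: y_def)
    have "norm (y - c) \<le> real n / 2 + h * real n" using norm_triangle_ineq4[of y c] k(3) ny by (simp add: rn)
    also have "\<dots> \<le> real n / 2 + 1 / 4 * real n" using h(2) by (intro add_left_mono mult_right_mono) auto
    also have "\<dots> < r" using k(5) n1 unfolding rn by linarith
    finally have yc: "norm (y - c) < r" .
    have "K * h * real n + t < (K + 2) * h * real n"
    proof -
      have "0 < h * real n" using h(1) n1 by simp
      then show ?thesis using k(4) by (simp add: rn algebra_simps)
    qed
    also have "\<dots> \<le> lam / 4 * real n" using h(3) n1 by (intro mult_right_mono) auto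
    also have "\<dots> = (lam - lam / 2) * norm y" by (simp add: ny)
    finally have "K * h * real n + t < (lam - lam / 2) * norm y" .
    from reach_step[OF rc k(2) yc this] have "reach (chi w) (ball 0 1) ((lam - lam / 2) * norm y) y" .
    moreover have "r0 \<le> norm y" using m n(2) by (simp add: ny)
    ultimately show False using r0 by blast
  qed
  then show False by simp
qed

end

section \<open>The asymptotic shape\<close>

lemma emeasure_lborel_scale:
  fixes U :: "'a::euclidean_space set"
  assumes c: "0 < c" and U: "U \<in> sets borel"
  shows "emeasure lborel ((\<lambda>x. c *\<^sub>R x) -` U) = ennreal (1 / c ^ DIM('a)) * emeasure lborel U"
proof -
  have m: "(\<lambda>x::'a. 0 + c *\<^sub>R x) \<in> measurable lborel borel" by simp
  have "emeasure lborel U = emeasure (density (distr lborel borel (\<lambda>x::'a. 0 + c *\<^sub>R x)) (\<lambda>_. ennreal (\<bar>c\<bar> ^ DIM('a)))) U"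
    using lborel_affine[of c "0::'a"] c by simp
  also have "\<dots> = ennreal (c ^ DIM('a)) * emeasure lborel ((\<lambda>x. c *\<^sub>R x) -` U)"
    using U c by (simp add: emeasure_density_const emeasure_distr)
  finally have "ennreal (1 / c ^ DIM('a)) * emeasure lborel U = ennreal (1 / c ^ DIM('a)) * ennreal (c ^ DIM('a)) * emeasure lborel ((\<lambda>x. c *\<^sub>R x) -` U)"
    by (simp add: mult.assoc)
  also have "ennreal (1 / c ^ DIM('a)) * ennreal (c ^ DIM('a)) = 1"
    using c by (simp add: ennreal_mult'[symmetric])
  finally show ?thesis by simp
qed

lemma emeasure_time_scale:
  assumes k: "0 < k" and U: "U \<in> sets borel"
  shows "emeasure time_measure ((\<lambda>t. k * t) -` U) = ennreal (1 / k) * emeasure time_measure U"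
proof -
  have m: "(\<lambda>t::real. k * t) -` U \<in> sets borel" using measurable_sets[of "\<lambda>t::real. k * t" borel borel U] U by simp
  have "(\<lambda>t. k * t) -` U \<inter> {0..} = (\<lambda>t. k *\<^sub>R t) -` (U \<inter> {0..})" using k by (auto simp: zero_le_mult_iff)
  then show ?thesis using emeasure_lborel_scale[OF k, of "U \<inter> {0..}"] U m by (simp add: emeasure_time)
qed

lemma reach_scale:
  fixes X :: "('a::euclidean_space \<times> real \<times> real) set"
  assumes "reach ((\<lambda>(c, t, r). (c, t, s * r)) ` X) (cball 0 1) a y" and s: "1 < s"
  shows "reach ((\<lambda>(c, t, r). (c /\<^sub>R s, s ^ DIM('a) * t, r)) ` X) (ball 0 1) (s ^ DIM('a) * a) (y /\<^sub>R s)"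
  using assms(1)
proof (induction rule: reach.induct)
  case (reach_base y a)
  have "norm y \<le> 1" using reach_base by simp
  then have "norm y / s < 1" using s by simp
  then have "y /\<^sub>R s \<in> ball 0 1" using s by (simp add: divide_inverse mult.commute)
  then show ?case using reach_base s by (intro reach.reach_base) auto
next
  case (reach_step a c t r y a')
  from reach_step.hyps(2) obtain r0 where r0: "(c, t, r0) \<in> X" "r = s * r0" by auto
  have "norm (y /\<^sub>R s - c /\<^sub>R s) = norm (y - c) / s"
    using s by (simp add: scaleR_right_diff_distrib[symmetric] divide_inverse mult.commute)
  also have "\<dots> < r0" using reach_step.hyps(3) s by (simp add: r0(2) pos_divide_less_eq mult.commute)
  finally have 1: "norm (y /\<^sub>R s - c /\<^sub>R s) < r0" .
  have 2: "(c /\<^sub>R s, s ^ DIM('a) * t, r0) \<in> (\<lambda>(c, t, r). (c /\<^sub>R s, s ^ DIM('a) * t, r)) ` X"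
    using r0(1) by (rule rev_image_eqI) simp
  have "s ^ DIM('a) * (a + t) < s ^ DIM('a) * a'" using reach_step.hyps(4) s by (intro mult_strict_left_mono) auto
  then have 3: "s ^ DIM('a) * a + s ^ DIM('a) * t < s ^ DIM('a) * a'" by (simp add: distrib_left)
  show ?case by (rule reach.reach_step[OF reach_step.IH 2 1 3])
qed

context deijfen_process begin

text \<open>The map \<open>(c, t, r) \<mapsto> (c / s, s\<^sup>d t, r)\<close> preserves the intensity, so the rescaled process has the same \<open>lam\<close>.\<close>

lemma scaled_lower_speed:
  assumes s: "1 < s" and e: "0 < e" "e < lam"
  shows "AE w in M. \<exists>r0. \<forall>y. r0 \<le> norm y \<longrightarrow>
    \<not> reach ((\<lambda>(c, t, r). (c /\<^sub>R s, s ^ DIM('a) * t, r)) ` chi w) (ball 0 1) ((lam - e) * norm y) y"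
proof -
  let ?g = "\<lambda>(c::'a, t::real, r::real). (c /\<^sub>R s, s ^ DIM('a) * t, r)"
  have s0: "0 < s" using s by simp
  have k: "0 < s ^ DIM('a)" using s0 by simp
  have inj: "inj (\<lambda>x::'a. x /\<^sub>R s)" using s0 by (auto simp: inj_def)
  have p: "ppp M N (\<lambda>w. ?g ` chi w)"
  proof (rule ppp_image)
    show "inj ?g" using s0 by (auto simp: inj_def)
    show "?g \<in> measurable borel borel" unfolding borel_prod[symmetric] by measurable
    show "distr N borel ?g = N"
    proof (rule R.intensity_invariant[OF _ _ k])
      fix U :: "'a set" assume "U \<in> sets borel"
      then show "emeasure lborel ((\<lambda>c. c /\<^sub>R s) -` U) = ennreal (s ^ DIM('a)) * emeasure lborel U"
        using emeasure_lborel_scale[of "inverse s" U] s0 by (simp add: power_one_over inverse_eq_divide)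
    next
      fix U :: "real set" assume "U \<in> sets borel"
      then show "emeasure time_measure ((\<lambda>t. s ^ DIM('a) * t) -` U) = ennreal (1 / s ^ DIM('a)) * emeasure time_measure U"
        by (rule emeasure_time_scale[OF k])
    qed auto
    fix X :: "('a \<times> real \<times> real) set" assume X: "nice X"
    have "norm x \<le> s * norm (x /\<^sub>R s) + 0" for x :: 'a using s0 by (simp add: mult.assoc[symmetric])
    from nice_image[OF X k inj this] show "nice (?g ` X)" using s0 by simp
  qed
  interpret S: deijfen_process mu M "\<lambda>w. ?g ` chi w" by (rule deijfen_process.intro[OF R.radius_law_axioms p])
  have law: "distr M nconf (\<lambda>w. ?g ` chi w) = distr M nconf chi"
    by (rule ppp_law_unique[OF p ppp_axioms])
  have "S.mean_time x y = mean_time x y" for x y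
  proof -
    have "S.mean_time x y = integral\<^sup>L (distr M nconf (\<lambda>w. ?g ` chi w)) (\<lambda>X. real (cover_time X x y))"
      unfolding S.mean_time_def by (rule integral_distr[symmetric, OF S.chi_measurable real_cover_time_nconf])
    also have "\<dots> = mean_time x y" unfolding law mean_time_def by (rule integral_distr[OF chi_measurable real_cover_time_nconf])
    finally show ?thesis .
  qed
  then have "S.lam = lam" unfolding S.lam_def lam_def by simp
  with S.lower_speed[of e] e show ?thesis by simp
qed

lemma covered_inner:
  "AE w in M. \<forall>m. lam * m < 1 \<longrightarrow> (\<exists>t0. \<forall>t\<ge>t0. cball 0 m \<subseteq> (\<lambda>x. (1 / t) *\<^sub>R x) ` covered (chi w) t)"
proof -
  have "AE w in M. \<forall>n::nat. \<exists>t0. \<forall>t\<ge>t0. \<forall>y. (lam + 1 / real (Suc n)) * norm y \<le> t \<longrightarrow> reach (chi w) (ball 0 1) t y"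
    unfolding AE_all_countable using upper_speed by simp
  then show ?thesis
  proof eventually_elim
    case (elim w)
    show ?case
    proof (intro allI impI)
      fix m :: real assume m: "lam * m < 1"
      have "\<exists>n. (lam + 1 / real (Suc n)) * m \<le> 1"
      proof (cases "m \<le> 0")
        case True
        have "(lam + 1 / real (Suc 0)) * m \<le> 0" using True lam_nonneg by (intro mult_nonneg_nonpos) auto
        then show ?thesis by (intro exI[of _ 0]) linarith
      next
        case False
        obtain n :: nat where n: "m / (1 - lam * m) \<le> real n" using real_arch_simple by blast
        then have "m / (1 - lam * m) \<le> real (Suc n)" by simp
        then have "m \<le> real (Suc n) * (1 - lam * m)" using m by (simp only: pos_divide_le_eq diff_gt_0_iff_gt)
        then have "m / real (Suc n) \<le> 1 - lam * m" by (subst pos_divide_le_eq) (simp_all only: of_nat_0_less_iff zero_less_Suc mult.commute)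
        then show ?thesis by (intro exI[of _ n]) (simp add: distrib_right del: of_nat_Suc)
      qed
      then obtain n where n: "(lam + 1 / real (Suc n)) * m \<le> 1" by blast
      obtain t0 where t0: "\<And>t y. t0 \<le> t \<Longrightarrow> (lam + 1 / real (Suc n)) * norm y \<le> t \<Longrightarrow> reach (chi w) (ball 0 1) t y"
        using elim by blast
      show "\<exists>t0. \<forall>t\<ge>t0. cball 0 m \<subseteq> (\<lambda>x. (1 / t) *\<^sub>R x) ` covered (chi w) t"
      proof (intro exI[of _ "max 1 t0"] allI impI subsetI)
        fix t and z :: 'a assume t: "max 1 t0 \<le> t" and z: "z \<in> cball 0 m"
        have tp: "0 < t" using t by simp
        have "(lam + 1 / real (Suc n)) * norm (t *\<^sub>R z) = t * ((lam + 1 / real (Suc n)) * norm z)" using tp by simp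
        also have "\<dots> \<le> t * ((lam + 1 / real (Suc n)) * m)" using tp z lam_nonneg by (intro mult_left_mono) auto
        also have "\<dots> \<le> t * 1" using tp n by (intro mult_left_mono) auto
        finally have "(lam + 1 / real (Suc n)) * norm (t *\<^sub>R z) \<le> t" by simp
        with t have "reach (chi w) (ball 0 1) t (t *\<^sub>R z)" by (intro t0) auto
        then have r: "reach (chi w) (cball 0 1) t (t *\<^sub>R z)" by (rule reach_mono) auto
        have "set_time (chi w) (cball 0 1) (t *\<^sub>R z) \<le> ennreal t"
          by (rule reach_imp_set_time_le[OF r]) (use nice_tm[of _ w] in fastforce)
        then have "t *\<^sub>R z \<in> covered (chi w) t" by (simp add: covered_def)
        then show "z \<in> (\<lambda>x. (1 / t) *\<^sub>R x) ` covered (chi w) t" using tp by (intro rev_image_eqI[of "t *\<^sub>R z"]) auto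
      qed
    qed
  qed
qed

lemma covered_outer:
  assumes lam: "0 < lam"
  shows "AE w in M. \<forall>eps>0. \<exists>t0. \<forall>t\<ge>t0. (\<lambda>x. (1 / t) *\<^sub>R x) ` covered (chi w) t \<subseteq> cball 0 ((1 + eps) / lam)"
proof -
  define s where "s n = 1 + 1 / real (Suc n)" for n
  have s1: "1 < s n" for n by (simp add: s_def)
  have "AE w in M. \<exists>r0. \<forall>y. r0 \<le> norm y \<longrightarrow>
    \<not> reach ((\<lambda>(c, t, r). (c /\<^sub>R s n, s n ^ DIM('a) * t, r)) ` chi w) (ball 0 1) (lam / s n * norm y) y" for n
  proof -
    have "0 < lam - lam / s n" "lam - lam / s n < lam" using lam s1[of n] by (auto simp: pos_divide_less_eq)
    from scaled_lower_speed[OF s1 this] show ?thesis by simp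
  qed
  then have "AE w in M. \<forall>n. \<exists>r0. \<forall>y. r0 \<le> norm y \<longrightarrow>
    \<not> reach ((\<lambda>(c, t, r). (c /\<^sub>R s n, s n ^ DIM('a) * t, r)) ` chi w) (ball 0 1) (lam / s n * norm y) y"
    unfolding AE_all_countable by blast
  then show ?thesis
  proof eventually_elim
    case (elim w)
    show ?case
    proof (intro allI impI)
      fix eps :: real assume eps: "0 < eps"
      have "(\<lambda>n. s n ^ (DIM('a) + 2)) \<longlonglongrightarrow> (1 + 0) ^ (DIM('a) + 2)"
        unfolding s_def using LIMSEQ_inverse_real_of_nat by (intro tendsto_intros) (simp add: inverse_eq_divide)
      then have "\<forall>\<^sub>F n in sequentially. s n ^ (DIM('a) + 2) < 1 + eps / 2"
        by (rule order_tendstoD) (use eps in simp)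
      then obtain n where n: "s n ^ (DIM('a) + 2) < 1 + eps / 2" unfolding eventually_sequentially by blast
      define q where "q = s n"
      have q: "1 < q" "q ^ (DIM('a) + 2) < 1 + eps / 2" using s1 n by (auto simp: q_def)
      obtain r0 where r0: "\<And>y. r0 \<le> norm y \<Longrightarrow>
        \<not> reach ((\<lambda>(c, t, r). (c /\<^sub>R q, q ^ DIM('a) * t, r)) ` chi w) (ball 0 1) (lam / q * norm y) y"
        using elim unfolding q_def by blast
      show "\<exists>t0. \<forall>t\<ge>t0. (\<lambda>x. (1 / t) *\<^sub>R x) ` covered (chi w) t \<subseteq> cball 0 ((1 + eps) / lam)"
      proof (intro exI[of _ "max (2 / eps + 1) (lam * (q * r0))"] allI impI subsetI)
        fix t and z assume t: "max (2 / eps + 1) (lam * (q * r0)) \<le> t"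
          and "z \<in> (\<lambda>x. (1 / t) *\<^sub>R x) ` covered (chi w) t"
        then obtain x where x: "x \<in> covered (chi w) t" "z = (1 / t) *\<^sub>R x" by blast
        have t1: "2 / eps + 1 \<le> t" "lam * (q * r0) \<le> t" using t by auto
        have "0 < 2 / eps" using eps by simp
        then have tp: "0 < t" using t1 by linarith
        have nx: "lam * norm x \<le> (1 + eps) * t"
        proof (cases "q * r0 \<le> norm x")
          case False
          then have "lam * norm x \<le> lam * (q * r0)" using lam by (intro mult_left_mono) auto
          also have "\<dots> \<le> 1 * t" using t1(2) by simp
          also have "\<dots> \<le> (1 + eps) * t" using eps tp by (intro mult_right_mono) auto
          finally show ?thesis .
        next
          case True
          have "set_time (chi w) (cball 0 1) x \<le> ennreal t" using x(1) by (simp add: covered_def)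
          also have "\<dots> < ennreal (t + 1)" using tp by (simp add: ennreal_lessI)
          finally have "reach ((\<lambda>(c, t, r). (c, t, (1 + (q - 1)) * r)) ` chi w) (cball 0 1) (t + 1) x"
            by (rule set_time_less_imp_reach) (use nice_chi[of w] q(1) in \<open>auto simp: nice_def\<close>)
          then have "reach ((\<lambda>(c, t, r). (c, t, q * r)) ` chi w) (cball 0 1) (t + 1) x" by simp
          from reach_scale[OF this q(1)]
          have re: "reach ((\<lambda>(c, t, r). (c /\<^sub>R q, q ^ DIM('a) * t, r)) ` chi w) (ball 0 1) (q ^ DIM('a) * (t + 1)) (x /\<^sub>R q)" .
          have nq: "norm (x /\<^sub>R q) = norm x / q" using q(1) by (simp add: divide_inverse mult.commute)
          have "r0 \<le> norm (x /\<^sub>R q)" unfolding nq using True q(1) by (simp add: pos_le_divide_eq mult.commute)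
          from r0[OF this] have "\<not> q ^ DIM('a) * (t + 1) \<le> lam / q * (norm x / q)"
            using reach_time_mono[OF re] unfolding nq by blast
          then have "lam * norm x / (q * q) < q ^ DIM('a) * (t + 1)" by simp
          then have "lam * norm x < q ^ (DIM('a) + 2) * (t + 1)" using q(1) by (simp add: pos_divide_less_eq mult.assoc mult.left_commute mult.commute)
          also have "\<dots> \<le> (1 + eps / 2) * (t + 1)" using q(2) tp by (intro mult_right_mono) auto
          also have "\<dots> \<le> (1 + eps) * t"
          proof -
            have "(2 / eps + 1) * (eps / 2) \<le> t * (eps / 2)" using t1(1) eps by (intro mult_right_mono) auto
            then have "1 + eps / 2 \<le> t * (eps / 2)" using eps by (simp add: distrib_right)
            moreover have "(1 + eps / 2) * (t + 1) = t + 1 + t * (eps / 2) + eps / 2" "(1 + eps) * t = t + t * (eps / 2) + t * (eps / 2)"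
              by (simp_all add: field_simps)
            ultimately show ?thesis by linarith
          qed
          finally show ?thesis by simp
        qed
        have "norm z = norm x / t" using tp by (simp add: x(2))
        also have "\<dots> \<le> (1 + eps) / lam" using nx lam tp by (simp add: divide_simps mult.commute)
        finally show "z \<in> cball 0 ((1 + eps) / lam)" by simp
      qed
    qed
  qed
qed

end

theorem theorem1p1:
  fixes M :: "'w measure" and mu :: "real measure"
    and chi :: "'w \<Rightarrow> ('a::euclidean_space \<times> real \<times> real) set"
  assumes mu_prob: "prob_space mu" and mu_borel: "sets mu = sets borel"
    and mu_pos: "emeasure mu {0<..} = 1"
    and ppp: "poisson_point_process M (deijfen_intensity mu) chi"
  shows "((\<integral>\<^sup>+ x. tail_root mu DIM('a) x * indicator {0..} x \<partial>lborel) < \<infinity> \<longrightarrow>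
           (\<exists>lam::real. 0 < lam \<and>
              (AE w in M. \<forall>eps>0. \<exists>t0. \<forall>t\<ge>t0.
                 cball 0 ((1 - eps) / lam) \<subseteq> (\<lambda>x. (1 / t) *\<^sub>R x) ` covered (chi w) t \<and>
                 (\<lambda>x. (1 / t) *\<^sub>R x) ` covered (chi w) t \<subseteq> cball 0 ((1 + eps) / lam))))
       \<and> ((\<integral>\<^sup>+ r. ennreal (r ^ (DIM('a) + 1)) \<partial>mu) = \<infinity> \<longrightarrow>
           (AE w in M. \<forall>m>0. \<exists>t0. \<forall>t\<ge>t0.
               cball 0 m \<subseteq> (\<lambda>x. (1 / t) *\<^sub>R x) ` covered (chi w) t))"
proof -
  have R: "radius_law mu"
    by (intro radius_law.intro radius_law_axioms.intro mu_prob mu_borel mu_pos)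
  interpret R: radius_law mu by (rule R)
  obtain chi' where chi': "ppp M (deijfen_intensity mu) chi'" "AE w in M. chi' w = chi w"
    using poisson_process_nice_version[OF ppp R.sets_intensity R.slab_intensity_finite R.null_intensity] by blast
  interpret D: deijfen_process mu M chi' by (rule deijfen_process.intro[OF R chi'(1)])
  show ?thesis
  proof (intro conjI impI)
    assume I: "(\<integral>\<^sup>+ x. tail_root mu DIM('a) x * indicator {0..} x \<partial>lborel) < \<infinity>"
    have lam: "0 < D.lam" by (rule D.lam_pos[OF I])
    from chi'(2) D.covered_inner D.covered_outer[OF lam]
    have "AE w in M. \<forall>eps>0. \<exists>t0. \<forall>t\<ge>t0.
                 cball 0 ((1 - eps) / D.lam) \<subseteq> (\<lambda>x. (1 / t) *\<^sub>R x) ` covered (chi w) t \<and>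
                 (\<lambda>x. (1 / t) *\<^sub>R x) ` covered (chi w) t \<subseteq> cball 0 ((1 + eps) / D.lam)"
    proof eventually_elim
      case (elim w)
      show ?case
      proof (intro allI impI)
        fix eps :: real assume eps: "0 < eps"
        have "D.lam * ((1 - eps) / D.lam) < 1" using lam eps by simp
        then obtain t1 where t1: "\<forall>t\<ge>t1. cball 0 ((1 - eps) / D.lam) \<subseteq> (\<lambda>x. (1 / t) *\<^sub>R x) ` covered (chi w) t"
          using elim(2) unfolding elim(1) by blast
        obtain t2 where t2: "\<forall>t\<ge>t2. (\<lambda>x. (1 / t) *\<^sub>R x) ` covered (chi w) t \<subseteq> cball 0 ((1 + eps) / D.lam)"
          using elim(3) eps unfolding elim(1) by blast
        show "\<exists>t0. \<forall>t\<ge>t0.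
                 cball 0 ((1 - eps) / D.lam) \<subseteq> (\<lambda>x. (1 / t) *\<^sub>R x) ` covered (chi w) t \<and>
                 (\<lambda>x. (1 / t) *\<^sub>R x) ` covered (chi w) t \<subseteq> cball 0 ((1 + eps) / D.lam)"
          using t1 t2 by (intro exI[of _ "max t1 t2"]) simp
      qed
    qed
    then show "\<exists>lam::real. 0 < lam \<and>
              (AE w in M. \<forall>eps>0. \<exists>t0. \<forall>t\<ge>t0.
                 cball 0 ((1 - eps) / lam) \<subseteq> (\<lambda>x. (1 / t) *\<^sub>R x) ` covered (chi w) t \<and>
                 (\<lambda>x. (1 / t) *\<^sub>R x) ` covered (chi w) t \<subseteq> cball 0 ((1 + eps) / lam))"
      using lam by (intro exI[of _ D.lam] conjI)
  next
    assume I: "(\<integral>\<^sup>+ r. ennreal (r ^ (DIM('a) + 1)) \<partial>mu) = \<infinity>"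
    have lam: "D.lam = 0" by (rule D.lam_zero[OF I])
    from chi'(2) D.covered_inner
    show "AE w in M. \<forall>m>0. \<exists>t0. \<forall>t\<ge>t0. cball 0 m \<subseteq> (\<lambda>x. (1 / t) *\<^sub>R x) ` covered (chi w) t"
    proof eventually_elim
      case (elim w)
      then show ?case unfolding lam by simp
    qed
  qed
qed

end
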